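(* Let $X$ be a del Pezzo surface of degree $4$ over $\mathbb C$ and let $\Phi=(Q_1,Q_2):T_X^*\to\mathbb C^2$ be the associated morphism. Then $\Phi$ is flat.
   Context: We work over $\mathbb C$. A del Pezzo surface $X$ of degree $4$ is a smooth complete intersection of two quadrics in $\mathbb P^4$; after a linear change of coordinates $X=\{Q_1=Q_2=0\}\subset\mathbb P^4_{y_1,\dots,y_5}$ with $Q_1=\sum_{i=1}^5y_i^2$, $Q_2=\sum_{i=1}^5a_iy_i^2$, the $a_i\in\mathbb C$ distinct. It is known that there is an isomorphism of graded rings $\bigoplus_{m\ge0}H^0(X,\mathrm{Sym}^mT_X)\simeq\mathbb C[Q_1,Q_2]$ with $Q_1,Q_2$ in degree $2$; in particular $Q_1,Q_2$ form a basis of $H^0(X,\mathrm{Sym}^2T_X)$. The quadratic form $Q_k$ is viewed as a section of $\mathrm{Sym}^2T_X$ as follows: for $x\in X$, $Q_k$ restricted to the affine cone over the embedded projective tangent plane $\mathbf T_xX\subset\mathbb P^4$ descends to a quadratic form on $T_xX\otimes\mathcal O_X(-1)_x$, giving a section of $\mathrm{Sym}^2(\Omega^1_X(1))$, and $\Omega^1_X(1)\cong\Omega^1_X\otimes\mathcal O_X(-K_X)\cong T_X$. A section of $\mathrm{Sym}^2T_X$ is a regular function on the total space of the cotangent bundle $T_X^*$ (quadratic on each fiber), so $(Q_1,Q_2)$ defines a morphism $\Phi:T_X^*\to\mathbb C^2$. *)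

theory Defs
  imports "HOL-Analysis.Analysis" "HOL-Algebra.Free_Abelian_Groups" "HOL-Algebra.Module"
begin

section \<open>Flat modules\<close>

text \<open>The tensor product is the free abelian group on the pairs, modulo the bilinearity relations.
  Only its additive group is needed to say that a map of tensor products is injective.\<close>

inductive_set tensor_relators ::
    "('r, 'a) ring_scheme \<Rightarrow> ('r, 'm, 'b) module_scheme \<Rightarrow> ('r, 'n, 'c) module_scheme \<Rightarrow>
      ('m \<times> 'n \<Rightarrow>\<^sub>0 int) set"
  for R M N where
  "\<lbrakk>x \<in> carrier M; x' \<in> carrier M; y \<in> carrier N\<rbrakk> \<Longrightarrow>
     frag_of (x \<oplus>\<^bsub>M\<^esub> x', y) - frag_of (x, y) - frag_of (x', y) \<in> tensor_relators R M N"
| "\<lbrakk>x \<in> carrier M; y \<in> carrier N; y' \<in> carrier N\<rbrakk> \<Longrightarrow>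
     frag_of (x, y \<oplus>\<^bsub>N\<^esub> y') - frag_of (x, y) - frag_of (x, y') \<in> tensor_relators R M N"
| "\<lbrakk>r \<in> carrier R; x \<in> carrier M; y \<in> carrier N\<rbrakk> \<Longrightarrow>
     frag_of (r \<odot>\<^bsub>M\<^esub> x, y) - frag_of (x, r \<odot>\<^bsub>N\<^esub> y) \<in> tensor_relators R M N"

definition tensor_relations ::
    "('r, 'a) ring_scheme \<Rightarrow> ('r, 'm, 'b) module_scheme \<Rightarrow> ('r, 'n, 'c) module_scheme \<Rightarrow>
      ('m \<times> 'n \<Rightarrow>\<^sub>0 int) set"
  where "tensor_relations R M N =
    generate (free_Abelian_group (carrier M \<times> carrier N)) (tensor_relators R M N)"

definition tensor_product ::
    "('r, 'a) ring_scheme \<Rightarrow> ('r, 'm, 'b) module_scheme \<Rightarrow> ('r, 'n, 'c) module_scheme \<Rightarrow>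
      ('m \<times> 'n \<Rightarrow>\<^sub>0 int) set monoid"
  where "tensor_product R M N =
    free_Abelian_group (carrier M \<times> carrier N) Mod tensor_relations R M N"

text \<open>The map induced by \<open>f : N \<rightarrow> N'\<close> on the tensor products with \<open>M\<close>; the union is over the
  representatives of a coset, all of which give the same coset.\<close>

definition tensor_map ::
    "('r, 'a) ring_scheme \<Rightarrow> ('r, 'm, 'b) module_scheme \<Rightarrow> ('r, 'k, 'c) module_scheme \<Rightarrow>
      ('n \<Rightarrow> 'k) \<Rightarrow> ('m \<times> 'n \<Rightarrow>\<^sub>0 int) set \<Rightarrow> ('m \<times> 'k \<Rightarrow>\<^sub>0 int) set"
  where "tensor_map R M N' f K =
    (\<Union>z\<in>K. tensor_relations R M N' #>\<^bsub>free_Abelian_group (carrier M \<times> carrier N')\<^esub>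
       frag_extend (\<lambda>(x, y). frag_of (x, f y)) z)"

definition module_homs ::
    "('r, 'a) ring_scheme \<Rightarrow> ('r, 'n, 'b) module_scheme \<Rightarrow> ('r, 'k, 'c) module_scheme \<Rightarrow>
      ('n \<Rightarrow> 'k) set"
  where "module_homs R N N' =
    {f \<in> carrier N \<rightarrow> carrier N'.
       (\<forall>x\<in>carrier N. \<forall>y\<in>carrier N. f (x \<oplus>\<^bsub>N\<^esub> y) = f x \<oplus>\<^bsub>N'\<^esub> f y) \<and>
       (\<forall>r\<in>carrier R. \<forall>x\<in>carrier N. f (r \<odot>\<^bsub>N\<^esub> x) = r \<odot>\<^bsub>N'\<^esub> f x)}"

text \<open>\<open>M\<close> is flat if tensoring with \<open>M\<close> preserves injectivity of module homomorphisms. HOL cannot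
  quantify over the types in which the test modules live, so these two types are parameters; in a
  theorem that concludes flatness they are type variables, i.e. the test modules are arbitrary.\<close>

definition flat_module ::
    "'r ring \<Rightarrow> ('r, 'm) module \<Rightarrow> 'n itself \<Rightarrow> 'k itself \<Rightarrow> bool"
  where "flat_module R M TN TK \<longleftrightarrow> Module.module R M \<and>
    (\<forall>(N :: ('r, 'n) module) (N' :: ('r, 'k) module) f.
       Module.module R N \<longrightarrow> Module.module R N' \<longrightarrow> f \<in> module_homs R N N' \<longrightarrow>
       inj_on f (carrier N) \<longrightarrow>
       inj_on (tensor_map R M N' f) (carrier (tensor_product R M N)))"

definition restrict_scalars :: "('r \<Rightarrow> 's) \<Rightarrow> 's ring \<Rightarrow> ('r, 's) module"
  where "restrict_scalars h S =
    \<lparr>carrier = carrier S, monoid.mult = monoid.mult S, one = one S, zero = zero S,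
     add = add S, smult = (\<lambda>r s. h r \<otimes>\<^bsub>S\<^esub> s)\<rparr>"


section \<open>Varieties as spaces with functions\<close>

text \<open>A complex variety in the classical sense: its closed points with the Zariski topology, and
  for every open \<open>U\<close> the regular functions on \<open>U\<close>. Whether \<open>f\<close> lies in \<open>regular X U\<close>
  depends only on the values of \<open>f\<close> on \<open>U\<close>.\<close>

record 'p function_space =
  zariski :: "'p topology"
  regular :: "'p set \<Rightarrow> ('p \<Rightarrow> complex) set"

abbreviation points :: "'p function_space \<Rightarrow> 'p set"
  where "points X \<equiv> topspace (zariski X)"

inductive polynomial_in :: "('p \<Rightarrow> complex) set \<Rightarrow> ('p \<Rightarrow> complex) \<Rightarrow> bool"
  for C where
  "polynomial_in C (\<lambda>p. c)"
| "f \<in> C \<Longrightarrow> polynomial_in C f"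
| "polynomial_in C f \<Longrightarrow> polynomial_in C g \<Longrightarrow> polynomial_in C (\<lambda>p. f p + g p)"
| "polynomial_in C f \<Longrightarrow> polynomial_in C g \<Longrightarrow> polynomial_in C (\<lambda>p. f p * g p)"

text \<open>A locally closed subset \<open>S\<close> of the affine space with coordinate functions \<open>C\<close>.\<close>

definition quasi_affine :: "'p set \<Rightarrow> ('p \<Rightarrow> complex) set \<Rightarrow> 'p function_space"
  where "quasi_affine S C =
    \<lparr>zariski = topology_generated_by {{p \<in> S. h p \<noteq> 0} | h. polynomial_in C h},
     regular = (\<lambda>U. {f. \<forall>p\<in>U. \<exists>g h. polynomial_in C g \<and> polynomial_in C h \<and> h p \<noteq> 0 \<and>
       (\<forall>q\<in>U. h q \<noteq> 0 \<longrightarrow> f q = g q / h q)})\<rparr>"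

text \<open>The quotient structure on \<open>E\<close> along a surjection \<open>\<pi>\<close> from (the points of) \<open>X\<close> onto \<open>E\<close>.\<close>

definition quotient_variety :: "'p function_space \<Rightarrow> ('p \<Rightarrow> 'e) \<Rightarrow> 'e set \<Rightarrow> 'e function_space"
  where "quotient_variety X \<pi> E =
    \<lparr>zariski = topology (\<lambda>U. U \<subseteq> E \<and> openin (zariski X) {p \<in> points X. \<pi> p \<in> U}),
     regular = (\<lambda>U. {f. f \<circ> \<pi> \<in> regular X {p \<in> points X. \<pi> p \<in> U}})\<rparr>"

lemma openin_quotient_variety:
  "openin (zariski (quotient_variety X \<pi> E)) U \<longleftrightarrow>
     U \<subseteq> E \<and> openin (zariski X) {p \<in> points X. \<pi> p \<in> U}"
proof -
  let ?L = "\<lambda>U. U \<subseteq> E \<and> openin (zariski X) {p \<in> points X. \<pi> p \<in> U}"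
  have "istopology ?L"
    unfolding istopology_def
  proof (intro conjI allI impI)
    fix U V assume "?L U" "?L V"
    moreover have "{p \<in> points X. \<pi> p \<in> U \<inter> V} =
        {p \<in> points X. \<pi> p \<in> U} \<inter> {p \<in> points X. \<pi> p \<in> V}" by auto
    ultimately show "U \<inter> V \<subseteq> E" "openin (zariski X) {p \<in> points X. \<pi> p \<in> U \<inter> V}"
      by auto
  next
    fix \<U> assume *: "\<forall>U\<in>\<U>. ?L U"
    then show "\<Union>\<U> \<subseteq> E" by blast
    have "{p \<in> points X. \<pi> p \<in> \<Union>\<U>} = (\<Union>U\<in>\<U>. {p \<in> points X. \<pi> p \<in> U})" by auto
    with * show "openin (zariski X) {p \<in> points X. \<pi> p \<in> \<Union>\<U>}" by auto
  qed
  then show ?thesis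
    by (simp add: quotient_variety_def topology_inverse')
qed

definition germ :: "'p function_space \<Rightarrow> 'p \<Rightarrow> 'p set \<Rightarrow> ('p \<Rightarrow> complex) \<Rightarrow> ('p set \<times> ('p \<Rightarrow> complex)) set"
  where "germ X p U f =
    {(V, g). openin (zariski X) V \<and> p \<in> V \<and> g \<in> regular X V \<and>
       (\<exists>W. openin (zariski X) W \<and> p \<in> W \<and> W \<subseteq> U \<inter> V \<and> (\<forall>q\<in>W. f q = g q))}"

text \<open>The local ring at \<open>p\<close>. The unions range over the representatives of the given germs.\<close>

definition local_ring :: "'p function_space \<Rightarrow> 'p \<Rightarrow> ('p set \<times> ('p \<Rightarrow> complex)) set ring"
  where "local_ring X p =
    \<lparr>carrier = {germ X p U f | U f. openin (zariski X) U \<and> p \<in> U \<and> f \<in> regular X U},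
     monoid.mult = (\<lambda>a b. \<Union>(U, f)\<in>a. \<Union>(V, g)\<in>b. germ X p (U \<inter> V) (\<lambda>q. f q * g q)),
     one = germ X p (points X) (\<lambda>q. 1),
     zero = germ X p (points X) (\<lambda>q. 0),
     add = (\<lambda>a b. \<Union>(U, f)\<in>a. \<Union>(V, g)\<in>b. germ X p (U \<inter> V) (\<lambda>q. f q + g q))\<rparr>"

definition is_morphism :: "'p function_space \<Rightarrow> 'q function_space \<Rightarrow> ('p \<Rightarrow> 'q) \<Rightarrow> bool"
  where "is_morphism X Y \<phi> \<longleftrightarrow> continuous_map (zariski X) (zariski Y) \<phi> \<and>
    (\<forall>V f. openin (zariski Y) V \<longrightarrow> f \<in> regular Y V \<longrightarrow>
       f \<circ> \<phi> \<in> regular X {p \<in> points X. \<phi> p \<in> V})"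

definition pullback_germ ::
    "'p function_space \<Rightarrow> ('p \<Rightarrow> 'q) \<Rightarrow> 'p \<Rightarrow> ('q set \<times> ('q \<Rightarrow> complex)) set \<Rightarrow>
      ('p set \<times> ('p \<Rightarrow> complex)) set"
  where "pullback_germ X \<phi> p a = (\<Union>(V, g)\<in>a. germ X p {q \<in> points X. \<phi> q \<in> V} (g \<circ> \<phi>))"

definition flat_morphism ::
    "'p function_space \<Rightarrow> 'q function_space \<Rightarrow> ('p \<Rightarrow> 'q) \<Rightarrow> 'n itself \<Rightarrow> 'k itself \<Rightarrow> bool"
  where "flat_morphism X Y \<phi> TN TK \<longleftrightarrow> is_morphism X Y \<phi> \<and>
    (\<forall>p\<in>points X. flat_module (local_ring Y (\<phi> p))
       (restrict_scalars (pullback_germ X \<phi> p) (local_ring X p)) TN TK)"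

definition affine_plane :: "(complex \<times> complex) function_space"
  where "affine_plane = quasi_affine UNIV {fst, snd}"


section \<open>Del Pezzo surfaces of degree 4\<close>

type_synonym vec5 = "complex ^ 5"
type_synonym mat5 = "complex ^ 5 ^ 5"

definition dot :: "vec5 \<Rightarrow> vec5 \<Rightarrow> complex"
  where "dot u v = (\<Sum>i\<in>UNIV. u $ i * v $ i)"

text \<open>A quadratic form on \<open>\<complex>\<^sup>5\<close> is given by its symmetric matrix.\<close>

definition bilin :: "mat5 \<Rightarrow> vec5 \<Rightarrow> vec5 \<Rightarrow> complex"
  where "bilin Q u v = dot u (Q *v v)"

abbreviation quad :: "mat5 \<Rightarrow> vec5 \<Rightarrow> complex"
  where "quad Q u \<equiv> bilin Q u u"

text \<open>The punctured affine cone over the intersection of two quadrics.\<close>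

definition cone :: "mat5 \<Rightarrow> mat5 \<Rightarrow> vec5 set"
  where "cone Q\<^sub>1 Q\<^sub>2 = {y. y \<noteq> 0 \<and> quad Q\<^sub>1 y = 0 \<and> quad Q\<^sub>2 y = 0}"

text \<open>Points of projective 4-space are lines in \<open>\<complex>\<^sup>5\<close>.\<close>

definition surface :: "mat5 \<Rightarrow> mat5 \<Rightarrow> vec5 set set"
  where "surface Q\<^sub>1 Q\<^sub>2 = {vec.span {y} | y. y \<in> cone Q\<^sub>1 Q\<^sub>2}"

text \<open>\<open>Q\<^sub>1 = Q\<^sub>2 = 0\<close> is a smooth complete intersection: at each of its points the differentials
  \<open>2 Q\<^sub>1 y\<close> and \<open>2 Q\<^sub>2 y\<close> of the two equations are linearly independent.\<close>

definition del_pezzo_4 :: "mat5 \<Rightarrow> mat5 \<Rightarrow> bool"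
  where "del_pezzo_4 Q\<^sub>1 Q\<^sub>2 \<longleftrightarrow> transpose Q\<^sub>1 = Q\<^sub>1 \<and> transpose Q\<^sub>2 = Q\<^sub>2 \<and>
    (\<forall>y\<in>cone Q\<^sub>1 Q\<^sub>2. \<forall>c d. c *s (Q\<^sub>1 *v y) + d *s (Q\<^sub>2 *v y) = 0 \<longrightarrow> c = 0 \<and> d = 0)"

definition diagonal :: "(5 \<Rightarrow> complex) \<Rightarrow> mat5"
  where "diagonal a = (\<chi> i j. if i = j then a i else 0)"

text \<open>The normal form \<open>Q\<^sub>1 = \<Sum> y\<^sub>i\<^sup>2\<close>, \<open>Q\<^sub>2 = \<Sum> a\<^sub>i y\<^sub>i\<^sup>2\<close> is an instance.\<close>

lemma diagonal_mult: "diagonal a *v y = (\<chi> i. a i * y $ i)"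
  by (simp add: diagonal_def matrix_vector_mult_def vec_eq_iff if_distrib[of "\<lambda>x. x * _"] cong: if_cong)

lemma quad_diagonal: "quad (diagonal a) y = (\<Sum>i\<in>UNIV. a i * (y $ i)\<^sup>2)"
  by (simp add: bilin_def dot_def diagonal_mult power2_eq_square mult_ac)

lemma del_pezzo_4_diagonal:
  assumes "inj a"
  shows "del_pezzo_4 (diagonal (\<lambda>i. 1)) (diagonal a)"
proof -
  have tr: "transpose (diagonal b) = diagonal b" for b
    by (simp add: diagonal_def transpose_def vec_eq_iff)
  have "c = 0 \<and> d = 0"
    if y: "y \<in> cone (diagonal (\<lambda>i. 1)) (diagonal a)"
      and *: "c *s (diagonal (\<lambda>i. 1) *v y) + d *s (diagonal a *v y) = 0" for y c d
  proof (rule ccontr)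
    assume cd: "\<not> (c = 0 \<and> d = 0)"
    have eq: "(c + d * a i) * y $ i = 0" for i
      using arg_cong[OF *, of "\<lambda>v. v $ i"] by (simp add: diagonal_mult algebra_simps)
    have "y \<noteq> 0" using y by (simp add: cone_def)
    then obtain k where k: "y $ k \<noteq> 0" by (auto simp: vec_eq_iff)
    have "y $ i = 0" if "i \<noteq> k" for i
    proof (rule ccontr)
      assume "y $ i \<noteq> 0"
      with eq[of i] eq[of k] k have e: "c + d * a i = 0" "c + d * a k = 0" by auto
      then have "d * (a i - a k) = 0" by (simp add: algebra_simps add_eq_0_iff)
      moreover have "a i \<noteq> a k" using that assms by (auto dest: injD)
      ultimately have "d = 0" by simp
      with e cd show False by simp
    qed
    then have "(\<Sum>i\<in>UNIV. 1 * (y $ i)\<^sup>2) = (\<Sum>i\<in>{k}. 1 * (y $ i)\<^sup>2)"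
      by (intro sum.mono_neutral_right) auto
    moreover have "(\<Sum>i\<in>UNIV. 1 * (y $ i)\<^sup>2) = 0"
      using y by (simp only: cone_def quad_diagonal mem_Collect_eq)
    ultimately show False using k by simp
  qed
  then show ?thesis by (simp only: del_pezzo_4_def tr) blast
qed


section \<open>The cotangent bundle\<close>

text \<open>The affine cone over the embedded projective tangent plane at the point \<open>[y]\<close>.\<close>

definition tangent_cone :: "mat5 \<Rightarrow> mat5 \<Rightarrow> vec5 \<Rightarrow> vec5 set"
  where "tangent_cone Q\<^sub>1 Q\<^sub>2 y = {u. bilin Q\<^sub>1 y u = 0 \<and> bilin Q\<^sub>2 y u = 0}"

text \<open>The image of \<open>u\<close> under the differential at \<open>y\<close> of the projection from \<open>\<complex>\<^sup>5 - {0}\<close> to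
  projective space, encoded as the class of all \<open>(y', u')\<close> that have the same image.\<close>

definition tangent_vector :: "vec5 \<Rightarrow> vec5 \<Rightarrow> (vec5 \<times> vec5) set"
  where "tangent_vector y u = {(c *s y, c *s u + d *s y) | c d. c \<noteq> 0}"

definition tangent_space ::
    "mat5 \<Rightarrow> mat5 \<Rightarrow> vec5 set \<Rightarrow> (vec5 \<times> vec5) set set"
  where "tangent_space Q\<^sub>1 Q\<^sub>2 l =
    {tangent_vector y u | y u. y \<in> l \<and> y \<noteq> 0 \<and> u \<in> tangent_cone Q\<^sub>1 Q\<^sub>2 y}"

type_synonym covector = "(vec5 \<times> vec5) set \<Rightarrow> complex"

text \<open>The linear functionals on the tangent space (for fixed \<open>y\<close>, the map \<open>tangent_vector y\<close> is
  linear with kernel spanned by \<open>y\<close>).\<close>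

definition cotangent_space ::
    "mat5 \<Rightarrow> mat5 \<Rightarrow> vec5 set \<Rightarrow> covector set"
  where "cotangent_space Q\<^sub>1 Q\<^sub>2 l =
    {\<xi> \<in> extensional (tangent_space Q\<^sub>1 Q\<^sub>2 l).
       \<forall>y\<in>l - {0}. \<forall>u\<in>tangent_cone Q\<^sub>1 Q\<^sub>2 y. \<forall>v\<in>tangent_cone Q\<^sub>1 Q\<^sub>2 y. \<forall>c d.
         \<xi> (tangent_vector y (c *s u + d *s v)) =
           c * \<xi> (tangent_vector y u) + d * \<xi> (tangent_vector y v)}"

definition cotangent_points ::
    "mat5 \<Rightarrow> mat5 \<Rightarrow> (vec5 set \<times> covector) set"
  where "cotangent_points Q\<^sub>1 Q\<^sub>2 = Sigma (surface Q\<^sub>1 Q\<^sub>2) (cotangent_space Q\<^sub>1 Q\<^sub>2)"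

text \<open>A cotangent vector of projective space at \<open>[y]\<close> is a functional \<open>\<eta>\<close> on \<open>\<complex>\<^sup>5\<close> with
  \<open>\<eta> y = 0\<close>. Restricting it to the tangent space of the surface gives a surjection from the
  quasi-affine variety of pairs \<open>(y, \<eta>)\<close> onto the total space of the cotangent bundle. It is
  a Zariski-locally trivial fibration, so the cotangent bundle carries the quotient structure.\<close>

definition covector_pairs ::
    "mat5 \<Rightarrow> mat5 \<Rightarrow> (vec5 \<times> vec5) set"
  where "covector_pairs Q\<^sub>1 Q\<^sub>2 = {(y, \<eta>). y \<in> cone Q\<^sub>1 Q\<^sub>2 \<and> dot \<eta> y = 0}"

definition restrict_covector ::
    "mat5 \<Rightarrow> mat5 \<Rightarrow> vec5 \<times> vec5 \<Rightarrow> vec5 set \<times> covector"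
  where "restrict_covector Q\<^sub>1 Q\<^sub>2 = (\<lambda>(y, \<eta>). (vec.span {y},
    restrict (\<lambda>t. THE z. \<exists>u. t = tangent_vector y u \<and> z = dot \<eta> u)
      (tangent_space Q\<^sub>1 Q\<^sub>2 (vec.span {y}))))"

definition cotangent_bundle ::
    "mat5 \<Rightarrow> mat5 \<Rightarrow> (vec5 set \<times> covector) function_space"
  where "cotangent_bundle Q\<^sub>1 Q\<^sub>2 =
    quotient_variety
      (quasi_affine (covector_pairs Q\<^sub>1 Q\<^sub>2)
        (range (\<lambda>i p. fst p $ i) \<union> range (\<lambda>i p. snd p $ i)))
      (restrict_covector Q\<^sub>1 Q\<^sub>2) (cotangent_points Q\<^sub>1 Q\<^sub>2)"


section \<open>The quadratic forms as functions on the cotangent bundle\<close>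

text \<open>The adjunction isomorphism between \<open>\<O>(1)\<close> and \<open>-K\<close>. The Poincare residue trivialises
  \<open>K(1)\<close>: at \<open>y\<close> it is the alternating form \<open>\<omega>\<close> on the tangent cone modulo \<open>y\<close> with
  \<open>\<omega> (v, u) (dQ\<^sub>1 \<and> dQ\<^sub>2) (w\<^sub>1, w\<^sub>2) = det (y, v, u, w\<^sub>1, w\<^sub>2)\<close>, up to a constant factor
  coming from \<open>dQ\<^sub>i = 2 bilin Q\<^sub>i y\<close>. It depends on \<open>y\<close> with weight \<open>-1\<close>.\<close>

definition residue_form ::
    "mat5 \<Rightarrow> mat5 \<Rightarrow> vec5 \<Rightarrow> vec5 \<Rightarrow> vec5 \<Rightarrow> complex"
  where "residue_form Q\<^sub>1 Q\<^sub>2 y v u = (THE z. \<forall>w\<^sub>1 w\<^sub>2.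
    det (\<chi> i::5. if i = 1 then y else if i = 2 then v else if i = 3 then u
       else if i = 4 then w\<^sub>1 else w\<^sub>2) =
    z * (bilin Q\<^sub>1 y w\<^sub>1 * bilin Q\<^sub>2 y w\<^sub>2 - bilin Q\<^sub>1 y w\<^sub>2 * bilin Q\<^sub>2 y w\<^sub>1))"

text \<open>Contraction with the residue form identifies the tangent cone modulo \<open>y\<close>, which is the fibre
  of \<open>T(-1)\<close>, with the cotangent space; the weight of \<open>\<omega>\<close> makes \<open>v\<close> independent of the
  choice of \<open>y\<close> on the line. The forms \<open>Q\<^sub>1\<close> and \<open>Q\<^sub>2\<close> descend to that quotient, so their
  values at \<open>v\<close> are functions on the cotangent bundle.\<close>

definition Phi ::
    "mat5 \<Rightarrow> mat5 \<Rightarrow> vec5 set \<times> covector \<Rightarrow> complex \<times> complex"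
  where "Phi Q\<^sub>1 Q\<^sub>2 = (\<lambda>(l, \<xi>). THE z. \<exists>y v. y \<in> l \<and> y \<noteq> 0 \<and> v \<in> tangent_cone Q\<^sub>1 Q\<^sub>2 y \<and>
    (\<forall>u\<in>tangent_cone Q\<^sub>1 Q\<^sub>2 y. \<xi> (tangent_vector y u) = residue_form Q\<^sub>1 Q\<^sub>2 y v u) \<and>
    z = (quad Q\<^sub>1 v, quad Q\<^sub>2 v))"

end

theory Submission
  imports Defs "HOL-Computational_Algebra.Polynomial_Factorial" "HOL-Computational_Algebra.Field_as_Ring"
begin

text \<open>
  The cotangent bundle and the plane are smooth of dimensions 4 and 2, so flatness should come from
  the dimension of the fibres. Write a cotangent vector at \<open>y\<close> as a tangent vector \<open>v\<close> modulo \<open>y\<close>,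
  so that \<open>\<Phi> = (Q\<^sub>1 v, Q\<^sub>2 v)\<close>. If the two forms have no common zero on the tangent plane, i.e. if
  no line on the surface passes through \<open>y\<close>, then \<open>\<Phi>\<close> restricted to the cotangent plane at \<open>y\<close>
  is surjective with finite fibres.
  Such \<open>y\<close> are dense: a line on the surface has normal bundle \<open>O(-1)\<close> and is rigid, hence isolated
  among the lines, so the lines through the points near \<open>y\<close> cannot sweep out a neighbourhood of
  \<open>y\<close>. By density the local rings upstairs are torsion-free over \<open>\<complex>[s, t]\<close>. Moreover
  \<open>(s - a, t - b)\<close> is a regular sequence on them: one of the two quadratic polynomials in the fibre
  coordinates has invertible leading coefficient in one of them, so one can divide with remainder,
  and the remainder vanishes wherever the two have no common root.

  Over \<open>\<complex>[s, t]\<close> these two properties imply the equational criterion for flatness. After removing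
  a greatest common divisor, the coefficients of a linear relation generate an ideal that is locally
  the unit ideal or primary to the maximal ideal; adding the monomials in \<open>s - a\<close>, \<open>t - b\<close> one by
  one reduces to the unit ideal, and regularity of the sequence handles each step.
\<close>

text \<open>Flatness quantifies over test modules of arbitrary types. The equational criterion
  speaks only of elements of the base ring and the module, so a single proof serves them all, and a
  relation between germs becomes a finite identity between polynomials.

  Primary ideals arise because coprime polynomials in two variables have finitely many common zeros:
  eliminating either variable leaves a nonzero polynomial in the other, and near the given point
  this is a power of the local parameter up to a unit.

  Density is meant in the classical topology. The functions involved are continuous, so identities
  pass from the points off the lines to all others. Spheres are compact, so lines through a sequence
  of points have a limit line, and the rescaled deviations from it have a limit that is a section of
  its normal bundle. The degree -1 appears as linear algebra: a dependence among four functionals on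
  a normal space of dimension three.

  An invertible leading coefficient exists because no tangent plane lies in the surface, which
  follows from smoothness.\<close>

lemma (in abelian_monoid) finsum_swap:
  assumes "finite A" "finite B" "\<And>i j. i \<in> A \<Longrightarrow> j \<in> B \<Longrightarrow> f i j \<in> carrier G"
  shows "(\<Oplus>i\<in>A. \<Oplus>j\<in>B. f i j) = (\<Oplus>j\<in>B. \<Oplus>i\<in>A. f i j)"
  using assms(1,3)
proof (induction A rule: finite_induct)
  case empty
  then show ?case by simp
next
  case (insert a A)
  have "(\<Oplus>i\<in>insert a A. \<Oplus>j\<in>B. f i j) = (\<Oplus>j\<in>B. f a j) \<oplus> (\<Oplus>i\<in>A. \<Oplus>j\<in>B. f i j)"
    using insert by (intro finsum_insert) auto
  also have "\<dots> = (\<Oplus>j\<in>B. f a j) \<oplus> (\<Oplus>j\<in>B. \<Oplus>i\<in>A. f i j)"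
    using insert by simp
  also have "\<dots> = (\<Oplus>j\<in>B. f a j \<oplus> (\<Oplus>i\<in>A. f i j))"
    using insert by (intro finsum_addf[symmetric]) auto
  also have "\<dots> = (\<Oplus>j\<in>B. \<Oplus>i\<in>insert a A. f i j)"
    using insert by (intro finsum_cong') (auto intro!: finsum_insert[symmetric])
  finally show ?case .
qed

lemma (in Module.module) finsum_smult_rdistr:
  assumes "finite A" "x \<in> carrier M" "\<And>i. i \<in> A \<Longrightarrow> f i \<in> carrier R"
  shows "(\<Oplus>\<^bsub>R\<^esub>i\<in>A. f i) \<odot>\<^bsub>M\<^esub> x = (\<Oplus>\<^bsub>M\<^esub>i\<in>A. f i \<odot>\<^bsub>M\<^esub> x)"
  using assms(1,3)
proof (induction A rule: finite_induct)
  case empty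
  then show ?case using assms(2) by simp
next
  case (insert a A)
  then show ?case using assms(2) by (simp add: smult_l_distr Pi_def)
qed

section \<open>The equational criterion for flatness\<close>

text \<open>It speaks about elements of \<open>R\<close> and \<open>M\<close> only. Since no test
  modules occur, one proof of it gives flatness against modules of every type.\<close>

definition equational_criterion :: "('r, 'a) ring_scheme \<Rightarrow> ('r, 'm, 'b) module_scheme \<Rightarrow> bool" where
  "equational_criterion R M \<longleftrightarrow> (\<forall>(n::nat) r m.
     (\<forall>i<n. r i \<in> carrier R \<and> m i \<in> carrier M) \<longrightarrow>
     (\<Oplus>\<^bsub>M\<^esub>i\<in>{..<n}. r i \<odot>\<^bsub>M\<^esub> m i) = \<zero>\<^bsub>M\<^esub> \<longrightarrow>
     (\<exists>(k::nat) b m'. (\<forall>i<n. \<forall>j<k. b i j \<in> carrier R) \<and> (\<forall>j<k. m' j \<in> carrier M) \<and>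
        (\<forall>i<n. m i = (\<Oplus>\<^bsub>M\<^esub>j\<in>{..<k}. b i j \<odot>\<^bsub>M\<^esub> m' j)) \<and>
        (\<forall>j<k. (\<Oplus>\<^bsub>R\<^esub>i\<in>{..<n}. r i \<otimes>\<^bsub>R\<^esub> b i j) = \<zero>\<^bsub>R\<^esub>)))"

text \<open>A list of pairs \<open>(r, x)\<close> encodes the linear relation \<open>\<Sum> r x = 0\<close> in \<open>M\<close>; \<open>B x\<close> is a vector
  of coordinates with \<open>x = \<Sum>\<^sub>j B x j m' j\<close>.\<close>

definition satisfies :: "('r, 'a) ring_scheme \<Rightarrow> nat \<Rightarrow> ('m \<Rightarrow> nat \<Rightarrow> 'r) \<Rightarrow> ('r \<times> 'm) list \<Rightarrow> bool" where
  "satisfies R k B e \<longleftrightarrow>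
     (\<forall>j<k. (\<Oplus>\<^bsub>R\<^esub>i\<in>{..<length e}. fst (e ! i) \<otimes>\<^bsub>R\<^esub> B (snd (e ! i)) j) = \<zero>\<^bsub>R\<^esub>)"

definition is_relation :: "('r, 'a) ring_scheme \<Rightarrow> ('r, 'm, 'b) module_scheme \<Rightarrow> ('r \<times> 'm) list \<Rightarrow> bool" where
  "is_relation R M e \<longleftrightarrow> set e \<subseteq> carrier R \<times> carrier M \<and>
     (\<Oplus>\<^bsub>M\<^esub>i\<in>{..<length e}. fst (e ! i) \<odot>\<^bsub>M\<^esub> snd (e ! i)) = \<zero>\<^bsub>M\<^esub>"

text \<open>The coordinates are elements of \<open>R\<close> for every \<open>x\<close>, also
  outside \<open>S\<close>: a homomorphism from the free group to \<open>N\<close> needs a scalar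
  for each element of \<open>M\<close>. Only on \<open>S\<close> do they represent
  \<open>x\<close>.\<close>

definition lifts :: "('r, 'a) ring_scheme \<Rightarrow> ('r, 'm, 'b) module_scheme \<Rightarrow> 'm set \<Rightarrow> nat \<Rightarrow>
    ('m \<Rightarrow> nat \<Rightarrow> 'r) \<Rightarrow> (nat \<Rightarrow> 'm) \<Rightarrow> bool" where
  "lifts R M S k B m' \<longleftrightarrow> (\<forall>x. \<forall>j<k. B x j \<in> carrier R) \<and> (\<forall>j<k. m' j \<in> carrier M) \<and>
     (\<forall>x\<in>S. x = (\<Oplus>\<^bsub>M\<^esub>j\<in>{..<k}. B x j \<odot>\<^bsub>M\<^esub> m' j))"

text \<open>Induction on the list. If the coordinates \<open>B\<close> satisfy the earlier
  relations, inserting them into the next one leaves coefficients \<open>\<rho> j\<close> that form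
  a relation between the \<open>m' j\<close>. The criterion for this relation rewrites the
  \<open>m' j\<close> through a matrix \<open>b\<close>, and the product of \<open>B\<close> with
  \<open>b\<close> satisfies the new relation; the earlier ones persist, because zero times
  \<open>b\<close> is zero. The empty list is served by the elements of \<open>S\<close> themselves
  with unit coordinate vectors.\<close>

lemma (in Module.module) lifts_exist:
  assumes "equational_criterion R M" "finite S" "S \<subseteq> carrier M"
    "\<And>e. e \<in> set es \<Longrightarrow> is_relation R M e \<and> snd ` set e \<subseteq> S"
  shows "\<exists>k B m'. lifts R M S k B m' \<and> (\<forall>e\<in>set es. satisfies R k B e)"
  using assms(4)
proof (induction es)
  case Nil
  obtain h where h: "bij_betw h {..<card S} S"
    using \<open>finite S\<close> ex_bij_betw_nat_finite atLeast0LessThan by metis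
  let ?B = "\<lambda>x j. if x = h j then \<one>\<^bsub>R\<^esub> else \<zero>\<^bsub>R\<^esub>"
  have hc: "h j \<in> carrier M" if "j < card S" for j
    using h that assms(3) by (auto simp: bij_betw_def)
  have "lifts R M S (card S) ?B h"
    unfolding lifts_def
  proof (intro conjI allI ballI impI)
    fix x assume "x \<in> S"
    then obtain l where l: "l < card S" "x = h l" using h by (auto simp: bij_betw_def)
    have "(\<Oplus>\<^bsub>M\<^esub>j\<in>{..<card S}. ?B x j \<odot>\<^bsub>M\<^esub> h j) =
        (\<Oplus>\<^bsub>M\<^esub>j\<in>{..<card S}. if l = j then h j else \<zero>\<^bsub>M\<^esub>)"
    proof (rule M.finsum_cong')
      fix j assume j: "j \<in> {..<card S}"
      have "h l = h j \<longleftrightarrow> l = j" using h l j by (auto simp: bij_betw_def inj_on_def)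
      then show "?B x j \<odot>\<^bsub>M\<^esub> h j = (if l = j then h j else \<zero>\<^bsub>M\<^esub>)"
        using hc j l by auto
    qed (use hc in auto)
    also have "\<dots> = h l" using l hc by (intro M.finsum_singleton) auto
    finally show "x = (\<Oplus>\<^bsub>M\<^esub>j\<in>{..<card S}. ?B x j \<odot>\<^bsub>M\<^esub> h j)" using l by simp
  qed (use hc in auto)
  then show ?case by (intro exI[of _ "card S"] exI[of _ ?B] exI[of _ h]) simp
next
  case (Cons e es)
  then obtain k B m' where L: "lifts R M S k B m'" and es: "\<forall>e\<in>set es. satisfies R k B e"
    by (meson list.set_intros(2))
  have Bc: "B x j \<in> carrier R" "m' j \<in> carrier M" if "j < k" for x j
    using L that by (auto simp: lifts_def)
  have m'c: "m' \<in> {..<k} \<rightarrow> carrier M" using Bc by auto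
  have val: "x = (\<Oplus>\<^bsub>M\<^esub>j\<in>{..<k}. B x j \<odot>\<^bsub>M\<^esub> m' j)" if "x \<in> S" for x
    using L that by (auto simp: lifts_def)
  have e: "is_relation R M e" "snd ` set e \<subseteq> S" using Cons.prems by auto
  let ?n = "length e"
  have ec: "fst (e ! i) \<in> carrier R" "snd (e ! i) \<in> S" "snd (e ! i) \<in> carrier M" if "i < ?n" for i
  proof -
    have "e ! i \<in> set e" using that by simp
    then have "e ! i \<in> carrier R \<times> carrier M" "snd (e ! i) \<in> S" using e by (auto simp: is_relation_def)
    then show "fst (e ! i) \<in> carrier R" "snd (e ! i) \<in> S" "snd (e ! i) \<in> carrier M"
      by (auto simp: mem_Times_iff)
  qed
  define \<rho> where "\<rho> = (\<lambda>j. \<Oplus>\<^bsub>R\<^esub>i\<in>{..<?n}. fst (e ! i) \<otimes>\<^bsub>R\<^esub> B (snd (e ! i)) j)"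
  have \<rho>c: "\<rho> j \<in> carrier R" if "j < k" for j
    unfolding \<rho>_def using ec Bc that by auto
  have "(\<Oplus>\<^bsub>M\<^esub>j\<in>{..<k}. \<rho> j \<odot>\<^bsub>M\<^esub> m' j) =
      (\<Oplus>\<^bsub>M\<^esub>j\<in>{..<k}. \<Oplus>\<^bsub>M\<^esub>i\<in>{..<?n}. fst (e ! i) \<odot>\<^bsub>M\<^esub> (B (snd (e ! i)) j \<odot>\<^bsub>M\<^esub> m' j))"
  proof (rule M.finsum_cong')
    fix j assume "j \<in> {..<k}"
    then show "\<rho> j \<odot>\<^bsub>M\<^esub> m' j =
      (\<Oplus>\<^bsub>M\<^esub>i\<in>{..<?n}. fst (e ! i) \<odot>\<^bsub>M\<^esub> (B (snd (e ! i)) j \<odot>\<^bsub>M\<^esub> m' j))"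
      unfolding \<rho>_def using ec Bc
      by (subst finsum_smult_rdistr) (auto intro!: M.finsum_cong' simp: smult_assoc1)
  qed (use ec Bc in auto)
  also have "\<dots> = (\<Oplus>\<^bsub>M\<^esub>i\<in>{..<?n}. \<Oplus>\<^bsub>M\<^esub>j\<in>{..<k}. fst (e ! i) \<odot>\<^bsub>M\<^esub> (B (snd (e ! i)) j \<odot>\<^bsub>M\<^esub> m' j))"
    using ec Bc by (intro M.finsum_swap) auto
  also have "\<dots> = (\<Oplus>\<^bsub>M\<^esub>i\<in>{..<?n}. fst (e ! i) \<odot>\<^bsub>M\<^esub> snd (e ! i))"
  proof (rule M.finsum_cong')
    fix i assume "i \<in> {..<?n}"
    then show "(\<Oplus>\<^bsub>M\<^esub>j\<in>{..<k}. fst (e ! i) \<odot>\<^bsub>M\<^esub> (B (snd (e ! i)) j \<odot>\<^bsub>M\<^esub> m' j)) =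
        fst (e ! i) \<odot>\<^bsub>M\<^esub> snd (e ! i)"
      using ec Bc val[of "snd (e ! i)"] by (subst finsum_smult_ldistr[symmetric]) auto
  qed (use ec in auto)
  also have "\<dots> = \<zero>\<^bsub>M\<^esub>" using e by (simp add: is_relation_def)
  finally have rel: "(\<Oplus>\<^bsub>M\<^esub>j\<in>{..<k}. \<rho> j \<odot>\<^bsub>M\<^esub> m' j) = \<zero>\<^bsub>M\<^esub>" .
  have "\<exists>(k'::nat) b m''. (\<forall>i<k. \<forall>j<k'. b i j \<in> carrier R) \<and> (\<forall>j<k'. m'' j \<in> carrier M) \<and>
        (\<forall>i<k. m' i = (\<Oplus>\<^bsub>M\<^esub>j\<in>{..<k'}. b i j \<odot>\<^bsub>M\<^esub> m'' j)) \<and>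
        (\<forall>j<k'. (\<Oplus>\<^bsub>R\<^esub>i\<in>{..<k}. \<rho> i \<otimes>\<^bsub>R\<^esub> b i j) = \<zero>\<^bsub>R\<^esub>)"
    using assms(1)[unfolded equational_criterion_def, THEN spec, of k, THEN spec, of \<rho>, THEN spec, of m',
        THEN mp, THEN mp, OF _ rel] \<rho>c Bc by simp
  then obtain k' :: nat and b m'' where bc: "\<forall>i<k. \<forall>j<k'. b i j \<in> carrier R" and m''c: "\<forall>j<k'. m'' j \<in> carrier M"
    and m'': "\<forall>i<k. m' i = (\<Oplus>\<^bsub>M\<^esub>j\<in>{..<k'}. b i j \<odot>\<^bsub>M\<^esub> m'' j)"
    and \<rho>b: "\<forall>j<k'. (\<Oplus>\<^bsub>R\<^esub>i\<in>{..<k}. \<rho> i \<otimes>\<^bsub>R\<^esub> b i j) = \<zero>\<^bsub>R\<^esub>"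
    by blast
  define B' where "B' = (\<lambda>x l. \<Oplus>\<^bsub>R\<^esub>j\<in>{..<k}. B x j \<otimes>\<^bsub>R\<^esub> b j l)"
  have B'c: "B' x l \<in> carrier R" if "l < k'" for x l
    unfolding B'_def using Bc bc that by auto
  \<comment> \<open>By associativity, inserting \<open>B'\<close> into a relation amounts to
    inserting \<open>B\<close> and multiplying the result by \<open>b\<close>. This serves the new
    relation and the old ones alike.\<close>
  have resp: "satisfies R k' B' d"
    if d: "set d \<subseteq> carrier R \<times> carrier M"
      and z: "\<And>l. l < k' \<Longrightarrow> (\<Oplus>\<^bsub>R\<^esub>j\<in>{..<k}. (\<Oplus>\<^bsub>R\<^esub>i\<in>{..<length d}. fst (d ! i) \<otimes>\<^bsub>R\<^esub> B (snd (d ! i)) j) \<otimes>\<^bsub>R\<^esub> b j l) = \<zero>\<^bsub>R\<^esub>"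
    for d
    unfolding satisfies_def
  proof (intro allI impI)
    fix l assume l: "l < k'"
    have dc: "fst (d ! i) \<in> carrier R" if "i < length d" for i
      using d nth_mem[OF that] by (metis mem_Times_iff subsetD)
    have "(\<Oplus>\<^bsub>R\<^esub>i\<in>{..<length d}. fst (d ! i) \<otimes>\<^bsub>R\<^esub> B' (snd (d ! i)) l) =
        (\<Oplus>\<^bsub>R\<^esub>i\<in>{..<length d}. \<Oplus>\<^bsub>R\<^esub>j\<in>{..<k}. (fst (d ! i) \<otimes>\<^bsub>R\<^esub> B (snd (d ! i)) j) \<otimes>\<^bsub>R\<^esub> b j l)"
      unfolding B'_def using dc Bc bc l
      by (auto intro!: R.finsum_cong' simp: R.finsum_rdistr R.m_assoc)
    also have "\<dots> = (\<Oplus>\<^bsub>R\<^esub>j\<in>{..<k}. \<Oplus>\<^bsub>R\<^esub>i\<in>{..<length d}. (fst (d ! i) \<otimes>\<^bsub>R\<^esub> B (snd (d ! i)) j) \<otimes>\<^bsub>R\<^esub> b j l)"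
      using dc Bc bc l by (intro R.finsum_swap) auto
    also have "\<dots> = (\<Oplus>\<^bsub>R\<^esub>j\<in>{..<k}. (\<Oplus>\<^bsub>R\<^esub>i\<in>{..<length d}. fst (d ! i) \<otimes>\<^bsub>R\<^esub> B (snd (d ! i)) j) \<otimes>\<^bsub>R\<^esub> b j l)"
      using dc Bc bc l by (intro R.finsum_cong') (auto simp: R.finsum_ldistr)
    also have "\<dots> = \<zero>\<^bsub>R\<^esub>" using z l by simp
    finally show "(\<Oplus>\<^bsub>R\<^esub>i\<in>{..<length d}. fst (d ! i) \<otimes>\<^bsub>R\<^esub> B' (snd (d ! i)) l) = \<zero>\<^bsub>R\<^esub>" .
  qed
  have "satisfies R k' B' e"
    using e(1) \<rho>b by (intro resp) (auto simp: is_relation_def \<rho>_def)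
  moreover have "satisfies R k' B' d" if "d \<in> set es" for d
  proof (rule resp)
    show "set d \<subseteq> carrier R \<times> carrier M" using Cons.prems[of d] that by (auto simp: is_relation_def)
    fix l assume l: "l < k'"
    have "satisfies R k B d" using es that by auto
    then have "(\<Oplus>\<^bsub>R\<^esub>j\<in>{..<k}. (\<Oplus>\<^bsub>R\<^esub>i\<in>{..<length d}. fst (d ! i) \<otimes>\<^bsub>R\<^esub> B (snd (d ! i)) j) \<otimes>\<^bsub>R\<^esub> b j l) =
        (\<Oplus>\<^bsub>R\<^esub>j\<in>{..<k}. \<zero>\<^bsub>R\<^esub>)"
      using bc l by (intro R.finsum_cong') (auto simp: satisfies_def)
    then show "(\<Oplus>\<^bsub>R\<^esub>j\<in>{..<k}. (\<Oplus>\<^bsub>R\<^esub>i\<in>{..<length d}. fst (d ! i) \<otimes>\<^bsub>R\<^esub> B (snd (d ! i)) j) \<otimes>\<^bsub>R\<^esub> b j l) = \<zero>\<^bsub>R\<^esub>"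
      by (simp add: R.finsum_zero)
  qed
  moreover have "lifts R M S k' B' m''"
    unfolding lifts_def
  proof (intro conjI allI ballI impI)
    fix x assume x: "x \<in> S"
    have "x = (\<Oplus>\<^bsub>M\<^esub>j\<in>{..<k}. B x j \<odot>\<^bsub>M\<^esub> m' j)" by (rule val[OF x])
    also have "\<dots> = (\<Oplus>\<^bsub>M\<^esub>j\<in>{..<k}. \<Oplus>\<^bsub>M\<^esub>l\<in>{..<k'}. (B x j \<otimes>\<^bsub>R\<^esub> b j l) \<odot>\<^bsub>M\<^esub> m'' l)"
    proof (rule M.finsum_cong')
      fix j assume "j \<in> {..<k}"
      then show "B x j \<odot>\<^bsub>M\<^esub> m' j = (\<Oplus>\<^bsub>M\<^esub>l\<in>{..<k'}. (B x j \<otimes>\<^bsub>R\<^esub> b j l) \<odot>\<^bsub>M\<^esub> m'' l)"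
        using Bc bc m''c m'' by (auto simp: finsum_smult_ldistr smult_assoc1 intro!: M.finsum_cong')
    qed (use Bc bc m''c in auto)
    also have "\<dots> = (\<Oplus>\<^bsub>M\<^esub>l\<in>{..<k'}. \<Oplus>\<^bsub>M\<^esub>j\<in>{..<k}. (B x j \<otimes>\<^bsub>R\<^esub> b j l) \<odot>\<^bsub>M\<^esub> m'' l)"
      using Bc bc m''c by (intro M.finsum_swap) auto
    also have "\<dots> = (\<Oplus>\<^bsub>M\<^esub>l\<in>{..<k'}. B' x l \<odot>\<^bsub>M\<^esub> m'' l)"
      unfolding B'_def using Bc bc m''c
      by (intro M.finsum_cong') (auto intro!: finsum_smult_rdistr[symmetric])
    finally show "x = (\<Oplus>\<^bsub>M\<^esub>l\<in>{..<k'}. B' x l \<odot>\<^bsub>M\<^esub> m'' l)" .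
  qed (use B'c m''c in auto)
  ultimately show ?case by (intro exI[of _ k'] exI[of _ B'] exI[of _ m'']) auto
qed

lemma (in abelian_group) eq_if_minus_zero:
  assumes "a \<ominus> b = \<zero>" "a \<in> carrier G" "b \<in> carrier G"
  shows "a = b"
proof -
  have "a = (a \<ominus> b) \<oplus> b" using assms(2,3) by (simp add: a_minus_def a_assoc l_neg)
  then show ?thesis using assms by simp
qed

section \<open>The relations that define the tensor product\<close>

lemma tensor_relators_carrier:
  assumes "Module.module R M" "Module.module R N"
  shows "tensor_relators R M N \<subseteq> carrier (free_Abelian_group (carrier M \<times> carrier N))"
proof
  interpret M: Module.module R M by fact
  interpret N: Module.module R N by fact
  fix z assume "z \<in> tensor_relators R M N"
  then show "z \<in> carrier (free_Abelian_group (carrier M \<times> carrier N))"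
  proof cases
    case (1 x x' y)
    show ?thesis unfolding 1(1) carrier_free_Abelian_group_iff
      by (rule order_trans[OF keys_diff] Un_least)+ (use 1 in auto)
  next
    case (2 x y y')
    show ?thesis unfolding 2(1) carrier_free_Abelian_group_iff
      by (rule order_trans[OF keys_diff] Un_least)+ (use 2 in auto)
  next
    case (3 r x y)
    show ?thesis unfolding 3(1) carrier_free_Abelian_group_iff
      by (rule order_trans[OF keys_diff] Un_least)+ (use 3 in auto)
  qed
qed

locale module_pair = M: Module.module R M + N: Module.module R N
  for R :: "('r, 'a) ring_scheme" and M :: "('r, 'm, 'b) module_scheme" and N :: "('r, 'n, 'c) module_scheme"
begin

abbreviation F where "F \<equiv> free_Abelian_group (carrier M \<times> carrier N)"

lemma subgroup_tensor_relations: "subgroup (tensor_relations R M N) F"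
  unfolding tensor_relations_def
  by (intro group.generate_is_subgroup tensor_relators_carrier M.module_axioms N.module_axioms) simp

lemma tensor_relations_keys: "z \<in> tensor_relations R M N \<Longrightarrow> Poly_Mapping.keys z \<subseteq> carrier M \<times> carrier N"
  by (drule subgroup.mem_carrier[OF subgroup_tensor_relations]) (simp only: carrier_free_Abelian_group_iff)

lemma tensor_relations_add:
  "a \<in> tensor_relations R M N \<Longrightarrow> b \<in> tensor_relations R M N \<Longrightarrow> a + b \<in> tensor_relations R M N"
  using subgroup.m_closed[OF subgroup_tensor_relations] by simp

lemma tensor_relations_minus:
  assumes "a \<in> tensor_relations R M N"
  shows "- a \<in> tensor_relations R M N"
  using subgroup.m_inv_closed[OF subgroup_tensor_relations assms]
  by (simp only: inv_free_Abelian_group[OF tensor_relations_keys[OF assms]])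

lemma tensor_relations_diff:
  "a \<in> tensor_relations R M N \<Longrightarrow> b \<in> tensor_relations R M N \<Longrightarrow> a - b \<in> tensor_relations R M N"
  using tensor_relations_add[OF _ tensor_relations_minus] by fastforce

lemma tensor_relations_zero: "0 \<in> tensor_relations R M N"
  using subgroup.one_closed[OF subgroup_tensor_relations] by simp

lemma relator_in: "z \<in> tensor_relators R M N \<Longrightarrow> z \<in> tensor_relations R M N"
  unfolding tensor_relations_def by (rule generate.incl)

text \<open>The additivity relator for zero plus zero is minus this generator.\<close>

lemma frag_zero_left: "y \<in> carrier N \<Longrightarrow> frag_of (\<zero>\<^bsub>M\<^esub>, y) \<in> tensor_relations R M N"
  using tensor_relations_minus[OF relator_in[OF tensor_relators.intros(1)[of "\<zero>\<^bsub>M\<^esub>" M "\<zero>\<^bsub>M\<^esub>" y N R]]]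
  by simp

lemma frag_zero_right: "x \<in> carrier M \<Longrightarrow> frag_of (x, \<zero>\<^bsub>N\<^esub>) \<in> tensor_relations R M N"
  using tensor_relations_minus[OF relator_in[OF tensor_relators.intros(2)[of x M "\<zero>\<^bsub>N\<^esub>" N "\<zero>\<^bsub>N\<^esub>" R]]]
  by simp

lemma frag_sum_left:
  assumes "finite J" "\<And>j. j \<in> J \<Longrightarrow> c j \<in> carrier M" "y \<in> carrier N"
  shows "frag_of (\<Oplus>\<^bsub>M\<^esub>j\<in>J. c j, y) - (\<Sum>j\<in>J. frag_of (c j, y)) \<in> tensor_relations R M N"
  using assms(1,2)
proof (induction J rule: finite_induct)
  case empty
  then show ?case using frag_zero_left assms(3) by simp
next
  case (insert a J)
  let ?s = "\<Oplus>\<^bsub>M\<^esub>j\<in>J. c j"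
  have "frag_of (c a \<oplus>\<^bsub>M\<^esub> ?s, y) - frag_of (c a, y) - frag_of (?s, y) \<in> tensor_relations R M N"
    using insert assms by (intro relator_in tensor_relators.intros) auto
  from tensor_relations_add[OF this insert.IH]
  have "frag_of (c a \<oplus>\<^bsub>M\<^esub> ?s, y) - frag_of (c a, y) - (\<Sum>j\<in>J. frag_of (c j, y)) \<in> tensor_relations R M N"
    using insert.prems by (simp add: algebra_simps)
  then show ?case using insert by (simp add: algebra_simps Pi_def)
qed

text \<open>On a generator \<open>(x, y)\<close> this expands \<open>x\<close> in the
  \<open>m' j\<close> and moves the scalars \<open>B x j\<close> to the other side; the general case
  follows by additivity. The maps \<open>h j\<close> live on the free group and need not respect the
  relations, as \<open>B\<close> need not be additive in \<open>x\<close>.\<close>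

lemma lift_coordinates:
  assumes L: "lifts R M S k B m'" and S: "S \<subseteq> carrier M"
    and c: "Poly_Mapping.keys c \<subseteq> S \<times> carrier N"
    and h: "\<And>j. j < k \<Longrightarrow> h j \<in> hom F (add_monoid N)"
    and hB: "\<And>j x y. j < k \<Longrightarrow> x \<in> carrier M \<Longrightarrow> y \<in> carrier N \<Longrightarrow> h j (frag_of (x, y)) = B x j \<odot>\<^bsub>N\<^esub> y"
  shows "c - (\<Sum>j<k. frag_of (m' j, h j c)) \<in> tensor_relations R M N"
proof -
  have Bc: "B x j \<in> carrier R" "m' j \<in> carrier M" if "j < k" for x j
    using L that by (auto simp: lifts_def)
  have grp: "group_hom F (add_monoid N) (h j)" if "j < k" for j
    using h[OF that] by (intro group_hom.intro group_hom_axioms.intro) (auto intro: N.a_group)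
  have inF: "x \<in> carrier F" if "Poly_Mapping.keys x \<subseteq> S \<times> carrier N" for x
    using that S by (force simp: carrier_free_Abelian_group_iff)
  from c show ?thesis
  proof (induction c rule: free_Abelian_group_induct[consumes 1, case_names zero diff frag])
    case zero
    have "frag_of (m' j, h j 0) \<in> tensor_relations R M N" if "j < k" for j
      using group_hom.hom_one[OF grp[OF that]] frag_zero_right Bc that by simp
    then have "(\<Sum>j<k'. frag_of (m' j, h j 0)) \<in> tensor_relations R M N" if "k' \<le> k" for k'
      using that by (induction k') (auto intro: tensor_relations_add tensor_relations_zero)
    then show ?case using tensor_relations_minus by fastforce
  next
    case (diff x y)
    have *: "frag_of (m' j, h j x) - frag_of (m' j, h j y) - frag_of (m' j, h j (x - y)) \<in> tensor_relations R M N"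
      if j: "j < k" for j
    proof -
      interpret gh: group_hom F "add_monoid N" "h j" by (rule grp[OF j])
      have k2: "Poly_Mapping.keys (x - y) \<subseteq> S \<times> carrier N"
        by (rule order_trans[OF keys_diff Un_least[OF diff(1,2)]])
      have hc: "h j (x - y) \<in> carrier N" "h j y \<in> carrier N"
        using gh.hom_closed[OF inF[OF k2]] gh.hom_closed[OF inF[OF diff(2)]] by auto
      have "h j x = h j (x - y + y)" by simp
      also have "\<dots> = h j (x - y) \<oplus>\<^bsub>N\<^esub> h j y"
        using gh.hom_mult[OF inF[OF k2] inF[OF diff(2)]] by simp
      finally have "frag_of (m' j, h j x) - frag_of (m' j, h j (x - y)) - frag_of (m' j, h j y) \<in> tensor_relations R M N"
        using hc Bc[OF j] by (auto intro!: relator_in tensor_relators.intros(2))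
      then show ?thesis by (simp add: algebra_simps)
    qed
    have "(\<Sum>j<k'. frag_of (m' j, h j x) - frag_of (m' j, h j y) - frag_of (m' j, h j (x - y)))
        \<in> tensor_relations R M N" if "k' \<le> k" for k'
      using that by (induction k') (auto intro!: tensor_relations_add tensor_relations_zero *)
    from tensor_relations_add[OF tensor_relations_diff[OF diff(3,4)] this[OF order_refl]] show ?case
      by (simp add: sum_subtractf sum.distrib algebra_simps)
  next
    case (frag a)
    obtain x y where a: "a = (x, y)" "x \<in> S" "x \<in> carrier M" "y \<in> carrier N" using frag S by auto
    have x: "x = (\<Oplus>\<^bsub>M\<^esub>j\<in>{..<k}. B x j \<odot>\<^bsub>M\<^esub> m' j)" using L a by (auto simp: lifts_def)
    have "frag_of (x, y) - (\<Sum>j<k. frag_of (B x j \<odot>\<^bsub>M\<^esub> m' j, y)) \<in> tensor_relations R M N"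
      using frag_sum_left[of "{..<k}" "\<lambda>j. B x j \<odot>\<^bsub>M\<^esub> m' j" y] a Bc x by simp
    moreover have "(\<Sum>j<k'. frag_of (B x j \<odot>\<^bsub>M\<^esub> m' j, y) - frag_of (m' j, B x j \<odot>\<^bsub>N\<^esub> y))
        \<in> tensor_relations R M N" if "k' \<le> k" for k'
    proof -
      have "frag_of (B x j \<odot>\<^bsub>M\<^esub> m' j, y) - frag_of (m' j, B x j \<odot>\<^bsub>N\<^esub> y) \<in> tensor_relations R M N"
        if "j < k" for j
        using that Bc a by (intro relator_in tensor_relators.intros(3)) auto
      with that show ?thesis by (induction k') (auto intro!: tensor_relations_add tensor_relations_zero)
    qed
    ultimately have "frag_of (x, y) - (\<Sum>j<k. frag_of (B x j \<odot>\<^bsub>M\<^esub> m' j, y)) +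
       (\<Sum>j<k. frag_of (B x j \<odot>\<^bsub>M\<^esub> m' j, y) - frag_of (m' j, B x j \<odot>\<^bsub>N\<^esub> y)) \<in> tensor_relations R M N"
      by (blast intro: tensor_relations_add)
    moreover have "(\<Sum>j<k. frag_of (m' j, h j (frag_of a))) = (\<Sum>j<k. frag_of (m' j, B x j \<odot>\<^bsub>N\<^esub> y))"
      using a hB by (intro sum.cong) auto
    ultimately show ?case by (simp add: sum_subtractf a)
  qed
qed

text \<open>Only finitely many linear relations of \<open>M\<close> enter a given consequence of the relators.\<close>

lemma tensor_relations_finite_support:
  assumes "z \<in> tensor_relations R M N"
  shows "\<exists>es. (\<forall>e\<in>set es. is_relation R M e) \<and>
    (\<forall>k B j h. (\<forall>x. \<forall>j<k. B x j \<in> carrier R) \<longrightarrow> (\<forall>e\<in>set es. satisfies R k B e) \<longrightarrow> j < k \<longrightarrow>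
      h \<in> hom F (add_monoid N) \<longrightarrow>
      (\<forall>x\<in>carrier M. \<forall>y\<in>carrier N. h (frag_of (x, y)) = B x j \<odot>\<^bsub>N\<^esub> y) \<longrightarrow> h z = \<zero>\<^bsub>N\<^esub>)"
  (is "\<exists>es. ?P z es")
proof -
  have grp: "group_hom F (add_monoid N) h" if "h \<in> hom F (add_monoid N)" for h
    using that by (intro group_hom.intro group_hom_axioms.intro) (auto intro: N.a_group)
  have h_diff: "h (u - v) = h u \<ominus>\<^bsub>N\<^esub> h v"
    if "h \<in> hom F (add_monoid N)" "u \<in> carrier F" "v \<in> carrier F" for h u v
  proof -
    interpret gh: group_hom F "add_monoid N" h by (rule grp[OF that(1)])
    have "u - v = u \<otimes>\<^bsub>F\<^esub> inv\<^bsub>F\<^esub> v"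
      using that(3) by (simp add: carrier_free_Abelian_group_iff)
    also have "h \<dots> = h u \<oplus>\<^bsub>N\<^esub> h (inv\<^bsub>F\<^esub> v)"
      using gh.hom_mult[OF that(2) group.inv_closed[OF group_free_Abelian_group that(3)]] by simp
    also have "h (inv\<^bsub>F\<^esub> v) = \<ominus>\<^bsub>N\<^esub> h v"
      using gh.hom_inv[OF that(3)] by (simp add: a_inv_def)
    finally show ?thesis by (simp add: a_minus_def)
  qed
  have fragF: "frag_of (x, y) \<in> carrier F" if "x \<in> carrier M" "y \<in> carrier N" for x y
    using that by (simp add: carrier_free_Abelian_group_iff)
  have FdiffF: "u - v \<in> carrier F" if "u \<in> carrier F" "v \<in> carrier F" for u v
    using that keys_diff[of u v] by (auto simp: carrier_free_Abelian_group_iff)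
  have sum3: "(\<Oplus>\<^bsub>G\<^esub>i\<in>{..<3::nat}. f i) = f 0 \<oplus>\<^bsub>G\<^esub> f 1 \<oplus>\<^bsub>G\<^esub> f 2"
    if "abelian_monoid G" "f 0 \<in> carrier G" "f 1 \<in> carrier G" "f 2 \<in> carrier G"
    for f and G :: "('x, 'y) ring_scheme"
  proof -
    interpret abelian_monoid G by fact
    have "{..<3::nat} = {0,1,2}" by auto
    then show ?thesis using that(2-) by (simp add: a_assoc)
  qed
  have sum2: "(\<Oplus>\<^bsub>G\<^esub>i\<in>{..<2::nat}. f i) = f 0 \<oplus>\<^bsub>G\<^esub> f 1"
    if "abelian_monoid G" "f 0 \<in> carrier G" "f 1 \<in> carrier G"
    for f and G :: "('x, 'y) ring_scheme"
  proof -
    interpret abelian_monoid G by fact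
    have "{..<2::nat} = {0,1}" by auto
    then show ?thesis using that(2-) by simp
  qed
  have rel: "\<exists>es. ?P z es" if "z \<in> tensor_relators R M N" for z
    using that
  proof cases
    case (1 x x' y)
    \<comment> \<open>The relation x + x' - (x + x') = 0 of \<open>M\<close>. Coordinates that
      satisfy it are additive on this one pair, which makes \<open>h\<close> vanish on the
      relator.\<close>
    let ?e = "[(\<one>\<^bsub>R\<^esub>, x), (\<one>\<^bsub>R\<^esub>, x'), (\<ominus>\<^bsub>R\<^esub> \<one>\<^bsub>R\<^esub>, x \<oplus>\<^bsub>M\<^esub> x')]"
    have "is_relation R M ?e"
      using 1 by (simp add: is_relation_def sum3 M.M.abelian_monoid_axioms M.smult_l_minus M.M.r_neg flip: numeral_3_eq_3)
    moreover have "h z = \<zero>\<^bsub>N\<^esub>"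
      if B: "\<forall>x. \<forall>j<k. B x j \<in> carrier R" and sat: "satisfies R k B ?e" and j: "j < k"
        and h: "h \<in> hom F (add_monoid N)" and hB: "\<forall>x\<in>carrier M. \<forall>y\<in>carrier N. h (frag_of (x, y)) = B x j \<odot>\<^bsub>N\<^esub> y"
      for k B j h
    proof -
      have Bc: "B x j \<in> carrier R" for x using B j by blast
      have "B x j \<oplus>\<^bsub>R\<^esub> B x' j \<ominus>\<^bsub>R\<^esub> B (x \<oplus>\<^bsub>M\<^esub> x') j = \<zero>\<^bsub>R\<^esub>"
        using sat[unfolded satisfies_def, rule_format, OF j] Bc
        by (simp add: sum3 M.R.abelian_monoid_axioms M.R.l_minus a_minus_def flip: numeral_3_eq_3)
      then have eq: "B (x \<oplus>\<^bsub>M\<^esub> x') j = B x j \<oplus>\<^bsub>R\<^esub> B x' j"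
        using Bc M.R.eq_if_minus_zero by (metis M.R.add.m_closed)
      have "h z = (B (x \<oplus>\<^bsub>M\<^esub> x') j \<odot>\<^bsub>N\<^esub> y \<ominus>\<^bsub>N\<^esub> B x j \<odot>\<^bsub>N\<^esub> y) \<ominus>\<^bsub>N\<^esub> B x' j \<odot>\<^bsub>N\<^esub> y"
        using 1 hB by (simp add: h_diff[OF h FdiffF[OF fragF fragF] fragF] h_diff[OF h fragF fragF])
      also have "\<dots> = \<zero>\<^bsub>N\<^esub>"
        using 1 Bc unfolding eq
        by (simp add: N.smult_l_distr a_minus_def N.M.a_ac N.M.r_neg N.M.r_neg1 N.M.r_neg2)
      finally show ?thesis .
    qed
    ultimately show ?thesis by (intro exI[of _ "[?e]"]) auto
  next
    case (2 x y y')
    have "h z = \<zero>\<^bsub>N\<^esub>"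
      if B: "\<forall>x. \<forall>j<k. B x j \<in> carrier R" and j: "j < k"
        and h: "h \<in> hom F (add_monoid N)" and hB: "\<forall>x\<in>carrier M. \<forall>y\<in>carrier N. h (frag_of (x, y)) = B x j \<odot>\<^bsub>N\<^esub> y"
      for k B j h
    proof -
      have Bc: "B x j \<in> carrier R" for x using B j by blast
      have "h z = (B x j \<odot>\<^bsub>N\<^esub> (y \<oplus>\<^bsub>N\<^esub> y') \<ominus>\<^bsub>N\<^esub> B x j \<odot>\<^bsub>N\<^esub> y) \<ominus>\<^bsub>N\<^esub> B x j \<odot>\<^bsub>N\<^esub> y'"
        using 2 hB by (simp add: h_diff[OF h FdiffF[OF fragF fragF] fragF] h_diff[OF h fragF fragF])
      also have "\<dots> = \<zero>\<^bsub>N\<^esub>"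
        using 2 Bc
        by (simp add: N.smult_r_distr a_minus_def N.M.a_ac N.M.r_neg N.M.r_neg1 N.M.r_neg2)
      finally show ?thesis .
    qed
    \<comment> \<open>Additivity in the second argument holds for arbitrary coordinates, so this
      relator contributes no relation of \<open>M\<close>.\<close>
    then show ?thesis by (intro exI[of _ "[]"]) auto
  next
    case (3 r x y)
    \<comment> \<open>Coordinates that satisfy this relation are compatible with the scalar
      \<open>r\<close> at the one element \<open>x\<close>.\<close>
    let ?e = "[(r, x), (\<ominus>\<^bsub>R\<^esub> \<one>\<^bsub>R\<^esub>, r \<odot>\<^bsub>M\<^esub> x)]"
    have "is_relation R M ?e"
      using 3 by (simp add: is_relation_def sum2 M.M.abelian_monoid_axioms M.smult_l_minus M.M.r_neg flip: numeral_2_eq_2)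
    moreover have "h z = \<zero>\<^bsub>N\<^esub>"
      if B: "\<forall>x. \<forall>j<k. B x j \<in> carrier R" and sat: "satisfies R k B ?e" and j: "j < k"
        and h: "h \<in> hom F (add_monoid N)" and hB: "\<forall>x\<in>carrier M. \<forall>y\<in>carrier N. h (frag_of (x, y)) = B x j \<odot>\<^bsub>N\<^esub> y"
      for k B j h
    proof -
      have Bc: "B x j \<in> carrier R" for x using B j by blast
      have "r \<otimes>\<^bsub>R\<^esub> B x j \<ominus>\<^bsub>R\<^esub> B (r \<odot>\<^bsub>M\<^esub> x) j = \<zero>\<^bsub>R\<^esub>"
        using sat[unfolded satisfies_def, rule_format, OF j] Bc 3
        by (simp add: sum2 M.R.abelian_monoid_axioms M.R.l_minus a_minus_def flip: numeral_2_eq_2)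
      then have eq: "B (r \<odot>\<^bsub>M\<^esub> x) j = r \<otimes>\<^bsub>R\<^esub> B x j"
        using Bc 3 M.R.eq_if_minus_zero by (metis M.R.m_closed)
      have "h z = B (r \<odot>\<^bsub>M\<^esub> x) j \<odot>\<^bsub>N\<^esub> y \<ominus>\<^bsub>N\<^esub> B x j \<odot>\<^bsub>N\<^esub> (r \<odot>\<^bsub>N\<^esub> y)"
        using 3 hB by (simp add: h_diff[OF h fragF fragF])
      also have "\<dots> = (r \<otimes>\<^bsub>R\<^esub> B x j) \<odot>\<^bsub>N\<^esub> y \<ominus>\<^bsub>N\<^esub> (B x j \<otimes>\<^bsub>R\<^esub> r) \<odot>\<^bsub>N\<^esub> y"
        using 3 Bc unfolding eq by (simp add: N.smult_assoc1)
      also have "\<dots> = \<zero>\<^bsub>N\<^esub>"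
        using 3 Bc by (simp add: M.R.m_comm a_minus_def N.M.r_neg)
      finally show ?thesis .
    qed
    ultimately show ?thesis by (intro exI[of _ "[?e]"]) auto
  qed
  from assms show ?thesis unfolding tensor_relations_def
  proof (induction rule: generate.induct)
    case one
    have "h 0 = \<zero>\<^bsub>N\<^esub>" if "h \<in> hom F (add_monoid N)" for h
      using group_hom.hom_one[OF grp[OF that]] by simp
    then show ?case by (intro exI[of _ "[]"]) auto
  next
    case (incl z)
    then show ?case by (rule rel)
  next
    case (inv z)
    have zF: "z \<in> carrier F"
      by (rule subsetD[OF tensor_relators_carrier[OF M.module_axioms N.module_axioms] inv])
    have "h (inv\<^bsub>F\<^esub> z) = \<zero>\<^bsub>N\<^esub>" if "h \<in> hom F (add_monoid N)" "h z = \<zero>\<^bsub>N\<^esub>" for h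
      using group_hom.hom_inv[OF grp[OF that(1)] zF] that(2) N.M.add.inv_one by simp
    with rel[OF inv] show ?case by blast
  next
    case (eng z1 z2)
    then obtain es1 es2 where "?P z1 es1" "?P z2 es2" by auto
    moreover have "z1 \<in> carrier F" "z2 \<in> carrier F"
      using eng(1,2) tensor_relators_carrier[OF M.module_axioms N.module_axioms]
        group.generate_in_carrier[OF group_free_Abelian_group] by blast+
    then have "h (z1 \<otimes>\<^bsub>F\<^esub> z2) = \<zero>\<^bsub>N\<^esub>" if "h \<in> hom F (add_monoid N)" "h z1 = \<zero>\<^bsub>N\<^esub>" "h z2 = \<zero>\<^bsub>N\<^esub>" for h
      using group_hom.hom_mult[OF grp[OF that(1)], of z1 z2] that by simp
    ultimately show ?case by (intro exI[of _ "es1 @ es2"]) (auto simp: ball_Un)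
  qed
qed

lemma coordinate_hom_exists:
  assumes "\<And>x. x \<in> carrier M \<Longrightarrow> b x \<in> carrier R"
  obtains h where "h \<in> hom F (add_monoid N)"
    "\<And>x y. x \<in> carrier M \<Longrightarrow> y \<in> carrier N \<Longrightarrow> h (frag_of (x, y)) = b x \<odot>\<^bsub>N\<^esub> y"
proof -
  have *: "(\<lambda>(x, y). b x \<odot>\<^bsub>N\<^esub> y) ` (carrier M \<times> carrier N) \<subseteq> carrier (add_monoid N)" using assms by auto
  obtain h where "h \<in> hom F (add_monoid N)"
    "\<And>p. p \<in> carrier M \<times> carrier N \<Longrightarrow> h (frag_of p) = (\<lambda>(x, y). b x \<odot>\<^bsub>N\<^esub> y) p"
    using comm_group.free_Abelian_group_universal[OF abelian_group.a_comm_group[OF N.M.abelian_group_axioms] *]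
    by metis
  then show ?thesis by (intro that) auto
qed

end

lemma frag_extend_pair_keys:
  assumes "Poly_Mapping.keys z \<subseteq> A \<times> B" "f \<in> B \<rightarrow> C"
  shows "Poly_Mapping.keys (frag_extend (\<lambda>(x, y). frag_of (x, f y)) z) \<subseteq> A \<times> C"
proof -
  have "Poly_Mapping.keys (frag_extend (\<lambda>(x, y). frag_of (x, f y)) z) \<subseteq>
      (\<Union>p\<in>Poly_Mapping.keys z. Poly_Mapping.keys ((\<lambda>(x, y). frag_of (x, f y)) p))"
    by (rule keys_frag_extend)
  also have "\<dots> \<subseteq> A \<times> C" using assms by fastforce
  finally show ?thesis .
qed

text \<open>Let \<open>c\<close> become a relation after applying \<open>f\<close>. Only finitely
  many linear relations of \<open>M\<close> are used for that; take coordinates that satisfy them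
  all. The coordinate map into \<open>N'\<close> then kills the image of \<open>c\<close>. It equals
  \<open>f\<close> after the coordinate map \<open>h j\<close> into \<open>N\<close>, so injectivity
  of \<open>f\<close> gives \<open>h j c\<close> = 0. By \<open>lift_coordinates\<close>,
  \<open>c\<close> is modulo relations a sum of tensors with zero, hence a relation.\<close>

theorem flat_module_if_equational_criterion:
  fixes R :: "'r ring" and M :: "('r, 'm) module"
  assumes RM: "Module.module R M" and crit: "equational_criterion R M"
  shows "flat_module R M TYPE('n) TYPE('k)"
  unfolding flat_module_def
proof (intro conjI allI impI RM)
  fix N :: "('r, 'n) module" and N' :: "('r, 'k) module" and f
  assume RN: "Module.module R N" and RN': "Module.module R N'"
    and f: "f \<in> module_homs R N N'" and inj: "inj_on f (carrier N)"
  interpret MN: module_pair R M N using RM RN by (simp add: module_pair_def)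
  interpret MN': module_pair R M N' using RM RN' by (simp add: module_pair_def)
  let ?fe = "frag_extend (\<lambda>(x, y). frag_of (x, f y))"
  have fc: "f \<in> carrier N \<rightarrow> carrier N'"
    and fadd: "\<And>x y. x \<in> carrier N \<Longrightarrow> y \<in> carrier N \<Longrightarrow> f (x \<oplus>\<^bsub>N\<^esub> y) = f x \<oplus>\<^bsub>N'\<^esub> f y"
    and fsm: "\<And>r x. r \<in> carrier R \<Longrightarrow> x \<in> carrier N \<Longrightarrow> f (r \<odot>\<^bsub>N\<^esub> x) = r \<odot>\<^bsub>N'\<^esub> f x"
    using f by (auto simp: module_homs_def)
  have f0: "f \<zero>\<^bsub>N\<^esub> = \<zero>\<^bsub>N'\<^esub>"
    using fsm[of "\<zero>\<^bsub>R\<^esub>" "\<zero>\<^bsub>N\<^esub>"] fc by (auto simp: Pi_def MN.N.smult_l_null MN'.N.smult_l_null)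
  have key: "c \<in> tensor_relations R M N"
    if c: "c \<in> carrier MN.F" and fc_rel: "?fe c \<in> tensor_relations R M N'" for c
  proof -
    have ck: "Poly_Mapping.keys c \<subseteq> carrier M \<times> carrier N"
      using c by (simp add: carrier_free_Abelian_group_iff)
    obtain es where es: "\<forall>e\<in>set es. is_relation R M e"
      and kill: "\<And>k B j h. (\<forall>x. \<forall>j<k. B x j \<in> carrier R) \<Longrightarrow> (\<forall>e\<in>set es. satisfies R k B e) \<Longrightarrow> j < k \<Longrightarrow>
        h \<in> hom MN'.F (add_monoid N') \<Longrightarrow>
        (\<forall>x\<in>carrier M. \<forall>y\<in>carrier N'. h (frag_of (x, y)) = B x j \<odot>\<^bsub>N'\<^esub> y) \<Longrightarrow> h (?fe c) = \<zero>\<^bsub>N'\<^esub>"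
      using MN'.tensor_relations_finite_support[OF fc_rel] by blast
    \<comment> \<open>The coordinates must represent the left entries of \<open>c\<close> and the
      elements that occur in the relations.\<close>
    define S where "S = fst ` Poly_Mapping.keys c \<union> (\<Union>e\<in>set es. snd ` set e)"
    have S: "finite S" "S \<subseteq> carrier M"
      using ck es by (fastforce simp: S_def is_relation_def)+
    have "\<exists>k B m'. lifts R M S k B m' \<and> (\<forall>e\<in>set es. satisfies R k B e)"
      using es by (intro MN.M.lifts_exist[OF crit S]) (auto simp: S_def)
    then obtain k B m' where L: "lifts R M S k B m'" and sat: "\<forall>e\<in>set es. satisfies R k B e"
      by blast
    have Bc: "\<forall>x. \<forall>j<k. B x j \<in> carrier R" and m'c: "\<forall>j<k. m' j \<in> carrier M"
      using L by (auto simp: lifts_def)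
    have "\<exists>h. h \<in> hom MN.F (add_monoid N) \<and>
        (\<forall>x\<in>carrier M. \<forall>y\<in>carrier N. h (frag_of (x, y)) = B x j \<odot>\<^bsub>N\<^esub> y)" if "j < k" for j
      using MN.coordinate_hom_exists[of "\<lambda>x. B x j"] Bc that by metis
    then obtain h where h: "\<And>j. j < k \<Longrightarrow> h j \<in> hom MN.F (add_monoid N)"
      "\<And>j x y. j < k \<Longrightarrow> x \<in> carrier M \<Longrightarrow> y \<in> carrier N \<Longrightarrow> h j (frag_of (x, y)) = B x j \<odot>\<^bsub>N\<^esub> y"
      by metis
    have hz: "h j c = \<zero>\<^bsub>N\<^esub>" if j: "j < k" for j
    proof -
      obtain h' where h': "h' \<in> hom MN'.F (add_monoid N')"
        "\<And>x y. x \<in> carrier M \<Longrightarrow> y \<in> carrier N' \<Longrightarrow> h' (frag_of (x, y)) = B x j \<odot>\<^bsub>N'\<^esub> y"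
        using MN'.coordinate_hom_exists[of "\<lambda>x. B x j"] Bc j by metis
      interpret gh: group_hom MN.F "add_monoid N" "h j"
        using h(1)[OF j] by (intro group_hom.intro group_hom_axioms.intro) (auto intro: MN.N.a_group)
      interpret gh': group_hom MN'.F "add_monoid N'" h'
        using h'(1) by (intro group_hom.intro group_hom_axioms.intro) (auto intro: MN'.N.a_group)
      have "f (h j d) = h' (?fe d) \<and> h j d \<in> carrier N"
        if "Poly_Mapping.keys d \<subseteq> carrier M \<times> carrier N" for d
        using that
      proof (induction d rule: free_Abelian_group_induct[consumes 1, case_names zero diff frag])
        case zero
        show ?case using gh.hom_one gh'.hom_one by (simp add: f0)
      next
        case (diff x y)
        have k2: "Poly_Mapping.keys (x - y) \<subseteq> carrier M \<times> carrier N"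
          by (rule order_trans[OF keys_diff Un_least[OF diff(1,2)]])
        have cF: "x - y \<in> carrier MN.F" "y \<in> carrier MN.F" using diff k2 by (auto simp: carrier_free_Abelian_group_iff)
        have cF': "?fe (x - y) \<in> carrier MN'.F" "?fe y \<in> carrier MN'.F"
          using frag_extend_pair_keys[OF k2 fc] frag_extend_pair_keys[OF diff(2) fc]
          by (simp_all add: carrier_free_Abelian_group_iff)
        have hc: "h j (x - y) \<in> carrier N" using gh.hom_closed[OF cF(1)] by simp
        have "h j x = h j (x - y) \<oplus>\<^bsub>N\<^esub> h j y"
          using gh.hom_mult[OF cF] by simp
        moreover have "h' (?fe x) = h' (?fe (x - y)) \<oplus>\<^bsub>N'\<^esub> h' (?fe y)"
          using gh'.hom_mult[OF cF'] by (simp flip: frag_extend_add)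
        moreover have "h' (?fe (x - y)) \<in> carrier N'" "h' (?fe y) \<in> carrier N'"
          using gh'.hom_closed[OF cF'(1)] gh'.hom_closed[OF cF'(2)] by auto
        ultimately have "f (h j (x - y)) \<oplus>\<^bsub>N'\<^esub> f (h j y) = h' (?fe (x - y)) \<oplus>\<^bsub>N'\<^esub> f (h j y)"
          using diff(3,4) fadd hc by auto
        then have "f (h j (x - y)) = h' (?fe (x - y))"
          using fc hc diff(4) gh'.hom_closed[OF cF'(1)]
          by (metis MN'.N.M.add.right_cancel funcset_mem partial_object.select_convs(1))
        then show ?case using hc by simp
      next
        case (frag a)
        then show ?case using h(2)[OF j] h'(2) Bc j fsm fc by (auto simp: Pi_def frag_extend_of)
      qed
      then have "f (h j c) = h' (?fe c)" "h j c \<in> carrier N" using ck by auto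
      moreover have "h' (?fe c) = \<zero>\<^bsub>N'\<^esub>" using kill[OF Bc sat j h'(1)] h'(2) by blast
      ultimately show ?thesis using inj f0 by (metis MN.N.M.zero_closed inj_onD)
    qed
    have "c - (\<Sum>j<k. frag_of (m' j, h j c)) \<in> tensor_relations R M N"
    proof (rule MN.lift_coordinates[OF L S(2)])
      show "Poly_Mapping.keys c \<subseteq> S \<times> carrier N" using ck by (force simp: S_def)
    qed (use h in auto)
    moreover have "(\<Sum>j<k'. frag_of (m' j, h j c)) \<in> tensor_relations R M N" if "k' \<le> k" for k'
      using that m'c hz
      by (induction k') (auto intro!: MN.tensor_relations_add MN.tensor_relations_zero MN.frag_zero_right)
    ultimately have "c - (\<Sum>j<k. frag_of (m' j, h j c)) + (\<Sum>j<k. frag_of (m' j, h j c)) \<in> tensor_relations R M N"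
      by (blast intro: MN.tensor_relations_add)
    then show ?thesis by simp
  qed
  \<comment> \<open>\<open>tensor_map\<close> is a union over the representatives of a coset. They
    all yield the same coset because the induced map sends relations to relations.\<close>
  have cosets: "tensor_map R M N' f (tensor_relations R M N #>\<^bsub>MN.F\<^esub> a) = tensor_relations R M N' #>\<^bsub>MN'.F\<^esub> ?fe a"
    if a: "a \<in> carrier MN.F" for a
  proof -
    have feF: "?fe z \<in> carrier MN'.F" if "z \<in> carrier MN.F" for z
      using frag_extend_pair_keys[OF _ fc] that by (simp add: carrier_free_Abelian_group_iff)
    have relator: "?fe z \<in> tensor_relations R M N'" if "z \<in> tensor_relators R M N" for z
      using that
    proof cases
      case (1 x x' y)
      then show ?thesis using fc
        by (auto simp: frag_extend_diff frag_extend_of intro!: MN'.relator_in tensor_relators.intros)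
    next
      case (2 x y y')
      then show ?thesis using fc
        by (auto simp: frag_extend_diff frag_extend_of fadd intro!: MN'.relator_in tensor_relators.intros)
    next
      case (3 r x y)
      then show ?thesis using fc
        by (auto simp: frag_extend_diff frag_extend_of fsm intro!: MN'.relator_in tensor_relators.intros)
    qed
    have rel: "?fe z \<in> tensor_relations R M N'" if "z \<in> tensor_relations R M N" for z
      using that unfolding tensor_relations_def[of R M N]
    proof (induction rule: generate.induct)
      case one
      then show ?case using MN'.tensor_relations_zero by simp
    next
      case (incl z)
      then show ?case by (rule relator)
    next
      case (inv z)
      have "z \<in> carrier MN.F" by (rule subsetD[OF tensor_relators_carrier[OF RM RN] inv])
      then show ?case using MN'.tensor_relations_minus[OF relator[OF inv]]
        by (simp add: carrier_free_Abelian_group_iff frag_extend_minus)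
    next
      case (eng z1 z2)
      then show ?case using MN'.tensor_relations_add by (simp add: frag_extend_add)
    qed
    have "tensor_relations R M N' #>\<^bsub>MN'.F\<^esub> ?fe z = tensor_relations R M N' #>\<^bsub>MN'.F\<^esub> ?fe a"
      if z: "z \<in> tensor_relations R M N #>\<^bsub>MN.F\<^esub> a" for z
    proof -
      obtain d where d: "d \<in> tensor_relations R M N" "z = d + a"
        using z by (auto simp: r_coset_def)
      have "?fe z = ?fe d + ?fe a" using d by (simp add: frag_extend_add)
      then have "?fe z \<in> tensor_relations R M N' #>\<^bsub>MN'.F\<^esub> ?fe a"
        using rel[OF d(1)] by (auto simp: r_coset_def)
      then show ?thesis
        using group.repr_independence[OF group_free_Abelian_group _ feF[OF a] MN'.subgroup_tensor_relations] by metis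
    qed
    moreover have "a \<in> tensor_relations R M N #>\<^bsub>MN.F\<^esub> a"
      using MN.tensor_relations_zero by (force simp: r_coset_def)
    ultimately show ?thesis unfolding tensor_map_def by blast
  qed
  show "inj_on (tensor_map R M N' f) (carrier (tensor_product R M N))"
  proof (rule inj_onI)
    fix K L assume K: "K \<in> carrier (tensor_product R M N)" and L: "L \<in> carrier (tensor_product R M N)"
      and eq: "tensor_map R M N' f K = tensor_map R M N' f L"
    obtain a b where a: "a \<in> carrier MN.F" "K = tensor_relations R M N #>\<^bsub>MN.F\<^esub> a"
      and b: "b \<in> carrier MN.F" "L = tensor_relations R M N #>\<^bsub>MN.F\<^esub> b"
      using K L by (auto simp: tensor_product_def FactGroup_def RCOSETS_def)
    have "tensor_relations R M N' #>\<^bsub>MN'.F\<^esub> ?fe a = tensor_relations R M N' #>\<^bsub>MN'.F\<^esub> ?fe b"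
      using eq a b cosets by simp
    moreover have "?fe a \<in> tensor_relations R M N' #>\<^bsub>MN'.F\<^esub> ?fe a"
      using MN'.tensor_relations_zero by (force simp: r_coset_def)
    ultimately obtain d where "d \<in> tensor_relations R M N'" "?fe a = d + ?fe b"
      by (auto simp: r_coset_def)
    then have "?fe (a - b) \<in> tensor_relations R M N'" by (simp add: frag_extend_diff)
    moreover have "a - b \<in> carrier MN.F"
      using a b keys_diff[of a b] by (auto simp: carrier_free_Abelian_group_iff)
    ultimately have "a - b \<in> tensor_relations R M N" by (intro key)
    then have "a \<in> tensor_relations R M N #>\<^bsub>MN.F\<^esub> b"
      unfolding r_coset_def by (auto intro!: bexI[of _ "a - b"])
    then show "K = L"
      using group.repr_independence[OF group_free_Abelian_group _ b(1) MN.subgroup_tensor_relations] a b by metis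
  qed
qed

section \<open>Polynomials in two variables\<close>

text \<open>The outer variable is the second coordinate of the plane. Nesting the polynomials gives
  access to contents and primitive parts over the polynomials in the first coordinate, on which the
  elimination below relies.\<close>

definition eval2 :: "complex poly poly \<Rightarrow> complex \<times> complex \<Rightarrow> complex" where
  "eval2 g z = poly (poly g [:snd z:]) (fst z)"

lemma eval2_simps [simp]:
  "eval2 0 z = 0" "eval2 1 z = 1" "eval2 (g + h) z = eval2 g z + eval2 h z"
  "eval2 (g - h) z = eval2 g z - eval2 h z" "eval2 (- g) z = - eval2 g z"
  "eval2 (g * h) z = eval2 g z * eval2 h z" "eval2 (g ^ k) z = eval2 g z ^ k"
  by (simp_all add: eval2_def)

lemma eval2_sum [simp]: "eval2 (\<Sum>i\<in>A. f i) z = (\<Sum>i\<in>A. eval2 (f i) z)"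
  by (simp add: eval2_def poly_sum)

lemma eval2_eq_0_imp: assumes "\<And>z. eval2 g z = 0" shows "g = 0"
proof (rule ccontr)
  assume "g \<noteq> 0"
  have "poly g [:b:] = 0" for b
  proof -
    have "poly (poly g [:b:]) a = 0" for a using assms[of "(a, b)"] by (simp add: eval2_def)
    then show ?thesis by (simp add: poly_all_0_iff_0[symmetric])
  qed
  then have "range (\<lambda>b. [:b:]) \<subseteq> {x. poly g x = 0}" by auto
  then have "finite (range (\<lambda>b::complex. [:b:]))"
    using poly_roots_finite[OF \<open>g \<noteq> 0\<close>] finite_subset by blast
  moreover have "inj (\<lambda>b::complex. [:b:])" by (auto intro: injI)
  ultimately show False using infinite_UNIV_char_0 finite_imageD by blast
qed

lemma eval2_eqI: "(\<And>z. eval2 g z = eval2 h z) \<Longrightarrow> g = h"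
  using eval2_eq_0_imp[of "g - h"] by simp

lemma polynomial_in_poly: "polynomial_in C u \<Longrightarrow> polynomial_in C (\<lambda>z. poly c (u z))"
proof (induction c)
  case 0
  then show ?case using polynomial_in.intros(1)[of C 0] by simp
next
  case (pCons a c)
  have "polynomial_in C (\<lambda>z. a + u z * poly c (u z))"
    by (intro polynomial_in.intros(3)[OF polynomial_in.intros(1)] polynomial_in.intros(4) pCons)
  then show ?case by simp
qed

lemma polynomial_in_eval2_pair:
  assumes "polynomial_in C u" "polynomial_in C v"
  shows "polynomial_in C (\<lambda>z. eval2 g (u z, v z))"
proof (induction g)
  case 0
  then show ?case using polynomial_in.intros(1)[of C 0] by simp
next
  case (pCons a g)
  have "polynomial_in C (\<lambda>z. poly a (u z) + v z * eval2 g (u z, v z))"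
    by (intro polynomial_in.intros(3,4) polynomial_in_poly assms pCons)
  then show ?case by (simp add: eval2_def)
qed

lemma polynomial_in_eval2: "polynomial_in {fst, snd} (eval2 g)"
  using polynomial_in_eval2_pair[of "{fst, snd}" fst snd g] by (simp add: polynomial_in.intros(2))

lemma polynomial_in_imp_eval2:
  assumes "polynomial_in {fst, snd} f" shows "\<exists>g. f = eval2 g"
  using assms
proof induction
  case (1 c)
  have "(\<lambda>p. c) = eval2 [:[:c:]:]" by (simp add: eval2_def fun_eq_iff)
  then show ?case ..
next
  case (2 f)
  have "fst = eval2 [:[:0, 1:]:]" "snd = eval2 [:0, 1:]" by (simp_all add: eval2_def fun_eq_iff)
  with 2 show ?case by blast
next
  case (3 f g)
  then obtain a b where "f = eval2 a" "g = eval2 b" by auto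
  then have "(\<lambda>p. f p + g p) = eval2 (a + b)" by (simp add: fun_eq_iff)
  then show ?case ..
next
  case (4 f g)
  then obtain a b where "f = eval2 a" "g = eval2 b" by auto
  then have "(\<lambda>p. f p * g p) = eval2 (a * b)" by (simp add: fun_eq_iff)
  then show ?case ..
qed

text \<open>Exchanging the variables turns elimination of the outer variable into elimination of the
  inner one.\<close>

lemma swap_eval2: "\<exists>h. \<forall>a b. eval2 h (a, b) = eval2 g (b, a)"
proof -
  have "polynomial_in {fst, snd} (\<lambda>z. eval2 g (snd z, fst z))"
    by (intro polynomial_in_eval2_pair polynomial_in.intros(2)) auto
  from polynomial_in_imp_eval2[OF this] show ?thesis by (auto simp: fun_eq_iff)
qed

text \<open>\<open>shift_fst a\<close> and \<open>shift_snd b\<close> are the local parameters at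
  the point \<open>(a, b)\<close>, generators of its maximal ideal.\<close>

definition shift_fst :: "complex \<Rightarrow> complex poly poly" where "shift_fst a = [:[:-a, 1:]:]"
definition shift_snd :: "complex \<Rightarrow> complex poly poly" where "shift_snd b = [:[:-b:], 1:]"

lemma eval2_shift [simp]: "eval2 (shift_fst a) z = fst z - a" "eval2 (shift_snd b) z = snd z - b"
  by (simp_all add: eval2_def shift_fst_def shift_snd_def)

text \<open>Dividing by the second parameter leaves a remainder in the first coordinate alone, and
  this vanishes at \<open>a\<close>.\<close>

lemma eval2_eq_0_decompose:
  assumes "eval2 g (a, b) = 0"
  shows "\<exists>g1 g2. g = shift_fst a * g1 + shift_snd b * g2"
proof -
  define c where "c = poly g [:b:]"
  have "shift_snd b dvd g - [:c:]"
    unfolding shift_snd_def using poly_eq_0_iff_dvd[of "g - [:c:]" "[:b:]"] by (simp add: c_def)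
  then obtain g2 where g2: "g - [:c:] = shift_snd b * g2" by (auto elim: dvdE)
  have "[:-a, 1:] dvd c" using assms poly_eq_0_iff_dvd[of c a] by (simp add: eval2_def c_def)
  then obtain c1 where "c = [:-a, 1:] * c1" by (auto elim: dvdE)
  then have "[:c:] = shift_fst a * [:c1:]" by (simp add: shift_fst_def)
  with g2 have "g = shift_fst a * [:c1:] + shift_snd b * g2" by (metis diff_add_cancel add.commute)
  then show ?thesis by blast
qed

section \<open>Elimination of a variable from a coprime family\<close>

definition in_ideal :: "nat \<Rightarrow> (nat \<Rightarrow> 'a::comm_ring_1) \<Rightarrow> 'a \<Rightarrow> bool" where
  "in_ideal n g x \<longleftrightarrow> (\<exists>c. x = (\<Sum>i<n. c i * g i))"

lemma in_ideal_gen: "i < n \<Longrightarrow> in_ideal n g (g i)"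
  unfolding in_ideal_def by (rule exI[of _ "\<lambda>j. if j = i then 1 else 0"]) (simp add: if_distrib[of "\<lambda>x. x * _"] cong: if_cong)

lemma in_ideal_mult: "in_ideal n g x \<Longrightarrow> in_ideal n g (a * x)"
  unfolding in_ideal_def
  by (elim exE, rule_tac x = "\<lambda>i. a * c i" in exI) (simp add: sum_distrib_left mult.assoc)

lemma in_ideal_add: "in_ideal n g x \<Longrightarrow> in_ideal n g y \<Longrightarrow> in_ideal n g (x + y)"
  unfolding in_ideal_def
  by (elim exE, rule_tac x = "\<lambda>i. c i + ca i" in exI) (simp add: sum.distrib algebra_simps)

lemma in_ideal_diff: "in_ideal n g x \<Longrightarrow> in_ideal n g y \<Longrightarrow> in_ideal n g (x - y)"
  using in_ideal_add[OF _ in_ideal_mult[of n g y "-1"]] by simp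

text \<open>The constant is one for the outer variable only, i.e. a polynomial in the first
  coordinate. By pseudo-division, an element \<open>p\<close> of least outer degree in the ideal
  divides each \<open>g i\<close> up to a factor from the coefficient ring. By Gauss, the primitive
  part of \<open>p\<close> then divides each \<open>g i\<close> itself; coprimality makes it a unit,
  so \<open>p\<close> has degree zero.\<close>

lemma coprime_family_constant_in_ideal:
  fixes g :: "nat \<Rightarrow> complex poly poly"
  assumes "\<And>h. (\<And>i. i < n \<Longrightarrow> h dvd g i) \<Longrightarrow> is_unit h"
  shows "\<exists>c. c \<noteq> 0 \<and> in_ideal n g [:c:]"
proof -
  have ex: "\<exists>p. p \<noteq> 0 \<and> in_ideal n g p"
  proof (rule ccontr)
    assume "\<not> ?thesis"
    then have "g i = 0" if "i < n" for i using in_ideal_gen[OF that] by blast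
    then have "is_unit (0 :: complex poly poly)" using assms by auto
    then show False by simp
  qed
  define p where "p = (ARG_MIN degree p. p \<noteq> 0 \<and> in_ideal n g p)"
  have p: "p \<noteq> 0" "in_ideal n g p" and min: "\<And>r. r \<noteq> 0 \<Longrightarrow> in_ideal n g r \<Longrightarrow> degree p \<le> degree r"
  proof -
    obtain p0 where p0: "p0 \<noteq> 0 \<and> in_ideal n g p0" using ex by blast
    from arg_min_natI[of "\<lambda>p. p \<noteq> 0 \<and> in_ideal n g p", OF p0, of degree]
    show "p \<noteq> 0" "in_ideal n g p" by (auto simp: p_def)
    show "degree p \<le> degree r" if "r \<noteq> 0" "in_ideal n g r" for r
      unfolding p_def using that by (intro arg_min_nat_le) auto
  qed
  have "primitive_part p dvd g i" if i: "i < n" for i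
  proof (cases "g i = 0")
    case False
    obtain q r where qr: "pseudo_divmod (g i) p = (q, r)" by fastforce
    define c where "c = coeff p (degree p) ^ (Suc (degree (g i)) - degree p)"
    have c0: "c \<noteq> 0" using p(1) by (simp add: c_def)
    have eq: "Polynomial.smult c (g i) = p * q + r" and r: "r = 0 \<or> degree r < degree p"
      using pseudo_divmod[OF p(1) qr] by (auto simp: c_def)
    have "r = [:c:] * g i - q * p" using eq by (simp add: algebra_simps)
    then have "in_ideal n g r"
      using in_ideal_diff[OF in_ideal_mult[OF in_ideal_gen[OF i]] in_ideal_mult[OF p(2)]] by metis
    with r min have "r = 0" using not_le by blast
    with eq have "primitive_part (Polynomial.smult c (g i)) = primitive_part p * primitive_part q"
      by (simp add: primitive_part_mult)
    \<comment> \<open>Passing to primitive parts reduces the multiplier \<open>c\<close> to its unit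
      factor, which is inverted next.\<close>
    then have "primitive_part p dvd Polynomial.smult (unit_factor c) (primitive_part (g i))"
      by (simp add: primitive_part_smult)
    moreover obtain v where "1 = unit_factor c * v"
      using c0 unit_factor_is_unit by (metis dvdE)
    then have "primitive_part (g i) = Polynomial.smult v (Polynomial.smult (unit_factor c) (primitive_part (g i)))"
      by (simp add: mult.commute)
    ultimately have "primitive_part p dvd primitive_part (g i)" by (metis dvd_smult)
    moreover have "primitive_part (g i) dvd g i"
      by (metis content_times_primitive_part dvd_smult dvd_refl)
    ultimately show ?thesis by (rule dvd_trans)
  qed auto
  then have "is_unit (primitive_part p)" by (rule assms)
  then have "degree (primitive_part p) = 0" by (metis is_unit_polyE degree_pCons_0)
  then have "degree p = 0" by simp
  then obtain c where "p = [:c:]" by (rule degree_eq_zeroE)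
  with p show ?thesis by (intro exI[of _ c]) auto
qed


section \<open>Syzygies\<close>

text \<open>\<open>P\<close> is an algebra of functions on \<open>Z\<close>, regarded as a module over the polynomials in two
  variables by means of \<open>\<Phi>\<close>; everything is local at \<open>z0\<close>. The last two assumptions say that it is
  torsion-free and that the two coordinates of \<open>\<Phi> - \<Phi> z0\<close> form a regular sequence.\<close>

locale regular_algebra =
  fixes Z :: "'z set" and P :: "('z \<Rightarrow> complex) set" and \<Phi> :: "'z \<Rightarrow> complex \<times> complex" and z0 :: 'z
  assumes z0: "z0 \<in> Z"
    and const_P: "\<And>c. (\<lambda>z. c) \<in> P"
    and add_P: "\<And>f g. f \<in> P \<Longrightarrow> g \<in> P \<Longrightarrow> (\<lambda>z. f z + g z) \<in> P"
    and mult_P: "\<And>f g. f \<in> P \<Longrightarrow> g \<in> P \<Longrightarrow> (\<lambda>z. f z * g z) \<in> P"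
    and eval_P: "\<And>g. (\<lambda>z. eval2 g (\<Phi> z)) \<in> P"
    and torsion_free: "\<And>g F. g \<noteq> 0 \<Longrightarrow> F \<in> P \<Longrightarrow> (\<And>z. z \<in> Z \<Longrightarrow> eval2 g (\<Phi> z) * F z = 0) \<Longrightarrow>
      (\<And>z. z \<in> Z \<Longrightarrow> F z = 0)"
    and regular: "\<And>X Y. X \<in> P \<Longrightarrow> Y \<in> P \<Longrightarrow>
      (\<And>z. z \<in> Z \<Longrightarrow> (fst (\<Phi> z) - fst (\<Phi> z0)) * X z + (snd (\<Phi> z) - snd (\<Phi> z0)) * Y z = 0) \<Longrightarrow>
      \<exists>H\<in>P. \<exists>w\<in>P. H z0 \<noteq> 0 \<and> (\<forall>z\<in>Z. H z * X z = (snd (\<Phi> z) - snd (\<Phi> z0)) * w z \<and>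
        H z * Y z = - (fst (\<Phi> z) - fst (\<Phi> z0)) * w z)"
begin

lemma sum_list_P: "(\<And>x. x \<in> set xs \<Longrightarrow> f x \<in> P) \<Longrightarrow> (\<lambda>z. \<Sum>x\<leftarrow>xs. f x z) \<in> P"
proof (induction xs)
  case Nil
  then show ?case using const_P[of 0] by simp
next
  case (Cons a xs)
  then show ?case using add_P[of "f a"] by simp
qed

lemma sum_P: "(\<And>x. x \<in> A \<Longrightarrow> f x \<in> P) \<Longrightarrow> (\<lambda>z. \<Sum>x\<in>A. f x z) \<in> P"
proof (induction A rule: infinite_finite_induct)
  case (insert a A)
  then show ?case using add_P[of "f a"] by simp
qed (use const_P[of 0] in simp_all)

definition syz :: "nat \<Rightarrow> (nat \<Rightarrow> complex poly poly) \<Rightarrow> (nat \<Rightarrow> complex poly poly) set" where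
  "syz n g = {b. (\<Sum>i<n. g i * b i) = 0}"

text \<open>The coefficients come from \<open>P\<close>. Equality is tested on \<open>Z\<close>
  only, since the elements of \<open>P\<close> are functions on the whole type.\<close>

definition in_syz_span :: "nat \<Rightarrow> (nat \<Rightarrow> complex poly poly) \<Rightarrow> (nat \<Rightarrow> 'z \<Rightarrow> complex) \<Rightarrow> bool" where
  "in_syz_span n g F \<longleftrightarrow> (\<exists>bs. (\<forall>x\<in>set bs. fst x \<in> syz n g \<and> snd x \<in> P) \<and>
     (\<forall>i<n. \<forall>z\<in>Z. F i z = (\<Sum>x\<leftarrow>bs. eval2 (fst x i) (\<Phi> z) * snd x z)))"

lemma in_syz_spanI:
  assumes "\<And>x. x \<in> set bs \<Longrightarrow> b x \<in> syz n g \<and> f x \<in> P"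
    "\<And>i z. i < n \<Longrightarrow> z \<in> Z \<Longrightarrow> F i z = (\<Sum>x\<leftarrow>bs. eval2 (b x i) (\<Phi> z) * f x z)"
  shows "in_syz_span n g F"
  unfolding in_syz_span_def
  using assms by (intro exI[of _ "map (\<lambda>x. (b x, f x)) bs"]) (auto simp: o_def)

lemma in_syz_span_add:
  assumes "in_syz_span n g F" "in_syz_span n g G"
  shows "in_syz_span n g (\<lambda>i z. F i z + G i z)"
proof -
  from assms obtain bs cs where "\<forall>x\<in>set bs. fst x \<in> syz n g \<and> snd x \<in> P" "\<forall>x\<in>set cs. fst x \<in> syz n g \<and> snd x \<in> P"
    "\<forall>i<n. \<forall>z\<in>Z. F i z = (\<Sum>x\<leftarrow>bs. eval2 (fst x i) (\<Phi> z) * snd x z)"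
    "\<forall>i<n. \<forall>z\<in>Z. G i z = (\<Sum>x\<leftarrow>cs. eval2 (fst x i) (\<Phi> z) * snd x z)"
    unfolding in_syz_span_def by blast
  then show ?thesis by (intro in_syz_spanI[of "bs @ cs" fst n g snd]) auto
qed

lemma in_syz_span_mult:
  assumes "in_syz_span n g F" "h \<in> P"
  shows "in_syz_span n g (\<lambda>i z. h z * F i z)"
proof -
  from assms obtain bs where "\<forall>x\<in>set bs. fst x \<in> syz n g \<and> snd x \<in> P"
    "\<forall>i<n. \<forall>z\<in>Z. F i z = (\<Sum>x\<leftarrow>bs. eval2 (fst x i) (\<Phi> z) * snd x z)"
    unfolding in_syz_span_def by blast
  then show ?thesis using mult_P[OF \<open>h \<in> P\<close>]
    by (intro in_syz_spanI[of bs fst n g "\<lambda>x z. h z * snd x z"]) (auto simp: sum_list_const_mult mult_ac)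
qed

lemma in_syz_span_single: "b \<in> syz n g \<Longrightarrow> f \<in> P \<Longrightarrow> in_syz_span n g (\<lambda>i z. eval2 (b i) (\<Phi> z) * f z)"
  by (rule in_syz_spanI[of "[()]" "\<lambda>_. b" n g "\<lambda>_. f"]) auto

lemma in_syz_span_cong:
  "in_syz_span n g F \<Longrightarrow> (\<And>i z. i < n \<Longrightarrow> z \<in> Z \<Longrightarrow> F i z = G i z) \<Longrightarrow> in_syz_span n g G"
  by (simp add: in_syz_span_def)

definition relation :: "nat \<Rightarrow> (nat \<Rightarrow> complex poly poly) \<Rightarrow> (nat \<Rightarrow> 'z \<Rightarrow> complex) \<Rightarrow> bool" where
  "relation n g F \<longleftrightarrow> (\<forall>i<n. F i \<in> P) \<and> (\<forall>z\<in>Z. (\<Sum>i<n. eval2 (g i) (\<Phi> z) * F i z) = 0)"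

text \<open>Vanishing at \<open>z0\<close> of the first Tor of \<open>P\<close> with the quotient by
  the ideal of the \<open>g i\<close>: each relation is a combination of polynomial syzygies. The
  multiplier \<open>H\<close>, nonzero at \<open>z0\<close>, expresses localisation without forming
  fractions.\<close>

definition exact :: "nat \<Rightarrow> (nat \<Rightarrow> complex poly poly) \<Rightarrow> bool" where
  "exact n g \<longleftrightarrow> (\<forall>F. relation n g F \<longrightarrow> (\<exists>H\<in>P. H z0 \<noteq> 0 \<and> in_syz_span n g (\<lambda>i z. H z * F i z)))"

text \<open>Membership in the ideal after localising at the point \<open>\<Phi> z0\<close>;
  \<open>u\<close> is the denominator.\<close>

definition in_local_ideal :: "nat \<Rightarrow> (nat \<Rightarrow> complex poly poly) \<Rightarrow> complex poly poly \<Rightarrow> bool" where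
  "in_local_ideal n g x \<longleftrightarrow> (\<exists>u. eval2 u (\<Phi> z0) \<noteq> 0 \<and> in_ideal n g (u * x))"

lemma in_local_ideal_mult: "in_local_ideal n g x \<Longrightarrow> in_local_ideal n g (a * x)"
  unfolding in_local_ideal_def using in_ideal_mult[of n g _ a] by (metis mult.left_commute)

text \<open>Koszul syzygies: the ideal generated by the \<open>g i\<close> annihilates the first homology.\<close>

lemma koszul:
  assumes F: "relation n g F" and d: "in_ideal n g d"
  shows "in_syz_span n g (\<lambda>i z. eval2 d (\<Phi> z) * F i z)"
proof -
  obtain c where c: "d = (\<Sum>i<n. c i * g i)" using d by (auto simp: in_ideal_def)
  \<comment> \<open>The k-th syzygy is \<open>d\<close> times the k-th unit vector minus
    \<open>g k\<close> times the vector \<open>c\<close>. Weighted with \<open>F k\<close> and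
    summed over k, the second part is \<open>c\<close> times the relation itself, hence
    zero.\<close>
  show ?thesis
  proof (rule in_syz_spanI[of "[0..<n]" "\<lambda>k i. (if i = k then d else 0) - g k * c i" n g F])
    fix k assume "k \<in> set [0..<n]"
    then have k: "k < n" by simp
    have "(\<Sum>i<n. g i * ((if i = k then d else 0) - g k * c i)) =
        (\<Sum>i<n. if i = k then g i * d else 0) - (\<Sum>i<n. g k * (c i * g i))"
      unfolding sum_subtractf[symmetric] by (intro sum.cong) (auto simp: algebra_simps)
    also have "\<dots> = 0" using k by (simp add: c sum_distrib_left)
    finally show "(\<lambda>i. (if i = k then d else 0) - g k * c i) \<in> syz n g \<and> F k \<in> P"
      using F k by (simp add: syz_def relation_def)
  next
    fix i z assume i: "i < n" and z: "z \<in> Z"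
    have "(\<Sum>k\<leftarrow>[0..<n]. eval2 ((if i = k then d else 0) - g k * c i) (\<Phi> z) * F k z) =
        (\<Sum>k<n. eval2 ((if i = k then d else 0) - g k * c i) (\<Phi> z) * F k z)"
      by (simp add: interv_sum_list_conv_sum_set_nat atLeast0LessThan)
    also have "\<dots> = (\<Sum>k<n. if i = k then eval2 d (\<Phi> z) * F k z else 0) - (\<Sum>k<n. eval2 (c i) (\<Phi> z) * (eval2 (g k) (\<Phi> z) * F k z))"
      unfolding sum_subtractf[symmetric] by (intro sum.cong) (auto simp: algebra_simps)
    also have "(\<Sum>k<n. eval2 (c i) (\<Phi> z) * (eval2 (g k) (\<Phi> z) * F k z)) = 0"
      using F z by (simp add: sum_distrib_left[symmetric] relation_def)
    also have "(\<Sum>k<n. if i = k then eval2 d (\<Phi> z) * F k z else 0) = eval2 d (\<Phi> z) * F i z"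
      using i by simp
    finally show "eval2 d (\<Phi> z) * F i z = (\<Sum>k\<leftarrow>[0..<n]. eval2 ((if i = k then d else 0) - g k * c i) (\<Phi> z) * F k z)"
      by simp
  qed
qed

text \<open>Adding a generator \<open>x\<close> that the maximal ideal multiplies into the ideal does not
  change the first homology, because the coordinates form a regular sequence.\<close>

lemma exact_step:
  fixes x :: "complex poly poly"
  defines "s \<equiv> shift_fst (fst (\<Phi> z0))" and "t \<equiv> shift_snd (snd (\<Phi> z0))"
  assumes ex: "exact (Suc n) (g(n := x))" and sx: "in_local_ideal n g (s * x)" and tx: "in_local_ideal n g (t * x)"
  shows "exact n g"
  unfolding exact_def
proof (intro allI impI)
  fix F assume F: "relation n g F"
  \<comment> \<open>Zero in the new place makes \<open>F\<close> a relation of the larger family.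
    The syzygies obtained there have last entries whose combination is zero; these entries have to
    be rewritten in terms of the old generators.\<close>
  have "relation (Suc n) (g(n := x)) (F(n := \<lambda>_. 0))"
    using F const_P by (auto simp: relation_def less_Suc_eq)
  then obtain H bs where H: "H \<in> P" "H z0 \<noteq> 0"
    and bs: "\<And>y. y \<in> set bs \<Longrightarrow> fst y \<in> syz (Suc n) (g(n := x))" "\<And>y. y \<in> set bs \<Longrightarrow> snd y \<in> P"
    and HF': "\<And>i z. i < Suc n \<Longrightarrow> z \<in> Z \<Longrightarrow> H z * (F(n := \<lambda>_. 0)) i z = (\<Sum>y\<leftarrow>bs. eval2 (fst y i) (\<Phi> z) * snd y z)"
    using ex unfolding exact_def in_syz_span_def by blast
  have HF: "H z * F i z = (\<Sum>y\<leftarrow>bs. eval2 (fst y i) (\<Phi> z) * snd y z)" if "i < n" "z \<in> Z" for i z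
    using HF'[of i z] that by simp
  have H0: "(\<Sum>y\<leftarrow>bs. eval2 (fst y n) (\<Phi> z) * snd y z) = 0" if "z \<in> Z" for z
    using HF'[of n z] that by simp
  have rel: "(\<Sum>i<n. g i * fst y i) + x * fst y n = 0" if "y \<in> set bs" for y
    using bs(1)[OF that] by (simp add: syz_def)
  show "\<exists>H\<in>P. H z0 \<noteq> 0 \<and> in_syz_span n g (\<lambda>i z. H z * F i z)"
  proof (cases "in_local_ideal n g x")
    case True
    then obtain u c where u: "eval2 u (\<Phi> z0) \<noteq> 0" and c: "u * x = (\<Sum>i<n. c i * g i)"
      by (auto simp: in_local_ideal_def in_ideal_def)
    \<comment> \<open>Here \<open>u x\<close> is a combination of the \<open>g i\<close>, so the
      last entry of each syzygy can be distributed over the old places. The total correction is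
      \<open>c i\<close> times the combination that vanishes by \<open>H0\<close>.\<close>
    have "in_syz_span n g (\<lambda>i z. eval2 u (\<Phi> z) * H z * F i z)"
    proof (rule in_syz_spanI[of bs "\<lambda>y i. u * fst y i + fst y n * c i" n g snd])
      fix y assume y: "y \<in> set bs"
      have "(\<Sum>i<n. g i * (u * fst y i + fst y n * c i)) = u * (\<Sum>i<n. g i * fst y i) + fst y n * (\<Sum>i<n. c i * g i)"
        by (simp add: sum_distrib_left sum.distrib[symmetric] algebra_simps)
      also have "\<dots> = u * ((\<Sum>i<n. g i * fst y i) + x * fst y n)"
        unfolding c[symmetric] by (simp add: algebra_simps)
      finally show "(\<lambda>i. u * fst y i + fst y n * c i) \<in> syz n g \<and> snd y \<in> P"
        using rel[OF y] bs(2)[OF y] by (simp add: syz_def)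
    next
      fix i z assume iz: "i < n" "z \<in> Z"
      have "(\<Sum>y\<leftarrow>bs. eval2 (u * fst y i + fst y n * c i) (\<Phi> z) * snd y z) =
        eval2 u (\<Phi> z) * (\<Sum>y\<leftarrow>bs. eval2 (fst y i) (\<Phi> z) * snd y z) +
        eval2 (c i) (\<Phi> z) * (\<Sum>y\<leftarrow>bs. eval2 (fst y n) (\<Phi> z) * snd y z)"
        by (simp add: sum_list_const_mult[symmetric] sum_list_addf[symmetric] algebra_simps)
      then show "eval2 u (\<Phi> z) * H z * F i z = (\<Sum>y\<leftarrow>bs. eval2 (u * fst y i + fst y n * c i) (\<Phi> z) * snd y z)"
        using HF[OF iz] H0[OF iz(2)] by (simp add: mult.assoc)
    qed
    moreover have "(\<lambda>z. eval2 u (\<Phi> z) * H z) \<in> P" using eval_P H mult_P by blast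
    ultimately show ?thesis using u H by (intro bexI[of _ "\<lambda>z. eval2 u (\<Phi> z) * H z"]) auto
  next
    case False
    \<comment> \<open>A last entry that does not vanish at \<open>\<Phi> z0\<close> would be a
      denominator that puts \<open>x\<close> into the local ideal.\<close>
    have "\<exists>g1 g2. fst y n = s * g1 + t * g2" if y: "y \<in> set bs" for y
    proof -
      have "fst y n * x = (\<Sum>i<n. (- fst y i) * g i)"
        using rel[OF y] by (simp add: sum_negf algebra_simps add_eq_0_iff2)
      then have "in_ideal n g (fst y n * x)"
        unfolding in_ideal_def by (rule exI[of _ "\<lambda>i. - fst y i"])
      then have "eval2 (fst y n) (\<Phi> z0) = 0"
        using False unfolding in_local_ideal_def by blast
      then show ?thesis
        unfolding s_def t_def by (intro eval2_eq_0_decompose) simp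
    qed
    then obtain \<beta>1 \<beta>2 where \<beta>: "\<And>y. y \<in> set bs \<Longrightarrow> fst y n = s * \<beta>1 y + t * \<beta>2 y" by metis
    obtain u1 p1 where u1: "eval2 u1 (\<Phi> z0) \<noteq> 0" "u1 * (s * x) = (\<Sum>i<n. p1 i * g i)"
      using sx by (auto simp: in_local_ideal_def in_ideal_def)
    obtain u2 p2 where u2: "eval2 u2 (\<Phi> z0) \<noteq> 0" "u2 * (t * x) = (\<Sum>i<n. p2 i * g i)"
      using tx by (auto simp: in_local_ideal_def in_ideal_def)
    \<comment> \<open>A common denominator: \<open>p\<close> and \<open>q\<close> express
      \<open>u s x\<close> and \<open>u t x\<close> in the old generators.\<close>
    define u where "u = u1 * u2"
    define p where "p = (\<lambda>i. u2 * p1 i)"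
    define q where "q = (\<lambda>i. u1 * p2 i)"
    have p: "(\<Sum>i<n. g i * p i) = u * s * x"
      using arg_cong[OF u1(2), of "\<lambda>v. u2 * v"] by (simp add: p_def u_def sum_distrib_left mult_ac)
    have q: "(\<Sum>i<n. g i * q i) = u * t * x"
      using arg_cong[OF u2(2), of "\<lambda>v. u1 * v"] by (simp add: q_def u_def sum_distrib_left mult_ac)
    define X where "X = (\<lambda>z. \<Sum>y\<leftarrow>bs. eval2 (\<beta>1 y) (\<Phi> z) * snd y z)"
    define Y where "Y = (\<lambda>z. \<Sum>y\<leftarrow>bs. eval2 (\<beta>2 y) (\<Phi> z) * snd y z)"
    have XY: "X \<in> P" "Y \<in> P" unfolding X_def Y_def using bs(2) eval_P mult_P by (auto intro!: sum_list_P)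
    have "(fst (\<Phi> z) - fst (\<Phi> z0)) * X z + (snd (\<Phi> z) - snd (\<Phi> z0)) * Y z = 0" if "z \<in> Z" for z
    proof -
      have "(fst (\<Phi> z) - fst (\<Phi> z0)) * X z + (snd (\<Phi> z) - snd (\<Phi> z0)) * Y z =
        (\<Sum>y\<leftarrow>bs. eval2 (s * \<beta>1 y + t * \<beta>2 y) (\<Phi> z) * snd y z)"
        by (simp add: X_def Y_def s_def t_def sum_list_const_mult[symmetric] sum_list_addf[symmetric] algebra_simps)
      also have "\<dots> = (\<Sum>y\<leftarrow>bs. eval2 (fst y n) (\<Phi> z) * snd y z)"
        using \<beta> by (intro arg_cong[of _ _ sum_list] map_cong) auto
      finally show ?thesis using H0[OF that] by simp
    qed
    from regular[OF XY this] obtain H' w where H': "H' \<in> P" "w \<in> P" "H' z0 \<noteq> 0"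
      and Xw: "\<And>z. z \<in> Z \<Longrightarrow> H' z * X z = eval2 t (\<Phi> z) * w z"
      and Yw: "\<And>z. z \<in> Z \<Longrightarrow> H' z * Y z = - eval2 s (\<Phi> z) * w z"
      by (auto simp: s_def t_def)
    \<comment> \<open>Replacing the last entry s \<beta>1 + t \<beta>2 by the vector \<beta>1 p +
      \<beta>2 q gives syzygies of the old family, at the price of the error terms with
      \<open>X\<close> and \<open>Y\<close>.\<close>
    have "in_syz_span n g (\<lambda>i z. eval2 u (\<Phi> z) * H z * F i z + eval2 (p i) (\<Phi> z) * X z + eval2 (q i) (\<Phi> z) * Y z)"
    proof (rule in_syz_spanI[of bs "\<lambda>y i. u * fst y i + \<beta>1 y * p i + \<beta>2 y * q i" n g snd])
      fix y assume y: "y \<in> set bs"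
      have "(\<Sum>i<n. g i * (u * fst y i + \<beta>1 y * p i + \<beta>2 y * q i)) =
          u * (\<Sum>i<n. g i * fst y i) + \<beta>1 y * (\<Sum>i<n. g i * p i) + \<beta>2 y * (\<Sum>i<n. g i * q i)"
        by (simp add: sum_distrib_left sum.distrib[symmetric] algebra_simps)
      also have "\<dots> = u * ((\<Sum>i<n. g i * fst y i) + x * fst y n)"
        unfolding p q using \<beta>[OF y] by (simp add: algebra_simps)
      finally show "(\<lambda>i. u * fst y i + \<beta>1 y * p i + \<beta>2 y * q i) \<in> syz n g \<and> snd y \<in> P"
        using rel[OF y] bs(2)[OF y] by (simp add: syz_def)
    next
      fix i z assume iz: "i < n" "z \<in> Z"
      have "(\<Sum>y\<leftarrow>bs. eval2 (u * fst y i + \<beta>1 y * p i + \<beta>2 y * q i) (\<Phi> z) * snd y z) =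
        eval2 u (\<Phi> z) * (\<Sum>y\<leftarrow>bs. eval2 (fst y i) (\<Phi> z) * snd y z) +
        eval2 (p i) (\<Phi> z) * X z + eval2 (q i) (\<Phi> z) * Y z"
        by (simp add: X_def Y_def sum_list_const_mult[symmetric] sum_list_addf[symmetric] algebra_simps)
      then show "eval2 u (\<Phi> z) * H z * F i z + eval2 (p i) (\<Phi> z) * X z + eval2 (q i) (\<Phi> z) * Y z =
          (\<Sum>y\<leftarrow>bs. eval2 (u * fst y i + \<beta>1 y * p i + \<beta>2 y * q i) (\<Phi> z) * snd y z)"
        using HF[OF iz] by (simp add: mult.assoc)
    qed
    from in_syz_span_mult[OF this H'(1)]
    have 1: "in_syz_span n g (\<lambda>i z. H' z * (eval2 u (\<Phi> z) * H z * F i z + eval2 (p i) (\<Phi> z) * X z + eval2 (q i) (\<Phi> z) * Y z))" .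
    \<comment> \<open>Against the generators both products sum to \<open>u s t x\<close>. After
      multiplication by \<open>H'\<close>, regularity turns the error into (p t - q s) w, so adding
      this syzygy with coefficient \<open>w\<close> cancels it.\<close>
    have "(\<lambda>i. q i * s - p i * t) \<in> syz n g"
    proof -
      have "(\<Sum>i<n. g i * (q i * s - p i * t)) = s * (\<Sum>i<n. g i * q i) - t * (\<Sum>i<n. g i * p i)"
        by (simp add: sum_distrib_left sum_subtractf[symmetric] algebra_simps)
      then show ?thesis unfolding p q by (simp add: syz_def algebra_simps)
    qed
    from in_syz_span_add[OF 1 in_syz_span_single[OF this H'(2)]]
    have "in_syz_span n g (\<lambda>i z. (H' z * (eval2 u (\<Phi> z) * H z)) * F i z)"
    proof (rule in_syz_span_cong)
      fix i z assume z: "z \<in> Z"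
      have "H' z * (eval2 u (\<Phi> z) * H z * F i z + eval2 (p i) (\<Phi> z) * X z + eval2 (q i) (\<Phi> z) * Y z) =
        H' z * (eval2 u (\<Phi> z) * H z) * F i z + eval2 (p i) (\<Phi> z) * (H' z * X z) + eval2 (q i) (\<Phi> z) * (H' z * Y z)"
        by (simp add: algebra_simps)
      then show "H' z * (eval2 u (\<Phi> z) * H z * F i z + eval2 (p i) (\<Phi> z) * X z + eval2 (q i) (\<Phi> z) * Y z) +
          eval2 (q i * s - p i * t) (\<Phi> z) * w z = (H' z * (eval2 u (\<Phi> z) * H z)) * F i z"
        unfolding Xw[OF z] Yw[OF z] by (simp add: algebra_simps)
    qed
    moreover have "(\<lambda>z. H' z * (eval2 u (\<Phi> z) * H z)) \<in> P" using mult_P[OF H'(1) mult_P[OF eval_P H(1)]] .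
    ultimately show ?thesis using H(2) H'(3) u1(1) u2(1)
      by (intro bexI[of _ "\<lambda>z. H' z * (eval2 u (\<Phi> z) * H z)"]) (auto simp: u_def)
  qed
qed

text \<open>Induction on the number of monomials \<open>s ^ i * t ^ j\<close> below the bounds that
  are missing from the local ideal. A missing monomial of largest total degree is multiplied into
  the ideal by both parameters, so \<open>exact_step\<close> allows it to be adjoined. When none is
  missing, the monomial 1 lies in the local ideal and \<open>koszul\<close> applies.\<close>

lemma exact_if_primary:
  fixes k l :: nat
  defines "s \<equiv> shift_fst (fst (\<Phi> z0))" and "t \<equiv> shift_snd (snd (\<Phi> z0))"
  assumes "in_local_ideal n g (s ^ k)" "in_local_ideal n g (t ^ l)"
  shows "exact n g"
  using assms(3,4)
proof (induction "card {(i, j). i < k \<and> j < l \<and> \<not> in_local_ideal n g (s ^ i * t ^ j)}" arbitrary: n g rule: less_induct)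
  case less
  let ?N = "\<lambda>n g. {(i, j). i < k \<and> j < l \<and> \<not> in_local_ideal n g (s ^ i * t ^ j)}"
  have fin: "finite (?N n g)" for n g
    by (rule finite_subset[of _ "{..<k} \<times> {..<l}"]) auto
  have big: "in_local_ideal n g (s ^ i * t ^ j)" if "k \<le> i \<or> l \<le> j" for i j
  proof (cases "k \<le> i")
    case True
    then have "s ^ i * t ^ j = (s ^ (i - k) * t ^ j) * s ^ k" by (simp add: power_add[symmetric] mult_ac)
    then show ?thesis using in_local_ideal_mult[OF less.prems(1)] by metis
  next
    case False
    then have "s ^ i * t ^ j = (s ^ i * t ^ (j - l)) * t ^ l" using that by (simp add: power_add[symmetric] mult_ac)
    then show ?thesis using in_local_ideal_mult[OF less.prems(2)] by metis
  qed
  show ?case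
  proof (cases "?N n g = {}")
    case True
    then have "in_local_ideal n g (s ^ 0 * t ^ 0)" using big[of 0 0] by fastforce
    then obtain u where u: "eval2 u (\<Phi> z0) \<noteq> 0" "in_ideal n g u" by (auto simp: in_local_ideal_def)
    show ?thesis unfolding exact_def
      using koszul[OF _ u(2)] u(1) eval_P by (intro allI impI bexI[of _ "\<lambda>z. eval2 u (\<Phi> z)"]) auto
  next
    case False
    define m where "m = Max ((\<lambda>(i, j). i + j) ` ?N n g)"
    have "m \<in> (\<lambda>(i, j). i + j) ` ?N n g" unfolding m_def using fin False by (intro Max_in) auto
    then obtain i j where ij: "(i, j) \<in> ?N n g" "m = i + j" by auto
    have max: "i' + j' \<le> i + j" if "(i', j') \<in> ?N n g" for i' j'
      unfolding ij(2)[symmetric] m_def using that fin by (intro Max_ge) force+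
    define x where "x = s ^ i * t ^ j"
    have next_mon: "in_local_ideal n g (s ^ i' * t ^ j')" if "i' + j' > i + j" for i' j'
      using max[of i' j'] big[of i' j'] that by fastforce
    have sx: "in_local_ideal n g (s * x)" "in_local_ideal n g (t * x)"
      using next_mon[of "Suc i" j] next_mon[of i "Suc j"] by (simp_all add: x_def mult_ac)
    have mono: "in_local_ideal (Suc n) (g(n := x)) y" if y: "in_local_ideal n g y" for y
    proof -
      obtain u c where "eval2 u (\<Phi> z0) \<noteq> 0" "u * y = (\<Sum>i<n. c i * g i)"
        using y by (auto simp: in_local_ideal_def in_ideal_def)
      then show ?thesis unfolding in_local_ideal_def in_ideal_def
        by (intro exI[of _ u] conjI exI[of _ "c(n := 0)"]) auto
    qed
    have "in_local_ideal (Suc n) (g(n := x)) x"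
      unfolding in_local_ideal_def using in_ideal_gen[of n "Suc n" "g(n := x)"] by (intro exI[of _ 1]) simp
    then have "?N (Suc n) (g(n := x)) \<subset> ?N n g" using mono ij(1) by (force simp: x_def)
    then have "card (?N (Suc n) (g(n := x))) < card (?N n g)" using fin psubset_card_mono by blast
    then have "exact (Suc n) (g(n := x))" using less.hyps mono less.prems by blast
    then show ?thesis using exact_step[of n g x] sx by (simp add: s_def t_def)
  qed
qed

text \<open>Elimination gives a nonzero polynomial in one variable inside the ideal. Its zero at the
  coordinate of \<open>\<Phi> z0\<close> is split off with its multiplicity; the cofactor is a local
  unit, so the corresponding power of the local parameter lies in the local ideal. The family with
  swapped variables gives the second parameter.\<close>

lemma exact_if_coprime:
  assumes coprime: "\<And>h. (\<And>i. i < n \<Longrightarrow> h dvd g i) \<Longrightarrow> is_unit h"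
  shows "exact n g"
proof -
  let ?a = "fst (\<Phi> z0)" and ?b = "snd (\<Phi> z0)"
  obtain c where c: "c \<noteq> 0" "in_ideal n g [:c:]"
    using coprime_family_constant_in_ideal[OF coprime] by blast
  obtain c' where c': "c = [:-?a, 1:] ^ Polynomial.order ?a c * c'" "\<not> [:-?a, 1:] dvd c'"
    using order_decomp[OF c(1)] by blast
  have pw: "[:q:] ^ k = [:q ^ k:]" for q :: "complex poly" and k
    by (induction k) auto
  have "[:c:] = [:c':] * shift_fst ?a ^ Polynomial.order ?a c"
    by (subst c'(1)) (simp add: shift_fst_def pw mult.commute)
  moreover have "eval2 [:c':] (\<Phi> z0) \<noteq> 0"
    using c'(2) by (simp add: eval2_def poly_eq_0_iff_dvd)
  ultimately have 1: "in_local_ideal n g (shift_fst ?a ^ Polynomial.order ?a c)"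
    using c(2) unfolding in_local_ideal_def by metis
  obtain sw where sw: "\<And>g a b. eval2 (sw g) (a, b) = eval2 g (b, a)"
    using swap_eval2 by metis
  have sw_mult: "sw (p * q) = sw p * sw q" for p q by (rule eval2_eqI) (auto simp: sw)
  have sw_sw: "sw (sw p) = p" for p by (rule eval2_eqI) (auto simp: sw)
  have sw_1: "sw 1 = 1" by (rule eval2_eqI) (auto simp: sw)
  have "is_unit h" if "\<And>i. i < n \<Longrightarrow> h dvd sw (g i)" for h
  proof -
    have "sw h dvd g i" if "i < n" for i
      using \<open>\<And>i. i < n \<Longrightarrow> h dvd sw (g i)\<close>[OF that] by (metis dvd_def sw_mult sw_sw)
    then have "is_unit (sw h)" by (rule coprime)
    then show ?thesis by (metis dvd_def sw_1 sw_mult sw_sw)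
  qed
  then obtain d where d: "d \<noteq> 0" "in_ideal n (\<lambda>i. sw (g i)) [:d:]"
    using coprime_family_constant_in_ideal[of n "\<lambda>i. sw (g i)"] by blast
  obtain e where e: "[:d:] = (\<Sum>i<n. e i * sw (g i))" using d(2) by (auto simp: in_ideal_def)
  obtain d' where d': "d = [:-?b, 1:] ^ Polynomial.order ?b d * d'" "\<not> [:-?b, 1:] dvd d'"
    using order_decomp[OF d(1)] by blast
  have "sw [:d':] * shift_snd ?b ^ Polynomial.order ?b d = (\<Sum>i<n. sw (e i) * g i)"
  proof (rule eval2_eqI)
    fix z :: "complex \<times> complex"
    obtain a b where z: "z = (a, b)" by fastforce
    have "eval2 (sw [:d':] * shift_snd ?b ^ Polynomial.order ?b d) z = poly d' b * (b - ?b) ^ Polynomial.order ?b d"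
      by (simp add: z sw) (simp add: eval2_def)
    also have "\<dots> = poly ([:-?b, 1:] ^ Polynomial.order ?b d * d') b"
      by (simp only: poly_mult poly_power) (simp add: mult.commute)
    also have "\<dots> = eval2 [:d:] (b, a)" by (subst d'(1)[symmetric]) (simp add: eval2_def)
    also have "\<dots> = eval2 (\<Sum>i<n. sw (e i) * g i) z"
      unfolding e by (simp add: z sw)
    finally show "eval2 (sw [:d':] * shift_snd ?b ^ Polynomial.order ?b d) z = eval2 (\<Sum>i<n. sw (e i) * g i) z" .
  qed
  moreover have "eval2 (sw [:d':]) (\<Phi> z0) \<noteq> 0"
    using d'(2) sw[of "[:d':]" ?a ?b] by (simp add: eval2_def poly_eq_0_iff_dvd)
  ultimately have 2: "in_local_ideal n g (shift_snd ?b ^ Polynomial.order ?b d)"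
    unfolding in_local_ideal_def in_ideal_def by metis
  show ?thesis by (rule exact_if_primary[OF 1 2])
qed

text \<open>Dividing by the greatest common divisor \<open>d\<close> changes neither the syzygies
  nor the relations: \<open>d\<close> times the reduced relation is the given one, and
  \<open>torsion_free\<close> cancels \<open>d\<close>. If all \<open>g i\<close> are zero, then so
  is \<open>d\<close>; in that case the unit vectors are syzygies.\<close>

theorem all_exact: "exact n g"
proof (cases "\<forall>i<n. g i = 0")
  case True
  have "in_syz_span n g F" if F: "relation n g F" for F
  proof (rule in_syz_spanI[of "[0..<n]" "\<lambda>k i. if i = k then 1 else 0" n g F])
    show "(\<lambda>i. if i = k then 1 else 0) \<in> syz n g \<and> F k \<in> P" if "k \<in> set [0..<n]" for k
      using that True F by (auto simp: syz_def relation_def)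
    fix i z assume "i < n"
    then show "F i z = (\<Sum>k\<leftarrow>[0..<n]. eval2 (if i = k then 1 else 0) (\<Phi> z) * F k z)"
      by (simp add: interv_sum_list_conv_sum_set_nat atLeast0LessThan if_distrib[of "\<lambda>p. eval2 p _ * _"] cong: if_cong)
  qed
  then show ?thesis unfolding exact_def using const_P[of 1] by (intro allI impI bexI[of _ "\<lambda>_. 1"]) auto
next
  case False
  define d where "d = Gcd (g ` {..<n})"
  have d0: "d \<noteq> 0" using False by (auto simp: d_def)
  have "\<exists>q. g i = d * q" if "i < n" for i
    using Gcd_dvd[of "g i" "g ` {..<n}"] that unfolding d_def dvd_def by blast
  then obtain g' where g': "\<And>i. i < n \<Longrightarrow> g i = d * g' i" by metis
  have "is_unit h" if h: "\<And>i. i < n \<Longrightarrow> h dvd g' i" for h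
  proof -
    have "d * h dvd d" unfolding d_def
      by (rule Gcd_greatest) (use g' h in \<open>auto simp: d_def\<close>)
    then show ?thesis using d0 by simp
  qed
  then have ex: "exact n g'" by (rule exact_if_coprime)
  have syz: "syz n g' = syz n g"
  proof -
    have "(\<Sum>i<n. g i * b i) = d * (\<Sum>i<n. g' i * b i)" for b
      using g' by (simp add: sum_distrib_left mult_ac)
    then show ?thesis using d0 by (simp add: syz_def)
  qed
  show ?thesis unfolding exact_def
  proof (intro allI impI)
    fix F assume F: "relation n g F"
    have FP: "F i \<in> P" if "i < n" for i using F that by (simp add: relation_def)
    have P: "(\<lambda>z. \<Sum>i<n. eval2 (g' i) (\<Phi> z) * F i z) \<in> P"
      using FP eval_P mult_P by (intro sum_P) auto
    have "(\<Sum>i<n. eval2 (g' i) (\<Phi> z) * F i z) = 0" if "z \<in> Z" for z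
    proof (rule torsion_free[OF d0 P _ that])
      fix z assume "z \<in> Z"
      have "eval2 d (\<Phi> z) * (\<Sum>i<n. eval2 (g' i) (\<Phi> z) * F i z) = (\<Sum>i<n. eval2 (g i) (\<Phi> z) * F i z)"
        using g' by (simp add: sum_distrib_left mult_ac)
      then show "eval2 d (\<Phi> z) * (\<Sum>i<n. eval2 (g' i) (\<Phi> z) * F i z) = 0"
        using F \<open>z \<in> Z\<close> by (simp add: relation_def)
    qed
    then have "relation n g' F" using FP by (simp add: relation_def)
    then show "\<exists>H\<in>P. H z0 \<noteq> 0 \<and> in_syz_span n g (\<lambda>i z. H z * F i z)"
      using ex unfolding exact_def in_syz_span_def syz by blast
  qed
qed

theorem equational_criterion_functions:
  fixes n :: nat
  assumes "\<And>i. i < n \<Longrightarrow> F i \<in> P" "\<And>z. z \<in> Z \<Longrightarrow> (\<Sum>i<n. eval2 (g i) (\<Phi> z) * F i z) = 0"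
  shows "\<exists>H\<in>P. H z0 \<noteq> 0 \<and> (\<exists>(k::nat) b f. (\<forall>j<k. f j \<in> P) \<and>
    (\<forall>i<n. \<forall>z\<in>Z. H z * F i z = (\<Sum>j<k. eval2 (b i j) (\<Phi> z) * f j z)) \<and> (\<forall>j<k. (\<Sum>i<n. g i * b i j) = 0))"
proof -
  have "relation n g F" using assms by (simp add: relation_def)
  then obtain H bs where H: "H \<in> P" "H z0 \<noteq> 0"
    and bs: "\<forall>x\<in>set bs. fst x \<in> syz n g \<and> snd x \<in> P"
    and HF: "\<forall>i<n. \<forall>z\<in>Z. H z * F i z = (\<Sum>x\<leftarrow>bs. eval2 (fst x i) (\<Phi> z) * snd x z)"
    using all_exact[of n g] unfolding exact_def in_syz_span_def by blast
  show ?thesis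
  proof (intro bexI[OF _ H(1)] conjI H(2) exI[of _ "length bs"] exI[of _ "\<lambda>i j. fst (bs ! j) i"]
      exI[of _ "\<lambda>j. snd (bs ! j)"] allI impI ballI)
    show "snd (bs ! j) \<in> P" if "j < length bs" for j using bs that by simp
    show "(\<Sum>i<n. g i * fst (bs ! j) i) = 0" if "j < length bs" for j
      using bs nth_mem[OF that] by (auto simp: syz_def)
    show "H z * F i z = (\<Sum>j<length bs. eval2 (fst (bs ! j) i) (\<Phi> z) * snd (bs ! j) z)" if "i < n" "z \<in> Z" for i z
      using HF that by (simp add: sum_list_sum_nth atLeast0LessThan)
  qed
qed

end

section \<open>Local rings\<close>

text \<open>The properties of regular functions from which germs form a commutative ring. They pass
  to quotient structures, because there regularity is tested after pulling back.\<close>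

locale ringed_space =
  fixes X :: "'p function_space"
  assumes const_regular: "\<And>U c. openin (zariski X) U \<Longrightarrow> (\<lambda>q. c) \<in> regular X U"
    and add_regular: "\<And>U f g. openin (zariski X) U \<Longrightarrow> f \<in> regular X U \<Longrightarrow> g \<in> regular X U \<Longrightarrow> (\<lambda>q. f q + g q) \<in> regular X U"
    and mult_regular: "\<And>U f g. openin (zariski X) U \<Longrightarrow> f \<in> regular X U \<Longrightarrow> g \<in> regular X U \<Longrightarrow> (\<lambda>q. f q * g q) \<in> regular X U"
    and restrict_regular: "\<And>U V f. openin (zariski X) U \<Longrightarrow> openin (zariski X) V \<Longrightarrow> V \<subseteq> U \<Longrightarrow> f \<in> regular X U \<Longrightarrow> f \<in> regular X V"
    and cong_regular: "\<And>U f g. openin (zariski X) U \<Longrightarrow> f \<in> regular X U \<Longrightarrow> (\<And>q. q \<in> U \<Longrightarrow> f q = g q) \<Longrightarrow> g \<in> regular X U"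
begin

definition represents :: "'p \<Rightarrow> 'p set \<Rightarrow> ('p \<Rightarrow> complex) \<Rightarrow> bool" where
  "represents p U f \<longleftrightarrow> openin (zariski X) U \<and> p \<in> U \<and> f \<in> regular X U"

lemma represents_restrict:
  "represents p U f \<Longrightarrow> openin (zariski X) V \<Longrightarrow> p \<in> V \<Longrightarrow> V \<subseteq> U \<Longrightarrow> represents p V f"
  using restrict_regular by (auto simp: represents_def)

lemma represents_add:
  assumes "represents p U f" "represents p V g"
  shows "represents p (U \<inter> V) (\<lambda>q. f q + g q)"
proof -
  have "openin (zariski X) (U \<inter> V)" using assms by (auto simp: represents_def)
  then show ?thesis
    using assms restrict_regular[of U "U \<inter> V" f] restrict_regular[of V "U \<inter> V" g] add_regular[of "U \<inter> V" f g]
    by (simp add: represents_def)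
qed

lemma represents_mult:
  assumes "represents p U f" "represents p V g"
  shows "represents p (U \<inter> V) (\<lambda>q. f q * g q)"
proof -
  have "openin (zariski X) (U \<inter> V)" using assms by (auto simp: represents_def)
  then show ?thesis
    using assms restrict_regular[of U "U \<inter> V" f] restrict_regular[of V "U \<inter> V" g] mult_regular[of "U \<inter> V" f g]
    by (simp add: represents_def)
qed

lemma represents_const: "p \<in> points X \<Longrightarrow> represents p (points X) (\<lambda>q. c)"
  by (auto simp: represents_def const_regular)

lemma represents_sum:
  assumes "openin (zariski X) U" "p \<in> U" "\<And>i. i < (n::nat) \<Longrightarrow> represents p U (f i)"
  shows "represents p U (\<lambda>q. \<Sum>i<n. f i q)"
  using assms(3)
proof (induction n)
  case 0
  then show ?case using assms(1,2) const_regular[OF assms(1), of 0] by (simp add: represents_def)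
next
  case (Suc n)
  then show ?case using represents_add[of p U "\<lambda>q. \<Sum>i<n. f i q" U "f n"] by simp
qed

definition germ_equiv :: "'p \<Rightarrow> 'p set \<Rightarrow> ('p \<Rightarrow> complex) \<Rightarrow> 'p set \<Rightarrow> ('p \<Rightarrow> complex) \<Rightarrow> bool" where
  "germ_equiv p U f V g \<longleftrightarrow> (\<exists>W. openin (zariski X) W \<and> p \<in> W \<and> W \<subseteq> U \<inter> V \<and> (\<forall>q\<in>W. f q = g q))"

lemma germ_eq: "germ X p U f = {(V, g). represents p V g \<and> germ_equiv p U f V g}"
  by (auto simp: germ_def represents_def germ_equiv_def)

lemma germ_equiv_sym: "germ_equiv p U f V g \<Longrightarrow> germ_equiv p V g U f"
  unfolding germ_equiv_def by (metis inf_commute)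

lemma germ_equiv_trans: "germ_equiv p U f V g \<Longrightarrow> germ_equiv p V g W h \<Longrightarrow> germ_equiv p U f W h"
  unfolding germ_equiv_def
proof (elim exE conjE)
  fix A B assume "openin (zariski X) A" "p \<in> A" "A \<subseteq> U \<inter> V" "\<forall>q\<in>A. f q = g q"
    "openin (zariski X) B" "p \<in> B" "B \<subseteq> V \<inter> W" "\<forall>q\<in>B. g q = h q"
  then show "\<exists>Wa. openin (zariski X) Wa \<and> p \<in> Wa \<and> Wa \<subseteq> U \<inter> W \<and> (\<forall>q\<in>Wa. f q = h q)"
    by (intro exI[of _ "A \<inter> B"]) auto
qed

lemma germ_equiv_refl: "represents p U f \<Longrightarrow> germ_equiv p U f U f"
  by (auto simp: germ_equiv_def represents_def)

lemma germ_eqI: "germ_equiv p U f V g \<Longrightarrow> germ X p U f = germ X p V g"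
  unfolding germ_eq using germ_equiv_sym germ_equiv_trans by blast

lemma germ_eq_iff: "represents p V g \<Longrightarrow> germ X p U f = germ X p V g \<longleftrightarrow> germ_equiv p U f V g"
  using germ_eqI[of p U f V g] germ_equiv_refl[of p V g] unfolding germ_eq by blast

lemma germ_restrict:
  "represents p U f \<Longrightarrow> openin (zariski X) V \<Longrightarrow> p \<in> V \<Longrightarrow> V \<subseteq> U \<Longrightarrow> germ X p V f = germ X p U f"
  by (rule germ_eqI) (auto simp: germ_equiv_def)

lemma germ_equiv_op:
  assumes "germ_equiv p U f U' f'" "germ_equiv p V g V' g'"
  shows "germ_equiv p (U \<inter> V) (\<lambda>q. h (f q) (g q)) (U' \<inter> V') (\<lambda>q. h (f' q) (g' q))"
  using assms unfolding germ_equiv_def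
proof (elim exE conjE)
  fix A B assume "openin (zariski X) A" "p \<in> A" "A \<subseteq> U \<inter> U'" "\<forall>q\<in>A. f q = f' q"
    "openin (zariski X) B" "p \<in> B" "B \<subseteq> V \<inter> V'" "\<forall>q\<in>B. g q = g' q"
  then show "\<exists>W. openin (zariski X) W \<and> p \<in> W \<and> W \<subseteq> (U \<inter> V) \<inter> (U' \<inter> V') \<and> (\<forall>q\<in>W. h (f q) (g q) = h (f' q) (g' q))"
    by (intro exI[of _ "A \<inter> B"]) auto
qed

text \<open>All terms of the union coincide and at least one exists, so the ring operations, defined
  without choices, can be computed with any representatives.\<close>

lemma germ_op:
  assumes "represents p U f" "represents p V g"
  shows "(\<Union>(U, f)\<in>germ X p U f. \<Union>(V, g)\<in>germ X p V g. germ X p (U \<inter> V) (\<lambda>q. h (f q) (g q))) =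
    germ X p (U \<inter> V) (\<lambda>q. h (f q) (g q))"
proof -
  have "germ X p (U' \<inter> V') (\<lambda>q. h (f' q) (g' q)) = germ X p (U \<inter> V) (\<lambda>q. h (f q) (g q))"
    if "(U', f') \<in> germ X p U f" "(V', g') \<in> germ X p V g" for U' f' V' g'
    using that germ_equiv_op[of p U f U' f' V g V' g' h] germ_eqI by (auto simp: germ_eq)
  moreover have "(U, f) \<in> germ X p U f" "(V, g) \<in> germ X p V g"
    using assms germ_equiv_refl by (auto simp: germ_eq)
  ultimately show ?thesis by blast
qed

abbreviation \<O> where "\<O> p \<equiv> local_ring X p"

lemma local_ring_simps:
  "carrier (\<O> p) = {germ X p U f | U f. represents p U f}"
  "\<one>\<^bsub>\<O> p\<^esub> = germ X p (points X) (\<lambda>q. 1)" "\<zero>\<^bsub>\<O> p\<^esub> = germ X p (points X) (\<lambda>q. 0)"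
  by (auto simp: local_ring_def represents_def)

lemma germ_in_carrier: "represents p U f \<Longrightarrow> germ X p U f \<in> carrier (\<O> p)"
  by (auto simp: local_ring_simps)

lemma germ_mult:
  "represents p U f \<Longrightarrow> represents p V g \<Longrightarrow>
    germ X p U f \<otimes>\<^bsub>\<O> p\<^esub> germ X p V g = germ X p (U \<inter> V) (\<lambda>q. f q * g q)"
  by (simp add: local_ring_def germ_op)

lemma germ_add:
  "represents p U f \<Longrightarrow> represents p V g \<Longrightarrow>
    germ X p U f \<oplus>\<^bsub>\<O> p\<^esub> germ X p V g = germ X p (U \<inter> V) (\<lambda>q. f q + g q)"
  by (simp add: local_ring_def germ_op)

lemma cring_local_ring:
  assumes p: "p \<in> points X"
  shows "cring (\<O> p)"
proof (rule cringI)
  note rc = represents_const[OF p]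
  have sub: "U \<subseteq> points X" if "represents p U f" for U f
    using that openin_subset by (auto simp: represents_def)
  have eqs: "germ X p U f = germ X p V g"
    if "represents p U f" "U = V" "\<And>q. f q = g q" for U V f g
    using that by presburger
  show "abelian_group (\<O> p)"
  proof (rule abelian_groupI)
    fix x y assume "x \<in> carrier (\<O> p)" "y \<in> carrier (\<O> p)"
    then obtain U f V g where r: "represents p U f" "represents p V g" "x = germ X p U f" "y = germ X p V g"
      by (auto simp: local_ring_simps)
    then show "x \<oplus>\<^bsub>\<O> p\<^esub> y \<in> carrier (\<O> p)"
      using germ_in_carrier represents_add by (simp add: germ_add)
    show "x \<oplus>\<^bsub>\<O> p\<^esub> y = y \<oplus>\<^bsub>\<O> p\<^esub> x"
      using r by (simp add: germ_add Int_commute add.commute)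
    fix z assume "z \<in> carrier (\<O> p)"
    then obtain W h where "represents p W h" "z = germ X p W h" by (auto simp: local_ring_simps)
    with r show "x \<oplus>\<^bsub>\<O> p\<^esub> y \<oplus>\<^bsub>\<O> p\<^esub> z = x \<oplus>\<^bsub>\<O> p\<^esub> (y \<oplus>\<^bsub>\<O> p\<^esub> z)"
      by (simp add: germ_add represents_add Int_assoc add.assoc)
  next
    show "\<zero>\<^bsub>\<O> p\<^esub> \<in> carrier (\<O> p)" using rc by (auto simp: local_ring_simps)
    fix x assume "x \<in> carrier (\<O> p)"
    then obtain U f where r: "represents p U f" "x = germ X p U f" by (auto simp: local_ring_simps)
    then show "\<zero>\<^bsub>\<O> p\<^esub> \<oplus>\<^bsub>\<O> p\<^esub> x = x"
      using rc sub[OF r(1)] by (simp add: local_ring_simps germ_add Int_absorb1)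
    have neg: "represents p U (\<lambda>q. (-1) * f q)"
      using represents_mult[OF rc[of "-1"] r(1)] sub[OF r(1)] by (simp add: Int_absorb1)
    have "germ X p U (\<lambda>q. (-1) * f q) \<oplus>\<^bsub>\<O> p\<^esub> x = germ X p U (\<lambda>q. 0)"
      using neg r by (simp add: germ_add)
    also have "\<dots> = \<zero>\<^bsub>\<O> p\<^esub>"
      using rc[of 0] r(1) sub[OF r(1)]
      by (simp add: local_ring_simps germ_restrict represents_def)
    finally show "\<exists>y\<in>carrier (\<O> p). y \<oplus>\<^bsub>\<O> p\<^esub> x = \<zero>\<^bsub>\<O> p\<^esub>"
      using germ_in_carrier[OF neg] by blast
  qed
  show "comm_monoid (\<O> p)"
  proof (rule comm_monoidI)
    fix x y assume "x \<in> carrier (\<O> p)" "y \<in> carrier (\<O> p)"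
    then obtain U f V g where r: "represents p U f" "represents p V g" "x = germ X p U f" "y = germ X p V g"
      by (auto simp: local_ring_simps)
    then show "x \<otimes>\<^bsub>\<O> p\<^esub> y \<in> carrier (\<O> p)"
      using germ_in_carrier represents_mult by (simp add: germ_mult)
    show "x \<otimes>\<^bsub>\<O> p\<^esub> y = y \<otimes>\<^bsub>\<O> p\<^esub> x"
      using r by (simp add: germ_mult Int_commute mult.commute)
    fix z assume "z \<in> carrier (\<O> p)"
    then obtain W h where "represents p W h" "z = germ X p W h" by (auto simp: local_ring_simps)
    with r show "x \<otimes>\<^bsub>\<O> p\<^esub> y \<otimes>\<^bsub>\<O> p\<^esub> z = x \<otimes>\<^bsub>\<O> p\<^esub> (y \<otimes>\<^bsub>\<O> p\<^esub> z)"
      by (simp add: germ_mult represents_mult Int_assoc mult.assoc)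
  next
    show "\<one>\<^bsub>\<O> p\<^esub> \<in> carrier (\<O> p)" using rc by (auto simp: local_ring_simps)
    fix x assume "x \<in> carrier (\<O> p)"
    then obtain U f where r: "represents p U f" "x = germ X p U f" by (auto simp: local_ring_simps)
    then show "\<one>\<^bsub>\<O> p\<^esub> \<otimes>\<^bsub>\<O> p\<^esub> x = x"
      using rc sub[OF r(1)] by (simp add: local_ring_simps germ_mult Int_absorb1)
  qed
  fix x y z assume "x \<in> carrier (\<O> p)" "y \<in> carrier (\<O> p)" "z \<in> carrier (\<O> p)"
  then obtain U f V g W h where r: "represents p U f" "represents p V g" "represents p W h"
    "x = germ X p U f" "y = germ X p V g" "z = germ X p W h"
    by (auto simp: local_ring_simps)
  then show "(x \<oplus>\<^bsub>\<O> p\<^esub> y) \<otimes>\<^bsub>\<O> p\<^esub> z = x \<otimes>\<^bsub>\<O> p\<^esub> z \<oplus>\<^bsub>\<O> p\<^esub> y \<otimes>\<^bsub>\<O> p\<^esub> z"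
    by (simp add: germ_add germ_mult represents_add represents_mult Int_ac distrib_right)
qed

lemma germ_finsum:
  assumes "openin (zariski X) U" "p \<in> U" "\<And>i. i < (n::nat) \<Longrightarrow> represents p U (f i)"
  shows "(\<Oplus>\<^bsub>\<O> p\<^esub>i\<in>{..<n}. germ X p U (f i)) = germ X p U (\<lambda>q. \<Sum>i<n. f i q)"
  using assms(3)
proof (induction n)
  have p: "p \<in> points X" using assms(1,2) openin_subset by blast
  interpret R: cring "\<O> p" by (rule cring_local_ring[OF p])
  {
    case 0
    have "germ X p U (\<lambda>q. 0) = germ X p (points X) (\<lambda>q. 0)"
      using germ_restrict[OF represents_const[OF p] assms(1,2)] openin_subset[OF assms(1)] by simp
    then show ?case by (simp add: local_ring_simps)
  next
    case (Suc n)
    have "(\<Oplus>\<^bsub>\<O> p\<^esub>i\<in>{..<Suc n}. germ X p U (f i)) = germ X p U (f n) \<oplus>\<^bsub>\<O> p\<^esub> (\<Oplus>\<^bsub>\<O> p\<^esub>i\<in>{..<n}. germ X p U (f i))"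
      using Suc.prems germ_in_carrier by (subst lessThan_Suc, subst R.finsum_insert) auto
    also have "\<dots> = germ X p U (f n) \<oplus>\<^bsub>\<O> p\<^esub> germ X p U (\<lambda>q. \<Sum>i<n. f i q)"
      using Suc by simp
    also have "\<dots> = germ X p U (\<lambda>q. \<Sum>i<Suc n. f i q)"
      using germ_add[OF Suc.prems[of n] represents_sum[OF assms(1,2), of n f]] Suc.prems by (simp add: add.commute)
    finally show ?case .
  }
qed

lemma common_open:
  assumes "p \<in> points X" "\<And>i. i < (n::nat) \<Longrightarrow> a i \<in> carrier (\<O> p)"
  shows "\<exists>U f. openin (zariski X) U \<and> p \<in> U \<and> (\<forall>i<n. represents p U (f i) \<and> a i = germ X p U (f i))"
  using assms(2)
proof (induction n)
  case 0
  then show ?case using assms(1) by (intro exI[of _ "points X"]) auto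
next
  case (Suc n)
  then obtain U f where U: "openin (zariski X) U" "p \<in> U" "\<forall>i<n. represents p U (f i) \<and> a i = germ X p U (f i)"
    by (meson less_Suc_eq)
  obtain V g where V: "represents p V g" "a n = germ X p V g"
    using Suc.prems[of n] by (auto simp: local_ring_simps)
  have W: "openin (zariski X) (U \<inter> V)" "p \<in> U \<inter> V" using U V by (auto simp: represents_def)
  have "represents p (U \<inter> V) ((f(n := g)) i) \<and> a i = germ X p (U \<inter> V) ((f(n := g)) i)" if "i < Suc n" for i
  proof (cases "i = n")
    case True
    then show ?thesis
      using represents_restrict[OF V(1) W] germ_restrict[OF V(1) W] V(2) by simp
  next
    case False
    with that U(3) have "represents p U (f i)" "a i = germ X p U (f i)" by auto
    then show ?thesis
      using represents_restrict[of p U "f i", OF _ W] germ_restrict[of p U "f i", OF _ W] False by simp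
  qed
  with W show ?case by blast
qed

end

section \<open>Pullback of germs\<close>

lemma module_restrict_scalars:
  assumes "cring R" "cring S" "h \<in> ring_hom R S"
  shows "Module.module R (restrict_scalars h S)"
proof -
  interpret R: cring R by fact
  interpret S: cring S by fact
  have hc: "h a \<in> carrier S" if "a \<in> carrier R" for a using assms(3) that by (rule ring_hom_closed)
  have ag: "abelian_group (restrict_scalars h S)"
    by (rule abelian_groupI) (auto simp: restrict_scalars_def S.a_assoc S.a_comm S.a_lcomm intro: S.l_neg bexI[of _ "\<ominus>\<^bsub>S\<^esub> _"])
  show ?thesis
    by (rule Module.moduleI[OF assms(1) ag])
      (auto simp: restrict_scalars_def hc S.l_distr S.r_distr S.m_assoc
        ring_hom_add[OF assms(3)] ring_hom_mult[OF assms(3)] ring_hom_one[OF assms(3)])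
qed

lemma finsum_restrict_scalars: "finsum (restrict_scalars h S) f A = finsum S f A"
  by (simp add: finsum_def finprod_def restrict_scalars_def)

locale space_morphism = X: ringed_space X + Y: ringed_space Y
  for X :: "'p function_space" and Y :: "'q function_space" +
  fixes \<phi> :: "'p \<Rightarrow> 'q"
  assumes morphism: "is_morphism X Y \<phi>"
begin

abbreviation preimage where "preimage V \<equiv> {q \<in> points X. \<phi> q \<in> V}"

lemma openin_preimage: "openin (zariski Y) V \<Longrightarrow> openin (zariski X) (preimage V)"
  using morphism by (auto simp: is_morphism_def continuous_map)

lemma point_image: "p \<in> points X \<Longrightarrow> \<phi> p \<in> points Y"
  using morphism continuous_map_image_subset_topspace by (fastforce simp: is_morphism_def)

lemma represents_pullback:
  "p \<in> points X \<Longrightarrow> Y.represents (\<phi> p) V g \<Longrightarrow> X.represents p (preimage V) (g \<circ> \<phi>)"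
  using morphism openin_preimage by (auto simp: Y.represents_def X.represents_def is_morphism_def)

lemma pullback_germ_germ:
  assumes p: "p \<in> points X" and g: "Y.represents (\<phi> p) V g"
  shows "pullback_germ X \<phi> p (germ Y (\<phi> p) V g) = germ X p (preimage V) (g \<circ> \<phi>)"
proof -
  have "germ X p (preimage V') (g' \<circ> \<phi>) = germ X p (preimage V) (g \<circ> \<phi>)"
    if mem: "(V', g') \<in> germ Y (\<phi> p) V g" for V' g'
  proof (rule X.germ_eqI)
    obtain W where "openin (zariski Y) W" "\<phi> p \<in> W" "W \<subseteq> V \<inter> V'" "\<forall>q\<in>W. g q = g' q"
      using mem by (auto simp: Y.germ_eq Y.germ_equiv_def)
    then show "X.germ_equiv p (preimage V') (g' \<circ> \<phi>) (preimage V) (g \<circ> \<phi>)"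
      unfolding X.germ_equiv_def using p openin_preimage[of W]
      by (intro exI[of _ "preimage W"]) auto
  qed
  moreover have "(V, g) \<in> germ Y (\<phi> p) V g" using g Y.germ_equiv_refl by (auto simp: Y.germ_eq)
  ultimately show ?thesis unfolding pullback_germ_def by blast
qed

lemma pullback_ring_hom:
  assumes p: "p \<in> points X"
  shows "pullback_germ X \<phi> p \<in> ring_hom (local_ring Y (\<phi> p)) (local_ring X p)"
proof (rule ring_hom_memI)
  note rp = represents_pullback[OF p] and pg = pullback_germ_germ[OF p]
  fix x y assume "x \<in> carrier (Y.\<O> (\<phi> p))" "y \<in> carrier (Y.\<O> (\<phi> p))"
  then obtain U f V g where r: "Y.represents (\<phi> p) U f" "Y.represents (\<phi> p) V g"
    "x = germ Y (\<phi> p) U f" "y = germ Y (\<phi> p) V g"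
    by (auto simp: Y.local_ring_simps)
  show "pullback_germ X \<phi> p x \<in> carrier (X.\<O> p)"
    using r rp X.germ_in_carrier by (simp add: pg)
  have int: "preimage (U \<inter> V) = preimage U \<inter> preimage V" by auto
  have "pullback_germ X \<phi> p (x \<otimes>\<^bsub>Y.\<O> (\<phi> p)\<^esub> y) = germ X p (preimage (U \<inter> V)) ((\<lambda>q. f q * g q) \<circ> \<phi>)"
    by (simp only: r(3,4) Y.germ_mult[OF r(1,2)] pg[OF Y.represents_mult[OF r(1,2)]])
  moreover have "pullback_germ X \<phi> p x \<otimes>\<^bsub>X.\<O> p\<^esub> pullback_germ X \<phi> p y =
      germ X p (preimage U \<inter> preimage V) (\<lambda>q. (f \<circ> \<phi>) q * (g \<circ> \<phi>) q)"
    by (simp only: r(3,4) pg[OF r(1)] pg[OF r(2)] X.germ_mult[OF rp[OF r(1)] rp[OF r(2)]])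
  ultimately show "pullback_germ X \<phi> p (x \<otimes>\<^bsub>Y.\<O> (\<phi> p)\<^esub> y) = pullback_germ X \<phi> p x \<otimes>\<^bsub>X.\<O> p\<^esub> pullback_germ X \<phi> p y"
    by (simp only: int o_def)
  have "pullback_germ X \<phi> p (x \<oplus>\<^bsub>Y.\<O> (\<phi> p)\<^esub> y) = germ X p (preimage (U \<inter> V)) ((\<lambda>q. f q + g q) \<circ> \<phi>)"
    by (simp only: r(3,4) Y.germ_add[OF r(1,2)] pg[OF Y.represents_add[OF r(1,2)]])
  moreover have "pullback_germ X \<phi> p x \<oplus>\<^bsub>X.\<O> p\<^esub> pullback_germ X \<phi> p y =
      germ X p (preimage U \<inter> preimage V) (\<lambda>q. (f \<circ> \<phi>) q + (g \<circ> \<phi>) q)"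
    by (simp only: r(3,4) pg[OF r(1)] pg[OF r(2)] X.germ_add[OF rp[OF r(1)] rp[OF r(2)]])
  ultimately show "pullback_germ X \<phi> p (x \<oplus>\<^bsub>Y.\<O> (\<phi> p)\<^esub> y) = pullback_germ X \<phi> p x \<oplus>\<^bsub>X.\<O> p\<^esub> pullback_germ X \<phi> p y"
    by (simp only: int o_def)
next
  have "preimage (points Y) = points X" using point_image by auto
  then show "pullback_germ X \<phi> p \<one>\<^bsub>Y.\<O> (\<phi> p)\<^esub> = \<one>\<^bsub>X.\<O> p\<^esub>"
    using pullback_germ_germ[OF p Y.represents_const[OF point_image[OF p], of 1]]
    by (simp add: Y.local_ring_simps X.local_ring_simps o_def)
qed

text \<open>Germs are removed from the criterion: finitely many germs have representatives on a
  common open set, and an equation between germs holds on a smaller one. In \<open>crit\<close>, the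
  syzygy relations have to hold on a neighbourhood \<open>V'\<close> downstairs, the decomposition
  of the \<open>m i\<close> on \<open>W\<close> upstairs.\<close>

lemma equational_criterion_germs:
  assumes p: "p \<in> points X"
    and crit: "\<And>n U m V r. openin (zariski X) U \<Longrightarrow> p \<in> U \<Longrightarrow> openin (zariski Y) V \<Longrightarrow> \<phi> p \<in> V \<Longrightarrow>
      U \<subseteq> preimage V \<Longrightarrow> (\<And>i. i < (n::nat) \<Longrightarrow> m i \<in> regular X U) \<Longrightarrow> (\<And>i. i < n \<Longrightarrow> r i \<in> regular Y V) \<Longrightarrow>
      (\<And>q. q \<in> U \<Longrightarrow> (\<Sum>i<n. r i (\<phi> q) * m i q) = 0) \<Longrightarrow>
      \<exists>(k::nat) W V' b m'. openin (zariski X) W \<and> p \<in> W \<and> openin (zariski Y) V' \<and> \<phi> p \<in> V' \<and>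
        W \<subseteq> U \<inter> preimage V' \<and> V' \<subseteq> V \<and> (\<forall>j<k. m' j \<in> regular X W) \<and> (\<forall>i<n. \<forall>j<k. b i j \<in> regular Y V') \<and>
        (\<forall>i<n. \<forall>q\<in>W. m i q = (\<Sum>j<k. b i j (\<phi> q) * m' j q)) \<and>
        (\<forall>j<k. \<forall>q\<in>V'. (\<Sum>i<n. r i q * b i j q) = 0)"
  shows "equational_criterion (local_ring Y (\<phi> p)) (restrict_scalars (pullback_germ X \<phi> p) (local_ring X p))"
  unfolding equational_criterion_def
proof (intro allI impI)
  let ?R = "local_ring Y (\<phi> p)" and ?S = "local_ring X p" and ?h = "pullback_germ X \<phi> p"
  let ?M = "restrict_scalars ?h ?S"
  interpret R: cring ?R by (rule Y.cring_local_ring[OF point_image[OF p]])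
  interpret S: cring ?S by (rule X.cring_local_ring[OF p])
  have M: "carrier ?M = carrier ?S" "\<zero>\<^bsub>?M\<^esub> = \<zero>\<^bsub>?S\<^esub>" "r \<odot>\<^bsub>?M\<^esub> x = ?h r \<otimes>\<^bsub>?S\<^esub> x" for r x
    by (simp_all add: restrict_scalars_def)
  fix n :: nat and r m
  assume rm: "\<forall>i<n. r i \<in> carrier ?R \<and> m i \<in> carrier ?M"
    and rel: "(\<Oplus>\<^bsub>?M\<^esub>i\<in>{..<n}. r i \<odot>\<^bsub>?M\<^esub> m i) = \<zero>\<^bsub>?M\<^esub>"
  obtain U0 f where U0: "openin (zariski X) U0" "p \<in> U0" and f: "\<And>i. i < n \<Longrightarrow> X.represents p U0 (f i)"
    and m: "\<And>i. i < n \<Longrightarrow> m i = germ X p U0 (f i)"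
  proof -
    have "\<exists>U f. openin (zariski X) U \<and> p \<in> U \<and> (\<forall>i<n. X.represents p U (f i) \<and> m i = germ X p U (f i))"
      using rm by (intro X.common_open[OF p]) (simp add: M)
    then show ?thesis by (elim exE conjE) (rule that, simp_all)
  qed
  obtain V \<rho> where V: "openin (zariski Y) V" "\<phi> p \<in> V" and \<rho>: "\<And>i. i < n \<Longrightarrow> Y.represents (\<phi> p) V (\<rho> i)"
    and r: "\<And>i. i < n \<Longrightarrow> r i = germ Y (\<phi> p) V (\<rho> i)"
  proof -
    have "\<exists>V \<rho>. openin (zariski Y) V \<and> \<phi> p \<in> V \<and> (\<forall>i<n. Y.represents (\<phi> p) V (\<rho> i) \<and> r i = germ Y (\<phi> p) V (\<rho> i))"
      using rm by (intro Y.common_open[OF point_image[OF p]]) simp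
    then show ?thesis by (elim exE conjE) (rule that, simp_all)
  qed
  let ?U1 = "preimage V \<inter> U0"
  have U1: "openin (zariski X) ?U1" "p \<in> ?U1" using U0 V p openin_preimage by auto
  have rep: "X.represents p ?U1 (\<lambda>q. \<rho> i (\<phi> q) * f i q)" if "i < n" for i
    using X.represents_mult[OF represents_pullback[OF p \<rho>[OF that]] f[OF that]] by (simp add: o_def)
  have "(\<Oplus>\<^bsub>?M\<^esub>i\<in>{..<n}. r i \<odot>\<^bsub>?M\<^esub> m i) = (\<Oplus>\<^bsub>?S\<^esub>i\<in>{..<n}. germ X p ?U1 (\<lambda>q. \<rho> i (\<phi> q) * f i q))"
    unfolding finsum_restrict_scalars M
  proof (rule S.finsum_cong')
    fix i assume "i \<in> {..<n}"
    then have i: "i < n" by simp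
    show "?h (r i) \<otimes>\<^bsub>?S\<^esub> m i = germ X p ?U1 (\<lambda>q. \<rho> i (\<phi> q) * f i q)"
      using represents_pullback[OF p \<rho>[OF i]] f[OF i]
      by (simp add: r[OF i] m[OF i] pullback_germ_germ[OF p \<rho>[OF i]] X.germ_mult)
  qed (use X.germ_in_carrier rep in auto)
  also have "\<dots> = germ X p ?U1 (\<lambda>q. \<Sum>i<n. \<rho> i (\<phi> q) * f i q)"
    by (rule X.germ_finsum[OF U1 rep])
  finally have "germ X p ?U1 (\<lambda>q. \<Sum>i<n. \<rho> i (\<phi> q) * f i q) = germ X p (points X) (\<lambda>q. 0)"
    using rel by (simp add: M X.local_ring_simps)
  then obtain U where U: "openin (zariski X) U" "p \<in> U" "U \<subseteq> ?U1"
    and eq: "\<And>q. q \<in> U \<Longrightarrow> (\<Sum>i<n. \<rho> i (\<phi> q) * f i q) = 0"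
    unfolding X.germ_eq_iff[OF X.represents_const[OF p]] by (auto simp: X.germ_equiv_def)
  have "\<exists>(k::nat) W V' b m'. openin (zariski X) W \<and> p \<in> W \<and> openin (zariski Y) V' \<and> \<phi> p \<in> V' \<and>
        W \<subseteq> U \<inter> preimage V' \<and> V' \<subseteq> V \<and> (\<forall>j<k. m' j \<in> regular X W) \<and> (\<forall>i<n. \<forall>j<k. b i j \<in> regular Y V') \<and>
        (\<forall>i<n. \<forall>q\<in>W. f i q = (\<Sum>j<k. b i j (\<phi> q) * m' j q)) \<and>
        (\<forall>j<k. \<forall>q\<in>V'. (\<Sum>i<n. \<rho> i q * b i j q) = 0)"
    (is "\<exists>k W V' b m'. ?C k W V' b m'")
  proof (rule crit[OF U(1,2) V])
    show "f i \<in> regular X U" if "i < n" for i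
      using X.represents_restrict[OF f[OF that] U(1,2)] U(3) by (auto simp: X.represents_def)
    show "\<rho> i \<in> regular Y V" if "i < n" for i using \<rho>[OF that] by (simp add: Y.represents_def)
  qed (use U eq in auto)
  then obtain k :: nat and W V' b m' where C: "?C k W V' b m'" by (elim exE) (rule that)
  have W: "openin (zariski X) W" "p \<in> W" and V': "openin (zariski Y) V'" "\<phi> p \<in> V'"
    and sub: "W \<subseteq> U \<inter> preimage V'" "V' \<subseteq> V"
    using C by (simp_all only:)
  have m'r: "\<And>j. j < k \<Longrightarrow> m' j \<in> regular X W"
    and br: "\<And>i j. i < n \<Longrightarrow> j < k \<Longrightarrow> b i j \<in> regular Y V'"
    and mb: "\<And>i q. i < n \<Longrightarrow> q \<in> W \<Longrightarrow> f i q = (\<Sum>j<k. b i j (\<phi> q) * m' j q)"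
    and rb: "\<And>j q. j < k \<Longrightarrow> q \<in> V' \<Longrightarrow> (\<Sum>i<n. \<rho> i q * b i j q) = 0"
    using C by (simp_all only:)
  have m': "X.represents p W (m' j)" if "j < k" for j using m'r[OF that] W by (simp add: X.represents_def)
  have b: "Y.represents (\<phi> p) V' (b i j)" if "i < n" "j < k" for i j
    using br[OF that] V' by (simp add: Y.represents_def)
  have WU0: "W \<subseteq> U0" using sub U by auto
  have Wpre: "preimage V' \<inter> W = W" using sub by auto
  show "\<exists>(k::nat) b m'. (\<forall>i<n. \<forall>j<k. b i j \<in> carrier ?R) \<and> (\<forall>j<k. m' j \<in> carrier ?M) \<and>
      (\<forall>i<n. m i = (\<Oplus>\<^bsub>?M\<^esub>j\<in>{..<k}. b i j \<odot>\<^bsub>?M\<^esub> m' j)) \<and>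
      (\<forall>j<k. (\<Oplus>\<^bsub>?R\<^esub>i\<in>{..<n}. r i \<otimes>\<^bsub>?R\<^esub> b i j) = \<zero>\<^bsub>?R\<^esub>)"
  proof (intro exI conjI allI impI)
    show "germ Y (\<phi> p) V' (b i j) \<in> carrier ?R" if "i < n" "j < k" for i j
      using b that by (simp add: Y.germ_in_carrier)
    show "germ X p W (m' j) \<in> carrier ?M" if "j < k" for j
      using m' that by (simp add: M X.germ_in_carrier)
    show "m i = (\<Oplus>\<^bsub>?M\<^esub>j\<in>{..<k}. germ Y (\<phi> p) V' (b i j) \<odot>\<^bsub>?M\<^esub> germ X p W (m' j))" if i: "i < n" for i
    proof -
      have rep: "X.represents p W (\<lambda>q. b i j (\<phi> q) * m' j q)" if "j < k" for j
        using X.represents_mult[OF represents_pullback[OF p b[OF i that]] m'[OF that]] by (simp add: o_def Wpre)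
      have "(\<Oplus>\<^bsub>?M\<^esub>j\<in>{..<k}. germ Y (\<phi> p) V' (b i j) \<odot>\<^bsub>?M\<^esub> germ X p W (m' j)) =
          (\<Oplus>\<^bsub>?S\<^esub>j\<in>{..<k}. germ X p W (\<lambda>q. b i j (\<phi> q) * m' j q))"
        unfolding finsum_restrict_scalars M
      proof (rule S.finsum_cong')
        fix j assume "j \<in> {..<k}"
        then have j: "j < k" by simp
        show "?h (germ Y (\<phi> p) V' (b i j)) \<otimes>\<^bsub>?S\<^esub> germ X p W (m' j) = germ X p W (\<lambda>q. b i j (\<phi> q) * m' j q)"
          using represents_pullback[OF p b[OF i j]] m'[OF j]
          by (simp add: pullback_germ_germ[OF p b[OF i j]] X.germ_mult Wpre)
      qed (use X.germ_in_carrier rep in auto)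
      also have "\<dots> = germ X p W (\<lambda>q. \<Sum>j<k. b i j (\<phi> q) * m' j q)"
        by (rule X.germ_finsum[OF W rep])
      also have "\<dots> = germ X p U0 (f i)"
        by (rule X.germ_eqI) (use W WU0 mb[OF i] in \<open>auto simp: X.germ_equiv_def\<close>)
      finally show ?thesis using m[OF i] by simp
    qed
    show "(\<Oplus>\<^bsub>?R\<^esub>i\<in>{..<n}. r i \<otimes>\<^bsub>?R\<^esub> germ Y (\<phi> p) V' (b i j)) = \<zero>\<^bsub>?R\<^esub>" if j: "j < k" for j
    proof -
      have VV': "V \<inter> V' = V'" using sub by auto
      have rep: "Y.represents (\<phi> p) V' (\<lambda>q. \<rho> i q * b i j q)" if "i < n" for i
        using Y.represents_mult[OF \<rho>[OF that] b[OF that j]] by (simp add: VV')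
      have "(\<Oplus>\<^bsub>?R\<^esub>i\<in>{..<n}. r i \<otimes>\<^bsub>?R\<^esub> germ Y (\<phi> p) V' (b i j)) = (\<Oplus>\<^bsub>?R\<^esub>i\<in>{..<n}. germ Y (\<phi> p) V' (\<lambda>q. \<rho> i q * b i j q))"
        by (rule R.finsum_cong')
          (use r \<rho> b j Y.germ_mult Y.germ_in_carrier rep in \<open>auto simp: VV'\<close>)
      also have "\<dots> = germ Y (\<phi> p) V' (\<lambda>q. \<Sum>i<n. \<rho> i q * b i j q)"
        by (rule Y.germ_finsum[OF V' rep])
      also have "\<dots> = germ Y (\<phi> p) (points Y) (\<lambda>q. 0)"
        by (rule Y.germ_eqI) (use V' rb[OF j] openin_subset[OF V'(1)] in \<open>auto simp: Y.germ_equiv_def\<close>)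
      finally show ?thesis by (simp add: Y.local_ring_simps)
    qed
  qed
qed

end

section \<open>Quasi-affine varieties and their quotients\<close>

lemma openin_quasi_affine_basic:
  "polynomial_in C h \<Longrightarrow> openin (zariski (quasi_affine S C)) {p \<in> S. h p \<noteq> 0}"
  unfolding quasi_affine_def by (auto intro!: topology_generated_by_Basis)

lemma points_quasi_affine [simp]: "points (quasi_affine S C) = S"
proof -
  have "S \<in> {{p \<in> S. h p \<noteq> 0} | h. polynomial_in C h}"
    using polynomial_in.intros(1)[of C 1] by (intro CollectI exI[of _ "\<lambda>p. 1"]) auto
  then show ?thesis by (auto simp: quasi_affine_def topology_generated_by_topspace)
qed

text \<open>Multiplying the functions intersects principal open sets, so these form a base of the
  topology they generate.\<close>

lemma openin_quasi_affine_contains_basic: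
  assumes "openin (zariski (quasi_affine S C)) U" "p \<in> U"
  shows "\<exists>h. polynomial_in C h \<and> h p \<noteq> 0 \<and> {q \<in> S. h q \<noteq> 0} \<subseteq> U"
proof -
  have "generate_topology_on {{p \<in> S. h p \<noteq> 0} | h. polynomial_in C h} U"
    using assms(1) by (simp add: quasi_affine_def openin_topology_generated_by_iff)
  then show ?thesis using assms(2)
  proof (induction arbitrary: p)
    case (Int a b)
    obtain g where "polynomial_in C g" "g p \<noteq> 0" "{q \<in> S. g q \<noteq> 0} \<subseteq> a"
      using Int.IH(1)[of p] Int.prems by auto
    moreover obtain h where "polynomial_in C h" "h p \<noteq> 0" "{q \<in> S. h q \<noteq> 0} \<subseteq> b"
      using Int.IH(2)[of p] Int.prems by auto
    ultimately show ?case by (intro exI[of _ "\<lambda>q. g q * h q"]) (auto intro: polynomial_in.intros)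
  next
    case (UN K)
    then obtain k where "k \<in> K" "p \<in> k" by auto
    with UN.IH show ?case by (meson Union_upper order_trans)
  qed auto
qed

lemma regular_quasi_affineI:
  assumes "\<And>p. p \<in> U \<Longrightarrow> \<exists>g h. polynomial_in C g \<and> polynomial_in C h \<and> h p \<noteq> 0 \<and> (\<forall>q\<in>U. h q \<noteq> 0 \<longrightarrow> f q = g q / h q)"
  shows "f \<in> regular (quasi_affine S C) U"
  using assms by (simp add: quasi_affine_def)

lemma regular_quasi_affineD:
  assumes "f \<in> regular (quasi_affine S C) U" "p \<in> U"
  shows "\<exists>g h. polynomial_in C g \<and> polynomial_in C h \<and> h p \<noteq> 0 \<and> (\<forall>q\<in>U. h q \<noteq> 0 \<longrightarrow> f q = g q / h q)"
  using assms by (simp add: quasi_affine_def)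

lemma ringed_space_quasi_affine: "ringed_space (quasi_affine S C)"
proof
  fix U c
  show "(\<lambda>q. c) \<in> regular (quasi_affine S C) U"
  proof (rule regular_quasi_affineI)
    show "\<exists>g h. polynomial_in C g \<and> polynomial_in C h \<and> h p \<noteq> 0 \<and> (\<forall>q\<in>U. h q \<noteq> 0 \<longrightarrow> c = g q / h q)" for p
      by (intro exI[of _ "\<lambda>_. c"] exI[of _ "\<lambda>_. 1"]) (auto intro: polynomial_in.intros)
  qed
next
  fix U f g assume f: "f \<in> regular (quasi_affine S C) U" and g: "g \<in> regular (quasi_affine S C) U"
  show "(\<lambda>q. f q + g q) \<in> regular (quasi_affine S C) U"
  proof (rule regular_quasi_affineI)
    fix p assume p: "p \<in> U"
    obtain a b where ab: "polynomial_in C a" "polynomial_in C b" "b p \<noteq> 0" "\<And>q. q \<in> U \<Longrightarrow> b q \<noteq> 0 \<Longrightarrow> f q = a q / b q"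
      using regular_quasi_affineD[OF f p] by blast
    obtain c d where cd: "polynomial_in C c" "polynomial_in C d" "d p \<noteq> 0" "\<And>q. q \<in> U \<Longrightarrow> d q \<noteq> 0 \<Longrightarrow> g q = c q / d q"
      using regular_quasi_affineD[OF g p] by blast
    show "\<exists>u v. polynomial_in C u \<and> polynomial_in C v \<and> v p \<noteq> 0 \<and> (\<forall>q\<in>U. v q \<noteq> 0 \<longrightarrow> f q + g q = u q / v q)"
    proof (intro exI conjI ballI impI)
      show "polynomial_in C (\<lambda>q. a q * d q + c q * b q)" "polynomial_in C (\<lambda>q. b q * d q)"
        using ab cd by (auto intro!: polynomial_in.intros(3,4))
    qed (use ab cd in \<open>auto simp: field_simps\<close>)
  qed
  show "(\<lambda>q. f q * g q) \<in> regular (quasi_affine S C) U"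
  proof (rule regular_quasi_affineI)
    fix p assume p: "p \<in> U"
    obtain a b where ab: "polynomial_in C a" "polynomial_in C b" "b p \<noteq> 0" "\<And>q. q \<in> U \<Longrightarrow> b q \<noteq> 0 \<Longrightarrow> f q = a q / b q"
      using regular_quasi_affineD[OF f p] by blast
    obtain c d where cd: "polynomial_in C c" "polynomial_in C d" "d p \<noteq> 0" "\<And>q. q \<in> U \<Longrightarrow> d q \<noteq> 0 \<Longrightarrow> g q = c q / d q"
      using regular_quasi_affineD[OF g p] by blast
    show "\<exists>u v. polynomial_in C u \<and> polynomial_in C v \<and> v p \<noteq> 0 \<and> (\<forall>q\<in>U. v q \<noteq> 0 \<longrightarrow> f q * g q = u q / v q)"
    proof (intro exI conjI ballI impI)
      show "polynomial_in C (\<lambda>q. a q * c q)" "polynomial_in C (\<lambda>q. b q * d q)"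
        using ab cd by (auto intro!: polynomial_in.intros(4))
    qed (use ab cd in auto)
  qed
next
  fix U V f assume "V \<subseteq> U" "f \<in> regular (quasi_affine S C) U"
  then show "f \<in> regular (quasi_affine S C) V"
    unfolding quasi_affine_def by simp blast
next
  fix U f g assume "f \<in> regular (quasi_affine S C) U" "\<And>q. q \<in> U \<Longrightarrow> f q = g q"
  then show "g \<in> regular (quasi_affine S C) U"
    unfolding quasi_affine_def by simp
qed

lemma points_quotient_variety:
  assumes "\<pi> ` points X \<subseteq> E"
  shows "points (quotient_variety X \<pi> E) = E"
proof -
  have "{p \<in> points X. \<pi> p \<in> E} = points X" using assms by auto
  then have "openin (zariski (quotient_variety X \<pi> E)) E" by (simp add: openin_quotient_variety)
  then have "E \<subseteq> points (quotient_variety X \<pi> E)" by (rule openin_subset)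
  moreover have "points (quotient_variety X \<pi> E) \<subseteq> E"
    using openin_topspace[of "zariski (quotient_variety X \<pi> E)"]
    unfolding openin_quotient_variety by (rule conjunct1)
  ultimately show ?thesis by blast
qed

lemma regular_quotient_variety:
  "f \<in> regular (quotient_variety X \<pi> E) U \<longleftrightarrow> f \<circ> \<pi> \<in> regular X {p \<in> points X. \<pi> p \<in> U}"
  by (simp add: quotient_variety_def)

lemma (in ringed_space) ringed_space_quotient: "ringed_space (quotient_variety X \<pi> E)"
proof
  fix U V f
  assume "openin (zariski (quotient_variety X \<pi> E)) U" "openin (zariski (quotient_variety X \<pi> E)) V" "V \<subseteq> U"
    "f \<in> regular (quotient_variety X \<pi> E) U"
  then show "f \<in> regular (quotient_variety X \<pi> E) V"
    unfolding openin_quotient_variety regular_quotient_variety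
    by (elim conjE) (rule restrict_regular[of "{p \<in> points X. \<pi> p \<in> U}"], auto)
next
  fix U f g
  assume "openin (zariski (quotient_variety X \<pi> E)) U" "f \<in> regular (quotient_variety X \<pi> E) U" "\<And>q. q \<in> U \<Longrightarrow> f q = g q"
  then show "g \<in> regular (quotient_variety X \<pi> E) U"
    unfolding openin_quotient_variety regular_quotient_variety
    by (elim conjE) (rule cong_regular[of "{p \<in> points X. \<pi> p \<in> U}" "f \<circ> \<pi>"], auto)
qed (auto simp: openin_quotient_variety regular_quotient_variety o_def intro: const_regular add_regular mult_regular)

section \<open>Linear algebra in dimension five\<close>

lemma exhaust_5: "x = 1 \<or> x = 2 \<or> x = 3 \<or> x = 4 \<or> x = 5" for x :: 5
proof (induct x)
  case (of_int z)
  then have "z = 0 \<or> z = 1 \<or> z = 2 \<or> z = 3 \<or> z = 4" by fastforce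
  then show ?case by auto
qed

lemma UNIV_5: "UNIV = {1, 2, 3, 4, 5::5}"
  using exhaust_5 by auto

lemma forall_5: "(\<forall>i::5. P i) \<longleftrightarrow> P 1 \<and> P 2 \<and> P 3 \<and> P 4 \<and> P 5"
  by (metis exhaust_5)

lemma dot_add [simp]: "dot (u + v) w = dot u w + dot v w" "dot w (u + v) = dot w u + dot w v"
  by (simp_all add: dot_def sum.distrib algebra_simps)

lemma dot_diff [simp]: "dot (u - v) w = dot u w - dot v w" "dot w (u - v) = dot w u - dot w v"
  by (simp_all add: dot_def sum_subtractf algebra_simps)

lemma dot_scale [simp]: "dot (c *s u) w = c * dot u w" "dot w (c *s u) = c * dot w u"
  by (simp_all add: dot_def sum_distrib_left mult_ac)

lemma dot_zero [simp]: "dot 0 w = 0" "dot w 0 = 0"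
  by (simp_all add: dot_def)

lemma dot_minus [simp]: "dot (- u) w = - dot u w" "dot w (- u) = - dot w u"
  by (simp_all add: dot_def sum_negf)

lemma dot_commute: "dot u v = dot v u"
  by (simp add: dot_def mult.commute)

lemma dot_axis [simp]: "dot u (axis i 1) = u $ i"
  by (simp add: dot_def axis_def if_distrib cong: if_cong)

lemma dot_eq_0_imp: "(\<And>w. dot u w = 0) \<Longrightarrow> u = 0"
  by (simp add: vec_eq_iff) (metis dot_axis)

text \<open>\<open>dot\<close> is bilinear and has isotropic vectors; pairing with the conjugate
  gives the squared Hermitian norm instead, which is positive.\<close>

definition conj_vec :: "vec5 \<Rightarrow> vec5" where "conj_vec x = (\<chi> i. cnj (x $ i))"

lemma dot_conj_vec: assumes "x \<noteq> 0" shows "dot (conj_vec x) x \<noteq> 0"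
proof -
  have "dot (conj_vec x) x = of_real (\<Sum>i\<in>UNIV. (cmod (x $ i))\<^sup>2)"
    by (simp add: dot_def conj_vec_def complex_norm_square mult.commute del: of_real_power)
  moreover obtain i where "x $ i \<noteq> 0" using assms by (auto simp: vec_eq_iff)
  then have "(\<Sum>i\<in>UNIV. (cmod (x $ i))\<^sup>2) > 0"
    by (intro sum_pos2[of _ i]) auto
  ultimately show ?thesis by (metis less_irrefl of_real_eq_0_iff)
qed

lemma matrix_vector_scale: "(A::complex^'n^'m) *v (c *s x) = c *s (A *v x)"
  by (simp add: vec_eq_iff matrix_vector_mult_def sum_distrib_left mult_ac)

lemma bilin_add [simp]: "bilin Q (u + v) w = bilin Q u w + bilin Q v w" "bilin Q w (u + v) = bilin Q w u + bilin Q w v"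
  by (simp_all add: bilin_def matrix_vector_right_distrib)

lemma bilin_scale [simp]: "bilin Q (c *s u) w = c * bilin Q u w" "bilin Q w (c *s u) = c * bilin Q w u"
  by (simp_all add: bilin_def matrix_vector_scale)

lemma bilin_zero [simp]: "bilin Q 0 w = 0" "bilin Q w 0 = 0"
  by (simp_all add: bilin_def)

lemma bilin_diff [simp]: "bilin Q (u - v) w = bilin Q u w - bilin Q v w" "bilin Q w (u - v) = bilin Q w u - bilin Q w v"
  using bilin_add(1)[of Q "u - v" v w] bilin_add(2)[of Q w "u - v" v] by (simp_all add: eq_diff_eq del: bilin_add)

lemma bilin_dot:
  assumes "transpose Q = Q" shows "bilin Q u v = dot (Q *v u) v"
proof -
  have Q: "Q $ i $ j = Q $ j $ i" for i j
    using arg_cong[OF assms, of "\<lambda>M. M $ j $ i"] by (simp add: transpose_def)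
  have "bilin Q u v = (\<Sum>i\<in>UNIV. \<Sum>j\<in>UNIV. u $ i * Q $ i $ j * v $ j)"
    by (simp add: bilin_def dot_def matrix_vector_mult_def sum_distrib_left mult_ac)
  also have "\<dots> = (\<Sum>i\<in>UNIV. \<Sum>j\<in>UNIV. Q $ j $ i * u $ i * v $ j)"
    using Q by (intro sum.cong refl) simp
  also have "\<dots> = (\<Sum>j\<in>UNIV. \<Sum>i\<in>UNIV. Q $ j $ i * u $ i * v $ j)"
    by (rule sum.swap)
  also have "\<dots> = dot (Q *v u) v"
    by (simp add: dot_def matrix_vector_mult_def sum_distrib_right)
  finally show ?thesis .
qed

lemma bilin_commute: "transpose Q = Q \<Longrightarrow> bilin Q u v = bilin Q v u"
  using bilin_dot[of Q u v] by (simp add: bilin_def dot_commute)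

section \<open>Determinants of five vectors\<close>

definition rows5 :: "vec5 \<Rightarrow> vec5 \<Rightarrow> vec5 \<Rightarrow> vec5 \<Rightarrow> vec5 \<Rightarrow> mat5" where
  "rows5 a b c d e = (\<chi> i::5. if i = 1 then a else if i = 2 then b else if i = 3 then c
       else if i = 4 then d else e)"

text \<open>The matrix is written exactly as in \<open>residue_form\<close>, so that the determinant
  there folds to \<open>det5\<close>.\<close>

definition det5 :: "vec5 \<Rightarrow> vec5 \<Rightarrow> vec5 \<Rightarrow> vec5 \<Rightarrow> vec5 \<Rightarrow> complex" where
  "det5 a b c d e = det (rows5 a b c d e)"

lemma rows5_nth [simp]:
  "rows5 a b c d e $ 1 = a" "rows5 a b c d e $ 2 = b" "rows5 a b c d e $ 3 = c"
  "rows5 a b c d e $ 4 = d" "rows5 a b c d e $ 5 = e"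
  by (simp_all add: rows5_def)

text \<open>Singles out one row, the form in which linearity of the determinant in that row
  applies.\<close>

lemma rows5_eq:
  "rows5 a b c d e = (\<chi> i. if i = 1 then a else rows5 0 b c d e $ i)"
  "rows5 a b c d e = (\<chi> i. if i = 2 then b else rows5 a 0 c d e $ i)"
  "rows5 a b c d e = (\<chi> i. if i = 3 then c else rows5 a b 0 d e $ i)"
  "rows5 a b c d e = (\<chi> i. if i = 4 then d else rows5 a b c 0 e $ i)"
  "rows5 a b c d e = (\<chi> i. if i = 5 then e else rows5 a b c d 0 $ i)"
  by (simp_all add: vec_eq_iff[of _ "vec_lambda _"] forall_5)

lemma det5_add:
  "det5 (a + a') b c d e = det5 a b c d e + det5 a' b c d e"
  "det5 a (b + b') c d e = det5 a b c d e + det5 a b' c d e"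
  "det5 a b (c + c') d e = det5 a b c d e + det5 a b c' d e"
  "det5 a b c (d + d') e = det5 a b c d e + det5 a b c d' e"
  "det5 a b c d (e + e') = det5 a b c d e + det5 a b c d e'"
  unfolding det5_def
  subgoal using det_row_add[of 1 "\<lambda>_. a" "\<lambda>_. a'" "\<lambda>i. rows5 0 b c d e $ i"] by (simp only: rows5_eq(1)[symmetric])
  subgoal using det_row_add[of 2 "\<lambda>_. b" "\<lambda>_. b'" "\<lambda>i. rows5 a 0 c d e $ i"] by (simp only: rows5_eq(2)[symmetric])
  subgoal using det_row_add[of 3 "\<lambda>_. c" "\<lambda>_. c'" "\<lambda>i. rows5 a b 0 d e $ i"] by (simp only: rows5_eq(3)[symmetric])
  subgoal using det_row_add[of 4 "\<lambda>_. d" "\<lambda>_. d'" "\<lambda>i. rows5 a b c 0 e $ i"] by (simp only: rows5_eq(4)[symmetric])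
  subgoal using det_row_add[of 5 "\<lambda>_. e" "\<lambda>_. e'" "\<lambda>i. rows5 a b c d 0 $ i"] by (simp only: rows5_eq(5)[symmetric])
  done

lemma det5_scale:
  "det5 (k *s a) b c d e = k * det5 a b c d e"
  "det5 a (k *s b) c d e = k * det5 a b c d e"
  "det5 a b (k *s c) d e = k * det5 a b c d e"
  "det5 a b c (k *s d) e = k * det5 a b c d e"
  "det5 a b c d (k *s e) = k * det5 a b c d e"
  unfolding det5_def
  subgoal using det_row_mul[of 1 k "\<lambda>_. a" "\<lambda>i. rows5 0 b c d e $ i"] by (simp only: rows5_eq(1)[symmetric])
  subgoal using det_row_mul[of 2 k "\<lambda>_. b" "\<lambda>i. rows5 a 0 c d e $ i"] by (simp only: rows5_eq(2)[symmetric])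
  subgoal using det_row_mul[of 3 k "\<lambda>_. c" "\<lambda>i. rows5 a b 0 d e $ i"] by (simp only: rows5_eq(3)[symmetric])
  subgoal using det_row_mul[of 4 k "\<lambda>_. d" "\<lambda>i. rows5 a b c 0 e $ i"] by (simp only: rows5_eq(4)[symmetric])
  subgoal using det_row_mul[of 5 k "\<lambda>_. e" "\<lambda>i. rows5 a b c d 0 $ i"] by (simp only: rows5_eq(5)[symmetric])
  done

lemma det5_minus:
  "det5 (a - a') b c d e = det5 a b c d e - det5 a' b c d e"
  "det5 a (b - b') c d e = det5 a b c d e - det5 a b' c d e"
  "det5 a b (c - c') d e = det5 a b c d e - det5 a b c' d e"
  "det5 a b c (d - d') e = det5 a b c d e - det5 a b c d' e"
  "det5 a b c d (e - e') = det5 a b c d e - det5 a b c d e'"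
  subgoal using det5_add(1)[of "a - a'" a' b c d e] by simp
  subgoal using det5_add(2)[of a "b - b'" b' c d e] by simp
  subgoal using det5_add(3)[of a b "c - c'" c' d e] by simp
  subgoal using det5_add(4)[of a b c "d - d'" d' e] by simp
  subgoal using det5_add(5)[of a b c d "e - e'" e'] by simp
  done

lemma det5_zero [simp]: "det5 0 b c d e = 0" "det5 a 0 c d e = 0" "det5 a b 0 d e = 0" "det5 a b c 0 e = 0" "det5 a b c d 0 = 0"
  using det5_scale(1)[of 0 0 b c d e] det5_scale(2)[of a 0 0 c d e] det5_scale(3)[of a b 0 0 d e]
    det5_scale(4)[of a b c 0 0 e] det5_scale(5)[of a b c d 0 0]
  by simp_all

lemma det5_same [simp]: "det5 a a c d e = 0" "det5 a b a d e = 0" "det5 a b c a e = 0" "det5 a b c d a = 0"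
  "det5 a b b d e = 0" "det5 a b c b e = 0" "det5 a b c d b = 0" "det5 a b c c e = 0" "det5 a b c d c = 0"
  "det5 a b c d d = 0"
proof -
  have *: "det (rows5 v w x y z) = 0" if "i \<noteq> j" "rows5 v w x y z $ i = rows5 v w x y z $ j" for i j v w x y z
    using that by (intro det_identical_rows[of i j]) (simp_all add: row_def)
  show "det5 a a c d e = 0" "det5 a b a d e = 0" "det5 a b c a e = 0" "det5 a b c d a = 0"
    "det5 a b b d e = 0" "det5 a b c b e = 0" "det5 a b c d b = 0" "det5 a b c c e = 0" "det5 a b c d c = 0"
    "det5 a b c d d = 0"
    unfolding det5_def
    using *[of 1 2 a a c d e] *[of 1 3 a b a d e] *[of 1 4 a b c a e] *[of 1 5 a b c d a]
      *[of 2 3 a b b d e] *[of 2 4 a b c b e] *[of 2 5 a b c d b] *[of 3 4 a b c c e] *[of 3 5 a b c d c]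
      *[of 4 5 a b c d d]
    by simp_all
qed

lemma det5_swap: "det5 y u v d e = - det5 y v u d e" "det5 y u v d e = - det5 y u v e d"
proof -
  have "det5 y (u + v) (u + v) d e = 0" by simp
  then show "det5 y u v d e = - det5 y v u d e"
    unfolding det5_add by (simp add: add_eq_0_iff)
  have "det5 y u v (d + e) (d + e) = 0" by simp
  then show "det5 y u v d e = - det5 y u v e d"
    unfolding det5_add by (simp add: add_eq_0_iff)
qed

lemma det_nonzero_iff_inj: "det (A::complex^'n^'n) \<noteq> 0 \<longleftrightarrow> inj ((*v) A)"
  using det_nz_iff_inj_gen[of "(*v) A"] matrix_vector_mul_linear_gen[of A] by simp

lemma sum_5: "sum f (UNIV::5 set) = f 1 + f 2 + f 3 + f 4 + f 5"
proof -
  have "distinct [1::5, 2, 3, 4, 5]" by simp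
  then have "sum f (set [1::5, 2, 3, 4, 5]) = f 1 + f 2 + f 3 + f 4 + f 5"
    by (subst sum.distinct_set_conv_list) (simp_all add: add.assoc)
  then show ?thesis by (simp only: UNIV_5 list.set)
qed

lemma rows5_mult_eq_0: "rows5 a b c d e *v x = 0 \<longleftrightarrow> dot a x = 0 \<and> dot b x = 0 \<and> dot c x = 0 \<and> dot d x = 0 \<and> dot e x = 0"
proof -
  have "(rows5 a b c d e *v x) $ i = dot (rows5 a b c d e $ i) x" for i
    by (simp add: matrix_vector_mult_def dot_def)
  then show ?thesis by (simp add: vec_eq_iff[of _ 0] forall_5)
qed

lemma det5_eq_0_iff_null_vector:
  "det5 a b c d e = 0 \<longleftrightarrow> (\<exists>x. x \<noteq> 0 \<and> dot a x = 0 \<and> dot b x = 0 \<and> dot c x = 0 \<and> dot d x = 0 \<and> dot e x = 0)"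
proof -
  have "det5 a b c d e = 0 \<longleftrightarrow> \<not> inj ((*v) (rows5 a b c d e))"
    unfolding det5_def using det_nonzero_iff_inj[of "rows5 a b c d e"] by blast
  also have "\<dots> \<longleftrightarrow> (\<exists>x. x \<noteq> 0 \<and> rows5 a b c d e *v x = 0)"
    using vec.inj_iff_eq_0[of "rows5 a b c d e"] by blast
  finally show ?thesis by (simp add: rows5_mult_eq_0)
qed

lemma null_vector: "\<exists>x. x \<noteq> 0 \<and> dot a x = 0 \<and> dot b x = 0 \<and> dot c x = 0 \<and> dot d x = 0"
  using det5_eq_0_iff_null_vector[of a b c d 0] by auto

lemma transpose_rows5_mult:
  "transpose (rows5 a b c d e) *v x = x $ 1 *s a + x $ 2 *s b + x $ 3 *s c + x $ 4 *s d + x $ 5 *s e"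
proof -
  have "column i (transpose (rows5 a b c d e)) = rows5 a b c d e $ i" for i
    by (simp add: column_transpose row_def vec_lambda_eta)
  then show ?thesis by (simp only: matrix_mult_sum sum_5 rows5_nth)
qed

lemma vec5_eq_0_iff: "x = 0 \<longleftrightarrow> x $ 1 = 0 \<and> x $ 2 = 0 \<and> x $ 3 = 0 \<and> x $ 4 = 0 \<and> x $ 5 = 0" for x :: vec5
  by (simp add: vec_eq_iff forall_5)

lemma det5_eq_0_imp_dependent:
  assumes "det5 a b c d e = 0"
  obtains x1 x2 x3 x4 x5 where "x1 *s a + x2 *s b + x3 *s c + x4 *s d + x5 *s e = 0"
    "\<not> (x1 = 0 \<and> x2 = 0 \<and> x3 = 0 \<and> x4 = 0 \<and> x5 = 0)"
proof -
  have "det (transpose (rows5 a b c d e)) = 0" using assms by (simp add: det5_def)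
  then have "\<not> inj ((*v) (transpose (rows5 a b c d e)))"
    using det_nonzero_iff_inj[of "transpose (rows5 a b c d e)"] by blast
  then obtain x where "x \<noteq> 0" "transpose (rows5 a b c d e) *v x = 0"
    using vec.inj_iff_eq_0[of "transpose (rows5 a b c d e)"] by blast
  then show ?thesis using that[of "x $ 1" "x $ 2" "x $ 3" "x $ 4" "x $ 5"]
    unfolding transpose_rows5_mult vec5_eq_0_iff by blast
qed

lemma det5_spans:
  assumes "det5 a b c d e \<noteq> 0"
  obtains x1 x2 x3 x4 x5 where "u = x1 *s a + x2 *s b + x3 *s c + x4 *s d + x5 *s e"
proof -
  have "det (transpose (rows5 a b c d e)) \<noteq> 0" using assms by (simp add: det5_def)
  then have "inj ((*v) (transpose (rows5 a b c d e)))"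
    using det_nonzero_iff_inj[of "transpose (rows5 a b c d e)"] by blast
  then have "surj ((*v) (transpose (rows5 a b c d e)))"
    using vec.linear_injective_imp_surjective[OF matrix_vector_mul_linear_gen] by blast
  then obtain x where "u = transpose (rows5 a b c d e) *v x" by (metis surjD)
  then show ?thesis using that unfolding transpose_rows5_mult by blast
qed

lemma two_equations_three_unknowns:
  fixes a1 a2 a3 b1 b2 b3 :: complex
  obtains x1 x2 x3 where "x1 * a1 + x2 * a2 + x3 * a3 = 0" "x1 * b1 + x2 * b2 + x3 * b3 = 0"
    "\<not> (x1 = 0 \<and> x2 = 0 \<and> x3 = 0)"
proof -
  let ?A = "(\<chi> i. if i = 1 then vector [a1, a2, a3] else if i = 2 then vector [b1, b2, b3] else 0) :: complex^3^3"
  have "det ?A = 0" by (simp add: det_3)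
  then have "\<not> inj ((*v) ?A)" using det_nonzero_iff_inj[of ?A] by blast
  then obtain x where x: "x \<noteq> 0" "?A *v x = 0" using vec.inj_iff_eq_0[of ?A] by blast
  have "(?A *v x) $ 1 = 0" "(?A *v x) $ 2 = 0" using x by simp_all
  then show ?thesis using x(1)
    by (intro that[of "x $ 1" "x $ 2" "x $ 3"])
      (auto simp: matrix_vector_mult_def sum_3 vec_eq_iff[of x] forall_3 mult_ac)
qed

section \<open>Tangent planes of the surface\<close>

locale del_pezzo =
  fixes Q1 Q2 :: mat5
  assumes del_pezzo: "del_pezzo_4 Q1 Q2"
begin

abbreviation B1 where "B1 \<equiv> bilin Q1"
abbreviation B2 where "B2 \<equiv> bilin Q2"
abbreviation K where "K \<equiv> cone Q1 Q2"
abbreviation T where "T \<equiv> tangent_cone Q1 Q2"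

lemma sym: "transpose Q1 = Q1" "transpose Q2 = Q2"
  using del_pezzo by (auto simp: del_pezzo_4_def)

lemma B_commute: "B1 u v = B1 v u" "B2 u v = B2 v u"
  using bilin_commute sym by blast+

lemma in_K: "y \<in> K \<longleftrightarrow> y \<noteq> 0 \<and> B1 y y = 0 \<and> B2 y y = 0"
  by (simp add: cone_def)

lemma in_T: "u \<in> T y \<longleftrightarrow> B1 y u = 0 \<and> B2 y u = 0"
  by (simp add: tangent_cone_def)

lemma K_scale: "y \<in> K \<Longrightarrow> c \<noteq> 0 \<Longrightarrow> c *s y \<in> K"
  by (simp add: in_K)

lemma T_scale: "c \<noteq> 0 \<Longrightarrow> T (c *s y) = T y"
  by (auto simp: in_T)

lemma K_in_T: "y \<in> K \<Longrightarrow> y \<in> T y"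
  by (simp add: in_K in_T)

lemma T_add: "u \<in> T y \<Longrightarrow> v \<in> T y \<Longrightarrow> u + v \<in> T y"
  and T_smult: "u \<in> T y \<Longrightarrow> c *s u \<in> T y"
  and T_diff: "u \<in> T y \<Longrightarrow> v \<in> T y \<Longrightarrow> u - v \<in> T y"
  by (simp_all add: in_T)

lemma smooth:
  assumes "y \<in> K" "\<And>w. c * B1 y w + d * B2 y w = 0"
  shows "c = 0 \<and> d = 0"
proof -
  have "c *s (Q1 *v y) + d *s (Q2 *v y) = 0"
    using assms(2) by (intro dot_eq_0_imp) (simp add: bilin_dot[OF sym(1)] bilin_dot[OF sym(2)])
  then show ?thesis using del_pezzo assms(1) by (auto simp: del_pezzo_4_def)
qed

text \<open>Up to a factor 4, the value on \<open>(e, f)\<close> of the wedge of the two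
  differentials at \<open>y\<close>. For \<open>y\<close> in the cone it is nonzero exactly when
  \<open>e\<close> and \<open>f\<close> span a complement of the tangent cone.\<close>

definition D :: "vec5 \<Rightarrow> vec5 \<Rightarrow> vec5 \<Rightarrow> complex" where
  "D e f y = B1 y e * B2 y f - B1 y f * B2 y e"

lemma D_nonzero_exists:
  assumes "y \<in> K" obtains e f where "D e f y \<noteq> 0"
proof -
  have "\<exists>e f. D e f y \<noteq> 0"
  proof (rule ccontr)
    assume "\<not> ?thesis"
    then have 0: "B1 y e * B2 y f = B1 y f * B2 y e" for e f by (simp add: D_def)
    obtain e where e: "B1 y e \<noteq> 0"
    proof -
      have "\<exists>e. B1 y e \<noteq> 0" using smooth[OF assms, of 1 0] by fastforce
      then show ?thesis using that by blast
    qed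
    show False using smooth[OF assms, of "B2 y e" "- B1 y e"] 0[of e] e by (simp add: algebra_simps)
  qed
  then show ?thesis using that by blast
qed

lemma D_cramer:
  assumes "D e f y \<noteq> 0" "a * B1 y e + b * B1 y f = 0" "a * B2 y e + b * B2 y f = 0"
  shows "a = 0" "b = 0"
proof -
  have "a * D e f y = B2 y f * (a * B1 y e + b * B1 y f) - B1 y f * (a * B2 y e + b * B2 y f)"
    "b * D e f y = B1 y e * (a * B2 y e + b * B2 y f) - B2 y e * (a * B1 y e + b * B1 y f)"
    by (simp_all add: D_def algebra_simps)
  then show "a = 0" "b = 0" using assms(1) unfolding assms(2,3) by simp_all
qed

text \<open>The projection to the tangent cone along \<open>e\<close> and \<open>f\<close>, with denominators cleared.\<close>

definition proj :: "vec5 \<Rightarrow> vec5 \<Rightarrow> vec5 \<Rightarrow> vec5 \<Rightarrow> vec5" where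
  "proj e f y u = D e f y *s u - (B1 y u * B2 y f - B2 y u * B1 y f) *s e - (B1 y e * B2 y u - B2 y e * B1 y u) *s f"

lemma proj_in_T: "proj e f y u \<in> T y"
  by (simp add: in_T proj_def D_def algebra_simps)

text \<open>The corrections along \<open>e\<close> and \<open>f\<close> drop out next to the rows
  \<open>e\<close> and \<open>f\<close>; each projection contributes a factor
  \<open>D e f y\<close>.\<close>

lemma det5_proj:
  "det5 y (proj e f y u) (proj e f y v) e f = (D e f y)\<^sup>2 * det5 y u v e f"
  by (simp add: proj_def det5_minus det5_scale power2_eq_square)

text \<open>The tangent cone has dimension three.\<close>

lemma det5_four_tangent:
  assumes y: "y \<in> K" and u: "u1 \<in> T y" "u2 \<in> T y" "u3 \<in> T y" "u4 \<in> T y"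
  shows "det5 u1 u2 u3 u4 w = 0"
proof -
  \<comment> \<open>A combination of the two differentials at \<open>y\<close> that also kills
    \<open>w\<close>: a common null vector of all five rows. It is zero only if \<open>w\<close>
    itself is tangent, and then one differential suffices.\<close>
  define x where "x = B2 y w *s (Q1 *v y) - B1 y w *s (Q2 *v y)"
  have x: "dot v x = B2 y w * B1 y v - B1 y w * B2 y v" for v
    by (simp add: x_def dot_commute[of v] bilin_dot[OF sym(1)] bilin_dot[OF sym(2)])
  show ?thesis
  proof (cases "B1 y w = 0 \<and> B2 y w = 0")
    case True
    define x' where "x' = Q1 *v y"
    have x': "dot v x' = B1 y v" for v
      by (simp add: x'_def dot_commute[of v] bilin_dot[OF sym(1)])
    have "x' \<noteq> 0"
    proof
      assume "x' = 0"
      then have "B1 y v = 0" for v using x'[of v] by simp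
      then show False using smooth[OF y, of 1 0] by simp
    qed
    then show ?thesis unfolding det5_eq_0_iff_null_vector
      using u True by (intro exI[of _ x']) (auto simp: x' in_T)
  next
    case False
    have "x \<noteq> 0"
    proof
      assume "x = 0"
      then have "B2 y w * B1 y v + (- B1 y w) * B2 y v = 0" for v using x[of v] by simp
      then show False using smooth[OF y, of "B2 y w" "- B1 y w"] False by simp
    qed
    then show ?thesis unfolding det5_eq_0_iff_null_vector
      using u by (intro exI[of _ x]) (auto simp: x in_T)
  qed
qed

text \<open>As a form in the last two arguments the determinant vanishes as soon as one of them is
  tangent, because the tangent cone has dimension three. It is therefore an alternating form on a
  two-dimensional quotient, and so is \<open>D\<close>; the two are proportional. Cross-multiplied,
  the claim also covers D e f y = 0, where another pair decides. This is what makes the residue form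
  well defined.\<close>

lemma det5_tangent_pair:
  assumes y: "y \<in> K" and u: "u1 \<in> T y" "u2 \<in> T y" "u3 \<in> T y"
  shows "det5 u1 u2 u3 w1 w2 * D e f y = det5 u1 u2 u3 e f * D w1 w2 y"
proof -
  have dec: "D e f y *s w = proj e f y w + (B1 y w * B2 y f - B2 y w * B1 y f) *s e + (B1 y e * B2 y w - B2 y e * B1 y w) *s f" for w
    by (simp add: proj_def)
  have swap: "det5 u1 u2 u3 w1 w2 = - det5 u1 u2 u3 w2 w1" for w1 w2 by (rule det5_swap)
  have p: "det5 u1 u2 u3 (proj e f y w) w' = 0" "det5 u1 u2 u3 w' (proj e f y w) = 0" for w w'
    using det5_four_tangent[OF y u proj_in_T] swap[of w' "proj e f y w"] by auto
  have "D e f y * (D e f y * det5 u1 u2 u3 w1 w2) = det5 u1 u2 u3 (D e f y *s w1) (D e f y *s w2)"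
    by (simp add: det5_scale)
  also have "\<dots> = D e f y * (D w1 w2 y * det5 u1 u2 u3 e f)"
    unfolding dec by (simp add: det5_add det5_scale det5_minus p swap[of f e]) (simp add: D_def algebra_simps)
  finally have *: "D e f y = 0 \<or> D e f y * det5 u1 u2 u3 w1 w2 = D w1 w2 y * det5 u1 u2 u3 e f" by simp
  show ?thesis
  proof (cases "D e f y = 0")
    case False
    then show ?thesis using * by (simp add: mult.commute)
  next
    case True
    obtain e' f' where nz: "D e' f' y \<noteq> 0" using D_nonzero_exists[OF y] .
    have dec': "D e' f' y *s w = proj e' f' y w + (B1 y w * B2 y f' - B2 y w * B1 y f') *s e' + (B1 y e' * B2 y w - B2 y e' * B1 y w) *s f'" for w
      by (simp add: proj_def)
    have p': "det5 u1 u2 u3 (proj e' f' y w) w' = 0" "det5 u1 u2 u3 w' (proj e' f' y w) = 0" for w w'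
      using det5_four_tangent[OF y u proj_in_T] swap[of w' "proj e' f' y w"] by auto
    have "D e' f' y * (D e' f' y * det5 u1 u2 u3 e f) = det5 u1 u2 u3 (D e' f' y *s e) (D e' f' y *s f)"
      by (simp add: det5_scale)
    also have "\<dots> = D e' f' y * (D e f y * det5 u1 u2 u3 e' f')"
      unfolding dec' by (simp add: det5_add det5_scale det5_minus p' swap[of f' e']) (simp add: D_def algebra_simps)
    finally have "det5 u1 u2 u3 e f = 0" using nz True by simp
    then show ?thesis using True by simp
  qed
qed

lemma tangent_basis_exists:
  assumes y: "y \<in> K" and nz: "D e f y \<noteq> 0"
  obtains u v where "u \<in> T y" "v \<in> T y" "det5 y u v e f \<noteq> 0"
proof -
  have y0: "y \<noteq> 0" using y by (simp add: in_K)
  let ?c = "conj_vec y"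
  \<comment> \<open>The conjugate of \<open>y\<close> is corrected by the differentials so as to
    kill \<open>e\<close> and \<open>f\<close>; as these vanish at \<open>y\<close>, its value there
    stays nonzero. The kernel of \<open>l\<close> in the tangent cone is then a complement of
    \<open>y\<close>, from which \<open>u\<close> and \<open>v\<close> are taken.\<close>
  define l where "l = D e f y *s ?c - (dot ?c e * B2 y f - dot ?c f * B2 y e) *s (Q1 *v y)
      - (dot ?c f * B1 y e - dot ?c e * B1 y f) *s (Q2 *v y)"
  have dB: "dot (Q1 *v y) w = B1 y w" "dot (Q2 *v y) w = B2 y w" for w
    by (simp_all add: bilin_dot[OF sym(1)] bilin_dot[OF sym(2)])
  have ly: "dot l y \<noteq> 0" using dot_conj_vec[OF y0] nz y by (simp add: l_def dB in_K)
  have le: "dot l e = 0" "dot l f = 0" by (simp_all add: l_def dB D_def algebra_simps)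
  obtain u where u: "u \<noteq> 0" "dot (Q1 *v y) u = 0" "dot (Q2 *v y) u = 0" "dot l u = 0"
    using null_vector[of "Q1 *v y" "Q2 *v y" l 0] by blast
  obtain v where v: "v \<noteq> 0" "dot (Q1 *v y) v = 0" "dot (Q2 *v y) v = 0" "dot l v = 0" "dot (conj_vec u) v = 0"
    using null_vector[of "Q1 *v y" "Q2 *v y" l "conj_vec u"] by blast
  have uT: "u \<in> T y" "v \<in> T y" using u v by (simp_all add: in_T dB)
  have "det5 y u v e f \<noteq> 0"
  proof
    assume "det5 y u v e f = 0"
    then obtain x1 x2 x3 x4 x5 where x: "x1 *s y + x2 *s u + x3 *s v + x4 *s e + x5 *s f = 0"
      and nx: "\<not> (x1 = 0 \<and> x2 = 0 \<and> x3 = 0 \<and> x4 = 0 \<and> x5 = 0)"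
      by (rule det5_eq_0_imp_dependent)
    have "dot l (x1 *s y + x2 *s u + x3 *s v + x4 *s e + x5 *s f) = 0" using x by simp
    then have x1: "x1 = 0" using u v ly le by simp
    have "B1 y (x1 *s y + x2 *s u + x3 *s v + x4 *s e + x5 *s f) = 0" "B2 y (x1 *s y + x2 *s u + x3 *s v + x4 *s e + x5 *s f) = 0"
      using x by simp_all
    then have b: "x4 * B1 y e + x5 * B1 y f = 0" "x4 * B2 y e + x5 * B2 y f = 0"
      using uT y by (simp_all add: in_T in_K)
    have x45: "x4 = 0" "x5 = 0" by (rule D_cramer[OF nz b])+
    then have "x2 *s u + x3 *s v = 0" using x x1 by simp
    then have "dot (conj_vec u) (x2 *s u + x3 *s v) = 0" by simp
    then have x2: "x2 = 0" using v dot_conj_vec[OF u(1)] by simp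
    then have "x3 *s v = 0" using x x1 x45 by simp
    then have "x3 = 0" using v(1) by simp
    with nx x1 x2 x45 show False by simp
  qed
  with uT show ?thesis using that by blast
qed

lemma tangent_spans:
  assumes y: "y \<in> K" and nz: "D e f y \<noteq> 0" and d: "det5 y u v e f \<noteq> 0" and uv: "u \<in> T y" "v \<in> T y" and w: "w \<in> T y"
  obtains x1 x2 x3 where "w = x1 *s y + x2 *s u + x3 *s v"
proof -
  obtain x1 x2 x3 x4 x5 where x: "w = x1 *s y + x2 *s u + x3 *s v + x4 *s e + x5 *s f"
    using det5_spans[OF d] .
  have b: "x4 * B1 y e + x5 * B1 y f = 0" "x4 * B2 y e + x5 * B2 y f = 0"
    using w uv y unfolding x by (simp_all add: in_T in_K)
  have "x4 = 0" "x5 = 0" by (rule D_cramer[OF nz b])+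
  then show ?thesis using that x by simp
qed

text \<open>No tangent plane lies in the surface, since the restriction of \<open>Q1\<close> would map it
  linearly into its two-dimensional annihilator.\<close>

lemma tangent_not_isotropic:
  assumes y: "y \<in> K" and nz: "D e f y \<noteq> 0" and d: "det5 y u v e f \<noteq> 0" and uv: "u \<in> T y" "v \<in> T y"
  shows "\<not> (B1 u u = 0 \<and> B2 u u = 0 \<and> B1 u v = 0 \<and> B2 u v = 0 \<and> B1 v v = 0 \<and> B2 v v = 0)"
proof
  assume iso: "B1 u u = 0 \<and> B2 u u = 0 \<and> B1 u v = 0 \<and> B2 u v = 0 \<and> B1 v v = 0 \<and> B2 v v = 0"
  \<comment> \<open>Three unknowns for two equations: a nonzero vector of the tangent cone that is
    orthogonal to \<open>e\<close> and \<open>f\<close> under \<open>B1\<close>, and by isotropy to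
    everything.\<close>
  obtain x1 x2 x3 where x: "x1 * B1 y e + x2 * B1 u e + x3 * B1 v e = 0" "x1 * B1 y f + x2 * B1 u f + x3 * B1 v f = 0"
    and nx: "\<not> (x1 = 0 \<and> x2 = 0 \<and> x3 = 0)"
    using two_equations_three_unknowns .
  define l where "l = x1 *s y + x2 *s u + x3 *s v"
  have "l \<noteq> 0"
  proof
    assume "l = 0"
    have "det5 l u v e f = x1 * det5 y u v e f" "det5 y l v e f = x2 * det5 y u v e f"
      "det5 y u l e f = x3 * det5 y u v e f"
      by (simp_all add: l_def det5_add det5_scale)
    then have "x1 * det5 y u v e f = 0" "x2 * det5 y u v e f = 0" "x3 * det5 y u v e f = 0"
      using \<open>l = 0\<close> by simp_all
    with nx d show False by simp
  qed
  moreover have "B1 l l = 0" "B2 l l = 0"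
    using iso y uv B_commute by (simp_all add: l_def in_K in_T)
  ultimately have "l \<in> K" by (simp add: in_K)
  moreover have "B1 l w = 0" for w
  proof -
    obtain y1 y2 y3 y4 y5 where w: "w = y1 *s y + y2 *s u + y3 *s v + y4 *s e + y5 *s f"
      using det5_spans[OF d] .
    have "B1 l y = 0" "B1 l u = 0" "B1 l v = 0"
      using iso y uv B_commute(1)[of u y] B_commute(1)[of v y] B_commute(1)[of v u] by (simp_all add: l_def in_K in_T)
    moreover have "B1 l e = 0" "B1 l f = 0" using x by (simp_all add: l_def)
    ultimately show ?thesis by (simp add: w)
  qed
  ultimately show False using smooth[of l 1 0] by simp
qed

text \<open>The vector \<open>u\<close> becomes the first fibre direction, where a form with nonzero
  value gives an invertible leading coefficient. If both basis vectors are zeros of both forms, the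
  mixed values cannot vanish as well, and u + v works.\<close>

lemma chart_vectors_exist:
  assumes y: "y \<in> K"
  obtains e f u v where "D e f y \<noteq> 0" "u \<in> T y" "v \<in> T y" "det5 y u v e f \<noteq> 0" "\<not> (B1 u u = 0 \<and> B2 u u = 0)"
proof -
  obtain e f where nz: "D e f y \<noteq> 0" using D_nonzero_exists[OF y] .
  obtain u v where uv: "u \<in> T y" "v \<in> T y" "det5 y u v e f \<noteq> 0" using tangent_basis_exists[OF y nz] .
  have d: "det5 y (u + v) v e f \<noteq> 0" "det5 y v u e f \<noteq> 0"
    using uv(3) det5_swap(1)[of y v u e f] by (simp_all add: det5_add)
  from tangent_not_isotropic[OF y nz uv(3,1,2)]
  consider "\<not> (B1 u u = 0 \<and> B2 u u = 0)" | "\<not> (B1 v v = 0 \<and> B2 v v = 0)"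
    | "B1 u u = 0" "B2 u u = 0" "B1 v v = 0" "B2 v v = 0" "\<not> (B1 u v = 0 \<and> B2 u v = 0)"
    by blast
  then show ?thesis
  proof cases
    case 1
    then show ?thesis using that[OF nz uv] by blast
  next
    case 2
    then show ?thesis using that[OF nz uv(2,1) d(2)] by blast
  next
    case 3
    then have "\<not> (B1 (u + v) (u + v) = 0 \<and> B2 (u + v) (u + v) = 0)"
      using B_commute[of v u] by simp
    then show ?thesis using that[OF nz T_add[OF uv(1,2)] uv(2) d(1)] by blast
  qed
qed

end

section \<open>Points off the lines are dense\<close>

lemma tendsto_if_dist_less_inverse:
  fixes x :: "nat \<Rightarrow> 'a::metric_space"
  assumes "\<And>n. dist (x n) a < 1 / real (Suc n)"
  shows "x \<longlonglongrightarrow> a"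
proof (rule metric_LIMSEQ_I)
  fix r :: real assume "r > 0"
  then obtain N where N: "1 / real (Suc N) < r" using nat_approx_posE by metis
  have "dist (x n) a < r" if "n \<ge> N" for n
  proof -
    have "1 / real (Suc n) \<le> 1 / real (Suc N)" using that by (simp add: frac_le)
    then show ?thesis using assms[of n] N by linarith
  qed
  then show "\<exists>N. \<forall>n\<ge>N. dist (x n) a < r" by blast
qed

lemma tendsto_bilin:
  assumes "(u \<longlongrightarrow> a) F" "(v \<longlongrightarrow> b) F"
  shows "((\<lambda>n. bilin Q (u n) (v n)) \<longlongrightarrow> bilin Q a b) F"
  unfolding bilin_def dot_def matrix_vector_mult_def
  by (simp, intro tendsto_sum tendsto_mult tendsto_const tendsto_vec_nth assms)

lemma tendsto_dot:
  assumes "(u \<longlongrightarrow> a) F" "(v \<longlongrightarrow> b) F"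
  shows "((\<lambda>n. dot (u n) (v n)) \<longlongrightarrow> dot a b) F"
  unfolding dot_def by (intro tendsto_sum tendsto_mult tendsto_vec_nth assms)

lemma tendsto_conj_vec: "(u \<longlongrightarrow> a) F \<Longrightarrow> ((\<lambda>n. conj_vec (u n)) \<longlongrightarrow> conj_vec a) F"
  unfolding conj_vec_def by (intro tendsto_vec_lambda tendsto_cnj tendsto_vec_nth)

lemma scaleR_eq_smult: "r *\<^sub>R u = complex_of_real r *s u" for u :: vec5
  by (simp add: vec_eq_iff) (simp add: scaleR_conv_of_real)

lemma bilin_minus [simp]: "bilin Q (- u) w = - bilin Q u w" "bilin Q w (- u) = - bilin Q w u"
  using bilin_diff[of Q 0 u w] bilin_diff(2)[of Q w 0 u] by simp_all

definition independent2 :: "vec5 \<Rightarrow> vec5 \<Rightarrow> bool" where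
  "independent2 y v \<longleftrightarrow> (\<forall>a b. a *s y + b *s v = 0 \<longrightarrow> a = 0 \<and> b = 0)"

lemma independent2_commute: "independent2 y v \<Longrightarrow> independent2 v y"
  unfolding independent2_def by (metis add.commute)

lemma independent2_separate:
  assumes "independent2 y v"
  obtains r where "dot r y = 0" "dot r v \<noteq> 0"
proof -
  have "y \<noteq> 0" using assms[unfolded independent2_def, rule_format, of 1 0] by auto
  then obtain i where i: "y $ i \<noteq> 0" by (auto simp: vec_eq_iff)
  have "\<exists>j. v $ j - y $ j * v $ i / y $ i \<noteq> 0"
  proof (rule ccontr)
    assume "\<not> ?thesis"
    then have "v $ j - y $ j * v $ i / y $ i = 0" for j by blast
    then have vj: "v $ j = y $ j * v $ i / y $ i" for j by (rule iffD2[OF eq_iff_diff_eq_0])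
    have "((- v $ i / y $ i) *s y + 1 *s v) $ j = 0" for j using vj[of j] by (simp add: mult.commute)
    then have "(- v $ i / y $ i) *s y + 1 *s v = 0" by (simp only: vec_eq_iff zero_index simp_thms)
    from assms[unfolded independent2_def, rule_format, OF this] show False by simp
  qed
  then obtain j where j: "v $ j - y $ j * v $ i / y $ i \<noteq> 0" by blast
  have ax: "dot (axis k 1) w = w $ k" for k w using dot_axis[of w k] by (simp add: dot_commute)
  show ?thesis
    using i j by (intro that[of "axis j 1 - (y $ j / y $ i) *s axis i 1"]) (simp_all add: ax)
qed

section \<open>First-order deformations of lines on the surface\<close>

context del_pezzo
begin

text \<open>The span of \<open>y\<close> and \<open>v\<close> lies in both quadrics; for independent
  vectors it is a line on the surface.\<close>

definition isotropic2 :: "vec5 \<Rightarrow> vec5 \<Rightarrow> bool" where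
  "isotropic2 y v \<longleftrightarrow> B1 y y = 0 \<and> B2 y y = 0 \<and> B1 y v = 0 \<and> B2 y v = 0 \<and> B1 v v = 0 \<and> B2 v v = 0"

lemma isotropic2_combo:
  assumes "isotropic2 y v"
  shows "B1 (a *s y + b *s v) (c *s y + d *s v) = 0" "B2 (a *s y + b *s v) (c *s y + d *s v) = 0"
  using assms B_commute[of v y] by (simp_all add: isotropic2_def)

lemma isotropic2_in_K:
  assumes "isotropic2 y v" "independent2 y v" "\<not> (a = 0 \<and> b = 0)"
  shows "a *s y + b *s v \<in> K"
  using isotropic2_combo[OF assms(1), of a b a b] assms(2,3) by (auto simp: in_K independent2_def)

text \<open>The four functionals vanish on the span of \<open>y\<close> and \<open>v\<close>, hence
  live on a quotient of dimension three and are dependent. The auxiliary row \<open>r\<close>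
  completes the determinant; evaluating the dependence at \<open>v\<close> removes it again.\<close>

lemma isotropic2_relation:
  assumes iso: "isotropic2 y v" and ind: "independent2 y v"
  obtains \<alpha> \<beta> \<gamma> \<delta> where "\<And>u. \<alpha> * B1 y u + \<beta> * B2 y u + \<gamma> * B1 v u + \<delta> * B2 v u = 0"
    "\<not> (\<alpha> = 0 \<and> \<beta> = 0 \<and> \<gamma> = 0 \<and> \<delta> = 0)"
proof -
  have dB: "dot (Q1 *v y) w = B1 y w" "dot (Q2 *v y) w = B2 y w" for y w
    by (simp_all add: bilin_dot[OF sym(1)] bilin_dot[OF sym(2)])
  obtain r where r: "dot r y = 0" "dot r v \<noteq> 0" using independent2_separate[OF ind] .
  have "y \<noteq> 0" using isotropic2_in_K[OF iso ind, of 1 0] by (simp add: in_K)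
  then have "det5 (Q1 *v y) (Q2 *v y) (Q1 *v v) (Q2 *v v) r = 0"
    unfolding det5_eq_0_iff_null_vector
    using iso r B_commute[of v y] by (intro exI[of _ y]) (simp add: dB isotropic2_def)
  then obtain x1 x2 x3 x4 x5 where x: "x1 *s (Q1 *v y) + x2 *s (Q2 *v y) + x3 *s (Q1 *v v) + x4 *s (Q2 *v v) + x5 *s r = 0"
    and nx: "\<not> (x1 = 0 \<and> x2 = 0 \<and> x3 = 0 \<and> x4 = 0 \<and> x5 = 0)"
    by (rule det5_eq_0_imp_dependent)
  have eq: "x1 * B1 y u + x2 * B2 y u + x3 * B1 v u + x4 * B2 v u + x5 * dot r u = 0" for u
    using arg_cong[OF x, of "\<lambda>w. dot w u"] by (simp add: dB)
  have "x5 = 0" using eq[of v] iso r by (simp add: isotropic2_def)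
  then show ?thesis using that[of x1 x2 x3 x4] eq nx by simp
qed

text \<open>Written with the basis of \<open>isotropic2_relation\<close>, three of the four functionals on the
  normal space are independent, so that their common kernel is the line.\<close>

lemma isotropic2_kernel:
  assumes iso: "isotropic2 y v" and ind: "independent2 y v" and rel: "\<And>u. B1 y u = B2 v u"
    and z: "B1 y z = 0" "B2 y z = 0" "B1 v z = 0"
  obtains a b where "z = a *s y + b *s v"
proof -
  have dB: "dot (Q1 *v y) w = B1 y w" "dot (Q2 *v y) w = B2 y w" for y w
    by (simp_all add: bilin_dot[OF sym(1)] bilin_dot[OF sym(2)])
  have iso': "B1 y y = 0" "B2 y y = 0" "B1 y v = 0" "B2 y v = 0" "B1 v v = 0" "B2 v v = 0" "B1 v y = 0" "B2 v y = 0"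
    using iso B_commute[of v y] by (auto simp: isotropic2_def)
  obtain r where r: "dot r y = 0" "dot r v \<noteq> 0" using independent2_separate[OF ind] .
  obtain s where s: "dot s v = 0" "dot s y \<noteq> 0" using independent2_separate[OF independent2_commute[OF ind]] .
  \<comment> \<open>A combination of \<open>y\<close>, \<open>v\<close>, \<open>z\<close> killed by
    \<open>r\<close> and \<open>s\<close>. If it is zero, \<open>z\<close> lies on the line; if not,
    it is a common null vector of the three functionals together with \<open>r\<close> and
    \<open>s\<close>, which are then dependent.\<close>
  obtain x1 x2 x3 where x: "x1 * dot r y + x2 * dot r v + x3 * dot r z = 0" "x1 * dot s y + x2 * dot s v + x3 * dot s z = 0"
    and nx: "\<not> (x1 = 0 \<and> x2 = 0 \<and> x3 = 0)"
    using two_equations_three_unknowns .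
  show ?thesis
  proof (cases "x1 *s y + x2 *s v + x3 *s z = 0")
    case True
    have "x3 \<noteq> 0" using True nx ind by (auto simp: independent2_def)
    have "z = (- x1 / x3) *s y + (- x2 / x3) *s v"
    proof -
      have "x1 * y $ i + x2 * v $ i + x3 * z $ i = 0" for i
        using arg_cong[OF True, of "\<lambda>w. w $ i"] by simp
      then have "x3 * z $ i = - (x1 * y $ i) - x2 * v $ i" for i
        by (metis (no_types) add_eq_0_iff diff_conv_add_uminus minus_add_distrib)
      then have "z $ i = (- (x1 * y $ i) - x2 * v $ i) / x3" for i
        using \<open>x3 \<noteq> 0\<close> by (metis nonzero_mult_div_cancel_left)
      then show ?thesis by (simp add: vec_eq_iff diff_divide_distrib)
    qed
    then show ?thesis using that by blast
  next
    case False
    then have "det5 (Q1 *v y) (Q2 *v y) (Q1 *v v) r s = 0"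
      unfolding det5_eq_0_iff_null_vector using x iso' z
      by (intro exI[of _ "x1 *s y + x2 *s v + x3 *s z"]) (simp add: dB)
    then obtain p q t x4 x5 where lin: "p *s (Q1 *v y) + q *s (Q2 *v y) + t *s (Q1 *v v) + x4 *s r + x5 *s s = 0"
      and npq: "\<not> (p = 0 \<and> q = 0 \<and> t = 0 \<and> x4 = 0 \<and> x5 = 0)"
      by (rule det5_eq_0_imp_dependent)
    have eq: "p * B1 y u + q * B2 y u + t * B1 v u + x4 * dot r u + x5 * dot s u = 0" for u
      using arg_cong[OF lin, of "\<lambda>w. dot w u"] by (simp add: dB)
    have "x4 = 0" "x5 = 0" using eq[of v] eq[of y] iso' r s by simp_all
    then have eq: "p * B1 y u + q * B2 y u + t * B1 v u = 0" for u using eq[of u] by simp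
    \<comment> \<open>The roots of X^2 - p X + q t. Splitting \<open>p\<close> into them, and using
      \<open>rel\<close> to trade \<open>B1 y\<close> for \<open>B2 v\<close>, turns the dependence
      into one whose coefficient matrix has determinant p1 p2 - q t = 0.\<close>
    define p1 where "p1 = (p + csqrt (p\<^sup>2 - 4 * (q * t))) / 2"
    define p2 where "p2 = (p - csqrt (p\<^sup>2 - 4 * (q * t))) / 2"
    have p12: "p1 + p2 = p" by (simp add: p1_def p2_def field_simps)
    have "(csqrt (p\<^sup>2 - 4 * (q * t)))\<^sup>2 = p\<^sup>2 - 4 * (q * t)" by simp
    then have pq: "p1 * p2 = q * t"
      by (simp add: p1_def p2_def field_simps power2_eq_square)
    text \<open>The relation is a tensor of rank one in (pencil) \<open>\<otimes>\<close> (line), after splitting \<open>p = p1 + p2\<close>.\<close>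
    have eq': "B1 (p1 *s y + t *s v) u + B2 (q *s y + p2 *s v) u = 0" for u
    proof -
      have "B1 (p1 *s y + t *s v) u + B2 (q *s y + p2 *s v) u = (p1 + p2) * B1 y u + q * B2 y u + t * B1 v u"
        by (simp add: rel[of u, symmetric] algebra_simps)
      then show ?thesis using eq[of u] p12 by simp
    qed
    show ?thesis
    proof (cases "p1 = 0 \<and> t = 0")
      case True
      then have "\<not> (q = 0 \<and> p2 = 0)" using npq p12 \<open>x4 = 0\<close> \<open>x5 = 0\<close> by auto
      then show ?thesis
        using smooth[OF isotropic2_in_K[OF iso ind, of q p2], of 0 1] eq' True by simp
    next
      case False
      obtain k where k: "q = k * p1" "p2 = k * t"
      proof (cases "p1 = 0")
        case True
        then show ?thesis using False pq by (intro that[of "p2 / t"]) auto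
      next
        case False
        then show ?thesis using pq by (intro that[of "q / p1"]) (auto simp: field_simps)
      qed
      have "q *s y + p2 *s v = k *s (p1 *s y + t *s v)" by (simp add: k vec_eq_iff algebra_simps)
      then have "1 * B1 (p1 *s y + t *s v) u + k * B2 (p1 *s y + t *s v) u = 0" for u
        using eq'[of u] by (simp only: bilin_scale mult_1)
      from smooth[OF isotropic2_in_K[OF iso ind False] this] show ?thesis by simp
    qed
  qed
qed

text \<open>The normal bundle of a line on the surface has degree \<open>-1\<close>, hence no sections.\<close>

lemma lines_rigid:
  assumes iso: "isotropic2 y v" and ind: "independent2 y v"
    and x: "B1 y x = 0" "B2 y x = 0" and w: "B1 v w = 0" "B2 v w = 0"
    and xw: "B1 y w + B1 v x = 0" "B2 y w + B2 v x = 0"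
  obtains a b c d where "x = a *s y + b *s v" "w = c *s y + d *s v"
proof -
  \<comment> \<open>The hypotheses on \<open>x\<close> and \<open>w\<close> linearise
    \<open>isotropic2\<close> at \<open>(y, v)\<close>: the pair is a first-order deformation of the
    line on the surface. It is to be shown that it moves the line only along itself.\<close>
  obtain \<alpha> \<beta> \<gamma> \<delta> where rel: "\<And>u. \<alpha> * B1 y u + \<beta> * B2 y u + \<gamma> * B1 v u + \<delta> * B2 v u = 0"
    and nz: "\<not> (\<alpha> = 0 \<and> \<beta> = 0 \<and> \<gamma> = 0 \<and> \<delta> = 0)"
    using isotropic2_relation[OF iso ind] by metis
  \<comment> \<open>A change of basis of the line that brings the dependence into the form B1 y' =
    B2 v'. The deformation is transformed alongside.\<close>
  define y' where "y' = \<alpha> *s y + \<gamma> *s v"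
  define v' where "v' = (- \<beta>) *s y + (- \<delta>) *s v"
  define x' where "x' = \<alpha> *s x + \<gamma> *s w"
  define w' where "w' = (- \<beta>) *s x + (- \<delta>) *s w"
  have rel': "B1 y' u = B2 v' u" for u
  proof -
    have "B1 y' u - B2 v' u = \<alpha> * B1 y u + \<beta> * B2 y u + \<gamma> * B1 v u + \<delta> * B2 v u"
      by (simp add: y'_def v'_def)
    then show ?thesis using rel[of u] by simp
  qed
  have \<alpha>\<gamma>: "\<not> (\<alpha> = 0 \<and> \<gamma> = 0)"
  proof
    assume 0: "\<alpha> = 0 \<and> \<gamma> = 0"
    then have "\<not> (- \<beta> = 0 \<and> - \<delta> = 0)" using nz by simp
    from smooth[OF isotropic2_in_K[OF iso ind this], of 0 1] rel' 0
    show False by (simp add: y'_def v'_def)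
  qed
  then have y'K: "y' \<in> K" unfolding y'_def by (rule isotropic2_in_K[OF iso ind])
  \<comment> \<open>If \<open>v'\<close> were a multiple of \<open>y'\<close>, the dependence would
    contradict smoothness at \<open>y'\<close>.\<close>
  have det: "\<alpha> * \<delta> - \<beta> * \<gamma> \<noteq> 0"
  proof
    assume det0: "\<alpha> * \<delta> - \<beta> * \<gamma> = 0"
    obtain k where k: "\<beta> = k * \<alpha>" "\<delta> = k * \<gamma>"
    proof (cases "\<alpha> = 0")
      case True
      then show ?thesis using \<alpha>\<gamma> det0 by (intro that[of "\<delta> / \<gamma>"]) auto
    next
      case False
      then show ?thesis using det0 by (intro that[of "\<beta> / \<alpha>"]) (auto simp: field_simps)
    qed
    have "v' = (- k) *s y'" by (simp add: v'_def y'_def k vec_eq_iff algebra_simps)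
    then have "1 * B1 y' u + k * B2 y' u = 0" for u using rel'[of u] by simp
    from smooth[OF y'K this] show False by simp
  qed
  have ind': "independent2 y' v'"
    unfolding independent2_def
  proof (intro allI impI)
    fix a b assume "a *s y' + b *s v' = 0"
    then have "(a * \<alpha> - b * \<beta>) *s y + (a * \<gamma> - b * \<delta>) *s v = 0"
      by (simp add: y'_def v'_def vec_eq_iff algebra_simps)
    from ind[unfolded independent2_def, rule_format, OF this]
    have 0: "a * \<alpha> - b * \<beta> = 0" "a * \<gamma> - b * \<delta> = 0" by blast+
    have "a * (\<alpha> * \<delta> - \<beta> * \<gamma>) = \<delta> * (a * \<alpha> - b * \<beta>) - \<beta> * (a * \<gamma> - b * \<delta>)"
      "b * (\<alpha> * \<delta> - \<beta> * \<gamma>) = \<gamma> * (a * \<alpha> - b * \<beta>) - \<alpha> * (a * \<gamma> - b * \<delta>)"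
      by (simp_all add: algebra_simps)
    then show "a = 0 \<and> b = 0" using det unfolding 0 by simp
  qed
  have iso': "isotropic2 y' v'"
    unfolding isotropic2_def y'_def v'_def by (simp only: isotropic2_combo[OF iso] simp_thms)
  have Bc: "B1 v x = - B1 y w" "B2 v x = - B2 y w" using xw by (simp_all add: add_eq_0_iff)
  have x1: "B1 y' x' = 0" "B2 y' x' = 0" and w1: "B1 v' w' = 0" "B2 v' w' = 0"
    and xw1: "B1 v' x' = - B1 y' w'" "B2 v' x' = - B2 y' w'"
    using x w Bc by (simp_all add: y'_def v'_def x'_def w'_def algebra_simps)
  \<comment> \<open>The mixed equation, the dependence and the equation for \<open>w'\<close> in
    turn: B1 v' x' = - B1 y' w' = - B2 v' w' = 0. The equations for \<open>w'\<close> below arise in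
    the same way.\<close>
  have "B1 v' x' = 0" using xw1 rel' w1 by simp
  then obtain a b where x': "x' = a *s y' + b *s v'"
    using isotropic2_kernel[OF iso' ind' rel' x1] by metis
  have "B2 y' w' = 0" using xw1 rel' x1 by (metis minus_equation_iff minus_zero)
  moreover have "B1 y' w' = 0" using rel' w1 by simp
  ultimately obtain c d where w': "w' = c *s y' + d *s v'"
    using isotropic2_kernel[OF iso' ind' rel' _ _ w1(1)] by metis
  let ?\<Delta> = "\<alpha> * \<delta> - \<beta> * \<gamma>"
  have "?\<Delta> *s x = \<delta> *s x' + \<gamma> *s w'" "?\<Delta> *s w = (- \<beta>) *s x' + (- \<alpha>) *s w'"
    by (simp_all add: x'_def w'_def vec_eq_iff algebra_simps)
  then have "x = (1 / ?\<Delta>) *s (\<delta> *s x' + \<gamma> *s w')" "w = (1 / ?\<Delta>) *s ((- \<beta>) *s x' + (- \<alpha>) *s w')"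
    using det by (metis divide_self_if mult.commute times_divide_eq_right mult.right_neutral vector_smult_assoc vector_smult_lid)+
  moreover have "\<exists>a b. (1 / ?\<Delta>) *s (p *s x' + q *s w') = a *s y + b *s v" for p q
  proof (intro exI)
    show "(1 / ?\<Delta>) *s (p *s x' + q *s w') =
      ((p * a + q * c) / ?\<Delta> * \<alpha> - (p * b + q * d) / ?\<Delta> * \<beta>) *s y + ((p * a + q * c) / ?\<Delta> * \<gamma> - (p * b + q * d) / ?\<Delta> * \<delta>) *s v"
      unfolding x' w' y'_def v'_def by (simp add: vec_eq_iff add_divide_distrib diff_divide_distrib algebra_simps)
  qed
  ultimately show ?thesis using that by metis
qed

text \<open>Otherwise the deviations of \<open>yn\<close> and \<open>vn\<close> from the span of
  \<open>y\<close> and \<open>v\<close> can be rescaled to joint length one. A limit of them is a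
  nonzero first-order deformation transverse to the line, which \<open>lines_rigid\<close>
  excludes.\<close>

lemma lines_isolated:
  assumes y: "yn \<longlonglongrightarrow> y" and v: "vn \<longlonglongrightarrow> v" and iso_n: "\<And>n. isotropic2 (yn n) (vn n)"
    and iso: "isotropic2 y v" and ind: "independent2 y v"
  shows "\<exists>n a b. yn n = a *s y + b *s v"
proof (rule ccontr)
  assume contra: "\<not> ?thesis"
  obtain r0 where r0: "dot r0 y = 0" "dot r0 v \<noteq> 0" using independent2_separate[OF ind] .
  obtain s0 where s0: "dot s0 v = 0" "dot s0 y \<noteq> 0" using independent2_separate[OF independent2_commute[OF ind]] .
  define r where "r = (1 / dot r0 v) *s r0"
  define s where "s = (1 / dot s0 y) *s s0"
  have rs: "dot r y = 0" "dot r v = 1" "dot s v = 0" "dot s y = 1" using r0 s0 by (simp_all add: r_def s_def)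
  \<comment> \<open>Projection onto the span of \<open>y\<close> and \<open>v\<close> along the
    common kernel of the dual functionals \<open>r\<close> and \<open>s\<close>.\<close>
  define L where "L = (\<lambda>x. dot s x *s y + dot r x *s v)"
  have Lyv: "L y = y" "L v = v" by (simp_all add: L_def rs)
  have rsL: "dot r (x - L x) = 0" "dot s (x - L x) = 0" for x by (simp_all add: L_def rs)
  define dn where "dn = (\<lambda>n. yn n - L (yn n))"
  define en where "en = (\<lambda>n. vn n - L (vn n))"
  have lim_L: "(\<lambda>n. L (xn n)) \<longlonglongrightarrow> L x" if "xn \<longlonglongrightarrow> x" for xn x
  proof -
    have "(\<lambda>n. \<chi> i. dot s (xn n) * y $ i + dot r (xn n) * v $ i) \<longlonglongrightarrow> (\<chi> i. dot s x * y $ i + dot r x * v $ i)"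
      by (intro tendsto_vec_lambda tendsto_add tendsto_mult tendsto_const tendsto_dot that)
    moreover have "(\<chi> i. dot s x * y $ i + dot r x * v $ i) = L x" for x by (simp add: L_def vec_eq_iff)
    ultimately show ?thesis by simp
  qed
  have lim: "(\<lambda>n. L (yn n)) \<longlonglongrightarrow> y" "(\<lambda>n. L (vn n)) \<longlonglongrightarrow> v" "dn \<longlonglongrightarrow> 0" "en \<longlonglongrightarrow> 0"
    using lim_L[OF y] lim_L[OF v] tendsto_diff[OF y lim_L[OF y]] tendsto_diff[OF v lim_L[OF v]]
    by (simp_all add: Lyv dn_def en_def)
  have dn0: "dn n \<noteq> 0" for n
  proof
    assume "dn n = 0"
    then have "yn n = dot s (yn n) *s y + dot r (yn n) *s v" by (simp add: dn_def L_def)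
    then show False using contra by blast
  qed
  \<comment> \<open>One joint norm for both deviations: the rescaled pairs lie on a compact sphere,
    so a subsequence has a nonzero limit, and the mixed equation of first order is rescaled by the
    same factor.\<close>
  define t where "t = (\<lambda>n. norm (dn n, en n))"
  have t0: "t n > 0" for n using dn0[of n] by (simp add: t_def zero_prod_def)
  define P where "P = (\<lambda>n. (1 / t n) *\<^sub>R (dn n, en n))"
  have "P n \<in> sphere 0 1" for n
  proof -
    have "norm (P n) = \<bar>1 / t n\<bar> * t n" unfolding P_def t_def by (rule norm_scaleR)
    then show ?thesis using t0[of n] by simp
  qed
  then obtain l \<rho> where l: "l \<in> sphere 0 1" "strict_mono (\<rho> :: nat \<Rightarrow> nat)" "(P \<circ> \<rho>) \<longlonglongrightarrow> l"
    using compact_sphere[of "0 :: vec5 \<times> vec5" 1] unfolding compact_def by metis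
  obtain x w where xw: "l = (x, w)" by fastforce
  define xn where "xn = (\<lambda>n. fst (P (\<rho> n)))"
  define wn where "wn = (\<lambda>n. snd (P (\<rho> n)))"
  have xnl: "xn \<longlonglongrightarrow> x" "wn \<longlonglongrightarrow> w"
    using tendsto_fst[OF l(3)] tendsto_snd[OF l(3)] by (simp_all add: xn_def wn_def xw o_def)
  have sub: "(\<lambda>n. L (yn (\<rho> n))) \<longlonglongrightarrow> y" "(\<lambda>n. L (vn (\<rho> n))) \<longlonglongrightarrow> v" "(\<lambda>n. dn (\<rho> n)) \<longlonglongrightarrow> 0" "(\<lambda>n. en (\<rho> n)) \<longlonglongrightarrow> 0"
    using LIMSEQ_subseq_LIMSEQ[OF lim(1) l(2)] LIMSEQ_subseq_LIMSEQ[OF lim(2) l(2)]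
      LIMSEQ_subseq_LIMSEQ[OF lim(3) l(2)] LIMSEQ_subseq_LIMSEQ[OF lim(4) l(2)] by (simp_all add: o_def)
  have xn_eq: "xn n = complex_of_real (1 / t (\<rho> n)) *s dn (\<rho> n)" "wn n = complex_of_real (1 / t (\<rho> n)) *s en (\<rho> n)" for n
    by (simp_all add: xn_def wn_def P_def scaleR_eq_smult del: of_real_divide)
  have isoL: "bilin Q (L a) (L b) = 0" if "Q = Q1 \<or> Q = Q2" for Q a b
    using that isotropic2_combo[OF iso] by (auto simp: L_def)
  have comm: "bilin Q a b = bilin Q b a" if "Q = Q1 \<or> Q = Q2" for Q a b
    using that B_commute by auto
  \<comment> \<open>Expansion of \<open>bilin Q a b\<close> around the projections; the term of
    order zero vanishes by \<open>isoL\<close>.\<close>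
  have Beq: "bilin Q (L a) (b - L b) + bilin Q (L b) (a - L a) + bilin Q (a - L a) (b - L b) = bilin Q a b"
    if "Q = Q1 \<or> Q = Q2" for Q a b
    using isoL[OF that, of a b] comm[OF that, of "L b" a] comm[OF that, of "L b" "L a"] by simp
  have limits: "bilin Q y x = 0" "bilin Q v w = 0" "bilin Q y w + bilin Q v x = 0" if Q: "Q = Q1 \<or> Q = Q2" for Q
  proof -
    have z: "bilin Q (yn n) (yn n) = 0" "bilin Q (vn n) (vn n) = 0" "bilin Q (yn n) (vn n) = 0" for n
      using iso_n[of n] Q by (auto simp: isotropic2_def)
    let ?c = "\<lambda>n. complex_of_real (1 / t (\<rho> n))"
    \<comment> \<open>Dividing the expansion once by \<open>t\<close> leaves a factor
      \<open>dn\<close> in the second-order term. It tends to zero, so the limit is the linearised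
      equation.\<close>
    have "2 * bilin Q (L (yn (\<rho> n))) (xn n) + bilin Q (dn (\<rho> n)) (xn n) = 0" for n
    proof -
      have "2 * bilin Q (L (yn (\<rho> n))) (xn n) + bilin Q (dn (\<rho> n)) (xn n) = ?c n *
        (bilin Q (L (yn (\<rho> n))) (dn (\<rho> n)) + bilin Q (L (yn (\<rho> n))) (dn (\<rho> n)) + bilin Q (dn (\<rho> n)) (dn (\<rho> n)))"
        by (simp only: xn_eq bilin_scale) (simp add: algebra_simps)
      then show ?thesis using Beq[OF Q, of "yn (\<rho> n)" "yn (\<rho> n)"] z by (simp add: dn_def)
    qed
    moreover have "(\<lambda>n. 2 * bilin Q (L (yn (\<rho> n))) (xn n) + bilin Q (dn (\<rho> n)) (xn n)) \<longlonglongrightarrow> 2 * bilin Q y x + bilin Q 0 x"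
      by (intro tendsto_add tendsto_mult tendsto_const tendsto_bilin sub xnl)
    ultimately have "2 * bilin Q y x + bilin Q 0 x = 0" by (simp add: LIMSEQ_const_iff)
    then show "bilin Q y x = 0" by simp
    have "2 * bilin Q (L (vn (\<rho> n))) (wn n) + bilin Q (en (\<rho> n)) (wn n) = 0" for n
    proof -
      have "2 * bilin Q (L (vn (\<rho> n))) (wn n) + bilin Q (en (\<rho> n)) (wn n) = ?c n *
        (bilin Q (L (vn (\<rho> n))) (en (\<rho> n)) + bilin Q (L (vn (\<rho> n))) (en (\<rho> n)) + bilin Q (en (\<rho> n)) (en (\<rho> n)))"
        by (simp only: xn_eq bilin_scale) (simp add: algebra_simps)
      then show ?thesis using Beq[OF Q, of "vn (\<rho> n)" "vn (\<rho> n)"] z by (simp add: en_def)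
    qed
    moreover have "(\<lambda>n. 2 * bilin Q (L (vn (\<rho> n))) (wn n) + bilin Q (en (\<rho> n)) (wn n)) \<longlonglongrightarrow> 2 * bilin Q v w + bilin Q 0 w"
      by (intro tendsto_add tendsto_mult tendsto_const tendsto_bilin sub xnl)
    ultimately have "2 * bilin Q v w + bilin Q 0 w = 0" by (simp add: LIMSEQ_const_iff)
    then show "bilin Q v w = 0" by simp
    have "bilin Q (L (yn (\<rho> n))) (wn n) + bilin Q (L (vn (\<rho> n))) (xn n) + bilin Q (dn (\<rho> n)) (wn n) = 0" for n
    proof -
      have "bilin Q (L (yn (\<rho> n))) (wn n) + bilin Q (L (vn (\<rho> n))) (xn n) + bilin Q (dn (\<rho> n)) (wn n) = ?c n *
        (bilin Q (L (yn (\<rho> n))) (en (\<rho> n)) + bilin Q (L (vn (\<rho> n))) (dn (\<rho> n)) + bilin Q (dn (\<rho> n)) (en (\<rho> n)))"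
        by (simp only: xn_eq bilin_scale) (simp add: algebra_simps)
      then show ?thesis using Beq[OF Q, of "yn (\<rho> n)" "vn (\<rho> n)"] z by (simp add: en_def dn_def)
    qed
    moreover have "(\<lambda>n. bilin Q (L (yn (\<rho> n))) (wn n) + bilin Q (L (vn (\<rho> n))) (xn n) + bilin Q (dn (\<rho> n)) (wn n))
        \<longlonglongrightarrow> bilin Q y w + bilin Q v x + bilin Q 0 w"
      by (intro tendsto_add tendsto_bilin sub xnl)
    ultimately have "bilin Q y w + bilin Q v x + bilin Q 0 w = 0" by (simp add: LIMSEQ_const_iff)
    then show "bilin Q y w + bilin Q v x = 0" by simp
  qed
  obtain a b c d where abcd: "x = a *s y + b *s v" "w = c *s y + d *s v"
    by (rule lines_rigid[OF iso ind, of x w]) (use limits in auto)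
  \<comment> \<open>The deviations lie in the kernel of \<open>r\<close> and \<open>s\<close>, and
    so do their limits; the only such vector in the span of \<open>y\<close> and \<open>v\<close> is
    zero.\<close>
  have "dot r (xn n) = 0" "dot s (xn n) = 0" "dot r (wn n) = 0" "dot s (wn n) = 0" for n
    by (simp_all only: xn_eq dn_def en_def dot_scale rsL mult_zero_right)
  then have "dot r x = 0" "dot s x = 0" "dot r w = 0" "dot s w = 0"
    using tendsto_dot[OF tendsto_const xnl(1), of r] tendsto_dot[OF tendsto_const xnl(1), of s]
      tendsto_dot[OF tendsto_const xnl(2), of r] tendsto_dot[OF tendsto_const xnl(2), of s]
    by (simp_all add: LIMSEQ_const_iff)
  then have "x = 0" "w = 0" unfolding abcd by (simp_all add: rs)
  then show False using l(1) by (simp add: xw)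
qed

text \<open>On the tangent cone modulo \<open>y\<close> the two forms have no common zero but 0; any
  other would span with \<open>y\<close> a line on the surface.\<close>

definition off_lines :: "vec5 \<Rightarrow> bool" where
  "off_lines y \<longleftrightarrow> (\<forall>v\<in>T y. B1 v v = 0 \<longrightarrow> B2 v v = 0 \<longrightarrow> (\<exists>c. v = c *s y))"

text \<open>The map from \<open>(t, a, b)\<close> to \<open>t\<close> and the two quadrics at the
  displaced point has an invertible derivative at 0, as \<open>D e f y\<close> is not zero, so its
  values fill a neighbourhood of the origin. A preimage of a small \<open>(t, 0, 0)\<close> with
  nonzero \<open>t\<close> is the desired point.\<close>

lemma curve_in_cone:
  assumes y: "y \<in> K" and u: "u \<in> T y" and nz: "D e f y \<noteq> 0" and \<epsilon>: "\<epsilon> > 0"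
  obtains t a b where "t \<noteq> 0" "y + t *s u + a *s e + b *s f \<in> K" "dist (y + t *s u + a *s e + b *s f) y < \<epsilon>"
proof -
  have y0: "y \<noteq> 0" using y by (simp add: in_K)
  define Y where "Y = (\<lambda>x :: complex \<times> complex \<times> complex. y + fst x *s u + fst (snd x) *s e + snd (snd x) *s f)"
  define q where "q = (\<lambda>Q (x :: complex \<times> complex \<times> complex). bilin Q u u * (fst x)\<^sup>2 + bilin Q e e * (fst (snd x))\<^sup>2 + bilin Q f f * (snd (snd x))\<^sup>2
      + 2 * bilin Q u e * (fst x * fst (snd x)) + 2 * bilin Q u f * (fst x * snd (snd x)) + 2 * bilin Q e f * (fst (snd x) * snd (snd x))
      + 2 * bilin Q y e * fst (snd x) + 2 * bilin Q y f * snd (snd x))"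
  have qY: "q Q1 x = B1 (Y x) (Y x)" "q Q2 x = B2 (Y x) (Y x)" for x
    using y u B_commute[of e u] B_commute[of f u] B_commute[of f e] B_commute[of u y] B_commute[of e y] B_commute[of f y]
    by (simp_all add: q_def Y_def in_K in_T algebra_simps power2_eq_square)
  define F where "F = (\<lambda>x. (fst x, q Q1 x, q Q2 x))"
  define q' where "q' = (\<lambda>Q (x :: complex \<times> complex \<times> complex). 2 * bilin Q y e * fst (snd x) + 2 * bilin Q y f * snd (snd x))"
  define F' where "F' = (\<lambda>x :: complex \<times> complex \<times> complex. (fst x, q' Q1 x, q' Q2 x))"
  \<comment> \<open>The right inverse of the derivative by Cramer's rule; the 2 comes from
    differentiating quadratic forms.\<close>
  define G' where "G' = (\<lambda>x :: complex \<times> complex \<times> complex.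
    (fst x, (B2 y f * fst (snd x) - B1 y f * snd (snd x)) / (2 * D e f y), (B1 y e * snd (snd x) - B2 y e * fst (snd x)) / (2 * D e f y)))"
  have q_der: "(q Q has_derivative q' Q) (at 0)" for Q
    unfolding q_def q'_def by (auto intro!: derivative_eq_intros simp: fun_eq_iff algebra_simps)
  have F_der: "(F has_derivative F') (at 0)"
    unfolding F_def F'_def by (intro has_derivative_Pair has_derivative_fst has_derivative_ident q_der)
  have F_cont: "continuous_on UNIV F"
    unfolding F_def q_def by (intro continuous_intros)
  have G'_bl: "bounded_linear G'"
    unfolding G'_def
    by (intro bounded_linear_Pair bounded_linear_fst bounded_linear_compose[OF bounded_linear_divide]
        bounded_linear_sub bounded_linear_const_mult bounded_linear_compose[OF bounded_linear_fst bounded_linear_snd]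
        bounded_linear_compose[OF bounded_linear_snd bounded_linear_snd])
  have FG: "F' \<circ> G' = id"
  proof
    fix x :: "complex \<times> complex \<times> complex"
    have "q' Q1 (G' x) = fst (snd x)" "q' Q2 (G' x) = snd (snd x)"
      using nz by (simp_all add: q'_def G'_def field_simps) (simp_all add: D_def algebra_simps)
    then show "(F' \<circ> G') x = id x" by (simp add: F'_def G'_def)
  qed
  have "Y = (\<lambda>x. \<chi> i. y $ i + fst x * u $ i + fst (snd x) * e $ i + snd (snd x) * f $ i)"
    by (simp add: Y_def fun_eq_iff vec_eq_iff)
  then have "continuous_on UNIV Y"
    by (simp only:) (intro continuous_on_vec_lambda continuous_intros)
  then have "isCont Y 0" using continuous_on_eq_continuous_at[OF open_UNIV, of Y] by blast
  \<comment> \<open>The bound \<open>norm y\<close> keeps the displaced point away from the origin,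
    as \<open>cone\<close> demands.\<close>
  then obtain d where d: "d > 0" "\<And>x. dist x 0 < d \<Longrightarrow> dist (Y x) (Y 0) < min \<epsilon> (norm y)"
    unfolding continuous_at_eps_delta using \<epsilon> y0 by (metis min_less_iff_conj zero_less_norm_iff)
  have Y0: "Y 0 = y" by (simp add: Y_def)
  have "F 0 \<in> interior (F ` ball 0 d)"
    by (rule sussmann_open_mapping[OF open_UNIV F_cont UNIV_I F_der G'_bl FG]) (use d(1) in auto)
  moreover have "F 0 = (0, 0, 0)" by (simp add: F_def q_def)
  ultimately obtain \<rho> where \<rho>: "\<rho> > 0" "ball (0, 0, 0) \<rho> \<subseteq> F ` ball 0 d"
    by (metis mem_interior)
  have "(complex_of_real (\<rho> / 2), 0, 0) \<in> ball (0, 0, 0) \<rho>"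
    using \<rho>(1) by (simp add: dist_Pair_Pair dist_norm norm_divide)
  then obtain x where x: "x \<in> ball 0 d" "F x = (complex_of_real (\<rho> / 2), 0, 0)" using \<rho>(2) by force
  have Yx: "dist (Y x) y < \<epsilon>" "dist (Y x) y < norm y" using d(2)[of x] x(1) by (auto simp: Y0 dist_commute)
  have "Y x \<noteq> 0" using Yx(2) by (auto simp: dist_norm)
  then have "Y x \<in> K" using x(2) qY by (simp add: in_K F_def)
  moreover have "fst x \<noteq> 0" using x(2) \<rho>(1) by (auto simp: F_def)
  ultimately show ?thesis using Yx(1) by (intro that[of "fst x" "fst (snd x)" "snd (snd x)"]) (simp_all add: Y_def)
qed

text \<open>Choose points \<open>yn\<close> of the cone tending to \<open>y\<close> in a tangent
  direction \<open>u\<close> on which one of the forms does not vanish. Were there lines through all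
  of them, a subsequence would converge to a line through \<open>y\<close>, and by
  \<open>lines_isolated\<close> some \<open>yn\<close> would lie on that limit. Then a nonzero
  multiple of \<open>u\<close> lies in its span, on which both forms vanish, against the choice of
  \<open>u\<close>.\<close>

lemma off_lines_dense:
  assumes y: "y \<in> K" and \<epsilon>: "\<epsilon> > 0"
  shows "\<exists>y'\<in>K. dist y' y < \<epsilon> \<and> off_lines y'"
proof (rule ccontr)
  assume contra: "\<not> ?thesis"
  obtain e f u v0 where nz: "D e f y \<noteq> 0" and u: "u \<in> T y" and Qu: "\<not> (B1 u u = 0 \<and> B2 u u = 0)"
    using chart_vectors_exist[OF y] by metis
  have "\<exists>t a b. t \<noteq> 0 \<and> y + t *s u + a *s e + b *s f \<in> K \<and> dist (y + t *s u + a *s e + b *s f) y < min \<epsilon> (1 / real (Suc n))" for n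
    using curve_in_cone[OF y u nz, of "min \<epsilon> (1 / real (Suc n))"] \<epsilon> by (metis min_less_iff_conj of_nat_0_less_iff zero_less_Suc zero_less_divide_1_iff)
  then obtain t a b where tab: "\<And>n. t n \<noteq> 0" "\<And>n. y + t n *s u + a n *s e + b n *s f \<in> K"
    "\<And>n. dist (y + t n *s u + a n *s e + b n *s f) y < min \<epsilon> (1 / real (Suc n))" by metis
  define yn where "yn = (\<lambda>n. y + t n *s u + a n *s e + b n *s f)"
  have ynK: "yn n \<in> K" and ynd: "dist (yn n) y < \<epsilon>" "dist (yn n) y < 1 / real (Suc n)" for n
    using tab(2)[of n] tab(3)[of n] by (auto simp: yn_def)
  have yn: "yn \<longlonglongrightarrow> y"
  by (rule tendsto_if_dist_less_inverse) (rule ynd(2))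
  have "\<exists>v. isotropic2 (yn n) v \<and> norm v = 1 \<and> dot (conj_vec (yn n)) v = 0" for n
  proof -
    have "\<not> off_lines (yn n)" using contra ynK ynd by blast
    then obtain v where v: "v \<in> T (yn n)" "B1 v v = 0" "B2 v v = 0" "\<And>c. v \<noteq> c *s yn n" by (auto simp: off_lines_def)
    have n0: "yn n \<noteq> 0" using ynK by (simp add: in_K)
    \<comment> \<open>Removing the component along \<open>yn\<close> in the Hermitian sense keeps
      the limit direction independent of \<open>y\<close>.\<close>
    define v1 where "v1 = v - (dot (conj_vec (yn n)) v / dot (conj_vec (yn n)) (yn n)) *s yn n"
    have "v1 \<noteq> 0" using v(4) by (simp add: v1_def)
    have iso1: "B1 v1 v1 = 0" "B2 v1 v1 = 0" "B1 (yn n) v1 = 0" "B2 (yn n) v1 = 0" "dot (conj_vec (yn n)) v1 = 0"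
      using v(1-3) ynK[of n] dot_conj_vec[OF n0] B_commute[of v "yn n"] by (simp_all add: v1_def in_K in_T)
    show ?thesis
      using iso1 \<open>v1 \<noteq> 0\<close> ynK[of n]
      by (intro exI[of _ "complex_of_real (1 / norm v1) *s v1"])
        (auto simp: isotropic2_def in_K scaleR_eq_smult[symmetric] simp del: of_real_divide, auto simp: scaleR_eq_smult)
  qed
  then obtain vn where vn: "\<And>n. isotropic2 (yn n) (vn n)" "\<And>n. norm (vn n) = 1" "\<And>n. dot (conj_vec (yn n)) (vn n) = 0" by metis
  have "vn n \<in> sphere 0 1" for n using vn(2) by simp
  then obtain v \<rho> where v: "v \<in> sphere 0 1" "strict_mono (\<rho> :: nat \<Rightarrow> nat)" "(vn \<circ> \<rho>) \<longlonglongrightarrow> v"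
    using compact_sphere[of "0 :: vec5" 1] unfolding compact_def by metis
  have yr: "(yn \<circ> \<rho>) \<longlonglongrightarrow> y" by (rule LIMSEQ_subseq_LIMSEQ[OF yn v(2)])
  have lim0: "l = 0" if "X \<longlonglongrightarrow> l" "\<And>n. X n = 0" for X and l :: complex
  proof -
    have "X = (\<lambda>n. 0)" by (rule ext) (rule that(2))
    then show ?thesis using that(1) by (simp add: LIMSEQ_const_iff)
  qed
  have "dot (conj_vec y) v = 0"
    by (rule lim0[OF tendsto_dot[OF tendsto_conj_vec[OF yr] v(3)]]) (simp add: vn)
  moreover have "v \<noteq> 0" using v(1) by auto
  ultimately have ind: "independent2 y v"
    unfolding independent2_def
  proof (intro allI impI)
    fix a b assume *: "dot (conj_vec y) v = 0" "v \<noteq> 0" "a *s y + b *s v = 0"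
    have "y \<noteq> 0" using y by (simp add: in_K)
    have "dot (conj_vec y) (a *s y + b *s v) = 0" using *(3) by simp
    then have "a = 0" using *(1) dot_conj_vec[OF \<open>y \<noteq> 0\<close>] by simp
    then show "a = 0 \<and> b = 0" using *(2,3) by simp
  qed
  have ison: "isotropic2 ((yn \<circ> \<rho>) n) ((vn \<circ> \<rho>) n)" for n using vn by simp
  have iso: "isotropic2 y v"
    unfolding isotropic2_def
    using lim0[OF tendsto_bilin[OF yr yr, of Q1]] lim0[OF tendsto_bilin[OF yr yr, of Q2]]
      lim0[OF tendsto_bilin[OF yr v(3), of Q1]] lim0[OF tendsto_bilin[OF yr v(3), of Q2]]
      lim0[OF tendsto_bilin[OF v(3) v(3), of Q1]] lim0[OF tendsto_bilin[OF v(3) v(3), of Q2]] ison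
    unfolding isotropic2_def by blast
  obtain n c d where "(yn \<circ> \<rho>) n = c *s y + d *s v" using lines_isolated[OF yr v(3) ison iso ind] by blast
  then have eq: "y + t (\<rho> n) *s u + a (\<rho> n) *s e + b (\<rho> n) *s f = c *s y + d *s v" by (simp add: yn_def)
  let ?t = "t (\<rho> n)" and ?a = "a (\<rho> n)" and ?b = "b (\<rho> n)"
  \<comment> \<open>The right-hand side of \<open>eq\<close> is tangent at \<open>y\<close>, so by
    Cramer's rule the parts along \<open>e\<close> and \<open>f\<close> vanish.\<close>
  have ab: "?a * B1 y e + ?b * B1 y f = 0" "?a * B2 y e + ?b * B2 y f = 0"
    using arg_cong[OF eq, of "B1 y"] arg_cong[OF eq, of "B2 y"] y u iso by (simp_all add: in_K in_T isotropic2_def)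
  have "?a = 0" "?b = 0" by (rule D_cramer[OF nz ab])+
  then have tu: "?t *s u = (c - 1) *s y + d *s v" using eq by (simp add: vec_eq_iff algebra_simps add_eq_0_iff)
  have "B1 (?t *s u) (?t *s u) = 0" "B2 (?t *s u) (?t *s u) = 0"
    unfolding tu by (rule isotropic2_combo[OF iso])+
  then show False using Qu tab(1) by simp
qed

end

section \<open>The cotangent bundle in charts\<close>

lemma vec5_axis_decompose:
  "u = u $ 1 *s axis 1 1 + u $ 2 *s axis 2 1 + u $ 3 *s axis 3 1 + u $ 4 *s axis 4 1 + u $ 5 *s axis 5 1" for u :: vec5
  by (simp add: vec_eq_iff forall_5 axis_def)

lemma tangent_vector_eqD:
  assumes "tangent_vector y u = tangent_vector y u'" "y \<noteq> 0"
  obtains d where "u' = u + d *s y"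
proof -
  have "(y, u') \<in> tangent_vector y u'"
    unfolding tangent_vector_def by (intro CollectI exI[of _ 1] exI[of _ 0]) simp
  then have "(y, u') \<in> tangent_vector y u" using assms(1) by simp
  then obtain c d where cd: "y = c *s y" "u' = c *s u + d *s y" by (auto simp: tangent_vector_def)
  obtain i where i: "y $ i \<noteq> 0" using assms(2) by (auto simp: vec_eq_iff)
  have "y $ i = c * y $ i" using arg_cong[OF cd(1), of "\<lambda>w. w $ i"] by simp
  then have "c = 1" using i by simp
  then show ?thesis using that[of d] cd(2) by simp
qed

lemma tangent_vector_scale:
  assumes "c \<noteq> 0" shows "tangent_vector (c *s y) u = tangent_vector y ((1 / c) *s u)"
proof (intro equalityI subsetI)
  fix t assume "t \<in> tangent_vector (c *s y) u"
  then obtain k d where "k \<noteq> 0" "t = (k *s (c *s y), k *s u + d *s (c *s y))" by (auto simp: tangent_vector_def)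
  then show "t \<in> tangent_vector y ((1 / c) *s u)"
    unfolding tangent_vector_def using assms
    by (intro CollectI exI[of _ "k * c"] exI[of _ "d * c"]) (simp add: vector_smult_assoc)
next
  fix t assume "t \<in> tangent_vector y ((1 / c) *s u)"
  then obtain k d where "k \<noteq> 0" "t = (k *s y, k *s ((1 / c) *s u) + d *s y)" by (auto simp: tangent_vector_def)
  then show "t \<in> tangent_vector (c *s y) u"
    unfolding tangent_vector_def using assms
    by (intro CollectI exI[of _ "k / c"] exI[of _ "d / c"]) (simp add: vector_smult_assoc)
qed

lemma span_singleton_vec: "vec.span {y} = range (\<lambda>k. k *s y)"
  by (rule vec.span_singleton)

lemma span_singleton_scale:
  assumes "c \<noteq> (0 :: complex)" shows "vec.span {c *s y} = vec.span {y}"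
  unfolding span_singleton_vec
proof (intro equalityI subsetI)
  fix t assume "t \<in> range (\<lambda>k. k *s (c *s y))"
  then obtain k where "t = (k * c) *s y" by (auto simp: vector_smult_assoc)
  then show "t \<in> range (\<lambda>k. k *s y)" by blast
next
  fix t assume "t \<in> range (\<lambda>k. k *s y)"
  then obtain k where "t = (k / c) *s (c *s y)" using assms by (auto simp: vector_smult_assoc)
  then show "t \<in> range (\<lambda>k. k *s (c *s y))" by blast
qed

context del_pezzo
begin

abbreviation "Pairs \<equiv> covector_pairs Q1 Q2"
abbreviation "\<pi> \<equiv> restrict_covector Q1 Q2"
abbreviation "E \<equiv> cotangent_points Q1 Q2"
abbreviation "\<Phi> \<equiv> Phi Q1 Q2"

lemma in_Pairs: "(y, \<eta>) \<in> Pairs \<longleftrightarrow> y \<in> K \<and> dot \<eta> y = 0"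
  by (simp add: covector_pairs_def)

lemma fst_\<pi>: "fst (\<pi> (y, \<eta>)) = vec.span {y}"
  by (simp add: restrict_covector_def)

lemma tangent_space_span:
  assumes "y \<in> K"
  shows "tangent_space Q1 Q2 (vec.span {y}) = tangent_vector y ` T y"
proof (intro equalityI subsetI)
  fix t assume "t \<in> tangent_space Q1 Q2 (vec.span {y})"
  then obtain y' u where t: "t = tangent_vector y' u" "y' \<in> vec.span {y}" "y' \<noteq> 0" "u \<in> T y'"
    by (auto simp: tangent_space_def)
  then obtain c where c: "y' = c *s y" "c \<noteq> 0" by (auto simp: span_singleton_vec)
  then have "t = tangent_vector y ((1 / c) *s u)" "(1 / c) *s u \<in> T y"
    using t T_scale T_smult by (auto simp: tangent_vector_scale)
  then show "t \<in> tangent_vector y ` T y" by blast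
next
  fix t assume "t \<in> tangent_vector y ` T y"
  moreover have "y \<in> vec.span {y}" by (simp add: vec.span_base)
  ultimately show "t \<in> tangent_space Q1 Q2 (vec.span {y})"
    using assms by (auto simp: tangent_space_def in_K)
qed

lemma \<pi>_eval:
  assumes "(y, \<eta>) \<in> Pairs" "u \<in> T y"
  shows "snd (\<pi> (y, \<eta>)) (tangent_vector y u) = dot \<eta> u"
proof -
  have y: "y \<in> K" "dot \<eta> y = 0" "y \<noteq> 0" using assms(1) by (auto simp: in_Pairs in_K)
  have "(THE z. \<exists>u'. tangent_vector y u = tangent_vector y u' \<and> z = dot \<eta> u') = dot \<eta> u"
  proof (rule the_equality)
    fix z assume "\<exists>u'. tangent_vector y u = tangent_vector y u' \<and> z = dot \<eta> u'"
    then obtain u' where "tangent_vector y u = tangent_vector y u'" "z = dot \<eta> u'" by blast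
    moreover from this(1) obtain d where "u' = u + d *s y" using tangent_vector_eqD y(3) by metis
    ultimately show "z = dot \<eta> u" using y by simp
  qed blast
  then show ?thesis using assms y by (simp add: restrict_covector_def tangent_space_span)
qed

lemma \<pi>_eval_scale:
  assumes "(y, \<eta>) \<in> Pairs" "u \<in> T y" "c \<noteq> 0"
  shows "snd (\<pi> (y, \<eta>)) (tangent_vector (c *s y) u) = dot \<eta> u / c"
  using \<pi>_eval[OF assms(1) T_smult[OF assms(2), of "1 / c"]] assms(3) by (simp add: tangent_vector_scale)

lemma cotangent_space_eqI:
  assumes y: "y \<in> K" and \<xi>: "\<xi> \<in> cotangent_space Q1 Q2 (vec.span {y})" "\<xi>' \<in> cotangent_space Q1 Q2 (vec.span {y})"
    and eq: "\<And>u. u \<in> T y \<Longrightarrow> \<xi> (tangent_vector y u) = \<xi>' (tangent_vector y u)"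
  shows "\<xi> = \<xi>'"
proof (rule extensionalityI)
  show "\<xi> \<in> extensional (tangent_space Q1 Q2 (vec.span {y}))" "\<xi>' \<in> extensional (tangent_space Q1 Q2 (vec.span {y}))"
    using \<xi> by (auto simp: cotangent_space_def)
  show "\<xi> t = \<xi>' t" if "t \<in> tangent_space Q1 Q2 (vec.span {y})" for t
    using that eq by (auto simp: tangent_space_span[OF y])
qed

lemma \<pi>_in_E: assumes "(y, \<eta>) \<in> Pairs" shows "\<pi> (y, \<eta>) \<in> E"
proof -
  have y: "y \<in> K" using assms by (simp add: in_Pairs)
  have "snd (\<pi> (y, \<eta>)) \<in> cotangent_space Q1 Q2 (vec.span {y})"
    unfolding cotangent_space_def
  proof (intro CollectI conjI ballI allI)
    show "snd (\<pi> (y, \<eta>)) \<in> extensional (tangent_space Q1 Q2 (vec.span {y}))"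
      by (simp add: restrict_covector_def)
    fix y' u v c d assume "y' \<in> vec.span {y} - {0}" and uv: "u \<in> T y'" "v \<in> T y'"
    then obtain k where k: "y' = k *s y" "k \<noteq> 0" by (auto simp: span_singleton_vec)
    have uv: "u \<in> T y" "v \<in> T y" using uv k T_scale by auto
    then have "c *s u + d *s v \<in> T y" by (intro T_add T_smult)
    then show "snd (\<pi> (y, \<eta>)) (tangent_vector y' (c *s u + d *s v)) =
        c * snd (\<pi> (y, \<eta>)) (tangent_vector y' u) + d * snd (\<pi> (y, \<eta>)) (tangent_vector y' v)"
      using \<pi>_eval_scale[OF assms _ k(2)] uv unfolding k(1) by (simp add: add_divide_distrib)
  qed
  moreover have "vec.span {y} \<in> surface Q1 Q2" using y by (auto simp: surface_def)
  ultimately show ?thesis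
    unfolding cotangent_points_def by (metis fst_\<pi> mem_Sigma_iff prod.collapse)
qed

lemma E_snd: "(l, \<xi>) \<in> E \<Longrightarrow> \<xi> \<in> cotangent_space Q1 Q2 l"
  by (auto simp: cotangent_points_def)

lemma \<pi>_snd_in: "(y, \<eta>) \<in> Pairs \<Longrightarrow> snd (\<pi> (y, \<eta>)) \<in> cotangent_space Q1 Q2 (vec.span {y})"
  using \<pi>_in_E E_snd by (metis fst_\<pi> prod.collapse)

lemma \<pi>_eqI:
  assumes "(y, \<eta>) \<in> Pairs" "(y, \<eta>') \<in> Pairs" "\<And>u. u \<in> T y \<Longrightarrow> dot \<eta> u = dot \<eta>' u"
  shows "\<pi> (y, \<eta>) = \<pi> (y, \<eta>')"
proof (rule prod_eqI)
  show "snd (\<pi> (y, \<eta>)) = snd (\<pi> (y, \<eta>'))"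
    by (rule cotangent_space_eqI[of y]) (use assms \<pi>_snd_in \<pi>_eval in \<open>auto simp: in_Pairs\<close>)
qed (simp add: fst_\<pi>)

lemma Pairs_scale: "(y, \<eta>) \<in> Pairs \<Longrightarrow> c \<noteq> 0 \<Longrightarrow> (c *s y, k *s \<eta>) \<in> Pairs"
  by (simp add: in_Pairs K_scale)

lemma \<pi>_scale:
  assumes "(y, \<eta>) \<in> Pairs" "c \<noteq> 0"
  shows "\<pi> (c *s y, (1 / c) *s \<eta>) = \<pi> (y, \<eta>)"
proof (rule prod_eqI)
  have P: "(c *s y, (1 / c) *s \<eta>) \<in> Pairs" using Pairs_scale[OF assms] by blast
  show "fst (\<pi> (c *s y, (1 / c) *s \<eta>)) = fst (\<pi> (y, \<eta>))"
    using assms(2) by (simp add: fst_\<pi> span_singleton_scale)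
  show "snd (\<pi> (c *s y, (1 / c) *s \<eta>)) = snd (\<pi> (y, \<eta>))"
  proof (rule cotangent_space_eqI[of "c *s y"])
    show "c *s y \<in> K" using P by (simp add: in_Pairs)
    show "snd (\<pi> (c *s y, (1 / c) *s \<eta>)) \<in> cotangent_space Q1 Q2 (vec.span {c *s y})" by (rule \<pi>_snd_in[OF P])
    show "snd (\<pi> (y, \<eta>)) \<in> cotangent_space Q1 Q2 (vec.span {c *s y})"
      using \<pi>_snd_in[OF assms(1)] assms(2) by (simp add: span_singleton_scale)
    show "snd (\<pi> (c *s y, (1 / c) *s \<eta>)) (tangent_vector (c *s y) u) = snd (\<pi> (y, \<eta>)) (tangent_vector (c *s y) u)"
      if "u \<in> T (c *s y)" for u
      using \<pi>_eval[OF P that] \<pi>_eval_scale[OF assms(1) _ assms(2), of u] that T_scale[OF assms(2)] by simp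
  qed
qed

lemma D_scale: "D e f (c *s y) = c\<^sup>2 * D e f y"
  by (simp add: D_def power2_eq_square algebra_simps)

lemma proj_scale: "proj e f (c *s y) u = c\<^sup>2 *s proj e f y u"
  by (simp add: proj_def D_scale vec_eq_iff power2_eq_square algebra_simps)

text \<open>By \<open>det5_tangent_pair\<close>, every pair with nonzero denominator computes the
  same value.\<close>

lemma residue_form_eq:
  assumes "y \<in> K" "v \<in> T y" "u \<in> T y" "D e f y \<noteq> 0"
  shows "residue_form Q1 Q2 y v u = det5 y v u e f / D e f y"
  unfolding residue_form_def rows5_def[symmetric] det5_def[symmetric]
proof (rule the_equality)
  show "\<forall>w1 w2. det5 y v u w1 w2 = det5 y v u e f / D e f y * (B1 y w1 * B2 y w2 - B1 y w2 * B2 y w1)"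
    using det5_tangent_pair[OF assms(1) K_in_T[OF assms(1)] assms(2,3), of _ _ e f] assms(4)
    by (simp add: field_simps D_def)
  show "z = det5 y v u e f / D e f y"
    if "\<forall>w1 w2. det5 y v u w1 w2 = z * (B1 y w1 * B2 y w2 - B1 y w2 * B2 y w1)" for z
    using that[rule_format, of e f] assms(4) by (simp add: D_def)
qed

text \<open>The description in \<open>Phi\<close> allows any vector \<open>y'\<close> =
  \<open>c y\<close> of the line. The powers of \<open>c\<close> from evaluating the covector and
  from the residue form agree, so \<open>v'\<close> and \<open>v\<close> have the same contraction.
  The form is nondegenerate modulo \<open>y\<close>, hence they differ by a multiple of
  \<open>y\<close>, which neither quadratic form notices on the tangent cone.\<close>

lemma Phi_\<pi>:
  assumes P: "(y, \<eta>) \<in> Pairs" and v: "v \<in> T y" and nz: "D e f y \<noteq> 0"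
    and \<eta>: "\<And>u. u \<in> T y \<Longrightarrow> dot \<eta> u = det5 y v u e f / D e f y"
  shows "\<Phi> (\<pi> (y, \<eta>)) = (quad Q1 v, quad Q2 v)"
proof -
  have y: "y \<in> K" using P by (simp add: in_Pairs)
  let ?l = "vec.span {y}" and ?\<xi> = "snd (\<pi> (y, \<eta>))"
  have "\<pi> (y, \<eta>) = (?l, ?\<xi>)" by (metis fst_\<pi> prod.collapse)
  then have "\<Phi> (\<pi> (y, \<eta>)) = \<Phi> (?l, ?\<xi>)" by (rule arg_cong)
  also have "\<dots> = (THE z. \<exists>y v. y \<in> ?l \<and> y \<noteq> 0 \<and> v \<in> T y \<and>
      (\<forall>u\<in>T y. ?\<xi> (tangent_vector y u) = residue_form Q1 Q2 y v u) \<and> z = (quad Q1 v, quad Q2 v))"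
    by (simp only: Phi_def prod.case)
  also have "\<dots> = (quad Q1 v, quad Q2 v)"
  proof (rule the_equality)
    have "y \<in> ?l" by (simp add: vec.span_base)
    then show "\<exists>y v'. y \<in> ?l \<and> y \<noteq> 0 \<and> v' \<in> T y \<and>
      (\<forall>u\<in>T y. ?\<xi> (tangent_vector y u) = residue_form Q1 Q2 y v' u) \<and> (quad Q1 v, quad Q2 v) = (quad Q1 v', quad Q2 v')"
      using y v \<pi>_eval[OF P] \<eta> residue_form_eq[OF y v _ nz]
      by (intro exI[of _ y] exI[of _ v]) (auto simp: in_K)
  next
    fix z assume "\<exists>y v. y \<in> ?l \<and> y \<noteq> 0 \<and> v \<in> T y \<and>
      (\<forall>u\<in>T y. ?\<xi> (tangent_vector y u) = residue_form Q1 Q2 y v u) \<and> z = (quad Q1 v, quad Q2 v)"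
    then obtain y' v' where y': "y' \<in> ?l" "y' \<noteq> 0" and v': "v' \<in> T y'"
      and res: "\<And>u. u \<in> T y' \<Longrightarrow> ?\<xi> (tangent_vector y' u) = residue_form Q1 Q2 y' v' u"
      and z: "z = (quad Q1 v', quad Q2 v')" by blast
    obtain c where c: "y' = c *s y" "c \<noteq> 0" using y' by (auto simp: span_singleton_vec)
    have T': "T y' = T y" using c T_scale by simp
    have y'K: "y' \<in> K" using c y K_scale by simp
    have nz': "D e f y' \<noteq> 0" using c nz by (simp add: D_scale)
    have 0: "det5 y (v' - v) u e f = 0" if u: "u \<in> T y" for u
    proof -
      have "dot \<eta> u / c = det5 y' v' u e f / D e f y'"
        using res[of u] residue_form_eq[OF y'K v' _ nz', of u] \<pi>_eval_scale[OF P u c(2)] u T' c(1) by simp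
      also have "\<dots> = det5 y v' u e f / D e f y / c"
        using c(2) by (simp add: c(1) det5_scale D_scale power2_eq_square)
      finally have "dot \<eta> u = det5 y v' u e f / D e f y" using c(2) nz by (simp add: field_simps)
      then show ?thesis using \<eta>[OF u] nz by (simp add: det5_minus)
    qed
    obtain a b where ab: "a \<in> T y" "b \<in> T y" "det5 y a b e f \<noteq> 0" using tangent_basis_exists[OF y nz] .
    have "v' - v \<in> T y" using v v' T' by (intro T_diff) auto
    then obtain x1 x2 x3 where x: "v' - v = x1 *s y + x2 *s a + x3 *s b"
      by (rule tangent_spans[OF y nz ab(3,1,2)])
    have "x2 = 0" using 0[OF ab(2)] ab(3) unfolding x by (simp add: det5_add det5_scale)
    moreover have "x3 = 0"
      using 0[OF ab(1)] ab(3) det5_swap(1)[of y b a e f] unfolding x by (simp add: det5_add det5_scale)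
    ultimately have "v' = v + x1 *s y" using x by (simp add: algebra_simps)
    then show "z = (quad Q1 v, quad Q2 v)"
      using v y B_commute[of v y] by (simp add: z in_T in_K)
  qed
  finally show ?thesis .
qed

text \<open>The contraction of the residue form with \<open>v\<close>, extended from the tangent
  cone to the whole space by the same determinant. The extension vanishes at \<open>y\<close>, so it
  is a covector of projective space.\<close>

definition eta :: "vec5 \<Rightarrow> vec5 \<Rightarrow> vec5 \<Rightarrow> vec5 \<Rightarrow> vec5" where
  "eta e f y v = (\<chi> i. det5 y v (axis i 1) e f / D e f y)"

lemma dot_eta: "dot (eta e f y v) u = det5 y v u e f / D e f y"
proof -
  have "det5 y v u e f = u $ 1 * det5 y v (axis 1 1) e f + u $ 2 * det5 y v (axis 2 1) e f +
      u $ 3 * det5 y v (axis 3 1) e f + u $ 4 * det5 y v (axis 4 1) e f + u $ 5 * det5 y v (axis 5 1) e f"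
    by (subst vec5_axis_decompose[of u]) (simp only: det5_add det5_scale)
  then show ?thesis by (simp add: dot_def eta_def sum_5 add_divide_distrib mult.commute)
qed

lemma eta_Pairs: "y \<in> K \<Longrightarrow> (y, eta e f y v) \<in> Pairs"
  by (simp add: in_Pairs dot_eta)

end

text \<open>Where \<open>D e f y\<close> and the determinant of \<open>y\<close>, \<open>u1\<close>,
  \<open>u2\<close>, \<open>e\<close>, \<open>f\<close> do not vanish, the projections of
  \<open>u1\<close> and \<open>u2\<close> complete \<open>y\<close> to a basis of the tangent cone.
  This set is \<open>V\<close>; the coordinate formulas have products of these two functions as
  denominators.\<close>

locale chart = del_pezzo +
  fixes e f u1 u2 :: vec5
begin

abbreviation "De \<equiv> D e f"
abbreviation "\<theta>1 y \<equiv> proj e f y u1"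
abbreviation "\<theta>2 y \<equiv> proj e f y u2"
abbreviation "\<delta> y \<equiv> det5 y u1 u2 e f"

definition V :: "vec5 set" where "V = {y \<in> K. De y \<noteq> 0 \<and> \<delta> y \<noteq> 0}"

lemma in_V: "y \<in> V \<longleftrightarrow> y \<in> K \<and> De y \<noteq> 0 \<and> \<delta> y \<noteq> 0"
  by (simp add: V_def)

lemma V_scale: "y \<in> V \<Longrightarrow> c \<noteq> 0 \<Longrightarrow> c *s y \<in> V"
  by (simp add: in_V K_scale D_scale det5_scale)

lemma det5_\<theta>: "det5 y (\<theta>1 y) (\<theta>2 y) e f = (De y)\<^sup>2 * \<delta> y"
  by (rule det5_proj)

text \<open>The values at \<theta>1 and \<theta>2 enter crosswise and with opposite signs, since the
  contraction is with an alternating form. The denominator is the value of that form at (\<theta>1,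
  \<theta>2), by \<open>det5_\<theta>\<close>.\<close>

lemma tangent_coordinates:
  assumes y: "y \<in> V" and g: "\<And>u v c d. u \<in> T y \<Longrightarrow> v \<in> T y \<Longrightarrow> g (c *s u + d *s v) = c * g u + d * g v"
    and gy: "g y = 0" and u: "u \<in> T y"
  defines "v \<equiv> (g (\<theta>2 y) / (De y * \<delta> y)) *s \<theta>1 y + (- g (\<theta>1 y) / (De y * \<delta> y)) *s \<theta>2 y"
  shows "g u = det5 y v u e f / De y"
proof -
  have y': "y \<in> K" "De y \<noteq> 0" "\<delta> y \<noteq> 0" using y by (auto simp: in_V)
  obtain x1 x2 x3 where x: "u = x1 *s y + x2 *s \<theta>1 y + x3 *s \<theta>2 y"
  proof -
    have "det5 y (\<theta>1 y) (\<theta>2 y) e f \<noteq> 0" using y' by (simp add: det5_\<theta>)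
    from tangent_spans[OF y'(1,2) this proj_in_T proj_in_T u] that show ?thesis by blast
  qed
  have "g u = g (1 *s (x1 *s y + x2 *s \<theta>1 y) + x3 *s \<theta>2 y)" by (simp add: x)
  also have "\<dots> = g (x1 *s y + x2 *s \<theta>1 y) + x3 * g (\<theta>2 y)"
    using K_in_T[OF y'(1)] by (subst g) (auto intro: T_add T_smult proj_in_T)
  also have "g (x1 *s y + x2 *s \<theta>1 y) = x2 * g (\<theta>1 y)"
    using g[OF K_in_T[OF y'(1)] proj_in_T[of e f y u1], of x1 x2] gy by simp
  finally have gu: "g u = x2 * g (\<theta>1 y) + x3 * g (\<theta>2 y)" .
  have sw: "det5 y (\<theta>2 y) (\<theta>1 y) e f = - ((De y)\<^sup>2 * \<delta> y)"
    using det5_swap(1)[of y "\<theta>2 y" "\<theta>1 y" e f] det5_\<theta> by simp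
  have "det5 y v u e f = g (\<theta>2 y) / (De y * \<delta> y) * x3 * ((De y)\<^sup>2 * \<delta> y) + (- g (\<theta>1 y) / (De y * \<delta> y)) * x2 * (- ((De y)\<^sup>2 * \<delta> y))"
    unfolding v_def x by (simp only: det5_add det5_scale det5_same det5_\<theta> sw) (simp add: algebra_simps)
  also have "\<dots> = De y * (x2 * g (\<theta>1 y) + x3 * g (\<theta>2 y))"
    using y' by (simp add: field_simps power2_eq_square)
  finally show ?thesis using gu y' by simp
qed

lemma \<pi>_surj_V:
  assumes p: "(l, \<xi>) \<in> E" and l: "l = vec.span {y}" and y: "y \<in> V"
  shows "\<exists>\<eta>. (y, \<eta>) \<in> Pairs \<and> \<pi> (y, \<eta>) = (l, \<xi>)"
proof -
  have yK: "y \<in> K" "y \<noteq> 0" using y by (auto simp: in_V in_K)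
  have \<xi>: "\<xi> \<in> cotangent_space Q1 Q2 (vec.span {y})" using E_snd[OF p] l by simp
  have yl: "y \<in> vec.span {y} - {0}" using yK by (simp add: vec.span_base)
  define g where "g = (\<lambda>u. \<xi> (tangent_vector y u))"
  have g: "g (c *s u + d *s v) = c * g u + d * g v" if "u \<in> T y" "v \<in> T y" for u v c d
    using \<xi> yl that unfolding cotangent_space_def g_def by blast
  \<comment> \<open>The covector is a function of classes; that it kills \<open>y\<close> comes from
    \<open>y\<close> and 0 having the same class.\<close>
  have "tangent_vector y y = tangent_vector y 0"
  proof (intro equalityI subsetI)
    fix t assume "t \<in> tangent_vector y y"
    then obtain c d where "c \<noteq> 0" "t = (c *s y, c *s y + d *s y)" by (auto simp: tangent_vector_def)
    then show "t \<in> tangent_vector y 0" unfolding tangent_vector_def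
      by (intro CollectI exI[of _ c] exI[of _ "c + d"]) (simp add: vec_eq_iff algebra_simps)
  next
    fix t assume "t \<in> tangent_vector y 0"
    then obtain c d where "c \<noteq> 0" "t = (c *s y, c *s 0 + d *s y)" by (auto simp: tangent_vector_def)
    then show "t \<in> tangent_vector y y" unfolding tangent_vector_def
      by (intro CollectI exI[of _ c] exI[of _ "d - c"]) (simp add: vec_eq_iff algebra_simps)
  qed
  then have "g y = g 0" by (simp add: g_def)
  also have "g 0 = 0" using g[of 0 0 0 0] by (simp add: in_T)
  finally have gy: "g y = 0" .
  define v where "v = (g (\<theta>2 y) / (De y * \<delta> y)) *s \<theta>1 y + (- g (\<theta>1 y) / (De y * \<delta> y)) *s \<theta>2 y"
  have P: "(y, eta e f y v) \<in> Pairs" by (rule eta_Pairs[OF yK(1)])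
  have "snd (\<pi> (y, eta e f y v)) = \<xi>"
  proof (rule cotangent_space_eqI[OF yK(1) \<pi>_snd_in[OF P] \<xi>])
    fix u assume u: "u \<in> T y"
    show "snd (\<pi> (y, eta e f y v)) (tangent_vector y u) = \<xi> (tangent_vector y u)"
      using \<pi>_eval[OF P u] tangent_coordinates[OF y g gy u] by (simp add: dot_eta v_def g_def)
  qed
  then have "\<pi> (y, eta e f y v) = (l, \<xi>)" using l by (metis fst_\<pi> prod.collapse)
  with P show ?thesis by blast
qed

lemma dot_coordinates:
  assumes "(y, \<eta>) \<in> Pairs" "y \<in> V" "u \<in> T y"
  shows "dot \<eta> u = det5 y ((dot \<eta> (\<theta>2 y) / (De y * \<delta> y)) *s \<theta>1 y + (- dot \<eta> (\<theta>1 y) / (De y * \<delta> y)) *s \<theta>2 y) u e f / De y"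
  using assms by (intro tangent_coordinates) (auto simp: in_Pairs)

lemma \<Phi>_\<pi>_V:
  assumes "(y, \<eta>) \<in> Pairs" "y \<in> V"
  defines "v \<equiv> (dot \<eta> (\<theta>2 y) / (De y * \<delta> y)) *s \<theta>1 y + (- dot \<eta> (\<theta>1 y) / (De y * \<delta> y)) *s \<theta>2 y"
  shows "\<Phi> (\<pi> (y, \<eta>)) = (quad Q1 v, quad Q2 v)"
proof (rule Phi_\<pi>[OF assms(1)])
  show "v \<in> T y" unfolding v_def by (intro T_add T_smult proj_in_T)
  show "De y \<noteq> 0" using assms(2) by (simp add: in_V)
  show "dot \<eta> u = det5 y v u e f / De y" if "u \<in> T y" for u
    unfolding v_def by (rule dot_coordinates[OF assms(1,2) that])
qed

text \<open>The coordinates \<open>(y, q1, q2)\<close> stand for the covector that corresponds to the tangent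
  vector \<open>q1 \<theta>1 + q2 \<theta>2\<close> at \<open>y\<close>.\<close>

definition vec_of :: "vec5 \<times> complex \<times> complex \<Rightarrow> vec5" where
  "vec_of z = fst (snd z) *s \<theta>1 (fst z) + snd (snd z) *s \<theta>2 (fst z)"

definition \<beta> :: "vec5 \<times> complex \<times> complex \<Rightarrow> vec5 \<times> vec5" where
  "\<beta> z = (fst z, eta e f (fst z) (vec_of z))"

definition \<Phi>' :: "vec5 \<times> complex \<times> complex \<Rightarrow> complex \<times> complex" where
  "\<Phi>' z = (quad Q1 (vec_of z), quad Q2 (vec_of z))"

text \<open>The function \<delta> is linear in \<open>y\<close>, so \<delta> y = 1 picks one vector
  on each line of the chart. The other two entries are the coefficients of
  \<open>tangent_coordinates\<close> for \<delta> = 1.\<close>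

definition coords :: "vec5 set \<times> covector \<Rightarrow> vec5 \<times> complex \<times> complex" where
  "coords = (\<lambda>(l, \<xi>). let y = (THE y. y \<in> l \<and> \<delta> y = 1) in
     (y, \<xi> (tangent_vector y (\<theta>2 y)) / De y, - \<xi> (tangent_vector y (\<theta>1 y)) / De y))"

lemma \<beta>_Pairs: "fst z \<in> K \<Longrightarrow> \<beta> z \<in> Pairs"
  by (simp add: \<beta>_def eta_Pairs)

lemma vec_of_in_T: "vec_of z \<in> T (fst z)"
  unfolding vec_of_def by (intro T_add T_smult proj_in_T)

lemma \<Phi>_\<pi>_\<beta>: "fst z \<in> V \<Longrightarrow> \<Phi> (\<pi> (\<beta> z)) = \<Phi>' z"
  unfolding \<beta>_def \<Phi>'_def
  by (rule Phi_\<pi>[OF eta_Pairs vec_of_in_T, of z e f]) (auto simp: in_V dot_eta)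

text \<open>Dividing \<open>y\<close> by \<delta> y rescales the projections and \<open>De\<close>
  by the same factor, and evaluation of the covector gains \<delta> y. This is the one factor that
  remains.\<close>

lemma coords_\<pi>:
  assumes P: "(y, \<eta>) \<in> Pairs" and y: "y \<in> V"
  shows "coords (\<pi> (y, \<eta>)) = ((1 / \<delta> y) *s y, \<delta> y * dot \<eta> (\<theta>2 y) / De y, - (\<delta> y * dot \<eta> (\<theta>1 y)) / De y)"
proof -
  let ?y = "(1 / \<delta> y) *s y" and ?\<xi> = "snd (\<pi> (y, \<eta>))"
  have nz: "\<delta> y \<noteq> 0" "De y \<noteq> 0" using y by (auto simp: in_V)
  have eq: "\<pi> (y, \<eta>) = (vec.span {y}, ?\<xi>)" by (metis fst_\<pi> prod.collapse)
  have "(THE y'. y' \<in> vec.span {y} \<and> \<delta> y' = 1) = ?y"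
  proof (rule the_equality)
    show "?y \<in> vec.span {y} \<and> \<delta> ?y = 1" using nz by (auto simp: span_singleton_vec det5_scale)
    show "y' = ?y" if y': "y' \<in> vec.span {y} \<and> \<delta> y' = 1" for y'
    proof -
      obtain k where k: "y' = k *s y" using y' by (auto simp: span_singleton_vec)
      then have "k = 1 / \<delta> y" using y' nz by (simp add: det5_scale field_simps)
      with k show ?thesis by simp
    qed
  qed
  moreover have "coords (\<pi> (y, \<eta>)) = coords (vec.span {y}, ?\<xi>)" by (rule arg_cong[OF eq])
  ultimately have "coords (\<pi> (y, \<eta>)) = (?y, ?\<xi> (tangent_vector ?y (\<theta>2 ?y)) / De ?y, - ?\<xi> (tangent_vector ?y (\<theta>1 ?y)) / De ?y)"
    by (simp only: coords_def prod.case Let_def)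
  moreover have "?\<xi> (tangent_vector ?y (proj e f ?y u)) / De ?y = \<delta> y * dot \<eta> (proj e f y u) / De y" for u
  proof -
    have "proj e f ?y u \<in> T y" using proj_in_T T_scale[of "1 / \<delta> y" y] nz by (metis divide_eq_0_iff one_neq_zero)
    then have "?\<xi> (tangent_vector ?y (proj e f ?y u)) = dot \<eta> (proj e f ?y u) / (1 / \<delta> y)"
      using nz by (intro \<pi>_eval_scale[OF P]) auto
    then show ?thesis using nz by (simp add: proj_scale D_scale field_simps)
  qed
  ultimately show ?thesis by simp
qed

lemma fst_coords_\<pi>: "(y, \<eta>) \<in> Pairs \<Longrightarrow> y \<in> V \<Longrightarrow> fst (coords (\<pi> (y, \<eta>))) \<in> V"
  using V_scale[of y "1 / \<delta> y"] by (simp add: coords_\<pi>) (simp add: in_V)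

text \<open>The pair is rescaled to \<delta> y = 1, which \<open>\<pi>\<close> does not see. There
  \<open>dot_coordinates\<close> says that \<beta> returns a covector with the same values on the
  tangent cone.\<close>

lemma \<pi>_\<beta>_coords_\<pi>:
  assumes P: "(y, \<eta>) \<in> Pairs" and y: "y \<in> V"
  shows "\<pi> (\<beta> (coords (\<pi> (y, \<eta>)))) = \<pi> (y, \<eta>)"
proof -
  have nz: "\<delta> y \<noteq> 0" "De y \<noteq> 0" using y by (auto simp: in_V)
  let ?y = "(1 / \<delta> y) *s y" and ?\<eta> = "\<delta> y *s \<eta>"
  have P': "(?y, ?\<eta>) \<in> Pairs" using Pairs_scale[OF P, of "1 / \<delta> y" "\<delta> y"] nz by simp
  have y': "?y \<in> V" using V_scale[OF y, of "1 / \<delta> y"] nz by simp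
  have \<delta>': "\<delta> ?y = 1" using nz by (simp add: det5_scale)
  have q: "coords (\<pi> (y, \<eta>)) = (?y, dot ?\<eta> (\<theta>2 ?y) / (De ?y * \<delta> ?y), - dot ?\<eta> (\<theta>1 ?y) / (De ?y * \<delta> ?y))"
    using nz by (simp add: coords_\<pi>[OF P y] \<delta>' proj_scale D_scale)
  have "\<pi> (?y, eta e f ?y (vec_of (coords (\<pi> (y, \<eta>))))) = \<pi> (?y, ?\<eta>)"
  proof (rule \<pi>_eqI[OF eta_Pairs P'])
    show "?y \<in> K" using y' by (simp add: in_V)
    show "dot (eta e f ?y (vec_of (coords (\<pi> (y, \<eta>))))) u = dot ?\<eta> u" if "u \<in> T ?y" for u
      unfolding dot_eta dot_coordinates[OF P' y' that] q vec_of_def by simp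
  qed
  moreover have "\<pi> (?y, ?\<eta>) = \<pi> (y, \<eta>)" using \<pi>_scale[OF P, of "1 / \<delta> y"] nz by simp
  ultimately show ?thesis by (simp add: \<beta>_def q)
qed

end

section \<open>Polynomial functions\<close>

lemmas polynomial_const = polynomial_in.intros(1)
lemmas polynomial_gen = polynomial_in.intros(2)
lemmas polynomial_add = polynomial_in.intros(3)
lemmas polynomial_mult = polynomial_in.intros(4)

lemma polynomial_minus: "polynomial_in C f \<Longrightarrow> polynomial_in C (\<lambda>z. - f z)"
  using polynomial_mult[OF polynomial_const[of C "-1"], of f] by simp

lemma polynomial_diff: "polynomial_in C f \<Longrightarrow> polynomial_in C g \<Longrightarrow> polynomial_in C (\<lambda>z. f z - g z)"
  using polynomial_add[OF _ polynomial_minus, of C f g] by simp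

lemma polynomial_power: "polynomial_in C f \<Longrightarrow> polynomial_in C (\<lambda>z. f z ^ n)"
proof (induction n)
  case 0
  show ?case using polynomial_const[of C 1] by simp
next
  case (Suc n)
  then show ?case using polynomial_mult[of C f "\<lambda>z. f z ^ n"] by simp
qed

lemma polynomial_sum: "(\<And>i. i \<in> I \<Longrightarrow> polynomial_in C (f i)) \<Longrightarrow> polynomial_in C (\<lambda>z. \<Sum>i\<in>I. f i z)"
proof (induction I rule: infinite_finite_induct)
  case (insert i I)
  then show ?case using polynomial_add[of C "f i" "\<lambda>z. \<Sum>i\<in>I. f i z"] by simp
qed (use polynomial_const[of C 0] in simp_all)

lemma polynomial_prod: "(\<And>i. i \<in> I \<Longrightarrow> polynomial_in C (f i)) \<Longrightarrow> polynomial_in C (\<lambda>z. \<Prod>i\<in>I. f i z)"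
proof (induction I rule: infinite_finite_induct)
  case (insert i I)
  then show ?case using polynomial_mult[of C "f i" "\<lambda>z. \<Prod>i\<in>I. f i z"] by simp
qed (use polynomial_const[of C 1] in simp_all)

lemma polynomial_mono: "polynomial_in C f \<Longrightarrow> C \<subseteq> C' \<Longrightarrow> polynomial_in C' f"
  by (induction rule: polynomial_in.induct) (auto intro: polynomial_in.intros)

lemmas polynomial_intros = polynomial_const polynomial_add polynomial_mult polynomial_diff polynomial_minus polynomial_power

definition polyvec :: "('p \<Rightarrow> complex) set \<Rightarrow> ('p \<Rightarrow> vec5) \<Rightarrow> bool" where
  "polyvec C Y \<longleftrightarrow> (\<forall>i. polynomial_in C (\<lambda>z. Y z $ i))"

lemma polyvec_const: "polyvec C (\<lambda>z. c)"
  by (simp add: polyvec_def polynomial_const)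

lemma polyvec_add: "polyvec C Y \<Longrightarrow> polyvec C Y' \<Longrightarrow> polyvec C (\<lambda>z. Y z + Y' z)"
  by (simp add: polyvec_def polynomial_add)

lemma polyvec_diff: "polyvec C Y \<Longrightarrow> polyvec C Y' \<Longrightarrow> polyvec C (\<lambda>z. Y z - Y' z)"
  by (simp add: polyvec_def polynomial_diff)

lemma polyvec_smult: "polynomial_in C c \<Longrightarrow> polyvec C Y \<Longrightarrow> polyvec C (\<lambda>z. c z *s Y z)"
  by (simp add: polyvec_def polynomial_mult)

lemma polynomial_dot: "polyvec C Y \<Longrightarrow> polyvec C Y' \<Longrightarrow> polynomial_in C (\<lambda>z. dot (Y z) (Y' z))"
  unfolding dot_def polyvec_def by (intro polynomial_sum polynomial_mult) auto

lemma polyvec_matrix: "polyvec C Y \<Longrightarrow> polyvec C (\<lambda>z. Q *v Y z)"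
  unfolding polyvec_def matrix_vector_mult_def by (auto intro!: polynomial_sum polynomial_mult polynomial_const)

lemma polynomial_bilin: "polyvec C Y \<Longrightarrow> polyvec C Y' \<Longrightarrow> polynomial_in C (\<lambda>z. bilin Q (Y z) (Y' z))"
  unfolding bilin_def by (intro polynomial_dot polyvec_matrix)

lemma polynomial_det5:
  assumes "polyvec C a" "polyvec C b" "polyvec C c" "polyvec C d" "polyvec C e"
  shows "polynomial_in C (\<lambda>z. det5 (a z) (b z) (c z) (d z) (e z))"
proof -
  have "polynomial_in C (\<lambda>z. rows5 (a z) (b z) (c z) (d z) (e z) $ i $ j)" for i j
    using exhaust_5[of i] assms by (auto simp: polyvec_def)
  then show ?thesis
    unfolding det5_def det_def by (intro polynomial_sum polynomial_mult polynomial_prod polynomial_const)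
qed

lemma (in del_pezzo) polynomial_D:
  "polyvec C Y \<Longrightarrow> polynomial_in C (\<lambda>z. D e f (Y z))"
  unfolding D_def by (intro polynomial_diff polynomial_mult polynomial_bilin polyvec_const)

lemma (in del_pezzo) polyvec_proj:
  "polyvec C Y \<Longrightarrow> polyvec C (\<lambda>z. proj e f (Y z) u)"
  unfolding proj_def
  by (intro polyvec_diff polyvec_smult polynomial_D polynomial_diff polynomial_mult polynomial_bilin polyvec_const)

lemma polynomial_continuous:
  fixes f :: "'p::topological_space \<Rightarrow> complex"
  assumes "polynomial_in C f" "\<And>c. c \<in> C \<Longrightarrow> continuous_on UNIV c"
  shows "continuous_on UNIV f"
  using assms(1) by induction (auto intro: continuous_intros assms(2))

lemma polynomial_on_path:
  assumes "polynomial_in C f" "\<And>c. c \<in> C \<Longrightarrow> \<exists>p. \<forall>x. c (l x) = poly p x"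
  shows "\<exists>p. \<forall>x. f (l x) = poly p x"
  using assms(1)
proof induction
  case (1 c)
  show ?case by (intro exI[of _ "[:c:]"]) simp
next
  case (2 f)
  then show ?case by (rule assms(2))
next
  case (3 f g)
  then obtain p q where "\<forall>x. f (l x) = poly p x" "\<forall>x. g (l x) = poly q x" by blast
  then show ?case by (intro exI[of _ "p + q"]) simp
next
  case (4 f g)
  then obtain p q where "\<forall>x. f (l x) = poly p x" "\<forall>x. g (l x) = poly q x" by blast
  then show ?case by (intro exI[of _ "p * q"]) simp
qed

lemma quadratic_root:
  fixes a b c :: complex assumes "a \<noteq> 0"
  shows "\<exists>r s. \<forall>x. a * x\<^sup>2 + b * x + c = a * (x - r) * (x - s)"
proof (intro exI allI)
  let ?d = "csqrt (b\<^sup>2 - 4 * a * c)"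
  fix x
  have d: "?d\<^sup>2 = b\<^sup>2 - 4 * a * c" by simp
  have "4 * a * (a * (x - (- b + ?d) / (2 * a)) * (x - (- b - ?d) / (2 * a))) = (2 * a * x + b)\<^sup>2 - ?d\<^sup>2"
    using assms by (simp add: field_simps power2_eq_square)
  also have "\<dots> = 4 * a * (a * x\<^sup>2 + b * x + c)" unfolding d by (simp add: algebra_simps power2_eq_square)
  finally show "a * x\<^sup>2 + b * x + c = a * (x - (- b + ?d) / (2 * a)) * (x - (- b - ?d) / (2 * a))"
    using assms by simp
qed

lemma binary_form_zero:
  fixes a b c :: complex
  obtains p q where "a * p\<^sup>2 + b * p * q + c * q\<^sup>2 = 0" "\<not> (p = 0 \<and> q = 0)"
proof (cases "a = 0")
  case True
  then show ?thesis using that[of 1 0] by simp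
next
  case False
  obtain r s where "\<And>x. a * x\<^sup>2 + b * x + c = a * (x - r) * (x - s)"
    using quadratic_root[OF False, of b c] by blast
  from this[of r] show ?thesis using that[of r 1] by simp
qed

section \<open>A regular sequence in a chart\<close>

text \<open>\<open>q1\<close> is the distinguished variable, in which \<open>QA\<close> has the leading coefficient \<open>QA \<theta>1 \<theta>1\<close>.\<close>

locale good_chart = chart +
  fixes QA QB :: mat5
  assumes QAB: "QA = Q1 \<and> QB = Q2 \<or> QA = Q2 \<and> QB = Q1"
begin

abbreviation "lead y \<equiv> bilin QA (\<theta>1 y) (\<theta>1 y)"

text \<open>The vectors \<open>y\<close> are not normalised, so \<open>Z\<close> has one dimension
  more than the bundle, and \<open>\<pi>\<close> after \<beta> maps it onto an open set of the
  bundle. Relations are solved on \<open>Z\<close> and brought back along the section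
  \<open>coords\<close>.\<close>

definition Z :: "(vec5 \<times> complex \<times> complex) set" where
  "Z = {z. fst z \<in> V \<and> lead (fst z) \<noteq> 0}"

definition coord_fns :: "(vec5 \<times> complex \<times> complex \<Rightarrow> complex) set" where
  "coord_fns = range (\<lambda>i z. fst z $ i) \<union> {\<lambda>z. fst (snd z), \<lambda>z. snd (snd z)}"

text \<open>The functions without \<open>q1\<close>, which generate the coefficient ring for
  polynomials in \<open>q1\<close>.\<close>

definition coord_fns0 :: "(vec5 \<times> complex \<times> complex \<Rightarrow> complex) set" where
  "coord_fns0 = range (\<lambda>i z. fst z $ i) \<union> {\<lambda>z. snd (snd z)}"

abbreviation "Pol \<equiv> {F. polynomial_in coord_fns F}"

lemma polyvec_base: "polyvec coord_fns fst" "polyvec coord_fns0 fst"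
  unfolding polyvec_def by (auto intro!: polynomial_gen simp: coord_fns_def coord_fns0_def)

lemma polynomial_q: "polynomial_in coord_fns (\<lambda>z. fst (snd z))" "polynomial_in coord_fns (\<lambda>z. snd (snd z))"
  "polynomial_in coord_fns0 (\<lambda>z. snd (snd z))"
  by (auto intro!: polynomial_gen simp: coord_fns_def coord_fns0_def)

lemma polynomial_form: "polynomial_in coord_fns (\<lambda>z. bilin Q (vec_of z) (vec_of z))"
  unfolding vec_of_def
  by (intro polynomial_bilin polyvec_add polyvec_smult polyvec_proj polyvec_base polynomial_q)

lemma polynomial_base_form: "polynomial_in coord_fns0 (\<lambda>z. bilin Q (proj e f (fst z) u) (proj e f (fst z) v))"
  by (intro polynomial_bilin polyvec_proj polyvec_base)

lemma coord_fns0_subset: "coord_fns0 \<subseteq> coord_fns"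
  by (auto simp: coord_fns_def coord_fns0_def)

lemma coord_fns0_indep: "polynomial_in coord_fns0 F \<Longrightarrow> F (y, p, q) = F (y, p', q)"
  by (induction rule: polynomial_in.induct) (auto simp: coord_fns0_def)

lemma Pol_continuous: "polynomial_in coord_fns F \<Longrightarrow> continuous_on UNIV F"
  by (erule polynomial_continuous) (auto simp: coord_fns_def intro!: continuous_intros)

lemma form_expand:
  assumes "Q = Q1 \<or> Q = Q2"
  shows "bilin Q (vec_of (y, p, q)) (vec_of (y, p, q)) =
    bilin Q (\<theta>1 y) (\<theta>1 y) * p\<^sup>2 + 2 * bilin Q (\<theta>1 y) (\<theta>2 y) * p * q + bilin Q (\<theta>2 y) (\<theta>2 y) * q\<^sup>2"
proof -
  have "bilin Q (\<theta>2 y) (\<theta>1 y) = bilin Q (\<theta>1 y) (\<theta>2 y)" using assms B_commute by blast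
  then show ?thesis by (simp add: vec_of_def algebra_simps power2_eq_square)
qed

text \<open>A common zero would be a multiple of \<open>y\<close>, but over \<open>V\<close> the
  vectors \<open>y\<close>, \<theta>1 and \<theta>2 are independent.\<close>

lemma off_lines_anisotropic:
  assumes y: "y \<in> V" "off_lines y" and 0: "bilin QA (vec_of (y, p, q)) (vec_of (y, p, q)) = 0" "bilin QB (vec_of (y, p, q)) (vec_of (y, p, q)) = 0"
  shows "p = 0 \<and> q = 0"
proof -
  let ?v = "vec_of (y, p, q)"
  have "?v \<in> T y" using vec_of_in_T[of "(y, p, q)"] by simp
  moreover have "B1 ?v ?v = 0" "B2 ?v ?v = 0" using 0 QAB by auto
  ultimately obtain c where c: "?v = c *s y" using y(2) by (auto simp: off_lines_def)
  have "det5 y ?v (\<theta>2 y) e f = p * ((De y)\<^sup>2 * \<delta> y)" "det5 y (\<theta>1 y) ?v e f = q * ((De y)\<^sup>2 * \<delta> y)"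
    by (simp_all add: vec_of_def det5_add det5_scale det5_\<theta>)
  moreover have "det5 y ?v (\<theta>2 y) e f = 0" "det5 y (\<theta>1 y) ?v e f = 0" by (simp_all add: c det5_scale)
  ultimately show ?thesis using y(1) by (simp add: in_V)
qed

text \<open>The base point is approached by points off the lines with the fibre coordinates kept
  fixed. The nonvanishing of \<open>De\<close>, \<delta> and \<open>lead\<close> is an open
  condition in the classical topology, so it holds for all late terms.\<close>

lemma dense_Z:
  assumes F: "continuous_on UNIV F" and 0: "\<And>y q. y \<in> V \<Longrightarrow> lead y \<noteq> 0 \<Longrightarrow> off_lines y \<Longrightarrow> F (y, q) = (0 :: complex)"
    and z: "z \<in> Z"
  shows "F z = 0"
proof -
  obtain y q where zy: "z = (y, q)" by (cases z)
  have y: "y \<in> V" "lead y \<noteq> 0" using z zy by (auto simp: Z_def)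
  then have yK: "y \<in> K" by (simp add: in_V)
  have "\<exists>y'\<in>K. dist y' y < 1 / real (Suc n) \<and> off_lines y'" for n
    by (rule off_lines_dense[OF yK]) simp
  then obtain yn where yn: "\<And>n. yn n \<in> K" "\<And>n. dist (yn n) y < 1 / real (Suc n)" "\<And>n. off_lines (yn n)" by metis
  have lim: "yn \<longlonglongrightarrow> y"
  by (rule tendsto_if_dist_less_inverse) (rule yn(2))
  have poly_lim: "(\<lambda>n. G (yn n, p)) \<longlonglongrightarrow> G (y, p)" if "continuous_on UNIV G" for G :: "_ \<Rightarrow> complex" and p
    using that by (rule continuous_on_tendsto_compose) (auto intro!: tendsto_Pair lim tendsto_const)
  let ?h = "\<lambda>z. De (fst z) * \<delta> (fst z) * lead (fst z)"
  have "polynomial_in coord_fns ?h"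
    by (intro polynomial_mult polynomial_D polynomial_det5 polynomial_bilin polyvec_proj polyvec_base polyvec_const)
  then have "(\<lambda>n. ?h (yn n, q)) \<longlonglongrightarrow> ?h (y, q)" by (intro poly_lim Pol_continuous)
  moreover have "?h (y, q) \<noteq> 0" using y by (simp add: in_V)
  ultimately have "\<forall>\<^sub>F n in sequentially. ?h (yn n, q) \<noteq> 0" by (rule tendsto_imp_eventually_ne)
  then have "\<forall>\<^sub>F n in sequentially. F (yn n, q) = 0"
    by eventually_elim (rule 0, use yn in \<open>auto simp: in_V\<close>)
  then have "(\<lambda>n. F (yn n, q)) \<longlonglongrightarrow> 0" by (rule tendsto_eventually)
  then show ?thesis using LIMSEQ_unique[OF poly_lim[OF F, of q]] zy by blast
qed

text \<open>The member \<open>b Q1 - a Q2\<close> of the pencil is a binary form on the fibre, so it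
  has a nontrivial zero. There the two values are proportional to \<open>(a, b)\<close> and not both
  zero by anisotropy, and a square root rescales them.\<close>

lemma \<Phi>'_surj:
  assumes y: "y \<in> V" "off_lines y"
  obtains p q where "\<Phi>' (y, p, q) = (a, b)"
proof (cases "a = 0 \<and> b = 0")
  case True
  then show ?thesis using that[of 0 0] by (simp add: \<Phi>'_def vec_of_def)
next
  case False
  let ?f = "\<lambda>Q p q. bilin Q (vec_of (y, p, q)) (vec_of (y, p, q))"
  define c where "c = (\<lambda>u v. b * B1 u v - a * B2 u v)"
  obtain p q where pq: "c (\<theta>1 y) (\<theta>1 y) * p\<^sup>2 + (2 * c (\<theta>1 y) (\<theta>2 y)) * p * q + c (\<theta>2 y) (\<theta>2 y) * q\<^sup>2 = 0" "\<not> (p = 0 \<and> q = 0)"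
    by (rule binary_form_zero)
  have eq: "b * ?f Q1 p q = a * ?f Q2 p q"
    using pq(1) by (simp add: form_expand c_def algebra_simps)
  have nz: "\<not> (?f Q1 p q = 0 \<and> ?f Q2 p q = 0)"
    using off_lines_anisotropic[OF y, of p q] pq(2) QAB by auto
  obtain k where k: "?f Q1 p q = k * a" "?f Q2 p q = k * b"
  proof (cases "a = 0")
    case True
    then show ?thesis using False eq by (intro that[of "?f Q2 p q / b"]) auto
  next
    case a: False
    then show ?thesis using eq by (intro that[of "?f Q1 p q / a"]) (auto simp: field_simps)
  qed
  have "k \<noteq> 0" using nz k by auto
  define r where "r = 1 / csqrt k"
  have r: "r\<^sup>2 * k = 1" using \<open>k \<noteq> 0\<close> by (simp add: r_def power_divide)
  have "vec_of (y, r * p, r * q) = r *s vec_of (y, p, q)" by (simp add: vec_of_def vec_eq_iff algebra_simps)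
  then have "?f Q (r * p) (r * q) = r\<^sup>2 * ?f Q p q" for Q by (simp add: power2_eq_square)
  then have "\<Phi>' (y, r * p, r * q) = (r\<^sup>2 * k * a, r\<^sup>2 * k * b)" using k by (simp add: \<Phi>'_def)
  then show ?thesis using that[of "r * p" "r * q"] r by simp
qed

lemma eval2_\<Phi>'_Pol: "polynomial_in coord_fns (\<lambda>z. eval2 g (\<Phi>' z))"
  unfolding \<Phi>'_def by (intro polynomial_in_eval2_pair polynomial_form)

text \<open>By density it suffices to treat points off the lines. There \<Phi>' maps the fibre onto
  the plane, so some fibre point has a nonzero value of \<open>g\<close>. Along the line from it to
  the given point both factors are polynomials in one variable, and the first is not the zero
  polynomial.\<close>

lemma torsion_free_Z:
  assumes g: "g \<noteq> 0" and F: "polynomial_in coord_fns F" and 0: "\<And>z. z \<in> Z \<Longrightarrow> eval2 g (\<Phi>' z) * F z = 0"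
    and z: "z \<in> Z"
  shows "F z = 0"
proof (rule dense_Z[OF Pol_continuous[OF F] _ z])
  fix y :: vec5 and pq :: "complex \<times> complex" assume y: "y \<in> V" "lead y \<noteq> 0" "off_lines y"
  obtain p q where pq: "pq = (p, q)" by (cases pq)
  obtain ab where ab: "eval2 g ab \<noteq> 0" using eval2_eq_0_imp g by blast
  obtain p' q' where p'q': "\<Phi>' (y, p', q') = ab" using \<Phi>'_surj[OF y(1,3), of "fst ab" "snd ab"] by auto
  define l where "l = (\<lambda>x. (y, p' + x * (p - p'), q' + x * (q - q')))"
  have gens: "\<exists>r. \<forall>x. c (l x) = poly r x" if "c \<in> coord_fns" for c
    using that unfolding coord_fns_def l_def
  proof (elim UnE insertE imageE emptyE)
    fix i assume "c = (\<lambda>z. fst z $ i)"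
    then show "\<exists>r. \<forall>x. c (y, p' + x * (p - p'), q' + x * (q - q')) = poly r x"
      by (intro exI[of _ "[:y $ i:]"]) simp
  next
    assume "c = (\<lambda>z. fst (snd z))"
    then show "\<exists>r. \<forall>x. c (y, p' + x * (p - p'), q' + x * (q - q')) = poly r x"
      by (intro exI[of _ "[:p', p - p':]"]) simp
  next
    assume "c = (\<lambda>z. snd (snd z))"
    then show "\<exists>r. \<forall>x. c (y, p' + x * (p - p'), q' + x * (q - q')) = poly r x"
      by (intro exI[of _ "[:q', q - q':]"]) simp
  qed
  obtain r1 where r1: "\<And>x. eval2 g (\<Phi>' (l x)) = poly r1 x"
    using polynomial_on_path[where l = l, OF eval2_\<Phi>'_Pol gens] by blast
  obtain r2 where r2: "\<And>x. F (l x) = poly r2 x" using polynomial_on_path[where l = l, OF F gens] by blast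
  have "poly (r1 * r2) x = 0" for x using 0[of "l x"] y r1 r2 by (simp add: Z_def l_def)
  then have "r1 * r2 = 0" by (simp add: poly_all_0_iff_0[symmetric])
  moreover have "poly r1 0 \<noteq> 0" using r1[of 0] ab p'q' by (simp add: l_def)
  then have "r1 \<noteq> 0" by auto
  ultimately have "r2 = 0" by simp
  then show "F (y, pq) = 0" using r2[of 1] by (simp add: l_def pq)
qed

text \<open>Eliminating \<open>q1\<close> leaves a quartic in \<open>q2\<close> whose leading coefficient is the resultant of
  the two binary forms.\<close>

lemma finitely_many_common_zeros:
  assumes y: "y \<in> V" "lead y \<noteq> 0" "off_lines y"
  shows "finite {q. \<exists>p. bilin QA (vec_of (y, p, q)) (vec_of (y, p, q)) = a \<and> bilin QB (vec_of (y, p, q)) (vec_of (y, p, q)) = b}"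
proof -
  define A where "A = bilin QA (\<theta>1 y) (\<theta>1 y)"
  define B where "B = 2 * bilin QA (\<theta>1 y) (\<theta>2 y)"
  define C where "C = bilin QA (\<theta>2 y) (\<theta>2 y)"
  define A' where "A' = bilin QB (\<theta>1 y) (\<theta>1 y)"
  define B' where "B' = 2 * bilin QB (\<theta>1 y) (\<theta>2 y)"
  define C' where "C' = bilin QB (\<theta>2 y) (\<theta>2 y)"
  have fA: "bilin QA (vec_of (y, p, q)) (vec_of (y, p, q)) = A * p\<^sup>2 + B * p * q + C * q\<^sup>2"
    and fB: "bilin QB (vec_of (y, p, q)) (vec_of (y, p, q)) = A' * p\<^sup>2 + B' * p * q + C' * q\<^sup>2" for p q
    using form_expand[of QA y p q] form_expand[of QB y p q] QAB by (auto simp: A_def B_def C_def A'_def B'_def C'_def)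
  have A0: "A \<noteq> 0" using y by (simp add: A_def)
  define E where "E = A * B' - A' * B"
  define G where "G = A * C' - A' * C"
  define m where "m = A * b - A' * a"
  \<comment> \<open>The value of the first form at \<open>(- G, E)\<close>, which is the zero of the
    linear form \<open>E p + G q\<close> from \<open>comb\<close>.\<close>
  define \<rho> where "\<rho> = A * G\<^sup>2 - B * E * G + C * E\<^sup>2"
  have comb: "A * (A' * p\<^sup>2 + B' * p * q + C' * q\<^sup>2) = A' * (A * p\<^sup>2 + B * p * q + C * q\<^sup>2) + q * (E * p + G * q)" for p q
    by (simp add: E_def G_def algebra_simps power2_eq_square)
  have "\<rho> \<noteq> 0"
  proof
    assume \<rho>: "\<rho> = 0"
    have no_zero: "p = 0 \<and> q = 0" if "A * p\<^sup>2 + B * p * q + C * q\<^sup>2 = 0" "E * p + G * q = 0" for p q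
    proof -
      have "A' * p\<^sup>2 + B' * p * q + C' * q\<^sup>2 = 0" using comb[of p q] that A0 by simp
      then show ?thesis using off_lines_anisotropic[OF y(1,3), of p q] that fA fB by simp
    qed
    show False
    proof (cases "E = 0")
      case True
      then have "G = 0" using \<rho> A0 by (simp add: \<rho>_def)
      obtain p q where "A * p\<^sup>2 + B * p * q + C * q\<^sup>2 = 0" "\<not> (p = 0 \<and> q = 0)" by (rule binary_form_zero)
      then show False using no_zero[of p q] True \<open>G = 0\<close> by simp
    next
      case False
      have "A * (- G)\<^sup>2 + B * (- G) * E + C * E\<^sup>2 = 0" using \<rho> by (simp add: \<rho>_def algebra_simps)
      from no_zero[OF this] False show False by simp
    qed
  qed
  \<comment> \<open>At a common solution \<open>comb\<close> gives E p q = m - G q^2. Multiplying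
    the first equation by E^2 q^2 and substituting this removes \<open>p\<close>.\<close>
  define P where "P = [:A * m\<^sup>2, 0, - 2 * A * m * G + B * E * m - a * E\<^sup>2, 0, \<rho>:]"
  have "P \<noteq> 0" using \<open>\<rho> \<noteq> 0\<close> by (simp add: P_def)
  have "poly P q = 0" if t: "A * p\<^sup>2 + B * p * q + C * q\<^sup>2 = a" and s: "A' * p\<^sup>2 + B' * p * q + C' * q\<^sup>2 = b" for p q
  proof -
    have Eq: "E * p * q = m - G * q\<^sup>2"
      using comb[of p q] unfolding t s by (simp add: m_def algebra_simps power2_eq_square)
    have "0 = (A * p\<^sup>2 + B * p * q + C * q\<^sup>2 - a) * (E\<^sup>2 * q\<^sup>2)" using t by simp
    also have "\<dots> = A * (E * p * q)\<^sup>2 + B * E * (E * p * q) * q\<^sup>2 + (C * q\<^sup>2 - a) * E\<^sup>2 * q\<^sup>2"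
      by (simp add: algebra_simps power2_eq_square)
    also have "\<dots> = poly P q"
      unfolding Eq by (simp add: P_def \<rho>_def algebra_simps power2_eq_square)
    finally show ?thesis by simp
  qed
  then have "{q. \<exists>p. bilin QA (vec_of (y, p, q)) (vec_of (y, p, q)) = a \<and> bilin QB (vec_of (y, p, q)) (vec_of (y, p, q)) = b} \<subseteq> {q. poly P q = 0}"
    unfolding fA fB by blast
  then show ?thesis using poly_roots_finite[OF \<open>P \<noteq> 0\<close>] finite_subset by blast
qed

text \<open>The divisor has degree two in \<open>q1\<close> with leading coefficient
  \<open>lead\<close>, powers of which are the price. In a product the remainders multiply to degree
  two in \<open>q1\<close>, and one more factor \<open>lead\<close> reduces that.\<close>

lemma division:
  assumes "polynomial_in coord_fns F"
  shows "\<exists>N W r0 r1. polynomial_in coord_fns W \<and> polynomial_in coord_fns0 r0 \<and> polynomial_in coord_fns0 r1 \<and>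
    (\<forall>z. lead (fst z) ^ N * F z = (bilin QA (vec_of z) (vec_of z) - a) * W z + r0 z + r1 z * fst (snd z))"
  using assms
proof induction
  case (1 c)
  show ?case
    by (intro exI[of _ 0] exI[of _ "\<lambda>_. 0"] exI[of _ "\<lambda>_. c"]) (auto intro: polynomial_const)
next
  case (2 c)
  show ?case
  proof (cases "c \<in> coord_fns0")
    case True
    then show ?thesis
      by (intro exI[of _ 0] exI[of _ "\<lambda>_. 0"] exI[of _ c]) (auto intro: polynomial_const polynomial_gen)
  next
    case False
    then have "c = (\<lambda>z. fst (snd z))" using 2 by (auto simp: coord_fns_def coord_fns0_def)
    then show ?thesis
      by (intro exI[of _ 0] exI[of _ "\<lambda>_. 0"] exI[of _ "\<lambda>_. 0"] exI[of _ "\<lambda>_. 1"]) (auto intro: polynomial_const)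
  qed
next
  case (3 F F')
  obtain N W r0 r1 where W: "polynomial_in coord_fns W" "polynomial_in coord_fns0 r0" "polynomial_in coord_fns0 r1"
    "\<And>z. lead (fst z) ^ N * F z = (bilin QA (vec_of z) (vec_of z) - a) * W z + r0 z + r1 z * fst (snd z)"
    using 3 by blast
  obtain N' W' r0' r1' where W': "polynomial_in coord_fns W'" "polynomial_in coord_fns0 r0'" "polynomial_in coord_fns0 r1'"
    "\<And>z. lead (fst z) ^ N' * F' z = (bilin QA (vec_of z) (vec_of z) - a) * W' z + r0' z + r1' z * fst (snd z)"
    using 3 by blast
  have L: "polynomial_in coord_fns (\<lambda>z. lead (fst z))" "polynomial_in coord_fns0 (\<lambda>z. lead (fst z))"
    using polynomial_base_form polynomial_mono[OF _ coord_fns0_subset] by blast+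
  show ?case
  proof (intro exI conjI allI)
    show "polynomial_in coord_fns (\<lambda>z. lead (fst z) ^ N' * W z + lead (fst z) ^ N * W' z)"
      "polynomial_in coord_fns0 (\<lambda>z. lead (fst z) ^ N' * r0 z + lead (fst z) ^ N * r0' z)"
      "polynomial_in coord_fns0 (\<lambda>z. lead (fst z) ^ N' * r1 z + lead (fst z) ^ N * r1' z)"
      using W W' L by (auto intro!: polynomial_intros)
    fix z
    have "lead (fst z) ^ (N + N') * (F z + F' z) =
        lead (fst z) ^ N' * (lead (fst z) ^ N * F z) + lead (fst z) ^ N * (lead (fst z) ^ N' * F' z)"
      by (simp add: power_add algebra_simps)
    then show "lead (fst z) ^ (N + N') * (F z + F' z) = (bilin QA (vec_of z) (vec_of z) - a) *
        (lead (fst z) ^ N' * W z + lead (fst z) ^ N * W' z) + (lead (fst z) ^ N' * r0 z + lead (fst z) ^ N * r0' z) +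
        (lead (fst z) ^ N' * r1 z + lead (fst z) ^ N * r1' z) * fst (snd z)"
      unfolding W(4) W'(4) by (simp add: algebra_simps)
  qed
next
  case (4 F F')
  obtain N W r0 r1 where W: "polynomial_in coord_fns W" "polynomial_in coord_fns0 r0" "polynomial_in coord_fns0 r1"
    "\<And>z. lead (fst z) ^ N * F z = (bilin QA (vec_of z) (vec_of z) - a) * W z + r0 z + r1 z * fst (snd z)"
    using 4 by blast
  obtain N' W' r0' r1' where W': "polynomial_in coord_fns W'" "polynomial_in coord_fns0 r0'" "polynomial_in coord_fns0 r1'"
    "\<And>z. lead (fst z) ^ N' * F' z = (bilin QA (vec_of z) (vec_of z) - a) * W' z + r0' z + r1' z * fst (snd z)"
    using 4 by blast
  let ?B = "\<lambda>z. 2 * bilin QA (\<theta>1 (fst z)) (\<theta>2 (fst z))" and ?C = "\<lambda>z. bilin QA (\<theta>2 (fst z)) (\<theta>2 (fst z))"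
  let ?t = "\<lambda>z. bilin QA (vec_of z) (vec_of z) - a" and ?p = "\<lambda>z. fst (snd z)" and ?q = "\<lambda>z. snd (snd z)"
  have L: "polynomial_in coord_fns0 (\<lambda>z. lead (fst z))" "polynomial_in coord_fns0 ?B" "polynomial_in coord_fns0 ?C"
    by (intro polynomial_intros polynomial_base_form)+
  note up = polynomial_mono[OF _ coord_fns0_subset]
  show ?case
  proof (intro exI conjI allI)
    show "polynomial_in coord_fns (\<lambda>z. lead (fst z) * (?t z * W z * W' z + W z * (r0' z + r1' z * ?p z) + W' z * (r0 z + r1 z * ?p z)) + r1 z * r1' z)"
      using W W' up[OF L(1)] up[OF W(2)] up[OF W(3)] up[OF W'(2)] up[OF W'(3)]
      by (intro polynomial_intros polynomial_form polynomial_q) auto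
    show "polynomial_in coord_fns0 (\<lambda>z. lead (fst z) * (r0 z * r0' z) + r1 z * r1' z * (a - ?C z * (?q z)\<^sup>2))"
      "polynomial_in coord_fns0 (\<lambda>z. lead (fst z) * (r0 z * r1' z + r1 z * r0' z) - r1 z * r1' z * (?B z * ?q z))"
      using W W' L by (auto intro!: polynomial_intros polynomial_q)
    fix z
    have t: "lead (fst z) * (?p z)\<^sup>2 = ?t z - ?B z * ?p z * ?q z - ?C z * (?q z)\<^sup>2 + a"
      using form_expand[of QA "fst z" "?p z" "?q z"] QAB by auto
    have "lead (fst z) ^ (N + N' + 1) * (F z * F' z) = lead (fst z) * (lead (fst z) ^ N * F z) * (lead (fst z) ^ N' * F' z)"
      by (simp add: power_add algebra_simps)
    also have "\<dots> = lead (fst z) * (?t z * W z + (r0 z + r1 z * ?p z)) * (?t z * W' z + (r0' z + r1' z * ?p z))"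
      unfolding W(4) W'(4) by (simp add: add.assoc)
    also have "\<dots> = ?t z * (lead (fst z) * (?t z * W z * W' z + W z * (r0' z + r1' z * ?p z) + W' z * (r0 z + r1 z * ?p z))) +
        lead (fst z) * (r0 z * r0' z) + lead (fst z) * (r0 z * r1' z + r1 z * r0' z) * ?p z + r1 z * r1' z * (lead (fst z) * (?p z)\<^sup>2)"
      by (simp add: algebra_simps power2_eq_square)
    also have "\<dots> = ?t z * (lead (fst z) * (?t z * W z * W' z + W z * (r0' z + r1' z * ?p z) + W' z * (r0 z + r1 z * ?p z)) + r1 z * r1' z) +
        (lead (fst z) * (r0 z * r0' z) + r1 z * r1' z * (a - ?C z * (?q z)\<^sup>2)) +
        (lead (fst z) * (r0 z * r1' z + r1 z * r0' z) - r1 z * r1' z * (?B z * ?q z)) * ?p z"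
      unfolding t by (simp add: algebra_simps)
    finally show "lead (fst z) ^ (N + N' + 1) * (F z * F' z) = \<dots>" .
  qed
qed

text \<open>Divide \<open>Y\<close> by the first form minus \<open>a\<close>. Fix \<open>y\<close>
  and \<open>q2\<close> such that the two equations have no common root in \<open>q1\<close>. At a
  root of the first, the relation forces \<open>Y\<close> to vanish, so the remainder, linear in
  \<open>q1\<close>, has both roots as zeros and is zero. This applies for all but finitely many
  \<open>q2\<close> over a dense set of \<open>y\<close>. Torsion-freeness then cancels the first
  factor in the relation, which gives \<open>X\<close>.\<close>

lemma regular_AB:
  assumes X: "polynomial_in coord_fns X" and Y: "polynomial_in coord_fns Y"
    and rel: "\<And>z. z \<in> Z \<Longrightarrow> (bilin QA (vec_of z) (vec_of z) - a) * X z + (bilin QB (vec_of z) (vec_of z) - b) * Y z = 0"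
  shows "\<exists>N W. polynomial_in coord_fns W \<and> (\<forall>z\<in>Z. lead (fst z) ^ N * Y z = (bilin QA (vec_of z) (vec_of z) - a) * W z \<and>
      lead (fst z) ^ N * X z = - (bilin QB (vec_of z) (vec_of z) - b) * W z)"
proof -
  let ?t = "\<lambda>z. bilin QA (vec_of z) (vec_of z) - a" and ?s = "\<lambda>z. bilin QB (vec_of z) (vec_of z) - b"
  obtain N W r0 r1 where W: "polynomial_in coord_fns W" and r: "polynomial_in coord_fns0 r0" "polynomial_in coord_fns0 r1"
    and div: "\<And>z. lead (fst z) ^ N * Y z = ?t z * W z + r0 z + r1 z * fst (snd z)"
    using division[OF Y] by blast
  note up = polynomial_mono[OF _ coord_fns0_subset]
  have cont: "continuous_on UNIV r0" "continuous_on UNIV r1" using r up Pol_continuous by blast+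
  have good: "r0 (y, p0, q) = 0 \<and> r1 (y, p0, q) = 0"
    if y: "y \<in> V" "lead y \<noteq> 0" and no: "\<And>p. \<not> (?t (y, p, q) = 0 \<and> ?s (y, p, q) = 0)" for y p0 q
  proof -
    define A where "A = lead y"
    have A0: "A \<noteq> 0" using y by (simp add: A_def)
    obtain k1 k2 where k: "\<And>p. A * p\<^sup>2 + 2 * bilin QA (\<theta>1 y) (\<theta>2 y) * q * p + (bilin QA (\<theta>2 y) (\<theta>2 y) * q\<^sup>2 - a) = A * (p - k1) * (p - k2)"
      using quadratic_root[OF A0, of "2 * bilin QA (\<theta>1 y) (\<theta>2 y) * q" "bilin QA (\<theta>2 y) (\<theta>2 y) * q\<^sup>2 - a"] by blast
    have t: "?t (y, p, q) = A * (p - k1) * (p - k2)" for p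
      unfolding k[symmetric] using form_expand[of QA y p q] QAB by (auto simp: A_def algebra_simps)
    define R0 where "R0 = r0 (y, p0, q)"
    define R1 where "R1 = r1 (y, p0, q)"
    have R: "r0 (y, p, q) = R0" "r1 (y, p, q) = R1" for p
      unfolding R0_def R1_def by (rule coord_fns0_indep[OF r(1)], rule coord_fns0_indep[OF r(2)])
    have inZ: "(y, p, q) \<in> Z" for p using y by (simp add: Z_def)
    have root: "R0 + R1 * p = 0" if p: "?t (y, p, q) = 0" for p
    proof -
      have "?s (y, p, q) \<noteq> 0" using no[of p] p by blast
      then have "Y (y, p, q) = 0" using rel[OF inZ[of p]] p by simp
      then show ?thesis using div[of "(y, p, q)"] p R by simp
    qed
    have k1: "R0 + R1 * k1 = 0" and k2: "R0 + R1 * k2 = 0" by (intro root; simp add: t)+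
    have "R1 = 0"
    proof (cases "k1 = k2")
      case False
      have "R1 * (k1 - k2) = (R0 + R1 * k1) - (R0 + R1 * k2)" by (simp add: algebra_simps)
      then show ?thesis using k1 k2 False by simp
    next
      case True
      \<comment> \<open>A double root has to count twice: \<open>?g\<close> is the relation,
        multiplied by \<open>A ^ N\<close>, after division by p - k1. It vanishes off k1, hence at
        k1 by continuity, and there its value is a nonzero multiple of \<open>R1\<close>.\<close>
      let ?g = "\<lambda>p. A ^ N * A * (p - k1) * X (y, p, q) + ?s (y, p, q) * (A * (p - k1) * W (y, p, q) + R1)"
      have g0: "?g p = 0" if "p \<noteq> k1" for p
      proof -
        have "R0 = - R1 * k1" using k1 by (simp add: add_eq_0_iff)
        then have Yp: "A ^ N * Y (y, p, q) = A * (p - k1) * (p - k1) * W (y, p, q) + R1 * (p - k1)"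
          using div[of "(y, p, q)"] R t True by (simp add: A_def algebra_simps)
        have "(p - k1) * ?g p = A ^ N * (?t (y, p, q) * X (y, p, q)) + ?s (y, p, q) * (A * (p - k1) * (p - k1) * W (y, p, q) + R1 * (p - k1))"
          unfolding t using True by (simp add: algebra_simps)
        also have "\<dots> = A ^ N * (?t (y, p, q) * X (y, p, q) + ?s (y, p, q) * Y (y, p, q))"
          unfolding Yp[symmetric] by (simp add: algebra_simps)
        also have "\<dots> = 0" using rel[OF inZ[of p]] by simp
        finally show ?thesis using that by simp
      qed
      have c: "continuous_on UNIV (\<lambda>p. G (y, p, q))" if "polynomial_in coord_fns G" for G :: "_ \<Rightarrow> complex"
        by (rule continuous_on_compose2[OF Pol_continuous[OF that]]) (auto intro!: continuous_intros)
      have "polynomial_in coord_fns ?s" by (intro polynomial_intros polynomial_form)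
      then have "continuous_on UNIV ?g" by (intro continuous_intros c[OF X] c[OF W] c)
      then have "(?g \<longlongrightarrow> ?g k1) (at k1)" unfolding continuous_on_def by blast
      moreover have "(?g \<longlongrightarrow> 0) (at k1)"
        by (rule tendsto_eventually) (use g0 in \<open>auto simp: eventually_at_filter\<close>)
      ultimately have "?g k1 = 0" using tendsto_unique[OF trivial_limit_at] by blast
      then have "?s (y, k1, q) * R1 = 0" by simp
      moreover have "?s (y, k1, q) \<noteq> 0" using no[of k1] t[of k1] by simp
      ultimately show ?thesis by simp
    qed
    with k1 show ?thesis by (simp add: R0_def R1_def)
  qed
  \<comment> \<open>The finitely many exceptional \<open>q2\<close> over a point off the lines are
    removed by continuity in \<open>q2\<close>, the points on lines by density.\<close>
  have van: "r z = 0" if z: "z \<in> Z" and r: "continuous_on UNIV r"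
    and good: "\<And>y p0 q. y \<in> V \<Longrightarrow> lead y \<noteq> 0 \<Longrightarrow> (\<And>p. \<not> (?t (y, p, q) = 0 \<and> ?s (y, p, q) = 0)) \<Longrightarrow> r (y, p0, q) = (0 :: complex)" for r z
  proof (rule dense_Z[OF r _ z])
    fix y :: vec5 and pq :: "complex \<times> complex" assume y: "y \<in> V" "lead y \<noteq> 0" "off_lines y"
    obtain p0 q0 where pq: "pq = (p0, q0)" by (cases pq)
    let ?S = "{q. \<exists>p. bilin QA (vec_of (y, p, q)) (vec_of (y, p, q)) = a \<and> bilin QB (vec_of (y, p, q)) (vec_of (y, p, q)) = b}"
    have fin: "finite ?S" by (rule finitely_many_common_zeros[OF y])
    have 0: "r (y, p0, q) = 0" if "q \<notin> ?S" for q
      by (rule good[OF y(1,2)]) (use that in auto)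
    have "continuous_on UNIV (\<lambda>q. r (y, p0, q))"
      by (rule continuous_on_compose2[OF r]) (auto intro!: continuous_intros)
    then have "((\<lambda>q. r (y, p0, q)) \<longlongrightarrow> r (y, p0, q0)) (at q0)" by (simp add: continuous_on_def)
    moreover have "\<forall>\<^sub>F q in at q0. q \<notin> ?S"
    proof -
      have "open (- (?S - {q0}))" using fin by (intro open_Compl finite_imp_closed) auto
      then have "\<forall>\<^sub>F q in nhds q0. q \<in> - (?S - {q0})" by (intro eventually_nhds_in_open) auto
      then show ?thesis unfolding eventually_at_filter by eventually_elim auto
    qed
    then have "((\<lambda>q. r (y, p0, q)) \<longlongrightarrow> 0) (at q0)"
      by (intro tendsto_eventually) (auto elim!: eventually_mono intro: 0)
    ultimately show "r (y, pq) = 0" using tendsto_unique[OF trivial_limit_at] pq by blast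
  qed
  have r0: "r0 z = 0" if "z \<in> Z" for z by (rule van[OF that cont(1)]) (use good in blast)
  have r1: "r1 z = 0" if "z \<in> Z" for z by (rule van[OF that cont(2)]) (use good in blast)
  have Y1: "lead (fst z) ^ N * Y z = ?t z * W z" if "z \<in> Z" for z using div[of z] r0 r1 that by simp
  have "lead (fst z) ^ N * X z + ?s z * W z = 0" if z: "z \<in> Z" for z
  proof -
    \<comment> \<open>The first factor is the pullback of a shifted coordinate of the plane, so
      torsion-freeness applies to it. Which coordinate depends on which form is
      \<open>QA\<close>.\<close>
    define g where "g = (if QA = Q1 then shift_fst a else shift_snd a)"
    have g: "eval2 g (\<Phi>' z) = ?t z" for z using QAB by (auto simp: g_def \<Phi>'_def)
    have "g \<noteq> 0" by (simp add: g_def shift_fst_def shift_snd_def)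
    have P: "polynomial_in coord_fns (\<lambda>z. lead (fst z) ^ N * X z + ?s z * W z)"
      using X W up[OF polynomial_base_form] by (intro polynomial_intros polynomial_form)
    show ?thesis
    proof (rule torsion_free_Z[OF \<open>g \<noteq> 0\<close> P _ z])
      fix z assume z: "z \<in> Z"
      have "eval2 g (\<Phi>' z) * (lead (fst z) ^ N * X z + ?s z * W z) = lead (fst z) ^ N * (?t z * X z) + ?s z * (?t z * W z)"
        unfolding g by (simp add: algebra_simps)
      also have "\<dots> = lead (fst z) ^ N * (?t z * X z + ?s z * Y z)"
        unfolding Y1[OF z, symmetric] by (simp add: algebra_simps)
      finally show "eval2 g (\<Phi>' z) * (lead (fst z) ^ N * X z + ?s z * W z) = 0" using rel[OF z] by simp
    qed
  qed
  then have X1: "lead (fst z) ^ N * X z = - ?s z * W z" if "z \<in> Z" for z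
    using that by (simp only: mult_minus_left eq_neg_iff_add_eq_0)
  show ?thesis using W Y1 X1 by (intro exI[of _ N] exI[of _ W]) blast
qed

lemma regular_algebra_Z:
  assumes z0: "z0 \<in> Z"
  shows "regular_algebra Z Pol \<Phi>' z0"
proof
  show "z0 \<in> Z" by fact
  show "\<And>c. (\<lambda>z. c) \<in> Pol" "\<And>f g. f \<in> Pol \<Longrightarrow> g \<in> Pol \<Longrightarrow> (\<lambda>z. f z + g z) \<in> Pol"
    "\<And>f g. f \<in> Pol \<Longrightarrow> g \<in> Pol \<Longrightarrow> (\<lambda>z. f z * g z) \<in> Pol" "\<And>g. (\<lambda>z. eval2 g (\<Phi>' z)) \<in> Pol"
    by (auto intro: polynomial_intros eval2_\<Phi>'_Pol)
  show "F z = 0" if "g \<noteq> 0" "F \<in> Pol" "\<And>z. z \<in> Z \<Longrightarrow> eval2 g (\<Phi>' z) * F z = 0" "z \<in> Z" for g F z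
    using torsion_free_Z[OF that(1) _ that(3,4)] that(2) by simp
  fix X Y assume XY: "X \<in> Pol" "Y \<in> Pol"
    and rel: "\<And>z. z \<in> Z \<Longrightarrow> (fst (\<Phi>' z) - fst (\<Phi>' z0)) * X z + (snd (\<Phi>' z) - snd (\<Phi>' z0)) * Y z = 0"
  have lead: "polynomial_in coord_fns (\<lambda>z. lead (fst z) ^ N)" for N
    using polynomial_mono[OF polynomial_base_form coord_fns0_subset] by (intro polynomial_power)
  have lead0: "lead (fst z0) ^ N \<noteq> 0" for N using z0 by (simp add: Z_def)
  from QAB show "\<exists>H\<in>Pol. \<exists>w\<in>Pol. H z0 \<noteq> 0 \<and> (\<forall>z\<in>Z. H z * X z = (snd (\<Phi>' z) - snd (\<Phi>' z0)) * w z \<and>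
        H z * Y z = - (fst (\<Phi>' z) - fst (\<Phi>' z0)) * w z)"
  proof (elim disjE conjE)
    assume Q: "QA = Q1" "QB = Q2"
    obtain N W where W: "polynomial_in coord_fns W"
      and eq: "\<forall>z\<in>Z. lead (fst z) ^ N * Y z = (bilin QA (vec_of z) (vec_of z) - fst (\<Phi>' z0)) * W z \<and>
        lead (fst z) ^ N * X z = - (bilin QB (vec_of z) (vec_of z) - snd (\<Phi>' z0)) * W z"
      using regular_AB[of X Y "fst (\<Phi>' z0)" "snd (\<Phi>' z0)"] XY rel unfolding Q \<Phi>'_def by auto
    \<comment> \<open>The roles of \<open>X\<close> and \<open>Y\<close> in \<open>regular\<close>
      are fixed, so this order of the two forms costs a sign that the other order does not.\<close>
    have W': "(\<lambda>z. - W z) \<in> Pol" using polynomial_minus[OF W] by simp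
    have H: "(\<lambda>z. lead (fst z) ^ N) \<in> Pol" using lead by simp
    show ?thesis
      by (rule bexI[OF _ H], rule bexI[OF _ W']) (use eq lead0 in \<open>simp add: Q \<Phi>'_def left_diff_distrib\<close>)
  next
    assume Q: "QA = Q2" "QB = Q1"
    obtain N W where W: "polynomial_in coord_fns W"
      and eq: "\<forall>z\<in>Z. lead (fst z) ^ N * X z = (bilin QA (vec_of z) (vec_of z) - snd (\<Phi>' z0)) * W z \<and>
        lead (fst z) ^ N * Y z = - (bilin QB (vec_of z) (vec_of z) - fst (\<Phi>' z0)) * W z"
      using regular_AB[of Y X "snd (\<Phi>' z0)" "fst (\<Phi>' z0)"] XY rel unfolding Q \<Phi>'_def by (auto simp: add.commute)
    have W': "W \<in> Pol" using W by simp
    have H: "(\<lambda>z. lead (fst z) ^ N) \<in> Pol" using lead by simp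
    show ?thesis
      by (rule bexI[OF _ H], rule bexI[OF _ W']) (use eq lead0 in \<open>simp add: Q \<Phi>'_def\<close>)
  qed
qed

end

section \<open>Substitution of rational functions\<close>

text \<open>All denominators are powers of one function \<open>h\<close>, so they combine under sums
  and products.\<close>

lemma rational_substitution:
  assumes F: "polynomial_in C' F" and h: "polynomial_in C h" and h0: "\<And>z. z \<in> S \<Longrightarrow> h z \<noteq> 0"
    and gen: "\<And>c. c \<in> C' \<Longrightarrow> \<exists>N k. polynomial_in C N \<and> (\<forall>z\<in>S. c (\<psi> z) = N z / h z ^ (k::nat))"
  shows "\<exists>N k. polynomial_in C N \<and> (\<forall>z\<in>S. F (\<psi> z) = N z / h z ^ (k::nat))"
  using F
proof induction
  case (1 c)
  show ?case by (intro exI[of _ "\<lambda>_. c"] exI[of _ 0]) (simp add: polynomial_const)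
next
  case (2 c)
  then show ?case by (rule gen)
next
  case (3 F G)
  then obtain N k N' k' where N: "polynomial_in C N" "polynomial_in C N'"
    "\<And>z. z \<in> S \<Longrightarrow> F (\<psi> z) = N z / h z ^ k" "\<And>z. z \<in> S \<Longrightarrow> G (\<psi> z) = N' z / h z ^ k'" by blast
  show ?case
  proof (intro exI[of _ "\<lambda>z. N z * h z ^ k' + N' z * h z ^ k"] exI[of _ "k + k'"] conjI ballI)
    show "polynomial_in C (\<lambda>z. N z * h z ^ k' + N' z * h z ^ k)" using N h by (intro polynomial_intros)
    show "F (\<psi> z) + G (\<psi> z) = (N z * h z ^ k' + N' z * h z ^ k) / h z ^ (k + k')" if "z \<in> S" for z
      using N(3,4)[OF that] h0[OF that] by (simp add: power_add field_simps)
  qed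
next
  case (4 F G)
  then obtain N k N' k' where N: "polynomial_in C N" "polynomial_in C N'"
    "\<And>z. z \<in> S \<Longrightarrow> F (\<psi> z) = N z / h z ^ k" "\<And>z. z \<in> S \<Longrightarrow> G (\<psi> z) = N' z / h z ^ k'" by blast
  show ?case
  proof (intro exI[of _ "\<lambda>z. N z * N' z"] exI[of _ "k + k'"] conjI ballI)
    show "polynomial_in C (\<lambda>z. N z * N' z)" using N by (intro polynomial_intros)
    show "F (\<psi> z) * G (\<psi> z) = N z * N' z / h z ^ (k + k')" if "z \<in> S" for z
      using N(3,4)[OF that] by (simp add: power_add)
  qed
qed

lemma ringed_space_affine_plane: "ringed_space affine_plane"
  unfolding affine_plane_def by (rule ringed_space_quasi_affine)

lemma points_affine_plane [simp]: "points affine_plane = UNIV"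
  by (simp add: affine_plane_def)

lemma affine_plane_common_denominator:
  assumes V: "openin (zariski affine_plane) V" "x \<in> V" and r: "\<And>i. i < (n::nat) \<Longrightarrow> r i \<in> regular affine_plane V"
  shows "\<exists>g b. eval2 b x \<noteq> 0 \<and> (\<forall>x'. eval2 b x' \<noteq> 0 \<longrightarrow> x' \<in> V \<and> (\<forall>i<n. r i x' = eval2 (g i) x' / eval2 b x'))"
  using r
proof (induction n)
  case 0
  obtain h where h: "polynomial_in {fst, snd} h" "h x \<noteq> 0" "{q \<in> UNIV. h q \<noteq> 0} \<subseteq> V"
    using openin_quasi_affine_contains_basic[of UNIV "{fst, snd}" V x] V unfolding affine_plane_def by blast
  obtain b where "h = eval2 b" using polynomial_in_imp_eval2[OF h(1)] by blast
  then show ?case using h by auto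
next
  case (Suc n)
  then obtain g b where b: "eval2 b x \<noteq> 0"
    and gb: "\<And>x'. eval2 b x' \<noteq> 0 \<Longrightarrow> x' \<in> V" "\<And>x' i. eval2 b x' \<noteq> 0 \<Longrightarrow> i < n \<Longrightarrow> r i x' = eval2 (g i) x' / eval2 b x'"
    by (metis less_SucI)
  have "r n \<in> regular (quasi_affine UNIV {fst, snd}) V" using Suc.prems[of n] by (simp add: affine_plane_def)
  then obtain G H where GH: "polynomial_in {fst, snd} G" "polynomial_in {fst, snd} H" "H x \<noteq> 0"
    "\<And>q. q \<in> V \<Longrightarrow> H q \<noteq> 0 \<Longrightarrow> r n q = G q / H q"
    using regular_quasi_affineD[of "r n" UNIV "{fst, snd}" V x] V(2) by blast
  obtain g' b' where g'b': "G = eval2 g'" "H = eval2 b'" using polynomial_in_imp_eval2 GH(1,2) by metis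
  show ?case
  proof (intro exI conjI allI impI)
    show "eval2 (b * b') x \<noteq> 0" using b GH(3) g'b' by simp
    fix x' assume nz: "eval2 (b * b') x' \<noteq> 0"
    then show "x' \<in> V" using gb by simp
    show "r i x' = eval2 (((\<lambda>i. g i * b')(n := g' * b)) i) x' / eval2 (b * b') x'" if "i < Suc n" for i
    proof (cases "i = n")
      case True
      then show ?thesis using nz gb(1)[of x'] GH(4)[of x'] g'b' by simp
    next
      case False
      then show ?thesis using nz gb(2)[of x' i] that by simp
    qed
  qed
qed

section \<open>The morphism\<close>

context del_pezzo
begin

definition pair_fns :: "(vec5 \<times> vec5 \<Rightarrow> complex) set" where
  "pair_fns = range (\<lambda>i p. fst p $ i) \<union> range (\<lambda>i p. snd p $ i)"

abbreviation "XP \<equiv> quasi_affine Pairs pair_fns"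
abbreviation "XT \<equiv> cotangent_bundle Q1 Q2"

lemma XT_eq: "XT = quotient_variety XP \<pi> E"
  by (simp add: cotangent_bundle_def pair_fns_def)

lemma \<pi>_image: "w \<in> Pairs \<Longrightarrow> \<pi> w \<in> E"
  using \<pi>_in_E[of "fst w" "snd w"] by simp

lemma ringed_space_XT: "ringed_space XT"
  unfolding XT_eq by (rule ringed_space.ringed_space_quotient[OF ringed_space_quasi_affine])

lemma points_XT [simp]: "points XT = E"
  unfolding XT_eq by (rule points_quotient_variety) (auto simp: \<pi>_image)

lemma openin_XT: "openin (zariski XT) U \<longleftrightarrow> U \<subseteq> E \<and> openin (zariski XP) {w \<in> Pairs. \<pi> w \<in> U}"
  unfolding XT_eq openin_quotient_variety by simp

lemma regular_XT: "f \<in> regular XT U \<longleftrightarrow> f \<circ> \<pi> \<in> regular XP {w \<in> Pairs. \<pi> w \<in> U}"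
  unfolding XT_eq regular_quotient_variety by simp

lemma polyvec_pair: "polyvec pair_fns fst" "polyvec pair_fns snd"
  unfolding polyvec_def by (auto intro!: polynomial_gen simp: pair_fns_def)

lemma E_chart:
  assumes "p \<in> E"
  obtains e f u1 u2 y \<eta> where "(y, \<eta>) \<in> Pairs" "\<pi> (y, \<eta>) = p" "u1 \<in> T y" "y \<in> chart.V Q1 Q2 e f u1 u2"
    "\<not> (B1 u1 u1 = 0 \<and> B2 u1 u1 = 0)"
proof -
  obtain l \<xi> where p: "p = (l, \<xi>)" by (cases p)
  then obtain y where y: "y \<in> K" "l = vec.span {y}"
    using assms by (auto simp: cotangent_points_def surface_def)
  obtain e f u1 u2 where ch: "D e f y \<noteq> 0" "u1 \<in> T y" "u2 \<in> T y" "det5 y u1 u2 e f \<noteq> 0" "\<not> (B1 u1 u1 = 0 \<and> B2 u1 u1 = 0)"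
    using chart_vectors_exist[OF y(1)] by metis
  interpret C: chart Q1 Q2 e f u1 u2 by unfold_locales
  have yV: "y \<in> C.V" using y ch by (simp add: C.in_V)
  then obtain \<eta> where "(y, \<eta>) \<in> Pairs" "\<pi> (y, \<eta>) = p"
    using C.\<pi>_surj_V[of l \<xi> y] assms p y(2) by blast
  then show ?thesis using that yV ch by blast
qed

end

context chart
begin

lemma polynomial_pair_De: "polynomial_in pair_fns (\<lambda>w. De (fst w) * \<delta> (fst w))"
  by (intro polynomial_mult polynomial_D polynomial_det5 polyvec_pair polyvec_const)

lemma \<Phi>_\<pi>_substitution:
  assumes "polynomial_in {fst, snd} F"
  shows "\<exists>N k. polynomial_in pair_fns N \<and>
    (\<forall>w\<in>{w \<in> Pairs. fst w \<in> V}. F (\<Phi> (\<pi> w)) = N w / (De (fst w) * \<delta> (fst w)) ^ (k::nat))"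
proof (rule rational_substitution[OF assms polynomial_pair_De])
  show "De (fst z) * \<delta> (fst z) \<noteq> 0" if "z \<in> {w \<in> Pairs. fst w \<in> V}" for z using that by (simp add: in_V)
  \<comment> \<open>The tangent vector of \<open>\<Phi>_\<pi>_V\<close> with its denominator
    cleared. The forms are quadratic, so the square of the denominator reappears.\<close>
  define v where "v = (\<lambda>w. dot (snd w) (\<theta>2 (fst w)) *s \<theta>1 (fst w) - dot (snd w) (\<theta>1 (fst w)) *s \<theta>2 (fst w))"
  have v: "polyvec pair_fns v"
    unfolding v_def by (intro polyvec_diff polyvec_smult polynomial_dot polyvec_proj polyvec_pair)
  have eq: "\<Phi> (\<pi> w) = (quad Q1 (v w) / (De (fst w) * \<delta> (fst w)) ^ 2, quad Q2 (v w) / (De (fst w) * \<delta> (fst w)) ^ 2)"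
    if w: "w \<in> {w \<in> Pairs. fst w \<in> V}" for w
  proof -
    let ?c = "De (fst w) * \<delta> (fst w)"
    have "(dot (snd w) (\<theta>2 (fst w)) / ?c) *s \<theta>1 (fst w) + (- dot (snd w) (\<theta>1 (fst w)) / ?c) *s \<theta>2 (fst w) = (1 / ?c) *s v w"
      by (simp add: v_def vec_eq_iff diff_divide_distrib)
    then have "\<Phi> (\<pi> w) = (quad Q1 ((1 / ?c) *s v w), quad Q2 ((1 / ?c) *s v w))"
      using \<Phi>_\<pi>_V[of "fst w" "snd w"] w by simp
    then show ?thesis by (simp add: power2_eq_square)
  qed
  fix c :: "complex \<times> complex \<Rightarrow> complex" assume "c \<in> {fst, snd}"
  then consider "c = fst" | "c = snd" by blast
  then show "\<exists>N k. polynomial_in pair_fns N \<and> (\<forall>z\<in>{w \<in> Pairs. fst w \<in> V}. c (\<Phi> (\<pi> z)) = N z / (De (fst z) * \<delta> (fst z)) ^ k)"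
  proof cases
    case 1
    then show ?thesis using eq polynomial_bilin[OF v v, of Q1]
      by (intro exI[of _ "\<lambda>w. quad Q1 (v w)"] exI[of _ 2]) simp
  next
    case 2
    then show ?thesis using eq polynomial_bilin[OF v v, of Q2]
      by (intro exI[of _ "\<lambda>w. quad Q2 (v w)"] exI[of _ 2]) simp
  qed
qed

end

context del_pezzo
begin

lemma \<Phi>_\<pi>_rational:
  assumes w0: "w0 \<in> Pairs"
  obtains h where "polynomial_in pair_fns h" "h w0 \<noteq> 0"
    "\<And>F. polynomial_in {fst, snd} F \<Longrightarrow> \<exists>N k. polynomial_in pair_fns N \<and> (\<forall>w\<in>Pairs. h w \<noteq> 0 \<longrightarrow> F (\<Phi> (\<pi> w)) = N w / h w ^ (k::nat))"
proof -
  have y: "fst w0 \<in> K" using w0 in_Pairs[of "fst w0" "snd w0"] by simp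
  obtain e f u1 u2 where ch: "D e f (fst w0) \<noteq> 0" "det5 (fst w0) u1 u2 e f \<noteq> 0"
    using chart_vectors_exist[OF y] by metis
  interpret C: chart Q1 Q2 e f u1 u2 by unfold_locales
  have V: "fst w \<in> C.V" if "w \<in> Pairs" "C.De (fst w) * C.\<delta> (fst w) \<noteq> 0" for w
    using that in_Pairs[of "fst w" "snd w"] by (simp add: C.in_V)
  show ?thesis
  proof (rule that[OF C.polynomial_pair_De])
    show "C.De (fst w0) * C.\<delta> (fst w0) \<noteq> 0" using ch by simp
    show "\<exists>N k. polynomial_in pair_fns N \<and> (\<forall>w\<in>Pairs. C.De (fst w) * C.\<delta> (fst w) \<noteq> 0 \<longrightarrow> F (\<Phi> (\<pi> w)) = N w / (C.De (fst w) * C.\<delta> (fst w)) ^ (k::nat))"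
      if F: "polynomial_in {fst, snd} F" for F
      using C.\<Phi>_\<pi>_substitution[OF F] V by blast
  qed
qed

text \<open>Open sets and regular functions of the bundle are tested on pairs, where polynomials in
  the coordinates of \<Phi> are locally polynomials divided by powers of one
  \<open>h\<close>.\<close>

lemma is_morphism_\<Phi>: "is_morphism XT affine_plane \<Phi>"
  unfolding is_morphism_def continuous_map
proof (intro conjI allI impI)
  show "\<Phi> ` points XT \<subseteq> points affine_plane" by simp
next
  fix U assume U: "openin (zariski affine_plane) U"
  have "openin (zariski XP) {w \<in> Pairs. \<Phi> (\<pi> w) \<in> U}"
  proof (subst openin_subopen, intro ballI)
    fix w0 assume w0: "w0 \<in> {w \<in> Pairs. \<Phi> (\<pi> w) \<in> U}"
    obtain g where g: "polynomial_in {fst, snd} g" "g (\<Phi> (\<pi> w0)) \<noteq> 0" "{q \<in> UNIV. g q \<noteq> 0} \<subseteq> U"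
      using openin_quasi_affine_contains_basic[of UNIV "{fst, snd}" U "\<Phi> (\<pi> w0)"] U w0 unfolding affine_plane_def by blast
    obtain h where h: "polynomial_in pair_fns h" "h w0 \<noteq> 0"
      and sub: "\<And>F. polynomial_in {fst, snd} F \<Longrightarrow> \<exists>N k. polynomial_in pair_fns N \<and> (\<forall>w\<in>Pairs. h w \<noteq> 0 \<longrightarrow> F (\<Phi> (\<pi> w)) = N w / h w ^ (k::nat))"
      using \<Phi>_\<pi>_rational w0 by blast
    obtain N k where N: "polynomial_in pair_fns N" "\<And>w. w \<in> Pairs \<Longrightarrow> h w \<noteq> 0 \<Longrightarrow> g (\<Phi> (\<pi> w)) = N w / h w ^ (k::nat)"
      using sub[OF g(1)] by blast
    show "\<exists>T. openin (zariski XP) T \<and> w0 \<in> T \<and> T \<subseteq> {w \<in> Pairs. \<Phi> (\<pi> w) \<in> U}"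
    proof (intro exI conjI)
      show "openin (zariski XP) {w \<in> Pairs. N w * h w \<noteq> 0}"
        using N h by (intro openin_quasi_affine_basic polynomial_mult)
      show "w0 \<in> {w \<in> Pairs. N w * h w \<noteq> 0}" using N(2)[of w0] w0 h(2) g(2) by auto
      show "{w \<in> Pairs. N w * h w \<noteq> 0} \<subseteq> {w \<in> Pairs. \<Phi> (\<pi> w) \<in> U}" using N(2) g(3) by auto
    qed
  qed
  moreover have "{w \<in> Pairs. \<pi> w \<in> {p \<in> E. \<Phi> p \<in> U}} = {w \<in> Pairs. \<Phi> (\<pi> w) \<in> U}" using \<pi>_image by auto
  ultimately show "openin (zariski XT) {x \<in> points XT. \<Phi> x \<in> U}" by (simp add: openin_XT)
next
  fix U f assume U: "openin (zariski affine_plane) U" and f: "f \<in> regular affine_plane U"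
  show "f \<circ> \<Phi> \<in> regular XT {p \<in> points XT. \<Phi> p \<in> U}"
    unfolding regular_XT
  proof (rule regular_quasi_affineI)
    fix w0 assume "w0 \<in> {w \<in> Pairs. \<pi> w \<in> {p \<in> points XT. \<Phi> p \<in> U}}"
    then have w0: "w0 \<in> Pairs" "\<Phi> (\<pi> w0) \<in> U" by auto
    have "f \<in> regular (quasi_affine UNIV {fst, snd}) U" using f by (simp add: affine_plane_def)
    then obtain G H where GH: "polynomial_in {fst, snd} G" "polynomial_in {fst, snd} H" "H (\<Phi> (\<pi> w0)) \<noteq> 0"
      "\<And>q. q \<in> U \<Longrightarrow> H q \<noteq> 0 \<Longrightarrow> f q = G q / H q"
      using regular_quasi_affineD[of f UNIV "{fst, snd}" U "\<Phi> (\<pi> w0)"] w0(2) by blast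
    obtain h where h: "polynomial_in pair_fns h" "h w0 \<noteq> 0"
      and sub: "\<And>F. polynomial_in {fst, snd} F \<Longrightarrow> \<exists>N k. polynomial_in pair_fns N \<and> (\<forall>w\<in>Pairs. h w \<noteq> 0 \<longrightarrow> F (\<Phi> (\<pi> w)) = N w / h w ^ (k::nat))"
      using \<Phi>_\<pi>_rational w0 by blast
    obtain N k where N: "polynomial_in pair_fns N" "\<And>w. w \<in> Pairs \<Longrightarrow> h w \<noteq> 0 \<Longrightarrow> G (\<Phi> (\<pi> w)) = N w / h w ^ (k::nat)"
      using sub[OF GH(1)] by blast
    obtain M l where M: "polynomial_in pair_fns M" "\<And>w. w \<in> Pairs \<Longrightarrow> h w \<noteq> 0 \<Longrightarrow> H (\<Phi> (\<pi> w)) = M w / h w ^ (l::nat)"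
      using sub[OF GH(2)] by blast
    show "\<exists>g g'. polynomial_in pair_fns g \<and> polynomial_in pair_fns g' \<and> g' w0 \<noteq> 0 \<and>
      (\<forall>q\<in>{w \<in> Pairs. \<pi> w \<in> {p \<in> points XT. \<Phi> p \<in> U}}. g' q \<noteq> 0 \<longrightarrow> (f \<circ> \<Phi> \<circ> \<pi>) q = g q / g' q)"
    proof (intro exI conjI ballI impI)
      \<comment> \<open>One extra factor \<open>h\<close> above and below: without it the
        denominator could be nonzero at zeros of \<open>h\<close>, where the formulas with
        \<open>N\<close> and \<open>M\<close> say nothing.\<close>
      show "polynomial_in pair_fns (\<lambda>w. N w * h w ^ Suc l)" "polynomial_in pair_fns (\<lambda>w. M w * h w ^ Suc k)"
        by (rule polynomial_mult[OF N(1) polynomial_power[OF h(1)]], rule polynomial_mult[OF M(1) polynomial_power[OF h(1)]])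
      show "M w0 * h w0 ^ Suc k \<noteq> 0" using M(2)[OF w0(1) h(2)] GH(3) h(2) by auto
      fix w assume "w \<in> {w \<in> Pairs. \<pi> w \<in> {p \<in> points XT. \<Phi> p \<in> U}}" and nz: "M w * h w ^ Suc k \<noteq> 0"
      then have w: "w \<in> Pairs" "\<Phi> (\<pi> w) \<in> U" "h w \<noteq> 0" "M w \<noteq> 0" by auto
      have "H (\<Phi> (\<pi> w)) \<noteq> 0" using M(2)[OF w(1,3)] w by simp
      then have "f (\<Phi> (\<pi> w)) = (N w / h w ^ k) / (M w / h w ^ l)"
        using GH(4)[OF w(2)] N(2)[OF w(1,3)] M(2)[OF w(1,3)] by simp
      then show "(f \<circ> \<Phi> \<circ> \<pi>) w = N w * h w ^ Suc l / (M w * h w ^ Suc k)"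
        using w by (simp add: field_simps)
    qed
  qed
qed

end

section \<open>Flatness\<close>

context good_chart
begin

lemma \<beta>_substitution:
  assumes "polynomial_in pair_fns F"
  shows "\<exists>N k. polynomial_in coord_fns N \<and> (\<forall>z\<in>{z. fst z \<in> V}. F (\<beta> z) = N z / De (fst z) ^ (k::nat))"
proof (rule rational_substitution[OF assms])
  show "polynomial_in coord_fns (\<lambda>z. De (fst z))" by (intro polynomial_D polyvec_base)
  show "De (fst z) \<noteq> 0" if "z \<in> {z. fst z \<in> V}" for z :: "vec5 \<times> complex \<times> complex" using that by (simp add: in_V)
  fix c assume "c \<in> pair_fns"
  then consider i where "c = (\<lambda>p. fst p $ i)" | i where "c = (\<lambda>p. snd p $ i)" by (auto simp: pair_fns_def)
  then show "\<exists>N k. polynomial_in coord_fns N \<and> (\<forall>z\<in>{z. fst z \<in> V}. c (\<beta> z) = N z / De (fst z) ^ k)"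
  proof cases
    case 1
    show ?thesis using polyvec_base(1) unfolding 1 polyvec_def
      by (intro exI[of _ "\<lambda>z. fst z $ i"] exI[of _ 0]) (simp add: \<beta>_def)
  next
    case 2
    have "polyvec coord_fns vec_of"
      unfolding vec_of_def by (intro polyvec_add polyvec_smult polyvec_proj polyvec_base polynomial_q)
    then have "polynomial_in coord_fns (\<lambda>z. det5 (fst z) (vec_of z) (axis i 1) e f)"
      by (intro polynomial_det5 polyvec_base polyvec_const)
    then show ?thesis unfolding 2
      by (intro exI[of _ "\<lambda>z. det5 (fst z) (vec_of z) (axis i 1) e f"] exI[of _ 1]) (simp add: \<beta>_def eta_def)
  qed
qed

lemma coords_substitution:
  assumes "polynomial_in coord_fns F"
  shows "\<exists>N k. polynomial_in pair_fns N \<and>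
    (\<forall>w\<in>{w \<in> Pairs. fst w \<in> V}. F (coords (\<pi> w)) = N w / (De (fst w) * \<delta> (fst w)) ^ (k::nat))"
proof (rule rational_substitution[OF assms polynomial_pair_De])
  show "De (fst z) * \<delta> (fst z) \<noteq> 0" if "z \<in> {w \<in> Pairs. fst w \<in> V}" for z using that by (simp add: in_V)
  have co: "coords (\<pi> w) = ((1 / \<delta> (fst w)) *s fst w, \<delta> (fst w) * dot (snd w) (\<theta>2 (fst w)) / De (fst w),
      - (\<delta> (fst w) * dot (snd w) (\<theta>1 (fst w))) / De (fst w))"
    and nz: "De (fst w) \<noteq> 0" "\<delta> (fst w) \<noteq> 0" if "w \<in> {w \<in> Pairs. fst w \<in> V}" for w
    using coords_\<pi>[of "fst w" "snd w"] that by (auto simp: in_V)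
  have pd: "polynomial_in pair_fns (\<lambda>w. De (fst w))" "polynomial_in pair_fns (\<lambda>w. \<delta> (fst w))"
    "polynomial_in pair_fns (\<lambda>w. dot (snd w) (proj e f (fst w) u))" "polynomial_in pair_fns (\<lambda>w. fst w $ i)" for u i
    using polyvec_pair(1) unfolding polyvec_def[of _ fst]
    by (auto intro!: polynomial_D polynomial_det5 polyvec_pair polyvec_const polynomial_dot polyvec_proj)
  fix c assume "c \<in> coord_fns"
  then consider i where "c = (\<lambda>z. fst z $ i)" | "c = (\<lambda>z. fst (snd z))" | "c = (\<lambda>z. snd (snd z))" by (auto simp: coord_fns_def)
  then show "\<exists>N k. polynomial_in pair_fns N \<and> (\<forall>z\<in>{w \<in> Pairs. fst w \<in> V}. c (coords (\<pi> z)) = N z / (De (fst z) * \<delta> (fst z)) ^ k)"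
  proof cases
    case 1
    show ?thesis unfolding 1 using pd co nz
      by (intro exI[of _ "\<lambda>w. De (fst w) * fst w $ i"] exI[of _ 1]) (auto intro!: polynomial_mult)
  next
    case 2
    show ?thesis unfolding 2 using pd co nz
      by (intro exI[of _ "\<lambda>w. \<delta> (fst w) * \<delta> (fst w) * dot (snd w) (\<theta>2 (fst w))"] exI[of _ 1]) (auto intro!: polynomial_mult)
  next
    case 3
    show ?thesis unfolding 3 using pd co nz
      by (intro exI[of _ "\<lambda>w. - (\<delta> (fst w) * \<delta> (fst w) * dot (snd w) (\<theta>1 (fst w)))"] exI[of _ 1])
        (auto intro!: polynomial_mult polynomial_minus)
  qed
qed

lemma Z_subset: "z \<in> Z \<Longrightarrow> fst z \<in> V" "z \<in> Z \<Longrightarrow> De (fst z) \<noteq> 0"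
  by (auto simp: Z_def in_V)

lemma open_pullback_Z:
  assumes U: "openin (zariski XT) U" and z0: "z0 \<in> Z" "\<pi> (\<beta> z0) \<in> U"
  shows "\<exists>L. polynomial_in coord_fns L \<and> L z0 \<noteq> 0 \<and> (\<forall>z\<in>Z. L z \<noteq> 0 \<longrightarrow> \<pi> (\<beta> z) \<in> U)"
proof -
  have P: "\<beta> z \<in> Pairs" if "z \<in> Z" for z using \<beta>_Pairs Z_subset(1)[OF that] in_V by blast
  obtain h where h: "polynomial_in pair_fns h" "h (\<beta> z0) \<noteq> 0" "{q \<in> Pairs. h q \<noteq> 0} \<subseteq> {w \<in> Pairs. \<pi> w \<in> U}"
    using openin_quasi_affine_contains_basic[of Pairs pair_fns "{w \<in> Pairs. \<pi> w \<in> U}" "\<beta> z0"] U z0 P[OF z0(1)]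
    by (auto simp: openin_XT)
  obtain N k where N: "polynomial_in coord_fns N" "\<And>z. fst z \<in> V \<Longrightarrow> h (\<beta> z) = N z / De (fst z) ^ (k::nat)"
    using \<beta>_substitution[OF h(1)] by blast
  have "N z0 \<noteq> 0" using N(2)[of z0] h(2) Z_subset[OF z0(1)] by auto
  moreover have "\<pi> (\<beta> z) \<in> U" if "z \<in> Z" "N z \<noteq> 0" for z
    using N(2)[of z] Z_subset[OF that(1)] that(2) P[OF that(1)] h(3) by auto
  ultimately show ?thesis using N(1) by blast
qed

lemma regular_pullback_Z:
  assumes U: "openin (zariski XT) U" and z0: "z0 \<in> Z" "\<pi> (\<beta> z0) \<in> U" and m: "m \<in> regular XT U"
  shows "\<exists>F L. polynomial_in coord_fns F \<and> polynomial_in coord_fns L \<and> L z0 \<noteq> 0 \<and>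
    (\<forall>z\<in>Z. L z \<noteq> 0 \<longrightarrow> \<pi> (\<beta> z) \<in> U \<longrightarrow> m (\<pi> (\<beta> z)) = F z / L z)"
proof -
  have P: "\<beta> z \<in> Pairs" if "z \<in> Z" for z using \<beta>_Pairs Z_subset(1)[OF that] in_V by blast
  have "m \<circ> \<pi> \<in> regular XP {w \<in> Pairs. \<pi> w \<in> U}" using m by (simp add: regular_XT)
  moreover have "\<beta> z0 \<in> {w \<in> Pairs. \<pi> w \<in> U}" using z0 P by auto
  ultimately obtain G H where GH: "polynomial_in pair_fns G" "polynomial_in pair_fns H" "H (\<beta> z0) \<noteq> 0"
    "\<And>q. q \<in> {w \<in> Pairs. \<pi> w \<in> U} \<Longrightarrow> H q \<noteq> 0 \<Longrightarrow> (m \<circ> \<pi>) q = G q / H q"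
    using regular_quasi_affineD[of "m \<circ> \<pi>" Pairs pair_fns "{w \<in> Pairs. \<pi> w \<in> U}" "\<beta> z0"] by blast
  obtain N k where N: "polynomial_in coord_fns N" "\<And>z. fst z \<in> V \<Longrightarrow> G (\<beta> z) = N z / De (fst z) ^ (k::nat)"
    using \<beta>_substitution[OF GH(1)] by blast
  obtain M l where M: "polynomial_in coord_fns M" "\<And>z. fst z \<in> V \<Longrightarrow> H (\<beta> z) = M z / De (fst z) ^ (l::nat)"
    using \<beta>_substitution[OF GH(2)] by blast
  have De: "polynomial_in coord_fns (\<lambda>z. De (fst z))" by (intro polynomial_D polyvec_base)
  show ?thesis
  proof (intro exI conjI ballI impI)
    show "polynomial_in coord_fns (\<lambda>z. N z * De (fst z) ^ l)" "polynomial_in coord_fns (\<lambda>z. M z * De (fst z) ^ k)"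
      by (rule polynomial_mult[OF N(1) polynomial_power[OF De]], rule polynomial_mult[OF M(1) polynomial_power[OF De]])
    show "M z0 * De (fst z0) ^ k \<noteq> 0" using M(2)[of z0] GH(3) Z_subset[OF z0(1)] by auto
    fix z assume z: "z \<in> Z" "M z * De (fst z) ^ k \<noteq> 0" "\<pi> (\<beta> z) \<in> U"
    note V = Z_subset[OF z(1)]
    have "H (\<beta> z) \<noteq> 0" using M(2)[OF V(1)] z(2) V(2) by simp
    then have "m (\<pi> (\<beta> z)) = (N z / De (fst z) ^ k) / (M z / De (fst z) ^ l)"
      using GH(4)[of "\<beta> z"] P[OF z(1)] z(3) N(2)[OF V(1)] M(2)[OF V(1)] by simp
    then show "m (\<pi> (\<beta> z)) = N z * De (fst z) ^ l / (M z * De (fst z) ^ k)" by simp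
  qed
qed

lemma common_denominator_Z:
  assumes U: "openin (zariski XT) U" and z0: "z0 \<in> Z" "\<pi> (\<beta> z0) \<in> U" and m: "\<And>i. i < (n::nat) \<Longrightarrow> m i \<in> regular XT U"
  shows "\<exists>F L. (\<forall>i<n. polynomial_in coord_fns (F i)) \<and> polynomial_in coord_fns L \<and> L z0 \<noteq> 0 \<and>
    (\<forall>z\<in>Z. L z \<noteq> 0 \<longrightarrow> \<pi> (\<beta> z) \<in> U \<and> (\<forall>i<n. m i (\<pi> (\<beta> z)) = F i z / L z))"
  using m
proof (induction n)
  case 0
  show ?case using open_pullback_Z[OF U z0] by auto
next
  case (Suc n)
  then obtain F L where FL: "\<And>i. i < n \<Longrightarrow> polynomial_in coord_fns (F i)" "polynomial_in coord_fns L" "L z0 \<noteq> 0"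
    and L: "\<And>z. z \<in> Z \<Longrightarrow> L z \<noteq> 0 \<Longrightarrow> \<pi> (\<beta> z) \<in> U"
    "\<And>z i. z \<in> Z \<Longrightarrow> L z \<noteq> 0 \<Longrightarrow> i < n \<Longrightarrow> m i (\<pi> (\<beta> z)) = F i z / L z"
    by (metis less_SucI)
  obtain F' L' where F'L': "polynomial_in coord_fns F'" "polynomial_in coord_fns L'" "L' z0 \<noteq> 0"
    "\<And>z. z \<in> Z \<Longrightarrow> L' z \<noteq> 0 \<Longrightarrow> \<pi> (\<beta> z) \<in> U \<Longrightarrow> m n (\<pi> (\<beta> z)) = F' z / L' z"
    using regular_pullback_Z[OF U z0 Suc.prems[of n]] by blast
  define F'' where "F'' = (\<lambda>i z. if i = n then F' z * L z else F i z * L' z)"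
  show ?case
  proof (intro exI conjI allI impI ballI)
    show "polynomial_in coord_fns (F'' i)" if "i < Suc n" for i
    proof (cases "i = n")
      case True
      then show ?thesis using polynomial_mult[OF F'L'(1) FL(2)] by (simp add: F''_def)
    next
      case False
      then show ?thesis using polynomial_mult[OF FL(1)[of i] F'L'(2)] that by (simp add: F''_def)
    qed
    show "polynomial_in coord_fns (\<lambda>z. L z * L' z)" using FL F'L' by (intro polynomial_mult)
    show "L z0 * L' z0 \<noteq> 0" using FL F'L' by simp
    fix z assume z: "z \<in> Z" "L z * L' z \<noteq> 0"
    then show "\<pi> (\<beta> z) \<in> U" using L(1) by simp
    show "m i (\<pi> (\<beta> z)) = F'' i z / (L z * L' z)" if "i < Suc n" for i
    proof (cases "i = n")
      case True
      then show ?thesis using F'L'(4)[OF z(1)] L(1)[OF z(1)] z(2) by (simp add: F''_def)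
    next
      case False
      then show ?thesis using L(2)[OF z(1), of i] z(2) that by (simp add: F''_def)
    qed
  qed
qed

lemma lead_scale: "lead (c *s y) = c ^ 4 * lead y"
  by (simp add: proj_scale power_numeral_reduce mult_ac power2_eq_square)

lemma coords_in_Z:
  assumes "(y, \<eta>) \<in> Pairs" "y \<in> V" "lead y \<noteq> 0"
  shows "coords (\<pi> (y, \<eta>)) \<in> Z"
proof -
  have "fst (coords (\<pi> (y, \<eta>))) = (1 / \<delta> y) *s y" using coords_\<pi>[OF assms(1,2)] by simp
  then show ?thesis
    using fst_coords_\<pi>[OF assms(1,2)] assms(2,3) by (simp add: Z_def lead_scale in_V)
qed

text \<open>A relation near \<open>p\<close> is pulled back along \<beta> and \<open>\<pi>\<close>
  to \<open>Z\<close>, where clearing denominators makes it polynomial and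
  \<open>equational_criterion_functions\<close> solves it. The solution is carried back to the
  bundle by \<open>coords\<close>.\<close>

lemma equational_criterion_at:
  assumes w0: "(y0, \<eta>0) \<in> Pairs" "y0 \<in> V" "lead y0 \<noteq> 0"
  defines "p \<equiv> \<pi> (y0, \<eta>0)"
  shows "equational_criterion (local_ring affine_plane (\<Phi> p)) (restrict_scalars (pullback_germ XT \<Phi> p) (local_ring XT p))"
proof -
  interpret M: space_morphism XT affine_plane \<Phi>
    by (intro space_morphism.intro space_morphism_axioms.intro ringed_space_XT ringed_space_affine_plane is_morphism_\<Phi>)
  have pE: "p \<in> points XT" unfolding p_def using \<pi>_in_E[OF w0(1)] by simp
  define z0 where "z0 = coords p"
  have z0: "z0 \<in> Z" unfolding z0_def p_def by (rule coords_in_Z[OF w0])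
  have \<pi>\<beta>z0: "\<pi> (\<beta> z0) = p" unfolding z0_def p_def by (rule \<pi>_\<beta>_coords_\<pi>[OF w0(1,2)])
  interpret A: regular_algebra Z Pol \<Phi>' z0 by (rule regular_algebra_Z[OF z0])
  show ?thesis
  proof (rule M.equational_criterion_germs[OF pE])
    fix n :: nat and U m V' r
    assume U: "openin (zariski XT) U" "p \<in> U" and V': "openin (zariski affine_plane) V'" "\<Phi> p \<in> V'"
      and UV: "U \<subseteq> {q \<in> points XT. \<Phi> q \<in> V'}" and m: "\<And>i. i < n \<Longrightarrow> m i \<in> regular XT U"
      and r: "\<And>i. i < n \<Longrightarrow> r i \<in> regular affine_plane V'"
      and rel: "\<And>q. q \<in> U \<Longrightarrow> (\<Sum>i<n. r i (\<Phi> q) * m i q) = 0"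
    have z0U: "\<pi> (\<beta> z0) \<in> U" using \<pi>\<beta>z0 U(2) by simp
    have "\<exists>F L. (\<forall>i<n. polynomial_in coord_fns (F i)) \<and> polynomial_in coord_fns L \<and> L z0 \<noteq> 0 \<and>
        (\<forall>z\<in>Z. L z \<noteq> 0 \<longrightarrow> \<pi> (\<beta> z) \<in> U \<and> (\<forall>i<n. m i (\<pi> (\<beta> z)) = F i z / L z))"
      (is "\<exists>F L. ?FL F L")
      using m by (rule common_denominator_Z[OF U(1) z0 z0U])
    then obtain F L where FL: "?FL F L" by (elim exE) (rule that)
    have F: "\<And>i. i < n \<Longrightarrow> polynomial_in coord_fns (F i)" and L: "polynomial_in coord_fns L" "L z0 \<noteq> 0"
      and LU: "\<And>z. z \<in> Z \<Longrightarrow> L z \<noteq> 0 \<Longrightarrow> \<pi> (\<beta> z) \<in> U"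
      and mF: "\<And>z i. z \<in> Z \<Longrightarrow> L z \<noteq> 0 \<Longrightarrow> i < n \<Longrightarrow> m i (\<pi> (\<beta> z)) = F i z / L z"
      using FL by blast+
    have "\<exists>g b. eval2 b (\<Phi> p) \<noteq> 0 \<and> (\<forall>x. eval2 b x \<noteq> 0 \<longrightarrow> x \<in> V' \<and> (\<forall>i<n. r i x = eval2 (g i) x / eval2 b x))"
      (is "\<exists>g b. ?gb g b")
      using r by (rule affine_plane_common_denominator[OF V'])
    then obtain g b where gb: "?gb g b" by (elim exE) (rule that)
    have b: "eval2 b (\<Phi> p) \<noteq> 0" and bV: "\<And>x. eval2 b x \<noteq> 0 \<Longrightarrow> x \<in> V'"
      and rg: "\<And>x i. eval2 b x \<noteq> 0 \<Longrightarrow> i < n \<Longrightarrow> r i x = eval2 (g i) x / eval2 b x"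
      using gb by blast+
    have \<Phi>'z: "\<Phi> (\<pi> (\<beta> z)) = \<Phi>' z" if "z \<in> Z" for z using \<Phi>_\<pi>_\<beta> Z_subset that by blast
    \<comment> \<open>Multiplying by the denominators makes the relation hold on all of
      \<open>Z\<close>: where they vanish it is trivial.\<close>
    define bL where "bL = (\<lambda>z. eval2 b (\<Phi>' z) * L z)"
    have bL: "polynomial_in coord_fns bL" unfolding bL_def by (intro polynomial_mult eval2_\<Phi>'_Pol L)
    have bL0: "bL z0 \<noteq> 0" using b L \<Phi>'z[OF z0] \<pi>\<beta>z0 by (simp add: bL_def)
    have P: "(\<lambda>z. bL z * F i z) \<in> Pol" if "i < n" for i using polynomial_mult[OF bL F[OF that]] by simp
    have Zrel: "(\<Sum>i<n. eval2 (g i) (\<Phi>' z) * (bL z * F i z)) = 0" if z: "z \<in> Z" for z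
    proof (cases "bL z = 0")
      case False
      then have nz: "eval2 b (\<Phi>' z) \<noteq> 0" "L z \<noteq> 0" by (auto simp: bL_def)
      have "0 = (\<Sum>i<n. r i (\<Phi>' z) * m i (\<pi> (\<beta> z)))"
        using rel[OF LU[OF z nz(2)]] \<Phi>'z[OF z] by simp
      also have "\<dots> = (\<Sum>i<n. eval2 (g i) (\<Phi>' z) * F i z / bL z)"
        using rg[OF nz(1)] mF[OF z nz(2)] by (intro sum.cong) (auto simp: bL_def)
      also have "\<dots> = (\<Sum>i<n. eval2 (g i) (\<Phi>' z) * F i z) / bL z" by (simp add: sum_divide_distrib)
      finally have "(\<Sum>i<n. eval2 (g i) (\<Phi>' z) * F i z) = 0" using False by simp
      moreover have "(\<Sum>i<n. eval2 (g i) (\<Phi>' z) * (bL z * F i z)) = bL z * (\<Sum>i<n. eval2 (g i) (\<Phi>' z) * F i z)"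
        by (simp add: sum_distrib_left mult_ac)
      ultimately show ?thesis by simp
    qed simp
    obtain H and k :: nat and c fj where H: "H \<in> Pol" "H z0 \<noteq> 0" and fj: "\<And>j. j < k \<Longrightarrow> fj j \<in> Pol"
      and HF: "\<And>i z. i < n \<Longrightarrow> z \<in> Z \<Longrightarrow> H z * (bL z * F i z) = (\<Sum>j<k. eval2 (c i j) (\<Phi>' z) * fj j z)"
      and gc: "\<And>j. j < k \<Longrightarrow> (\<Sum>i<n. g i * c i j) = 0"
      using A.equational_criterion_functions[of n "\<lambda>i z. bL z * F i z" g, OF P Zrel] by blast
    \<comment> \<open>The product of all functions to be inverted: \<open>L\<close> from the
      pullback of the \<open>m i\<close>, \<open>bL\<close> from clearing denominators,
      \<open>H\<close> from localising at \<open>z0\<close>.\<close>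
    define \<Lambda> where "\<Lambda> = (\<lambda>z. H z * bL z * L z)"
    have \<Lambda>: "polynomial_in coord_fns \<Lambda>" unfolding \<Lambda>_def using H(1) bL L(1) by (intro polynomial_mult) auto
    have \<Lambda>0: "\<Lambda> z0 \<noteq> 0" using H(2) bL0 L(2) by (simp add: \<Lambda>_def)
    have mc: "m i (\<pi> (\<beta> z)) = (\<Sum>j<k. eval2 (c i j) (\<Phi>' z) * (fj j z / \<Lambda> z))"
      if z: "z \<in> Z" "\<Lambda> z \<noteq> 0" and i: "i < n" for z i
    proof -
      have nz: "H z \<noteq> 0" "bL z \<noteq> 0" "L z \<noteq> 0" using z(2) by (auto simp: \<Lambda>_def)
      have "m i (\<pi> (\<beta> z)) = H z * (bL z * F i z) / \<Lambda> z"
        using mF[OF z(1) nz(3) i] nz by (simp add: \<Lambda>_def)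
      also have "\<dots> = (\<Sum>j<k. eval2 (c i j) (\<Phi>' z) * (fj j z / \<Lambda> z))"
        unfolding HF[OF i z(1)] by (simp add: sum_divide_distrib)
      finally show ?thesis .
    qed
    \<comment> \<open>A set of points of the bundle, hence stated through some vector of the line.
      The conditions are stable under scaling, so every nonzero vector of the line may serve, and
      \<open>Pre\<close> identifies the preimage with a principal open set.\<close>
    define W where "W = {q \<in> E. (\<exists>y\<in>fst q. y \<in> V \<and> lead y \<noteq> 0) \<and> \<Lambda> (coords q) \<noteq> 0}"
    have \<pi>W: "\<pi> w \<in> W \<longleftrightarrow> fst w \<in> V \<and> lead (fst w) \<noteq> 0 \<and> \<Lambda> (coords (\<pi> w)) \<noteq> 0" if w: "w \<in> Pairs" for w
    proof -
      have "fst (\<pi> w) = vec.span {fst w}" using fst_\<pi>[of "fst w" "snd w"] by simp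
      moreover have "(\<exists>y\<in>vec.span {fst w}. y \<in> V \<and> lead y \<noteq> 0) \<longleftrightarrow> fst w \<in> V \<and> lead (fst w) \<noteq> 0"
      proof
        assume "\<exists>y\<in>vec.span {fst w}. y \<in> V \<and> lead y \<noteq> 0"
        then obtain a where a: "a *s fst w \<in> V" "lead (a *s fst w) \<noteq> 0" by (auto simp: span_singleton_vec)
        then have "a \<noteq> 0" by (auto simp: in_V in_K)
        then show "fst w \<in> V \<and> lead (fst w) \<noteq> 0"
          using a V_scale[OF a(1), of "1 / a"] by (simp add: lead_scale vector_smult_assoc)
      next
        assume "fst w \<in> V \<and> lead (fst w) \<noteq> 0"
        then show "\<exists>y\<in>vec.span {fst w}. y \<in> V \<and> lead y \<noteq> 0" by (meson insertI1 vec.span_base)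
      qed
      ultimately show ?thesis using \<pi>_image[OF w] by (simp add: W_def)
    qed
    have Wq: "\<exists>w. w \<in> Pairs \<and> q = \<pi> w \<and> fst w \<in> V \<and> lead (fst w) \<noteq> 0" if q: "q \<in> W" for q
    proof -
      obtain l \<xi> where q2: "q = (l, \<xi>)" by (cases q)
      have qE: "(l, \<xi>) \<in> E" using q q2 by (simp add: W_def)
      obtain y where y: "y \<in> l" "y \<in> V" "lead y \<noteq> 0" using q q2 by (auto simp: W_def)
      obtain y' where y': "y' \<in> K" "l = vec.span {y'}" using qE by (auto simp: cotangent_points_def surface_def)
      obtain a where a: "y = a *s y'" using y(1) y'(2) by (auto simp: span_singleton_vec)
      have "a \<noteq> 0" using a y(2) by (auto simp: in_V in_K)
      then have "l = vec.span {y}" using a y'(2) by (simp add: span_singleton_scale)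
      then obtain \<eta> where "(y, \<eta>) \<in> Pairs" "\<pi> (y, \<eta>) = (l, \<xi>)" using \<pi>_surj_V[OF qE _ y(2)] by blast
      then show ?thesis using y q2 by (intro exI[of _ "(y, \<eta>)"]) auto
    qed
    have Wz: "coords q \<in> Z \<and> \<pi> (\<beta> (coords q)) = q \<and> \<Lambda> (coords q) \<noteq> 0 \<and> \<Phi> q = \<Phi>' (coords q)" if q: "q \<in> W" for q
    proof -
      obtain w where w: "w \<in> Pairs" "q = \<pi> w" "fst w \<in> V" "lead (fst w) \<noteq> 0" using Wq[OF q] by blast
      have 1: "coords q \<in> Z" using coords_in_Z[of "fst w" "snd w"] w by simp
      have 2: "\<pi> (\<beta> (coords q)) = q" using \<pi>_\<beta>_coords_\<pi>[of "fst w" "snd w"] w by simp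
      show ?thesis using 1 2 q \<Phi>'z[OF 1] by (simp add: W_def)
    qed
    let ?h = "\<lambda>w. De (fst w) * \<delta> (fst w)"
    obtain N\<Lambda> k\<Lambda> where N\<Lambda>: "polynomial_in pair_fns N\<Lambda>"
      "\<And>w. w \<in> Pairs \<Longrightarrow> fst w \<in> V \<Longrightarrow> \<Lambda> (coords (\<pi> w)) = N\<Lambda> w / ?h w ^ (k\<Lambda>::nat)"
      using coords_substitution[OF \<Lambda>] by blast
    have hnz: "?h w \<noteq> 0" if "fst w \<in> V" for w :: "vec5 \<times> vec5" using that by (simp add: in_V)
    have Pre: "{w \<in> Pairs. \<pi> w \<in> W} = {w \<in> Pairs. ?h w * lead (fst w) * N\<Lambda> w \<noteq> 0}"
    proof (intro Collect_cong conj_cong refl)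
      fix w assume w: "w \<in> Pairs"
      then have wK: "fst w \<in> K" using in_Pairs[of "fst w" "snd w"] by simp
      show "\<pi> w \<in> W \<longleftrightarrow> ?h w * lead (fst w) * N\<Lambda> w \<noteq> 0"
      proof (cases "fst w \<in> V")
        case True
        then show ?thesis using \<pi>W[OF w] N\<Lambda>(2)[OF w True] hnz[OF True] by auto
      next
        case False
        then show ?thesis using \<pi>W[OF w] wK by (auto simp: in_V)
      qed
    qed
    have "polynomial_in pair_fns (\<lambda>w. ?h w * lead (fst w) * N\<Lambda> w)"
      by (intro polynomial_mult polynomial_D polynomial_det5 polynomial_bilin polyvec_proj polyvec_pair polyvec_const N\<Lambda>(1))
    then have Wopen: "openin (zariski XT) W"
      unfolding openin_XT Pre by (intro conjI openin_quasi_affine_basic) (auto simp: W_def)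
    have pW: "p \<in> W"
      using \<pi>W[OF w0(1)] w0(2,3) \<Lambda>0 by (simp add: p_def z0_def)
    have m'reg: "(\<lambda>q. fj j (coords q) / \<Lambda> (coords q)) \<in> regular XT W" if j: "j < k" for j
      unfolding regular_XT
    proof (rule regular_quasi_affineI)
      obtain N l where N: "polynomial_in pair_fns N"
        "\<And>w. w \<in> Pairs \<Longrightarrow> fst w \<in> V \<Longrightarrow> fj j (coords (\<pi> w)) = N w / ?h w ^ (l::nat)"
        using coords_substitution[of "fj j"] fj[OF j] by blast
      fix w1 assume w1: "w1 \<in> {w \<in> Pairs. \<pi> w \<in> W}"
      show "\<exists>g h. polynomial_in pair_fns g \<and> polynomial_in pair_fns h \<and> h w1 \<noteq> 0 \<and>
          (\<forall>w\<in>{w \<in> Pairs. \<pi> w \<in> W}. h w \<noteq> 0 \<longrightarrow> ((\<lambda>q. fj j (coords q) / \<Lambda> (coords q)) \<circ> \<pi>) w = g w / h w)"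
      proof (intro exI conjI ballI impI)
        show "polynomial_in pair_fns (\<lambda>w. N w * ?h w ^ k\<Lambda>)" "polynomial_in pair_fns (\<lambda>w. N\<Lambda> w * ?h w ^ l)"
          by (rule polynomial_mult[OF N(1) polynomial_power[OF polynomial_pair_De]],
            rule polynomial_mult[OF N\<Lambda>(1) polynomial_power[OF polynomial_pair_De]])
        show "N\<Lambda> w1 * ?h w1 ^ l \<noteq> 0" using w1 unfolding Pre by simp
        fix w assume w: "w \<in> {w \<in> Pairs. \<pi> w \<in> W}"
        then have wV: "w \<in> Pairs" "fst w \<in> V" using \<pi>W[of w] by blast+
        show "((\<lambda>q. fj j (coords q) / \<Lambda> (coords q)) \<circ> \<pi>) w = N w * ?h w ^ k\<Lambda> / (N\<Lambda> w * ?h w ^ l)"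
          using N(2)[OF wV] N\<Lambda>(2)[OF wV] by simp
      qed
    qed
    \<comment> \<open>Downstairs only \<open>b\<close> is inverted; the coefficients of the syzygies
      are polynomials.\<close>
    define V'' where "V'' = {x. eval2 b x \<noteq> 0}"
    have V''open: "openin (zariski affine_plane) V''"
      using openin_quasi_affine_basic[OF polynomial_in_eval2[of b], of UNIV] by (simp add: affine_plane_def V''_def)
    have creg: "eval2 (c i j) \<in> regular affine_plane V''" for i j
      unfolding affine_plane_def
      by (rule regular_quasi_affineI) (use polynomial_in_eval2[of "c i j"] polynomial_const[of _ 1] in
        \<open>intro exI[of _ "eval2 (c i j)"] exI[of _ "\<lambda>_. 1"], auto\<close>)
    have gc0: "(\<Sum>i<n. r i x * eval2 (c i j) x) = 0" if j: "j < k" and x: "x \<in> V''" for j x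
    proof -
      have "(\<Sum>i<n. r i x * eval2 (c i j) x) = (\<Sum>i<n. eval2 (g i * c i j) x / eval2 b x)"
        using rg x by (intro sum.cong) (auto simp: V''_def)
      also have "\<dots> = eval2 (\<Sum>i<n. g i * c i j) x / eval2 b x" by (simp add: sum_divide_distrib)
      finally show ?thesis by (simp only: gc[OF j] eval2_simps div_0)
    qed
    have sub: "W \<subseteq> U \<inter> {q \<in> points XT. \<Phi> q \<in> V''}"
    proof
      fix q assume q: "q \<in> W"
      note z = Wz[OF q]
      have "L (coords q) \<noteq> 0" "eval2 b (\<Phi>' (coords q)) \<noteq> 0" using z by (auto simp: \<Lambda>_def bL_def)
      then show "q \<in> U \<inter> {q \<in> points XT. \<Phi> q \<in> V''}"
        using z LU[of "coords q"] q by (simp add: V''_def W_def)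
    qed
    show "\<exists>(k::nat) W V'' c m'. openin (zariski XT) W \<and> p \<in> W \<and> openin (zariski affine_plane) V'' \<and> \<Phi> p \<in> V'' \<and>
        W \<subseteq> U \<inter> {q \<in> points XT. \<Phi> q \<in> V''} \<and> V'' \<subseteq> V' \<and> (\<forall>j<k. m' j \<in> regular XT W) \<and>
        (\<forall>i<n. \<forall>j<k. c i j \<in> regular affine_plane V'') \<and>
        (\<forall>i<n. \<forall>q\<in>W. m i q = (\<Sum>j<k. c i j (\<Phi> q) * m' j q)) \<and>
        (\<forall>j<k. \<forall>q\<in>V''. (\<Sum>i<n. r i q * c i j q) = 0)"
    proof (rule exI[of _ k], rule exI[of _ W], rule exI[of _ V''], rule exI[of _ "\<lambda>i j. eval2 (c i j)"],
        rule exI[of _ "\<lambda>j q. fj j (coords q) / \<Lambda> (coords q)"], intro conjI allI impI ballI)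
      show "openin (zariski XT) W" "p \<in> W" "openin (zariski affine_plane) V''" by fact+
      show "\<Phi> p \<in> V''" using b by (simp add: V''_def)
      show "W \<subseteq> U \<inter> {q \<in> points XT. \<Phi> q \<in> V''}" by fact
      show "V'' \<subseteq> V'" using bV by (auto simp: V''_def)
      show "(\<lambda>q. fj j (coords q) / \<Lambda> (coords q)) \<in> regular XT W" if "j < k" for j by (rule m'reg[OF that])
      show "eval2 (c i j) \<in> regular affine_plane V''" for i j by (rule creg)
      show "m i q = (\<Sum>j<k. eval2 (c i j) (\<Phi> q) * (fj j (coords q) / \<Lambda> (coords q)))" if "i < n" "q \<in> W" for i q
        using mc[of "coords q" i] Wz[OF that(2)] that(1) by simp
      show "(\<Sum>i<n. r i q * eval2 (c i j) q) = 0" if "j < k" "q \<in> V''" for j q by (rule gc0[OF that])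
    qed
  qed
qed

end

context del_pezzo
begin

lemma equational_criterion_\<Phi>:
  assumes p: "p \<in> E"
  shows "equational_criterion (local_ring affine_plane (\<Phi> p)) (restrict_scalars (pullback_germ XT \<Phi> p) (local_ring XT p))"
proof -
  obtain e f u1 u2 y \<eta> where w: "(y, \<eta>) \<in> Pairs" "\<pi> (y, \<eta>) = p" and u1: "u1 \<in> T y"
    and y: "y \<in> chart.V Q1 Q2 e f u1 u2" and Qu: "\<not> (B1 u1 u1 = 0 \<and> B2 u1 u1 = 0)"
    using E_chart[OF p] .
  interpret C: chart Q1 Q2 e f u1 u2 by unfold_locales
  have De: "C.De y \<noteq> 0" using y by (simp add: C.in_V)
  \<comment> \<open>On a tangent vector the projection is multiplication by \<open>De\<close>, so
    \<open>lead\<close> is a nonzero multiple of the value of \<open>QA\<close> at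
    \<open>u1\<close>.\<close>
  have \<theta>1: "C.\<theta>1 y = C.De y *s u1" using u1 by (simp add: proj_def in_T)
  obtain QA QB where Q: "QA = Q1 \<and> QB = Q2 \<or> QA = Q2 \<and> QB = Q1" "bilin QA u1 u1 \<noteq> 0" using Qu by blast
  interpret G: good_chart Q1 Q2 e f u1 u2 QA QB by unfold_locales (rule Q(1))
  have "bilin QA (C.\<theta>1 y) (C.\<theta>1 y) \<noteq> 0" using Q(2) De by (simp add: \<theta>1)
  from G.equational_criterion_at[OF w(1) y this] show ?thesis by (simp only: w(2))
qed

end

theorem corollary3p14:
  fixes Q\<^sub>1 Q\<^sub>2 :: "complex ^ 5 ^ 5"
  assumes "del_pezzo_4 Q\<^sub>1 Q\<^sub>2"
  shows "flat_morphism (cotangent_bundle Q\<^sub>1 Q\<^sub>2) affine_plane (Phi Q\<^sub>1 Q\<^sub>2) TYPE('n) TYPE('k)"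
proof -
  interpret del_pezzo Q\<^sub>1 Q\<^sub>2 by unfold_locales fact
  interpret M: space_morphism XT affine_plane \<Phi>
    by (intro space_morphism.intro space_morphism_axioms.intro ringed_space_XT ringed_space_affine_plane is_morphism_\<Phi>)
  show ?thesis
    unfolding flat_morphism_def
  proof (intro conjI ballI)
    show "is_morphism XT affine_plane \<Phi>" by (rule is_morphism_\<Phi>)
    fix p assume p: "p \<in> points XT"
    show "flat_module (local_ring affine_plane (\<Phi> p)) (restrict_scalars (pullback_germ XT \<Phi> p) (local_ring XT p)) TYPE('n) TYPE('k)"
    proof (rule flat_module_if_equational_criterion)
      show "Module.module (local_ring affine_plane (\<Phi> p)) (restrict_scalars (pullback_germ XT \<Phi> p) (local_ring XT p))"
        by (rule module_restrict_scalars[OF M.Y.cring_local_ring M.X.cring_local_ring[OF p] M.pullback_ring_hom[OF p]]) simp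
      show "equational_criterion (local_ring affine_plane (\<Phi> p)) (restrict_scalars (pullback_germ XT \<Phi> p) (local_ring XT p))"
        by (rule equational_criterion_\<Phi>) (use p in simp)
    qed
  qed
qed

end
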